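(* Let $q$ be a prime power. For $n\ge 1$ let $\rho_n=\rho\big(ch(\chi^{(n)}_{(q_1,\ldots,q_{n-1})}\uparrow_{U_n}^{G_n})\big)\in\Lambda_{\mathbb C}(Y)$ be the image under the plethysm map $\rho$ of the characteristic of the linear character $\chi^{(n)}_{(q_1,\ldots,q_{n-1})}$ ($q_i\in\mathbb F_q^\times$) of $U_n$ induced to $G_n=GL_n(\mathbb F_q)$. Then for every $n\ge 1$ $$\rho_n = q^{n}\,q_n(Y;q^{-1}) = (1-q^{-1})\,q^{n}\,P_{(n)}(Y;q^{-1}) = q^{n-1}(q-1)\,P_{(n)}(Y;q^{-1})= q^{n-1}(q-1)\,\tilde{P}_{(n)}(Y;q).$$
   Context: Groups and symmetric functions. $\mathbb F_q$ is the field with $q$ elements, $\bar{\mathbb F}_q$ its algebraic closure, $G_n=GL_n(\mathbb F_q)$, $U_n\le G_n$ the group of unipotent upper-triangular matrices. For a set $Z$ of infinitely many variables, $\Lambda_{\mathbb C}(Z)$ is the ring of symmetric functions in $Z$ over $\mathbb C$, with complete functions $h_\lambda$, power sums $p_\lambda$, Schur functions $s_\lambda$; $Y=\{y_1,y_2,\ldots\}$. $P_\lambda(Z;t)$ is the Hall-Littlewood symmetric function (the limit as $N\to\infty$ of $\sum_{w\in S_N/S_N^\lambda}w\big(z_1^{\lambda_1}\cdots z_N^{\lambda_N}\prod_{\lambda_i>\lambda_j}\frac{z_i-tz_j}{z_i-z_j}\big)$, $S_N^\lambda$ the stabilizer of $(\lambda_1,\ldots,\lambda_N)$). $q_r(Y;t)=(1-t)P_{(r)}(Y;t)$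 for $r\ge 1$, $q_0(Y;t)=1$; equivalently $\sum_{r\ge 0}q_r(Y;t)u^r=\prod_i\frac{1-y_itu}{1-y_iu}$. With $n(\lambda)=\sum_{i\ge1}(i-1)\lambda_i$, the twisted Hall-Littlewood function is $\tilde P_\lambda(Z;q)=q^{-n(\lambda)}P_\lambda(Z;q^{-1})$. Index sets. $F:z\mapsto z^q$ is the Frobenius. $\Phi$ is the set of $F$-orbits in $\bar{\mathbb F}_q^\times$, identified with the monic irreducible polynomials $f\neq x$ in $\mathbb F_q[x]$; $d(f)=\deg f$; $f_z\in\Phi$ is the orbit of $z$. Let $M_n=\mathbb F_{q^n}^\times$ and $\hat M_n=\mathrm{Hom}(M_n,\mathbb C^\times)$; for $m\mid n$ embed $\hat M_m\subset\hat M_n$ by composing with the norm $M_n\to M_m$. $\Theta$ is the set of orbits of $\xi\mapsto\xi^q$ on $\bigcup_n\hat M_n$; $d(\varphi)=\deg(\varphi)=|\varphi|$. If $\xi\in\varphi$ and $d(\varphi)\mid n$ then $\xi\in\hat M_n$ and $\xi(z)$, $z\in M_n$, is its value there. For a partition-valued function $\bm\mu$ on $\Phi$, $\|\bm\mu\|=\sum_f d(f)|\bm\mu(f)|$, and $\mathcal P^\Phi_n=\{\bm\mu:\|\bm\mu\|=n\}$; similarly $\mathcal P^\Theta_n$. Characteristic map. For $f\in\Phi$ and $\varphi\in\Theta$ let $X_f$ and $Y^\varphi$ be infinite sets of variables (of degree $d(f)$, resp. $d(\varphi)$). $\Lambda_{\mathbb C}=\otimes_{f\in\Phi}\Lambda_{\mathbb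 C}(X_f)$ is identified with $\otimes_{\varphi\in\Theta}\Lambda_{\mathbb C}(Y^\varphi)$ by $p_k(Y^\varphi)=(-1)^{n-1}\sum_{z\in M_n}\xi(z)\,p_{n/d(f_z)}(X_{f_z})$, where $\xi\in\varphi$, $n=k\,d(\varphi)$. Put $\tilde P_{\bm\mu}=\prod_f\tilde P_{\bm\mu(f)}(X_f;q^{d(f)})$ and $S_{\bm\lambda}=\prod_\varphi s_{\bm\lambda(\varphi)}(Y^\varphi)$. For $\bm\mu\in\mathcal P^\Phi_n$, $\pi_{\bm\mu}$ is the indicator function of the conjugacy class $K^{\bm\mu}$ of those $g\in G_n$ making $\mathbb F_q^n$ an $\mathbb F_q[x]$-module isomorphic to $\bigoplus_f\bigoplus_i\mathbb F_q[x]/(f^{\bm\mu(f)_i})$. $ch$ is the linear map from the direct sum over $n\ge0$ of the spaces of class functions on $G_n$ to $\Lambda_{\mathbb C}$ with $\pi_{\bm\mu}\mapsto\tilde P_{\bm\mu}$; it is a (Hopf algebra) isomorphism, and it maps the irreducible characters $\chi^{\bm\lambda}$ of $G_n$ bijectively to the $S_{\bm\lambda}$, $\bm\lambda\in\mathcal P_n^\Theta$. Plethysm map. $\rho:\Lambda_{\mathbb C}\to\Lambda_{\mathbb C}(Y)$ is the $\mathbb C$-algebra homomorphism with $\rho(h_a(Y^\varphi))=h_a[p_b]:=h_a(y_1^b,y_2^b,\ldots)$, $b=d(\varphi)$. Linear characters. Fix a nontrivial additive character $\psi:\mathbb F_q\to\mathbb C^\times$. For $q_1,\ldots,q_{n-1}\in\mathbb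 F_q^\times$, $\chi^{(n)}_{(q_1,\ldots,q_{n-1})}(u)=\prod_{i=1}^{n-1}\psi(q_iu_{i,i+1})$ for $u\in U_n$; $\uparrow_{U_n}^{G_n}$ denotes induction. The induced character (hence $\rho_n$) does not depend on $q_1,\ldots,q_{n-1}$. *)

theory Defs
  imports
    Complex_Main
    "HOL-Library.Poly_Mapping"
    "HOL-Library.Cardinality"
    "HOL-Combinatorics.Permutations"
    "HOL-Computational_Algebra.Polynomial_Factorial"
    "HOL-Computational_Algebra.Fraction_Field"
    "HOL-Algebra.Algebraic_Closure_Type"
    "Jordan_Normal_Form.Matrix"
begin

section \<open>Formal power series in arbitrarily many variables\<close>

text \<open>A monomial is a finitely supported exponent vector, and a series is an arbitrary
  complex-valued function on monomials.  Symmetric functions are the symmetric series of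
  bounded degree.\<close>

typedef 'v mseries = "UNIV :: (('v \<Rightarrow>\<^sub>0 nat) \<Rightarrow> complex) set"
  morphisms mcoeff Mseries ..

setup_lifting type_definition_mseries

lemma mcoeff_Mseries [simp]: "mcoeff (Mseries F) m = F m"
  by (simp add: Mseries_inverse)

lemma mseries_eqI: "(\<And>m. mcoeff F m = mcoeff G m) \<Longrightarrow> F = G"
  by (metis ext mcoeff_inject)

definition mono_splits :: "('v \<Rightarrow>\<^sub>0 nat) \<Rightarrow> (('v \<Rightarrow>\<^sub>0 nat) \<times> ('v \<Rightarrow>\<^sub>0 nat)) set" where
  "mono_splits m = {(a, b). a + b = m}"

lemma in_mono_splits [simp]: "(a, b) \<in> mono_splits m \<longleftrightarrow> a + b = m"
  by (simp add: mono_splits_def)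

lemma finite_mono_splits [simp]: "finite (mono_splits m)"
proof -
  let ?l = "Poly_Mapping.lookup m" and ?K = "Poly_Mapping.keys m"
  have "finite {f. \<forall>i. (i \<in> ?K \<longrightarrow> f i \<in> {..Max (?l ` ?K)}) \<and> (i \<notin> ?K \<longrightarrow> f i = (0::nat))}"
    by (rule finite_set_of_finite_funs) simp_all
  moreover have "Poly_Mapping.lookup ` fst ` mono_splits m \<subseteq>
      {f. \<forall>i. (i \<in> ?K \<longrightarrow> f i \<in> {..Max (?l ` ?K)}) \<and> (i \<notin> ?K \<longrightarrow> f i = (0::nat))}"
  proof clarify
    fix a b i
    assume "(a, b) \<in> mono_splits m"
    then have "Poly_Mapping.lookup a i \<le> ?l i"
      by (auto simp: mono_splits_def lookup_add)
    moreover have "i \<in> ?K \<longrightarrow> ?l i \<le> Max (?l ` ?K)"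
      by (intro impI Max_ge) auto
    moreover have "i \<notin> ?K \<longrightarrow> ?l i = 0"
      by (simp add: in_keys_iff)
    ultimately show "(i \<in> ?K \<longrightarrow> Poly_Mapping.lookup (fst (a, b)) i \<in> {..Max (?l ` ?K)}) \<and>
        (i \<notin> ?K \<longrightarrow> Poly_Mapping.lookup (fst (a, b)) i = 0)"
      unfolding fst_conv atMost_iff by linarith
  qed
  ultimately have "finite (Poly_Mapping.lookup ` fst ` mono_splits m)"
    by (rule finite_subset[rotated])
  then have "finite (fst ` mono_splits m)"
    by (rule finite_imageD) (auto intro!: inj_onI poly_mapping_eqI)
  moreover have "inj_on fst (mono_splits m)"
    by (auto simp: inj_on_def mono_splits_def)
  ultimately show ?thesis
    by (rule finite_imageD)
qed

instantiation mseries :: (type) comm_ring_1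
begin

lift_definition zero_mseries :: "'a mseries" is "\<lambda>_. 0" .
lift_definition one_mseries :: "'a mseries" is "\<lambda>m. if m = 0 then 1 else 0" .
lift_definition plus_mseries :: "'a mseries \<Rightarrow> 'a mseries \<Rightarrow> 'a mseries"
  is "\<lambda>F G m. F m + G m" .
lift_definition minus_mseries :: "'a mseries \<Rightarrow> 'a mseries \<Rightarrow> 'a mseries"
  is "\<lambda>F G m. F m - G m" .
lift_definition uminus_mseries :: "'a mseries \<Rightarrow> 'a mseries"
  is "\<lambda>F m. - F m" .
lift_definition times_mseries :: "'a mseries \<Rightarrow> 'a mseries \<Rightarrow> 'a mseries"
  is "\<lambda>F G m. \<Sum>(a, b)\<in>mono_splits m. F a * G b" .

instance
proof
  fix F G H :: "'a mseries"
  show "F * G * H = F * (G * H)"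
  proof transfer
    fix F G H :: "('a \<Rightarrow>\<^sub>0 nat) \<Rightarrow> complex"
    show "(\<lambda>m. \<Sum>(a, b)\<in>mono_splits m. (\<Sum>(c, d)\<in>mono_splits a. F c * G d) * H b) =
          (\<lambda>m. \<Sum>(a, b)\<in>mono_splits m. F a * (\<Sum>(c, d)\<in>mono_splits b. G c * H d))"
    proof
      fix m
      have "(\<Sum>(a, b)\<in>mono_splits m. (\<Sum>(c, d)\<in>mono_splits a. F c * G d) * H b) =
            (\<Sum>x\<in>mono_splits m. \<Sum>y\<in>mono_splits (fst x). F (fst y) * G (snd y) * H (snd x))"
        by (simp add: split_def sum_distrib_right)
      also have "\<dots> = (\<Sum>(x, y)\<in>(SIGMA x:mono_splits m. mono_splits (fst x)). F (fst y) * G (snd y) * H (snd x))"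
        by (rule sum.Sigma) auto
      also have "\<dots> = (\<Sum>(x, y)\<in>(SIGMA x:mono_splits m. mono_splits (snd x)). F (fst x) * (G (fst y) * H (snd y)))"
        by (rule sum.reindex_bij_witness[of _
              "\<lambda>(x, y). ((fst x + fst y, snd y), (fst x, fst y))"
              "\<lambda>(x, y). ((fst y, snd y + snd x), (snd y, snd x))"])
           (auto simp: mono_splits_def algebra_simps)
      also have "\<dots> = (\<Sum>x\<in>mono_splits m. \<Sum>y\<in>mono_splits (snd x). F (fst x) * (G (fst y) * H (snd y)))"
        by (rule sum.Sigma[symmetric]) auto
      also have "\<dots> = (\<Sum>(a, b)\<in>mono_splits m. F a * (\<Sum>(c, d)\<in>mono_splits b. G c * H d))"
        by (simp add: split_def sum_distrib_left)
      finally show "(\<Sum>(a, b)\<in>mono_splits m. (\<Sum>(c, d)\<in>mono_splits a. F c * G d) * H b) =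
          (\<Sum>(a, b)\<in>mono_splits m. F a * (\<Sum>(c, d)\<in>mono_splits b. G c * H d))" .
    qed
  qed
  show "F * G = G * F"
  proof transfer
    fix F G :: "('a \<Rightarrow>\<^sub>0 nat) \<Rightarrow> complex"
    show "(\<lambda>m. \<Sum>(a, b)\<in>mono_splits m. F a * G b) = (\<lambda>m. \<Sum>(a, b)\<in>mono_splits m. G a * F b)"
      by (rule ext, rule sum.reindex_bij_witness[of _ prod.swap prod.swap])
         (auto simp: mono_splits_def ac_simps)
  qed
  show "1 * F = F"
  proof transfer
    fix F :: "('a \<Rightarrow>\<^sub>0 nat) \<Rightarrow> complex"
    show "(\<lambda>m. \<Sum>(a, b)\<in>mono_splits m. (if a = 0 then 1 else 0) * F b) = F"
    proof
      fix m
      have "(\<Sum>(a, b)\<in>mono_splits m. (if a = 0 then 1 else 0) * F b) =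
            (\<Sum>(a, b)\<in>{(0 :: 'a \<Rightarrow>\<^sub>0 nat, m)}. (if a = 0 then 1 else 0) * F b)"
        by (rule sum.mono_neutral_right) (auto split: if_splits)
      then show "(\<Sum>(a, b)\<in>mono_splits m. (if a = 0 then 1 else 0) * F b) = F m" by simp
    qed
  qed
  show "(F + G) * H = F * H + G * H"
    by transfer (simp add: split_def algebra_simps sum.distrib)
  show "(0 :: 'a mseries) \<noteq> 1"
    by transfer (auto simp: fun_eq_iff)
qed (transfer; simp add: algebra_simps)+

end

lemma mcoeff_mult: "mcoeff (F * G) m = (\<Sum>(a, b)\<in>mono_splits m. mcoeff F a * mcoeff G b)"
  by (simp add: times_mseries.rep_eq)

definition mconst :: "complex \<Rightarrow> 'v mseries" where
  "mconst c = Mseries (\<lambda>m. if m = 0 then c else 0)"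

lemma mcoeff_mconst_mult [simp]:
  fixes F :: "'v mseries"
  shows "mcoeff (mconst c * F) m = c * mcoeff F m"
proof -
  have "mcoeff (mconst c * F) m = (\<Sum>(a, b)\<in>mono_splits m. mcoeff (mconst c) a * mcoeff F b)"
    by (rule mcoeff_mult)
  also have "\<dots> = (\<Sum>(a, b)\<in>{(0 :: 'v \<Rightarrow>\<^sub>0 nat, m)}. mcoeff (mconst c) a * mcoeff F b)"
    by (rule sum.mono_neutral_right) (auto simp: mconst_def split: if_splits)
  finally show ?thesis by (simp add: mconst_def)
qed

definition mdegree :: "('v \<Rightarrow>\<^sub>0 nat) \<Rightarrow> nat" where
  "mdegree m = (\<Sum>i\<in>Poly_Mapping.keys m. Poly_Mapping.lookup m i)"

section \<open>Symmetric functions in one alphabet\<close>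

text \<open>The alphabet is \<open>z\<^sub>0, z\<^sub>1, \<dots>\<close>, indexed from zero.\<close>

definition sym_funs :: "nat mseries set" where
  "sym_funs = {F. (\<exists>d. \<forall>m. mcoeff F m \<noteq> 0 \<longrightarrow> mdegree m \<le> d) \<and>
     (\<forall>\<pi> m. bij \<pi> \<longrightarrow> mcoeff F (Poly_Mapping.map_key \<pi> m) = mcoeff F m)}"

definition complete_sym :: "nat \<Rightarrow> nat mseries" where
  "complete_sym a = Mseries (\<lambda>m. if mdegree m = a then 1 else 0)"

text \<open>Only meaningful for \<open>k \<ge> 1\<close>.\<close>

definition power_sum :: "nat \<Rightarrow> nat mseries" where
  "power_sum k = Mseries (\<lambda>m. if \<exists>i. m = Poly_Mapping.single i k then 1 else 0)"

text \<open>\<open>F[p\<^sub>b] = F(z\<^sub>0\<^sup>b, z\<^sub>1\<^sup>b, \<dots>)\<close> for \<open>b \<ge> 1\<close>.\<close>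

definition plethysm_power :: "nat \<Rightarrow> nat mseries \<Rightarrow> nat mseries" where
  "plethysm_power b F = Mseries (\<lambda>m. if \<forall>i. b dvd Poly_Mapping.lookup m i
     then mcoeff F (Poly_Mapping.map (\<lambda>e. e div b) m) else 0)"

subsection \<open>Hall-Littlewood functions\<close>

definition partitions :: "nat list set" where
  "partitions = {\<nu>. sorted_wrt (\<ge>) \<nu> \<and> 0 \<notin> set \<nu>}"

definition part_nth :: "nat list \<Rightarrow> nat \<Rightarrow> nat" where
  "part_nth \<nu> i = (if i < length \<nu> then \<nu> ! i else 0)"

definition n_part :: "nat list \<Rightarrow> nat" where
  "n_part \<nu> = (\<Sum>i<length \<nu>. i * \<nu> ! i)"

type_synonym mpoly_fract = "((nat \<Rightarrow>\<^sub>0 nat) \<Rightarrow>\<^sub>0 complex) fract"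

definition fvar :: "nat \<Rightarrow> mpoly_fract" where
  "fvar i = Fraction_Field.Fract (Poly_Mapping.single (Poly_Mapping.single i 1) 1) 1"

definition fconst :: "complex \<Rightarrow> mpoly_fract" where
  "fconst c = Fraction_Field.Fract (Poly_Mapping.single 0 c) 1"

definition HL_stabilizer :: "nat \<Rightarrow> nat list \<Rightarrow> (nat \<Rightarrow> nat) set" where
  "HL_stabilizer N \<nu> = {s. s permutes {..<N} \<and> (\<forall>i<N. part_nth \<nu> (s i) = part_nth \<nu> i)}"

definition HL_cosets :: "nat \<Rightarrow> nat list \<Rightarrow> (nat \<Rightarrow> nat) set set" where
  "HL_cosets N \<nu> = {(\<lambda>s. w \<circ> s) ` HL_stabilizer N \<nu> | w. w permutes {..<N}}"

definition HL_term :: "nat \<Rightarrow> nat list \<Rightarrow> complex \<Rightarrow> (nat \<Rightarrow> nat) \<Rightarrow> mpoly_fract" where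
  "HL_term N \<nu> t w = (\<Prod>i<N. fvar (w i) ^ part_nth \<nu> i) *
     (\<Prod>(i, j)\<in>{(i, j). i < N \<and> j < N \<and> part_nth \<nu> i > part_nth \<nu> j}.
        (fvar (w i) - fconst t * fvar (w j)) / (fvar (w i) - fvar (w j)))"

text \<open>For \<open>N\<close> at least the length of \<open>\<nu>\<close> the sum of rational functions below is a polynomial.
  The choice of coset representatives does not matter.\<close>

definition HL_poly :: "nat \<Rightarrow> nat list \<Rightarrow> complex \<Rightarrow> (nat \<Rightarrow>\<^sub>0 nat) \<Rightarrow>\<^sub>0 complex" where
  "HL_poly N \<nu> t = (THE p. Fraction_Field.Fract p 1 =
     (\<Sum>C\<in>HL_cosets N \<nu>. HL_term N \<nu> t (SOME w. w \<in> C)))"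

text \<open>The limit \<open>N \<rightarrow> \<infinity>\<close> is taken coefficientwise; every coefficient is eventually constant.\<close>

definition HL_P :: "nat list \<Rightarrow> complex \<Rightarrow> nat mseries" where
  "HL_P \<nu> t = Mseries (\<lambda>m. THE c. \<forall>\<^sub>F N in sequentially. Poly_Mapping.lookup (HL_poly N \<nu> t) m = c)"

definition HL_q :: "nat \<Rightarrow> complex \<Rightarrow> nat mseries" where
  "HL_q r t = (if r = 0 then 1 else mconst (1 - t) * HL_P [r] t)"

definition HL_P_twisted :: "nat list \<Rightarrow> complex \<Rightarrow> nat mseries" where
  "HL_P_twisted \<nu> q = mconst (inverse (q ^ n_part \<nu>)) * HL_P \<nu> (inverse q)"

section \<open>The index sets\<close>

text \<open>The finite field of \<open>q\<close> elements is the type \<open>'a\<close>, with \<open>q = CARD('a)\<close>.\<close>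

definition Phi :: "'a::{finite,field} poly set" where
  "Phi = {f. lead_coeff f = 1 \<and> irreducible f \<and> f \<noteq> [:0, 1:]}"

definition frob_orbit :: "'a::{finite,field} alg_closure \<Rightarrow> 'a alg_closure set" where
  "frob_orbit z = {z ^ (CARD('a) ^ k) | k. True}"

text \<open>The identification of orbits with polynomials: an orbit is the set of roots of its
  polynomial.\<close>

definition Phi_of :: "'a::{finite,field} alg_closure \<Rightarrow> 'a poly" where
  "Phi_of z = (THE f. f \<in> Phi \<and> {w. poly (map_poly to_ac f) w = 0} = frob_orbit z)"

definition ext_units :: "nat \<Rightarrow> 'a::{finite,field} alg_closure set" where
  "ext_units n = {z. z \<noteq> 0 \<and> z ^ (CARD('a) ^ n) = z}"

text \<open>The norm \<open>M\<^sub>n \<rightarrow> M\<^sub>m\<close> for \<open>m dvd n\<close>.\<close>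

definition norm_map :: "nat \<Rightarrow> nat \<Rightarrow> 'a::{finite,field} alg_closure \<Rightarrow> 'a alg_closure" where
  "norm_map n m z = (\<Prod>i<n div m. z ^ (CARD('a) ^ (m * i)))"

text \<open>Characters are extended by zero outside \<open>M\<^sub>n\<close>, so that they are determined by their
  values on \<open>M\<^sub>n\<close>.\<close>

definition M_hat :: "nat \<Rightarrow> ('a::{finite,field} alg_closure \<Rightarrow> complex) set" where
  "M_hat n = {\<xi>. (\<forall>z\<in>ext_units n. \<xi> z \<noteq> 0) \<and> (\<forall>z\<in>ext_units n. \<forall>w\<in>ext_units n. \<xi> (z * w) = \<xi> z * \<xi> w) \<and>
     (\<forall>z. z \<notin> ext_units n \<longrightarrow> \<xi> z = 0)}"

text \<open>The union of the \<open>M_hat n\<close> is their direct limit along the embeddings \<open>\<xi> \<mapsto> \<xi> \<circ> norm\<close>.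
  An element of it is an equivalence class of pairs \<open>(n, \<xi>)\<close> with \<open>\<xi> \<in> M_hat n\<close>; it lies in
  \<open>M_hat n\<close> iff it contains a (necessarily unique) pair with first component \<open>n\<close>.\<close>

type_synonym 'a lim_char = "(nat \<times> ('a alg_closure \<Rightarrow> complex)) set"

definition M_hat_pairs :: "(nat \<times> ('a::{finite,field} alg_closure \<Rightarrow> complex)) set" where
  "M_hat_pairs = (SIGMA n:{1..}. M_hat n)"

definition M_hat_rel :: "((nat \<times> ('a::{finite,field} alg_closure \<Rightarrow> complex)) \<times>
    (nat \<times> ('a alg_closure \<Rightarrow> complex))) set" where
  "M_hat_rel = {((m, \<xi>), (n, \<eta>)). (m, \<xi>) \<in> M_hat_pairs \<and> (n, \<eta>) \<in> M_hat_pairs \<and>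
     (\<exists>N\<ge>1. m dvd N \<and> n dvd N \<and> (\<forall>z\<in>ext_units N. \<xi> (norm_map N m z) = \<eta> (norm_map N n z)))}"

definition lim_chars :: "'a::{finite,field} lim_char set" where
  "lim_chars = M_hat_pairs // M_hat_rel"

definition lim_char_value :: "'a::{finite,field} lim_char \<Rightarrow> nat \<Rightarrow> 'a alg_closure \<Rightarrow> complex" where
  "lim_char_value C n z = (THE \<xi>. (n, \<xi>) \<in> C) z"

definition lim_char_frob :: "'a::{finite,field} lim_char \<Rightarrow> 'a lim_char" where
  "lim_char_frob C = (\<lambda>(n, \<xi>). (n, \<lambda>z. \<xi> z ^ CARD('a))) ` C"

definition Theta :: "'a::{finite,field} lim_char set set" where
  "Theta = {{(lim_char_frob ^^ k) C | k. True} | C. C \<in> lim_chars}"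

section \<open>The ring generated by the symmetric functions in the alphabets \<open>X\<^sub>f\<close>\<close>

text \<open>The variables are the pairs \<open>(f, i)\<close>.  Since the alphabets \<open>X\<^sub>f\<close> are disjoint, the tensor
  product of the rings of symmetric functions in the \<open>X\<^sub>f\<close> is the subalgebra they generate.\<close>

definition in_alphabet :: "'i \<Rightarrow> nat mseries \<Rightarrow> ('i \<times> nat) mseries" where
  "in_alphabet f F = Mseries (\<lambda>m. if Poly_Mapping.keys m \<subseteq> {f} \<times> UNIV
     then mcoeff F (Poly_Mapping.map_key (\<lambda>i. (f, i)) m) else 0)"

inductive_set Lambda :: "('a::{finite,field} poly \<times> nat) mseries set" where
  const: "mconst c \<in> Lambda"
| alphabet: "f \<in> Phi \<Longrightarrow> F \<in> sym_funs \<Longrightarrow> in_alphabet f F \<in> Lambda"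
| add: "F \<in> Lambda \<Longrightarrow> G \<in> Lambda \<Longrightarrow> F + G \<in> Lambda"
| mult: "F \<in> Lambda \<Longrightarrow> G \<in> Lambda \<Longrightarrow> F * G \<in> Lambda"

text \<open>\<open>p\<^sub>k(Y\<^sup>\<phi>)\<close>, where \<open>card \<phi>\<close> is the degree of \<open>\<phi>\<close>.  The result does not depend on the choice
  of \<open>\<xi> \<in> \<phi>\<close>.\<close>

definition power_sum_Y :: "'a::{finite,field} lim_char set \<Rightarrow> nat \<Rightarrow> ('a poly \<times> nat) mseries" where
  "power_sum_Y \<phi> k = (let n = k * card \<phi>; \<xi> = (SOME \<xi>. \<xi> \<in> \<phi>) in
     mconst ((-1) ^ (n - 1)) *
     (\<Sum>z\<in>ext_units n. mconst (lim_char_value \<xi> n z) *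
        in_alphabet (Phi_of z) (power_sum (n div degree (Phi_of z)))))"

text \<open>The complete functions attached to a sequence of power sums, by Newton's identity
  \<open>a h\<^sub>a = \<Sum>k=1..a. p\<^sub>k h\<^bsub>a-k\<^esub>\<close>.\<close>

fun complete_of :: "(nat \<Rightarrow> 'v mseries) \<Rightarrow> nat \<Rightarrow> 'v mseries" where
  "complete_of p a = (if a = 0 then 1 else
     mconst (1 / of_nat a) * (\<Sum>k=1..a. p k * complete_of p (a - k)))"

declare complete_of.simps [simp del]

definition complete_Y :: "'a::{finite,field} lim_char set \<Rightarrow> nat \<Rightarrow> ('a poly \<times> nat) mseries" where
  "complete_Y \<phi> a = complete_of (power_sum_Y \<phi>) a"

lemma mcoeff_power_sum_mult:
  assumes "k \<ge> 1"
  shows "mcoeff (power_sum k * F) m =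
    (\<Sum>i | k \<le> Poly_Mapping.lookup m i. mcoeff F (m - Poly_Mapping.single i k))"
proof -
  have inj: "i = j" if "Poly_Mapping.single i k = Poly_Mapping.single j k" for i j :: nat
    using that assms by (metis lookup_single_eq lookup_single_not_eq not_one_le_zero)
  have le: "Poly_Mapping.single i k + (m - Poly_Mapping.single i k) = m"
    if "k \<le> Poly_Mapping.lookup m i" for i
    using that by (intro poly_mapping_eqI) (auto simp: lookup_add lookup_minus lookup_single when_def)
  have "mcoeff (power_sum k * F) m = (\<Sum>(a, b)\<in>mono_splits m. mcoeff (power_sum k) a * mcoeff F b)"
    by (rule mcoeff_mult)
  also have "\<dots> = (\<Sum>(a, b)\<in>(\<lambda>i. (Poly_Mapping.single i k, m - Poly_Mapping.single i k)) `
       {i. k \<le> Poly_Mapping.lookup m i}. mcoeff (power_sum k) a * mcoeff F b)"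
  proof (rule sum.mono_neutral_right)
    show "\<forall>x\<in>mono_splits m - (\<lambda>i. (Poly_Mapping.single i k, m - Poly_Mapping.single i k)) `
       {i. k \<le> Poly_Mapping.lookup m i}. (case x of (a, b) \<Rightarrow> mcoeff (power_sum k) a * mcoeff F b) = 0"
    proof clarify
      fix a b
      assume ab: "(a, b) \<in> mono_splits m" and
        "(a, b) \<notin> (\<lambda>i. (Poly_Mapping.single i k, m - Poly_Mapping.single i k)) `
          {i. k \<le> Poly_Mapping.lookup m i}"
      moreover have "k \<le> Poly_Mapping.lookup m i" "b = m - Poly_Mapping.single i k"
        if "a = Poly_Mapping.single i k" for i
        using ab that by (auto simp: mono_splits_def lookup_add)
      ultimately have "\<nexists>i. a = Poly_Mapping.single i k" by blast
      then show "mcoeff (power_sum k) a * mcoeff F b = 0" by (simp add: power_sum_def)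
    qed
  qed (auto simp: le)
  also have "\<dots> = (\<Sum>i | k \<le> Poly_Mapping.lookup m i. mcoeff F (m - Poly_Mapping.single i k))"
  proof (subst sum.reindex)
    show "inj_on (\<lambda>i. (Poly_Mapping.single i k, m - Poly_Mapping.single i k)) {i. k \<le> Poly_Mapping.lookup m i}"
      by (auto simp: inj_on_def dest: inj)
    have "mcoeff (power_sum k) (Poly_Mapping.single i k) = 1" for i
      by (auto simp: power_sum_def)
    then show "sum ((\<lambda>(a, b). mcoeff (power_sum k) a * mcoeff F b) \<circ>
        (\<lambda>i. (Poly_Mapping.single i k, m - Poly_Mapping.single i k))) {i. k \<le> Poly_Mapping.lookup m i} =
      (\<Sum>i | k \<le> Poly_Mapping.lookup m i. mcoeff F (m - Poly_Mapping.single i k))"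
      by simp
  qed
  finally show ?thesis .
qed

lemma mdegree_superset:
  "finite A \<Longrightarrow> Poly_Mapping.keys m \<subseteq> A \<Longrightarrow> mdegree m = (\<Sum>i\<in>A. Poly_Mapping.lookup m i)"
  unfolding mdegree_def by (rule sum.mono_neutral_left) (auto simp: in_keys_iff)

lemma mdegree_minus_single:
  assumes "k \<le> Poly_Mapping.lookup m i" "k \<ge> 1"
  shows "mdegree (m - Poly_Mapping.single i k) = mdegree m - k"
proof -
  let ?m = "m - Poly_Mapping.single i k"
  have i: "i \<in> Poly_Mapping.keys m"
    using assms by (auto simp: in_keys_iff)
  have "mdegree ?m = (\<Sum>j\<in>Poly_Mapping.keys m. Poly_Mapping.lookup ?m j)"
    by (rule mdegree_superset) (auto simp: in_keys_iff lookup_minus)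
  also have "\<dots> = Poly_Mapping.lookup m i - k + (\<Sum>j\<in>Poly_Mapping.keys m - {i}. Poly_Mapping.lookup m j)"
  proof -
    have "Poly_Mapping.lookup ?m j = Poly_Mapping.lookup m j" if "j \<noteq> i" for j
      using that by (simp add: lookup_minus lookup_single_not_eq)
    moreover have "Poly_Mapping.lookup ?m i = Poly_Mapping.lookup m i - k"
      by (simp add: lookup_minus)
    ultimately show ?thesis
      using i by (subst sum.remove[of _ i]) (simp_all cong: sum.cong_simp)
  qed
  also have "\<dots> = mdegree m - k"
    unfolding mdegree_def using i assms by (subst (2) sum.remove[of _ i]) auto
  finally show ?thesis .
qed

text \<open>Applied to the power sums of an actual alphabet, \<open>complete_of\<close> yields its complete
  functions.\<close>

lemma complete_of_power_sum: "complete_of power_sum a = complete_sym a"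
proof (induction a rule: less_induct)
  case (less a)
  show ?case
  proof (cases "a = 0")
    case True
    have "mdegree m = 0 \<longleftrightarrow> m = 0" for m :: "nat \<Rightarrow>\<^sub>0 nat"
      by (auto simp: mdegree_def in_keys_iff poly_mapping_eq_iff fun_eq_iff)
    with True show ?thesis
      by (intro mseries_eqI) (simp add: complete_of.simps complete_sym_def one_mseries.rep_eq)
  next
    case False
    show ?thesis
    proof (rule mseries_eqI)
      fix m :: "nat \<Rightarrow>\<^sub>0 nat"
      let ?K = "Poly_Mapping.keys m" and ?l = "Poly_Mapping.lookup m"
      have coeff_sum: "mcoeff (\<Sum>k\<in>S. F k) m = (\<Sum>k\<in>S. mcoeff (F k) m)"
        for S :: "nat set" and F :: "nat \<Rightarrow> nat mseries"
        by (induction S rule: infinite_finite_induct) (auto simp: zero_mseries.rep_eq plus_mseries.rep_eq)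
      have le: "?l i \<le> mdegree m" for i
        by (cases "i \<in> ?K") (auto simp: mdegree_def in_keys_iff intro: member_le_sum)
      have "mcoeff (\<Sum>k=1..a. power_sum k * complete_of power_sum (a - k)) m =
            (\<Sum>k=1..a. mcoeff (power_sum k * complete_sym (a - k)) m)"
        using less by (simp add: coeff_sum)
      also have "\<dots> = (\<Sum>k=1..a. \<Sum>i | k \<le> ?l i. if mdegree m = a then 1 else 0)"
      proof (intro sum.cong refl)
        fix k assume k: "k \<in> {1..a}"
        have "mcoeff (complete_sym (a - k)) (m - Poly_Mapping.single i k) =
              (if mdegree m = a then 1 else 0)" if "k \<le> ?l i" for i
          using k that le[of i] by (auto simp: complete_sym_def mdegree_minus_single)
        with k show "mcoeff (power_sum k * complete_sym (a - k)) m =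
            (\<Sum>i | k \<le> ?l i. if mdegree m = a then 1 else 0)"
          by (simp add: mcoeff_power_sum_mult)
      qed
      also have "\<dots> = (if mdegree m = a then \<Sum>k=1..a. \<Sum>i | k \<le> ?l i. 1 else 0)"
        by simp
      also have "\<dots> = (if mdegree m = a then of_nat a else 0)"
      proof (cases "mdegree m = a")
        case True
        have "(\<Sum>k=1..a. \<Sum>i | k \<le> ?l i. 1::complex) = (\<Sum>k=1..a. \<Sum>i\<in>{i\<in>?K. k \<le> ?l i}. 1)"
          by (intro sum.cong refl) (auto simp: in_keys_iff)
        also have "\<dots> = (\<Sum>i\<in>?K. \<Sum>k\<in>{k\<in>{1..a}. k \<le> ?l i}. 1)"
          by (rule sum.swap_restrict) auto
        also have "\<dots> = (\<Sum>i\<in>?K. of_nat (?l i))"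
        proof (intro sum.cong refl)
          fix i
          have "{k\<in>{1..a}. k \<le> ?l i} = {1..?l i}" using le[of i] True by auto
          then show "(\<Sum>k\<in>{k\<in>{1..a}. k \<le> ?l i}. 1::complex) = of_nat (?l i)" by simp
        qed
        also have "\<dots> = of_nat a" using True by (simp add: mdegree_def flip: of_nat_sum)
        finally show ?thesis using True by simp
      qed simp
      finally show "mcoeff (complete_of power_sum a) m = mcoeff (complete_sym a) m"
        using False by (simp add: complete_of.simps[of _ a] complete_sym_def)
    qed
  qed
qed

text \<open>Complex algebra homomorphisms from \<open>Lambda\<close> to \<open>sym_funs\<close> with the prescribed values on the
  complete functions in the \<open>Y\<^sup>\<phi>\<close>.  These conditions determine \<open>\<rho>\<close> on \<open>Lambda\<close>; its values
  elsewhere are irrelevant.\<close>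

definition plethysm_map :: "(('a::{finite,field} poly \<times> nat) mseries \<Rightarrow> nat mseries) \<Rightarrow> bool" where
  "plethysm_map \<rho> \<longleftrightarrow>
     (\<forall>F\<in>Lambda. \<rho> F \<in> sym_funs) \<and>
     (\<forall>c. \<rho> (mconst c) = mconst c) \<and>
     (\<forall>F\<in>Lambda. \<forall>G\<in>Lambda. \<rho> (F + G) = \<rho> F + \<rho> G) \<and>
     (\<forall>F\<in>Lambda. \<forall>G\<in>Lambda. \<rho> (F * G) = \<rho> F * \<rho> G) \<and>
     (\<forall>\<phi>\<in>Theta. \<forall>a. \<rho> (complete_Y \<phi> a) = plethysm_power (card \<phi>) (complete_sym a))"

section \<open>The characteristic map\<close>

definition GL :: "nat \<Rightarrow> 'a::{finite,field} mat monoid" where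
  "GL n = units_of (ring_mat TYPE('a) n ())"

definition unitriangular :: "nat \<Rightarrow> 'a::{finite,field} mat set" where
  "unitriangular n = {u \<in> carrier_mat n n. upper_triangular u \<and> (\<forall>i<n. u $$ (i, i) = 1)}"

definition induced_fun :: "('g, 'b) monoid_scheme \<Rightarrow> 'g set \<Rightarrow> ('g \<Rightarrow> complex) \<Rightarrow> 'g \<Rightarrow> complex" where
  "induced_fun G H \<chi> g = (1 / of_nat (card H)) *
     (\<Sum>x\<in>{x \<in> carrier G. inv\<^bsub>G\<^esub> x \<otimes>\<^bsub>G\<^esub> g \<otimes>\<^bsub>G\<^esub> x \<in> H}. \<chi> (inv\<^bsub>G\<^esub> x \<otimes>\<^bsub>G\<^esub> g \<otimes>\<^bsub>G\<^esub> x))"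

definition part_funs_Phi :: "nat \<Rightarrow> ('a::{finite,field} poly \<Rightarrow> nat list) set" where
  "part_funs_Phi n = {\<mu>. (\<forall>f. \<mu> f \<in> partitions) \<and> {f. \<mu> f \<noteq> []} \<subseteq> Phi \<and>
     finite {f. \<mu> f \<noteq> []} \<and> (\<Sum>f | \<mu> f \<noteq> []. degree f * sum_list (\<mu> f)) = n}"

text \<open>The module \<open>\<Oplus>\<^sub>f \<Oplus>\<^sub>i F\<^sub>q[x] / (f\<^bsup>\<mu>(f)\<^sub>i\<^esup>)\<close>, with residue classes represented by reduced
  polynomials, and the action of \<open>x\<close> on it.\<close>

definition elem_module :: "('a::{finite,field} poly \<Rightarrow> nat list) \<Rightarrow> ('a poly \<times> nat \<Rightarrow> 'a poly) set" where
  "elem_module \<mu> = {u. \<forall>f i. if i < length (\<mu> f)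
     then u (f, i) mod f ^ (\<mu> f ! i) = u (f, i) else u (f, i) = 0}"

definition elem_module_x :: "('a::{finite,field} poly \<Rightarrow> nat list) \<Rightarrow>
    ('a poly \<times> nat \<Rightarrow> 'a poly) \<Rightarrow> 'a poly \<times> nat \<Rightarrow> 'a poly" where
  "elem_module_x \<mu> u = (\<lambda>(f, i). if i < length (\<mu> f)
     then ([:0, 1:] * u (f, i)) mod f ^ (\<mu> f ! i) else 0)"

definition K_class :: "nat \<Rightarrow> ('a::{finite,field} poly \<Rightarrow> nat list) \<Rightarrow> 'a mat set" where
  "K_class n \<mu> = {g \<in> carrier (GL n). \<exists>T. bij_betw T (carrier_vec n) (elem_module \<mu>) \<and>
     (\<forall>v\<in>carrier_vec n. \<forall>w\<in>carrier_vec n. T (v + w) = (\<lambda>k. T v k + T w k)) \<and>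
     (\<forall>c. \<forall>v\<in>carrier_vec n. T (c \<cdot>\<^sub>v v) = (\<lambda>k. smult c (T v k))) \<and>
     (\<forall>v\<in>carrier_vec n. T (g *\<^sub>v v) = elem_module_x \<mu> (T v))}"

definition P_tilde :: "('a::{finite,field} poly \<Rightarrow> nat list) \<Rightarrow> ('a poly \<times> nat) mseries" where
  "P_tilde \<mu> = (\<Prod>f | \<mu> f \<noteq> [].
     in_alphabet f (HL_P_twisted (\<mu> f) (of_nat CARD('a) ^ degree f)))"

text \<open>The component of \<open>ch\<close> on class functions on \<open>GL n\<close>: the coefficient of the indicator
  function of a conjugacy class in \<open>\<gamma>\<close> is the value of \<open>\<gamma>\<close> on this class.\<close>

definition char_map :: "nat \<Rightarrow> ('a::{finite,field} mat \<Rightarrow> complex) \<Rightarrow> ('a poly \<times> nat) mseries" where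
  "char_map n \<gamma> = (\<Sum>\<mu>\<in>part_funs_Phi n. mconst (\<gamma> (SOME g. g \<in> K_class n \<mu>)) * P_tilde \<mu>)"

definition additive_char :: "('a::{finite,field} \<Rightarrow> complex) \<Rightarrow> bool" where
  "additive_char \<psi> \<longleftrightarrow> (\<forall>x. \<psi> x \<noteq> 0) \<and> (\<forall>x y. \<psi> (x + y) = \<psi> x * \<psi> y)"

text \<open>Matrix entries are indexed from zero, so the superdiagonal entry \<open>u\<^bsub>i,i+1\<^esub>\<close> is
  \<open>u $$ (i - 1, i)\<close>.\<close>

definition linear_char :: "('a::{finite,field} \<Rightarrow> complex) \<Rightarrow> nat \<Rightarrow> (nat \<Rightarrow> 'a) \<Rightarrow> 'a mat \<Rightarrow> complex" where
  "linear_char \<psi> n c u = (\<Prod>i\<in>{1..<n}. \<psi> (c i * u $$ (i - 1, i)))"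

end

theory Submission
  imports Defs "Jordan_Normal_Form.Determinant"
begin

text \<open>Let \<open>Q\<^sub>n(y)\<close> be the coefficient of \<open>u\<^sup>n\<close> in \<open>\<Prod>\<^sub>i (1 - y z\<^sub>i u) / (1 - z\<^sub>i u)\<close>.  For all \<open>t\<close> and \<open>y\<close>
  it has the expansion \<open>Q\<^sub>n(y) = \<Sum>\<nu>. t\<^bsup>n(\<nu>)\<^esup> (\<Prod>j<l(\<nu>). 1 - y t\<^bsup>-j\<^esup>) P\<^sub>\<nu>(t)\<close>, which reduces to an
  interpolation identity for sums over subsets of finitely many variables; \<open>y = t\<close> gives
  \<open>q\<^sub>n(t) = Q\<^sub>n(t)\<close>.  The induced character vanishes off the unipotent elements, and at a unipotent
  \<open>g\<close> with \<open>dim ker (g - 1) = k\<close> it takes the value \<open>(-1)\<^bsup>n-k\<^esup> (q - 1) \<dots> (q\<^sup>k - 1)\<close>.  The dimension is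
  the length of the type of \<open>g\<close>, so the expansion with \<open>t = 1/q\<close> and \<open>y = q\<close> identifies the
  characteristic with \<open>(-1)\<^sup>n Q\<^sub>n(q)\<close> in the alphabet of the polynomial \<open>x - 1\<close>.  Orthogonality of the
  characters of \<open>M\<^sub>k\<close> shows that \<open>\<rho>\<close> sends the power sum \<open>p\<^sub>k\<close> of this alphabet to \<open>(-1)\<^bsup>k-1\<^esup> p\<^sub>k(Y)\<close>.
  As \<open>Q\<^sub>n(y)\<close> is the complete function attached to the power sums \<open>(1 - y\<^sup>k) p\<^sub>k\<close>, the image under
  \<open>\<rho>\<close> is attached to \<open>(q\<^sup>k - 1) p\<^sub>k = q\<^sup>k (1 - q\<^bsup>-k\<^esup>) p\<^sub>k\<close>, and so it equals \<open>q\<^sup>n Q\<^sub>n(1/q)\<close>.\<close>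

section \<open>Symmetrisation over subsets of the variables\<close>

text \<open>A Hall-Littlewood function is a limit of sums of rational functions over cosets, so no
  coefficient is accessible before these sums are known to be polynomials that are stable in
  \<open>N\<close>. Indexing them by rearranged exponent vectors instead of cosets lets all
  partitions of n together run over all weak compositions of n, and this is what makes an induction
  possible: 1 is subtracted from every nonzero exponent. The parameter y stays free because the
  interpolation itself moves it to y/t, and because both y = q and y = t are needed for the same t =
  1/q. For the induced character a direct induction on the matrix fails: fixing the last row of the
  inverse of the conjugating matrix leaves a smaller matrix together with a column, whose last entry
  enters one more value of \<psi>. Sums with such an additional column close up, and for nilpotent
  matrices of a given size their value depends only on the number of rows that annihilate both the
  matrix and the column. Each step multiplies by q^r - 1 or by -1, which is the origin of the sign
  (-1)^(n-k).\<close>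

definition qpoch :: "'b::field \<Rightarrow> 'b \<Rightarrow> nat \<Rightarrow> 'b" where
  "qpoch t y r = (\<Prod>j<r. t ^ j - y)"

text \<open>The factor j = 0 splits off and t is drawn out of all others. The resulting change of
  \<open>y\<close> into \<open>y / t\<close> is the shift made by the induction in
  \<open>HL_subset_identity\<close>.\<close>

lemma qpoch_Suc': "t \<noteq> 0 \<Longrightarrow> qpoch t y (Suc r) = (1 - y) * t ^ r * qpoch t (y / t) r"
proof -
  assume t: "t \<noteq> 0"
  have "qpoch t y (Suc r) = (1 - y) * (\<Prod>j<r. t ^ Suc j - y)"
    unfolding qpoch_def by (subst prod.lessThan_Suc_shift) simp
  also have "(\<Prod>j<r. t ^ Suc j - y) = (\<Prod>j<r. t * (t ^ j - y / t))"
    using t by (intro prod.cong) (auto simp: field_simps)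
  also have "\<dots> = t ^ r * qpoch t (y / t) r" by (simp add: prod.distrib qpoch_def)
  finally show ?thesis by simp
qed

text \<open>The part of a Hall-Littlewood term that comes from pairs of a nonzero exponent, with
  index in \<open>T\<close>, and a zero exponent, with index in \<open>U\<close>.\<close>

definition HL_cross :: "('i \<Rightarrow> 'b::field) \<Rightarrow> 'b \<Rightarrow> 'i set \<Rightarrow> 'i set \<Rightarrow> 'b" where
  "HL_cross x t T U = (\<Prod>i\<in>T. \<Prod>j\<in>U. (x i - t * x j) / (x i - x j))"

definition one_minus :: "'b::field \<Rightarrow> 'b poly" where
  "one_minus c = [:1, - c:]"

lemma poly_one_minus [simp]: "poly (one_minus c) u = 1 - c * u"
  by (simp add: one_minus_def algebra_simps)

lemma degree_one_minus: "degree (one_minus c) \<le> 1"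
  by (simp add: one_minus_def)

lemma degree_prod_one_minus: "finite S \<Longrightarrow> degree (\<Prod>i\<in>S. one_minus (f i)) \<le> card S"
  using degree_prod_sum_le[of S "\<lambda>i. one_minus (f i)"] sum_mono[of S "\<lambda>i. degree (one_minus (f i))" "\<lambda>_. 1"]
    degree_one_minus by (force simp: o_def)

text \<open>Both sides are polynomials in u of degree at most |S|, so it suffices to compare them at
  the |S| + 1 distinct points 0 and 1/x_k. At 1/x_k only the sets T containing k survive, and
  deleting k from them leaves the identity for S - {k} with parameter y/t, evaluated at
  t/x_k.\<close>

theorem HL_subset_identity:
  fixes x :: "'i \<Rightarrow> 'b::field"
  assumes "finite S" "inj_on x S" "\<forall>i\<in>S. x i \<noteq> 0" and t: "t \<noteq> 0"
  shows "(\<Sum>T\<in>Pow S. monom (qpoch t y (card T) * (\<Prod>i\<in>T. x i) * HL_cross x t T (S - T)) (card T) *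
            (\<Prod>j\<in>S - T. one_minus (x j))) = (\<Prod>i\<in>S. one_minus (y * x i))"
  using assms(1-3)
proof (induction "card S" arbitrary: S y)
  case 0
  then show ?case by (simp add: qpoch_def HL_cross_def)
next
  case (Suc n)
  let ?L = "\<lambda>S y. \<Sum>T\<in>Pow S. monom (qpoch t y (card T) * (\<Prod>i\<in>T. x i) * HL_cross x t T (S - T)) (card T) *
            (\<Prod>j\<in>S - T. one_minus (x j))"
  let ?R = "\<lambda>S y. \<Prod>i\<in>S. one_minus (y * x i)"
  have fin: "finite S" by fact
  have finT: "finite T" if "T \<in> Pow S" for T using that fin finite_subset by auto
  have at_k: "poly (?L S y) (1 / x k) = poly (?R S y) (1 / x k)" if k: "k \<in> S" for k
  proof -
    let ?u = "1 / x k" and ?S = "S - {k}"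
    have xk: "x k \<noteq> 0" using k Suc by auto
    have poly_L: "poly (?L S y) ?u = (\<Sum>T\<in>Pow S. qpoch t y (card T) * (\<Prod>i\<in>T. x i) * HL_cross x t T (S - T) *
        ?u ^ card T * (\<Prod>j\<in>S - T. 1 - x j * ?u))" for S y
      by (simp add: poly_sum poly_monom poly_prod)
    have IH: "poly (?L ?S (y / t)) (t * ?u) = poly (?R ?S (y / t)) (t * ?u)"
      using Suc.hyps(2) Suc.prems k by (subst Suc.hyps(1)) (auto simp: inj_on_def)
    have "poly (?L S y) ?u = (\<Sum>T\<in>insert k ` Pow ?S. qpoch t y (card T) * (\<Prod>i\<in>T. x i) * HL_cross x t T (S - T) *
        ?u ^ card T * (\<Prod>j\<in>S - T. 1 - x j * ?u))"
      unfolding poly_L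
    proof (rule sum.mono_neutral_right)
      show "\<forall>T\<in>Pow S - insert k ` Pow ?S. qpoch t y (card T) * (\<Prod>i\<in>T. x i) * HL_cross x t T (S - T) *
        ?u ^ card T * (\<Prod>j\<in>S - T. 1 - x j * ?u) = 0"
      proof
        fix T assume T: "T \<in> Pow S - insert k ` Pow ?S"
        have "k \<notin> T"
        proof
          assume "k \<in> T"
          then have "T = insert k (T - {k})" "T - {k} \<in> Pow ?S" using T by auto
          then show False using T by blast
        qed
        then have "(\<Prod>j\<in>S - T. 1 - x j * ?u) = 0"
          using fin k xk by (intro prod_zero bexI[of _ k]) auto
        then show "qpoch t y (card T) * (\<Prod>i\<in>T. x i) * HL_cross x t T (S - T) *
          ?u ^ card T * (\<Prod>j\<in>S - T. 1 - x j * ?u) = 0" by simp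
      qed
    qed (use fin k in auto)
    also have "\<dots> = (\<Sum>T\<in>Pow ?S. qpoch t y (card (insert k T)) * (\<Prod>i\<in>insert k T. x i) * HL_cross x t (insert k T) (S - insert k T) *
        ?u ^ card (insert k T) * (\<Prod>j\<in>S - insert k T. 1 - x j * ?u))"
      by (rule sum.reindex_cong[OF _ refl refl]) (auto simp: inj_on_def)
    also have "\<dots> = (\<Sum>T\<in>Pow ?S. (1 - y) * (qpoch t (y / t) (card T) * (\<Prod>i\<in>T. x i) * HL_cross x t T (?S - T) *
        (t * ?u) ^ card T * (\<Prod>j\<in>?S - T. 1 - x j * (t * ?u))))"
    proof (rule sum.cong[OF refl])
      fix T assume T: "T \<in> Pow ?S"
      have [simp]: "finite T" "k \<notin> T" using T fin finite_subset by auto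
      have ST: "S - insert k T = ?S - T" by auto
      \<comment> \<open>The denominator x_k - x_j cancels against 1 - x_j/x_k; what is left is the
        linear factor of the smaller identity at t/x_k.\<close>
      have "(\<Prod>j\<in>?S - T. (x k - t * x j) / (x k - x j)) * (\<Prod>j\<in>?S - T. 1 - x j * ?u) =
          (\<Prod>j\<in>?S - T. 1 - x j * (t * ?u))"
        unfolding prod.distrib[symmetric]
      proof (rule prod.cong[OF refl])
        fix j assume "j \<in> ?S - T"
        then have "x k \<noteq> x j" using Suc.prems(2) k by (auto simp: inj_on_def)
        then show "(x k - t * x j) / (x k - x j) * (1 - x j * ?u) = 1 - x j * (t * ?u)"
          using xk by (simp add: field_simps)
      qed
      moreover have "HL_cross x t (insert k T) (?S - T) =
          (\<Prod>j\<in>?S - T. (x k - t * x j) / (x k - x j)) * HL_cross x t T (?S - T)"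
        unfolding HL_cross_def by simp
      ultimately have *: "HL_cross x t (insert k T) (?S - T) * (\<Prod>j\<in>?S - T. 1 - x j * ?u) =
          HL_cross x t T (?S - T) * (\<Prod>j\<in>?S - T. 1 - x j * (t * ?u))" by (simp add: mult_ac)
      have "qpoch t y (card (insert k T)) * (\<Prod>i\<in>insert k T. x i) * HL_cross x t (insert k T) (S - insert k T) *
        ?u ^ card (insert k T) * (\<Prod>j\<in>S - insert k T. 1 - x j * ?u) =
        (1 - y) * t ^ card T * qpoch t (y / t) (card T) * (x k * (\<Prod>i\<in>T. x i)) * (?u * ?u ^ card T) *
        (HL_cross x t (insert k T) (?S - T) * (\<Prod>j\<in>?S - T. 1 - x j * ?u))"
        unfolding ST by (simp add: qpoch_Suc'[OF t])
      also have "\<dots> = (1 - y) * (qpoch t (y / t) (card T) * (\<Prod>i\<in>T. x i) * HL_cross x t T (?S - T) *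
        (t * ?u) ^ card T * (\<Prod>j\<in>?S - T. 1 - x j * (t * ?u)))"
        unfolding * power_mult_distrib using xk by (simp add: mult_ac)
      finally show "qpoch t y (card (insert k T)) * (\<Prod>i\<in>insert k T. x i) * HL_cross x t (insert k T) (S - insert k T) *
        ?u ^ card (insert k T) * (\<Prod>j\<in>S - insert k T. 1 - x j * ?u) = \<dots>" .
    qed
    also have "\<dots> = (1 - y) * poly (?L ?S (y / t)) (t * ?u)"
      unfolding sum_distrib_left[symmetric] by (simp add: poly_sum poly_monom poly_prod)
    also have "\<dots> = (1 - y) * (\<Prod>i\<in>?S. 1 - y * x i * ?u)"
      unfolding IH using t by (simp add: poly_prod mult_ac)
    also have "\<dots> = poly (?R S y) ?u"
      using xk prod.remove[OF fin k, of "\<lambda>i. 1 - y * x i * ?u"] by (simp add: poly_prod)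
    finally show ?thesis .
  qed
  have at_0: "poly (?L S y) 0 = poly (?R S y) 0"
  proof -
    have "poly (?L S y) 0 = (\<Sum>T\<in>Pow S. if T = {} then 1 else 0)"
      unfolding poly_sum
    proof (rule sum.cong[OF refl])
      fix T assume "T \<in> Pow S"
      then show "poly (monom (qpoch t y (card T) * (\<Prod>i\<in>T. x i) * HL_cross x t T (S - T)) (card T) *
            (\<Prod>j\<in>S - T. one_minus (x j))) 0 = (if T = {} then 1 else 0)"
      proof (cases "T = {}")
        case True
        then show ?thesis by (simp add: poly_prod qpoch_def HL_cross_def)
      next
        case False
        have "finite T" by (rule finT) fact
        with False have "card T \<noteq> 0" by simp
        then show ?thesis using False by (simp add: poly_monom power_0_left)
      qed
    qed
    also have "\<dots> = 1" using fin by (subst sum.delta) auto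
    finally show ?thesis by (simp add: poly_prod)
  qed
  define A where "A = insert 0 ((\<lambda>k. 1 / x k) ` S)"
  have "card A = Suc (card S)"
  proof -
    have "inj_on (\<lambda>k. 1 / x k) S" using Suc.prems by (auto simp: inj_on_def)
    then show ?thesis unfolding A_def using fin Suc.prems(3)
      by (subst card_insert_disjoint) (auto simp: card_image)
  qed
  moreover have "degree (?L S y) \<le> card S"
  proof (rule degree_sum_le)
    show "finite (Pow S)" using fin by simp
    fix T assume T: "T \<in> Pow S"
    have "degree (monom (qpoch t y (card T) * (\<Prod>i\<in>T. x i) * HL_cross x t T (S - T)) (card T)) \<le> card T"
      by (rule degree_monom_le)
    moreover have "degree (\<Prod>j\<in>S - T. one_minus (x j)) \<le> card (S - T)"
      using fin by (intro degree_prod_one_minus) auto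
    moreover have "card T + card (S - T) = card S"
      using T fin by (simp add: card_Diff_subset card_mono finT)
    ultimately show "degree (monom (qpoch t y (card T) * (\<Prod>i\<in>T. x i) * HL_cross x t T (S - T)) (card T) *
            (\<Prod>j\<in>S - T. one_minus (x j))) \<le> card S"
      by (intro order.trans[OF degree_mult_le]) linarith
  qed
  moreover have "degree (?R S y) \<le> card S"
    using fin by (rule degree_prod_one_minus)
  ultimately show ?case
    using at_0 at_k by (intro poly_eqI_degree[of A]) (auto simp: A_def)
qed

section \<open>Weak compositions and generating functions\<close>

definition comps :: "'i set \<Rightarrow> nat \<Rightarrow> ('i \<Rightarrow> nat) set" where
  "comps S n = {\<alpha>. (\<forall>i. i \<notin> S \<longrightarrow> \<alpha> i = 0) \<and> sum \<alpha> S = n}"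

lemma finite_comps: "finite S \<Longrightarrow> finite (comps S n)"
proof -
  assume S: "finite S"
  have "comps S n \<subseteq> {\<alpha>. \<forall>i. (i \<in> S \<longrightarrow> \<alpha> i \<in> {..n}) \<and> (i \<notin> S \<longrightarrow> \<alpha> i = 0)}"
    using S by (auto simp: comps_def intro: member_le_sum)
  moreover have "finite {\<alpha>. \<forall>i. (i \<in> S \<longrightarrow> \<alpha> i \<in> {..n}) \<and> (i \<notin> S \<longrightarrow> \<alpha> i = (0::nat))}"
    using S by (intro finite_set_of_finite_funs) auto
  ultimately show ?thesis by (rule finite_subset)
qed

lemma sum_comps_insert:
  assumes "finite S" "i \<notin> S"
  shows "(\<Sum>\<alpha>\<in>comps (insert i S) n. f \<alpha>) = (\<Sum>k\<le>n. \<Sum>\<beta>\<in>comps S (n - k). f (\<beta>(i := k)))"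
proof -
  have "(\<Sum>k\<le>n. \<Sum>\<beta>\<in>comps S (n - k). f (\<beta>(i := k))) =
      (\<Sum>(k, \<beta>)\<in>(SIGMA k:{..n}. comps S (n - k)). f (\<beta>(i := k)))"
    by (rule sum.Sigma) (auto intro: finite_comps assms)
  also have "\<dots> = (\<Sum>\<alpha>\<in>comps (insert i S) n. f \<alpha>)"
  proof (rule sum.reindex_bij_witness[of _ "\<lambda>\<alpha>. (\<alpha> i, \<alpha>(i := 0))" "\<lambda>(k, \<beta>). \<beta>(i := k)"], goal_cases)
    case (4 \<alpha>)
    have "sum (\<alpha>(i := 0)) S = sum \<alpha> S" using assms by (intro sum.cong) auto
    then show ?case using 4 assms by (auto simp: comps_def)
  next
    case (2 p)
    obtain k \<beta> where p: "p = (k, \<beta>)" by (cases p)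
    have "sum (\<beta>(i := k)) S = sum \<beta> S" using assms by (intro sum.cong) auto
    then show ?case using 2 assms p by (auto simp: comps_def)
  qed (use assms in \<open>auto simp: comps_def\<close>)
  finally show ?thesis ..
qed

lemma comps_empty: "comps {} n = (if n = 0 then {\<lambda>_. 0} else {})"
  by (auto simp: comps_def)

text \<open>The coefficient of u^n in the product over \<open>S\<close> of (1 - y x_i u)/(1 - x_i
  u), because each factor expands as 1 plus the sum of (1 - y) x_i^k u^k over k \<ge> 1. For y = 0
  it is the complete symmetric polynomial of degree n.\<close>

definition hsum :: "('i \<Rightarrow> 'b::field) \<Rightarrow> 'b \<Rightarrow> 'i set \<Rightarrow> nat \<Rightarrow> 'b" where
  "hsum x y S n = (\<Sum>\<alpha>\<in>comps S n. \<Prod>i\<in>S. if \<alpha> i = 0 then 1 else (1 - y) * x i ^ \<alpha> i)"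

definition hfactor :: "'b::field \<Rightarrow> 'b \<Rightarrow> 'b fps" where
  "hfactor y c = Abs_fps (\<lambda>k. if k = 0 then 1 else (1 - y) * c ^ k)"

lemma hfactor_mult:
  fixes y c :: "'b::field"
  shows "hfactor y c * fps_of_poly (one_minus c) = fps_of_poly (one_minus (y * c))"
proof -
  have *: "fps_of_poly (one_minus d) = 1 - fps_const d * fps_X" for d :: 'b
    by (simp add: one_minus_def fps_of_poly_pCons)
  have "hfactor y c * fps_of_poly (one_minus c) = hfactor y c - fps_const c * (fps_X * hfactor y c)"
    unfolding * by (simp add: algebra_simps)
  also have "\<dots> = 1 - fps_const (y * c) * fps_X"
  proof (rule fps_ext)
    fix n
    show "fps_nth (hfactor y c - fps_const c * (fps_X * hfactor y c)) n = fps_nth (1 - fps_const (y * c) * fps_X) n"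
    proof (cases n)
      case (Suc m)
      then show ?thesis by (cases m) (auto simp: hfactor_def algebra_simps)
    qed (simp add: hfactor_def)
  qed
  finally show ?thesis unfolding * .
qed

lemma hsum_fps: "finite S \<Longrightarrow> fps_nth (\<Prod>i\<in>S. hfactor y (x i)) n = hsum x y S n"
proof (induction S arbitrary: n rule: finite_induct)
  case empty
  show ?case by (simp add: hsum_def comps_empty)
next
  case (insert i S)
  have "fps_nth (\<Prod>i\<in>insert i S. hfactor y (x i)) n =
      (\<Sum>k\<le>n. fps_nth (hfactor y (x i)) k * hsum x y S (n - k))"
    using insert by (simp add: fps_mult_nth atLeast0AtMost)
  also have "\<dots> = hsum x y (insert i S) n"
    unfolding hsum_def sum_comps_insert[OF insert(1,2)] sum_distrib_left
  proof (intro sum.cong refl)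
    fix k \<beta> assume "\<beta> \<in> comps S (n - k)"
    have "(\<Prod>j\<in>S. if (\<beta>(i := k)) j = 0 then 1 else (1 - y) * x j ^ (\<beta>(i := k)) j) =
       (\<Prod>j\<in>S. if \<beta> j = 0 then 1 else (1 - y) * x j ^ \<beta> j)"
      using insert by (intro prod.cong) auto
    then show "fps_nth (hfactor y (x i)) k * (\<Prod>j\<in>S. if \<beta> j = 0 then 1 else (1 - y) * x j ^ \<beta> j) =
       (\<Prod>j\<in>insert i S. if (\<beta>(i := k)) j = 0 then 1 else (1 - y) * x j ^ (\<beta>(i := k)) j)"
      using insert by (simp add: hfactor_def)
  qed
  finally show ?case .
qed

text \<open>This is \<open>HL_subset_identity\<close> divided by the product of all 1 - x_j u: the
  factors for S - T cancel, the inverses for T remain, and the coefficient of u^n is read off. Sets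
  with more than n elements start in a higher degree.\<close>

lemma hsum_subset_identity:
  fixes x :: "'i \<Rightarrow> 'b::field"
  assumes S: "finite S" "inj_on x S" "\<forall>i\<in>S. x i \<noteq> 0" and t: "t \<noteq> 0"
  shows "(\<Sum>T | T \<subseteq> S \<and> card T \<le> n. qpoch t y (card T) * (\<Prod>i\<in>T. x i) * HL_cross x t T (S - T) *
            hsum x 0 T (n - card T)) = hsum x y S n"
proof -
  let ?c = "\<lambda>T. qpoch t y (card T) * (\<Prod>i\<in>T. x i) * HL_cross x t T (S - T)"
  let ?H = "\<lambda>y S. \<Prod>i\<in>S. hfactor y (x i)"
  have "?H y S = ?H 0 S * (\<Prod>i\<in>S. fps_of_poly (one_minus (y * x i)))"
    unfolding prod.distrib[symmetric]
  proof (rule prod.cong[OF refl])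
    fix i
    have "hfactor 0 (x i) * fps_of_poly (one_minus (y * x i)) =
        hfactor y (x i) * (hfactor 0 (x i) * fps_of_poly (one_minus (x i)))"
      unfolding hfactor_mult[of y, symmetric] by (simp add: mult_ac)
    also have "\<dots> = hfactor y (x i)" unfolding hfactor_mult by (simp add: one_minus_def)
    finally show "hfactor y (x i) = hfactor 0 (x i) * fps_of_poly (one_minus (y * x i))" ..
  qed
  also have "(\<Prod>i\<in>S. fps_of_poly (one_minus (y * x i))) =
      (\<Sum>T\<in>Pow S. fps_const (?c T) * fps_X ^ card T * (\<Prod>j\<in>S - T. fps_of_poly (one_minus (x j))))"
    using arg_cong[OF HL_subset_identity[OF S t, of y], of fps_of_poly]
    by (simp add: fps_of_poly_prod fps_of_poly_sum fps_of_poly_mult fps_of_poly_monom)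
  also have "?H 0 S * \<dots> = (\<Sum>T\<in>Pow S. fps_const (?c T) * (fps_X ^ card T * ?H 0 T))"
    unfolding sum_distrib_left
  proof (rule sum.cong[OF refl])
    fix T assume T: "T \<in> Pow S"
    have 1: "?H 0 (S - T) * (\<Prod>j\<in>S - T. fps_of_poly (one_minus (x j))) = 1"
      unfolding prod.distrib[symmetric] hfactor_mult by (simp add: one_minus_def)
    have "?H 0 S = ?H 0 T * ?H 0 (S - T)"
      using T S by (metis Pow_iff mult.commute prod.subset_diff)
    then have "?H 0 S * (fps_const (?c T) * fps_X ^ card T * (\<Prod>j\<in>S - T. fps_of_poly (one_minus (x j)))) =
      fps_const (?c T) * (fps_X ^ card T * ?H 0 T) * (?H 0 (S - T) * (\<Prod>j\<in>S - T. fps_of_poly (one_minus (x j))))"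
      by (simp add: mult_ac)
    then show "?H 0 S * (fps_const (?c T) * fps_X ^ card T * (\<Prod>j\<in>S - T. fps_of_poly (one_minus (x j)))) =
      fps_const (?c T) * (fps_X ^ card T * ?H 0 T)" unfolding 1 by simp
  qed
  finally have "fps_nth (?H y S) n = fps_nth (\<Sum>T\<in>Pow S. fps_const (?c T) * (fps_X ^ card T * ?H 0 T)) n" by simp
  also have "\<dots> = (\<Sum>T\<in>Pow S. if card T \<le> n then ?c T * hsum x 0 T (n - card T) else 0)"
  proof -
    have "fps_nth (?H 0 T) k = hsum x 0 T k" if "T \<in> Pow S" for T k
      using that S by (intro hsum_fps) (auto intro: finite_subset)
    then show ?thesis
      by (auto simp: fps_sum_nth fps_mult_left_const_nth fps_X_power_mult_nth intro!: sum.cong)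
  qed
  also have "\<dots> = (\<Sum>T | T \<subseteq> S \<and> card T \<le> n. ?c T * hsum x 0 T (n - card T))"
    using S by (intro sum.mono_neutral_cong_right) auto
  finally show ?thesis using S by (simp add: hsum_fps)
qed

text \<open>One summand of the Hall-Littlewood sum, indexed by its exponent vector \<alpha> instead
  of a coset of permutations. Arbitrary finite index sets are allowed because the induction passes
  to subsets.\<close>

definition HL_R :: "('i \<Rightarrow> 'b::field) \<Rightarrow> 'b \<Rightarrow> 'i set \<Rightarrow> ('i \<Rightarrow> nat) \<Rightarrow> 'b" where
  "HL_R x t S \<alpha> = (\<Prod>i\<in>S. x i ^ \<alpha> i) *
     (\<Prod>(i, j)\<in>{(i, j). i \<in> S \<and> j \<in> S \<and> \<alpha> i > \<alpha> j}. (x i - t * x j) / (x i - x j))"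

text \<open>Twice the statistic \<open>n(\<alpha>\<^sup>+)\<close>: unlike \<open>\<Sum>(i-1)\<alpha>\<^sub>i\<close>, the sum of the minima over all pairs does not
  require \<open>\<alpha>\<close> to be sorted.\<close>

definition min_stat :: "'i set \<Rightarrow> ('i \<Rightarrow> nat) \<Rightarrow> nat" where
  "min_stat S \<alpha> = (\<Sum>i\<in>S. \<Sum>j\<in>S - {i}. min (\<alpha> i) (\<alpha> j))"

definition rpoch :: "'b::field \<Rightarrow> 'b \<Rightarrow> nat \<Rightarrow> 'b" where
  "rpoch t y r = (\<Prod>j<r. 1 - y / t ^ j)"

text \<open>The extracted power t^(r(r-1)/2) is exactly what t^(n(\<alpha>)) gains when 1 is added
  to r exponents, see \<open>min_stat_raise\<close>.\<close>

lemma qpoch_rpoch: "t \<noteq> 0 \<Longrightarrow> qpoch t y r = t ^ (r * (r - 1) div 2) * rpoch t y r"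
proof -
  assume t: "t \<noteq> 0"
  have "qpoch t y r = (\<Prod>j<r. t ^ j * (1 - y / t ^ j))"
    unfolding qpoch_def using t by (intro prod.cong) (auto simp: field_simps)
  also have "\<dots> = t ^ (\<Sum>j<r. j) * rpoch t y r"
    by (simp add: prod.distrib rpoch_def power_sum)
  moreover have "2 * (\<Sum>j<r. j) = r * (r - 1)"
  proof (induction r)
    case (Suc r)
    then show ?case by (cases r) auto
  qed simp
  then have "(\<Sum>j<r. j) = r * (r - 1) div 2" by linarith
  ultimately show ?thesis by simp
qed

text \<open>Inverse to removing the first column of a diagram: a composition with support
  \<open>T\<close> is \<open>raise T \<beta>\<close> for exactly one \<beta> that vanishes outside
  \<open>T\<close>.\<close>

definition raise :: "'i set \<Rightarrow> ('i \<Rightarrow> nat) \<Rightarrow> 'i \<Rightarrow> nat" where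
  "raise T \<beta> = (\<lambda>i. if i \<in> T then Suc (\<beta> i) else 0)"

lemma sum_comps_support:
  assumes S: "finite S"
  shows "(\<Sum>\<alpha>\<in>comps S n. f \<alpha>) = (\<Sum>T | T \<subseteq> S \<and> card T \<le> n. \<Sum>\<beta>\<in>comps T (n - card T). f (raise T \<beta>))"
proof -
  have fin: "finite T" if "T \<subseteq> S" for T using that S finite_subset by auto
  have "(\<Sum>T | T \<subseteq> S \<and> card T \<le> n. \<Sum>\<beta>\<in>comps T (n - card T). f (raise T \<beta>)) =
      (\<Sum>(T, \<beta>)\<in>(SIGMA T:{T. T \<subseteq> S \<and> card T \<le> n}. comps T (n - card T)). f (raise T \<beta>))"
    using S by (intro sum.Sigma) (auto intro: finite_comps fin)
  also have "\<dots> = (\<Sum>\<alpha>\<in>comps S n. f \<alpha>)"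
  proof (rule sum.reindex_bij_witness[of _ "\<lambda>\<alpha>. ({i\<in>S. \<alpha> i > 0}, \<lambda>i. \<alpha> i - 1)" "\<lambda>(T, \<beta>). raise T \<beta>"], goal_cases)
    case (4 \<alpha>)
    let ?T = "{i\<in>S. \<alpha> i > 0}"
    have "n = sum \<alpha> S" using 4 by (simp add: comps_def)
    also have "\<dots> = sum \<alpha> ?T" using S by (intro sum.mono_neutral_right) auto
    also have "\<dots> = (\<Sum>i\<in>?T. (\<alpha> i - 1) + 1)" by (intro sum.cong) auto
    also have "\<dots> = (\<Sum>i\<in>?T. \<alpha> i - 1) + card ?T" by (simp only: sum.distrib sum_constant) simp
    finally have "n = (\<Sum>i\<in>?T. \<alpha> i - 1) + card ?T" .
    then show ?case using 4 by (auto simp: comps_def)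
  next
    case (2 p)
    obtain T \<beta> where p: "p = (T, \<beta>)" by (cases p)
    have T: "T \<subseteq> S" "card T \<le> n" and \<beta>: "\<beta> \<in> comps T (n - card T)" using 2 p by auto
    have "sum (raise T \<beta>) S = sum (raise T \<beta>) T"
      using S T by (intro sum.mono_neutral_right) (auto simp: raise_def)
    also have "\<dots> = (\<Sum>i\<in>T. \<beta> i + 1)" by (intro sum.cong) (auto simp: raise_def)
    also have "\<dots> = sum \<beta> T + card T" by (simp only: sum.distrib sum_constant) simp
    also have "\<dots> = n" using \<beta> T by (auto simp: comps_def)
    finally show ?case using T p by (auto simp: comps_def raise_def)
  qed (auto simp: raise_def comps_def fun_eq_iff split: if_splits)
  finally show ?thesis ..
qed

text \<open>Adding 1 on all of T keeps the order of the exponents there, so pairs inside T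
  contribute as before. The only further pairs join T to its complement, where a positive exponent
  meets a zero one.\<close>

lemma HL_R_raise:
  assumes S: "finite S" and T: "T \<subseteq> S"
  shows "HL_R x t S (raise T \<beta>) = (\<Prod>i\<in>T. x i) * HL_cross x t T (S - T) * HL_R x t T \<beta>"
proof -
  have fT: "finite T" using S T finite_subset by auto
  have "(\<Prod>i\<in>S. x i ^ raise T \<beta> i) = (\<Prod>i\<in>T. x i ^ raise T \<beta> i)"
    using S T by (intro prod.mono_neutral_right) (auto simp: raise_def)
  also have "\<dots> = (\<Prod>i\<in>T. x i * x i ^ \<beta> i)" by (intro prod.cong) (auto simp: raise_def)
  finally have 1: "(\<Prod>i\<in>S. x i ^ raise T \<beta> i) = (\<Prod>i\<in>T. x i) * (\<Prod>i\<in>T. x i ^ \<beta> i)"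
    by (simp add: prod.distrib)
  let ?P = "{(i, j). i \<in> T \<and> j \<in> T \<and> \<beta> i > \<beta> j}"
  have "{(i, j). i \<in> S \<and> j \<in> S \<and> raise T \<beta> i > raise T \<beta> j} = T \<times> (S - T) \<union> ?P"
    using T by (auto simp: raise_def split: if_splits)
  moreover have "finite ?P" by (rule finite_subset[of _ "T \<times> T"]) (use fT in auto)
  ultimately have 2: "(\<Prod>(i, j)\<in>{(i, j). i \<in> S \<and> j \<in> S \<and> raise T \<beta> i > raise T \<beta> j}. (x i - t * x j) / (x i - x j)) =
      HL_cross x t T (S - T) * (\<Prod>(i, j)\<in>?P. (x i - t * x j) / (x i - x j))"
    unfolding HL_cross_def prod.cartesian_product using S fT by (simp only:) (rule prod.union_disjoint; auto)
  show ?thesis unfolding HL_R_def 1 2 by (simp add: mult_ac)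
qed

lemma min_stat_raise:
  assumes S: "finite S" and T: "T \<subseteq> S"
  shows "min_stat S (raise T \<beta>) = min_stat T \<beta> + card T * (card T - 1)"
proof -
  have fT: "finite T" using S T finite_subset by auto
  have "min_stat S (raise T \<beta>) = (\<Sum>i\<in>T. \<Sum>j\<in>S - {i}. min (raise T \<beta> i) (raise T \<beta> j))"
    unfolding min_stat_def using S T by (intro sum.mono_neutral_right) (auto simp: raise_def)
  also have "\<dots> = (\<Sum>i\<in>T. \<Sum>j\<in>T - {i}. min (raise T \<beta> i) (raise T \<beta> j))"
    using S T by (intro sum.cong sum.mono_neutral_right) (auto simp: raise_def)
  also have "\<dots> = (\<Sum>i\<in>T. \<Sum>j\<in>T - {i}. min (\<beta> i) (\<beta> j) + 1)"
    by (intro sum.cong) (auto simp: raise_def)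
  also have "\<dots> = (\<Sum>i\<in>T. (\<Sum>j\<in>T - {i}. min (\<beta> i) (\<beta> j)) + (card T - 1))"
    using fT by (intro sum.cong refl) (simp only: sum.distrib sum_constant, simp)
  also have "\<dots> = min_stat T \<beta> + card T * (card T - 1)"
    unfolding min_stat_def by (simp only: sum.distrib sum_constant) simp
  finally show ?thesis .
qed

text \<open>Induction on n: grouped by support T, the compositions become compositions of n - |T| on
  T, and their sum is known from the induction hypothesis at y = 0, where \<open>rpoch\<close> is 1.
  The dependence on y then sits in a factor that involves only |T|, and
  \<open>hsum_subset_identity\<close> evaluates the sum over T.\<close>

theorem HL_R_sum:
  fixes x :: "'i \<Rightarrow> 'b::field"
  assumes S: "finite S" "inj_on x S" "\<forall>i\<in>S. x i \<noteq> 0" and t: "t \<noteq> 0"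
  shows "(\<Sum>\<alpha>\<in>comps S n. t ^ (min_stat S \<alpha> div 2) * rpoch t y (card {i\<in>S. \<alpha> i > 0}) * HL_R x t S \<alpha>) = hsum x y S n"
  using S
proof (induction n arbitrary: S y rule: less_induct)
  case (less n)
  have fin: "finite T" if "T \<subseteq> S" for T using that less.prems finite_subset by auto
  have IH: "(\<Sum>\<beta>\<in>comps T (n - card T). t ^ (min_stat T \<beta> div 2) * HL_R x t T \<beta>) = hsum x 0 T (n - card T)"
    if T: "T \<subseteq> S" "card T \<le> n" for T
  \<comment> \<open>For empty T the degree does not drop, so the induction hypothesis does not apply
    and the value is computed directly.\<close>
  proof (cases "T = {}")
    case True
    then show ?thesis by (simp add: hsum_def min_stat_def HL_R_def comps_empty)
  next
    case False
    then have "card T > 0" using fin T by (simp add: card_gt_0_iff)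
    then have "n - card T < n" using T by linarith
    from less.IH[OF this fin[OF T(1)], of 0] show ?thesis using less.prems T(1)
      by (simp add: rpoch_def inj_on_subset subset_iff)
  qed
  have "(\<Sum>\<alpha>\<in>comps S n. t ^ (min_stat S \<alpha> div 2) * rpoch t y (card {i\<in>S. \<alpha> i > 0}) * HL_R x t S \<alpha>) =
    (\<Sum>T | T \<subseteq> S \<and> card T \<le> n. \<Sum>\<beta>\<in>comps T (n - card T).
      (qpoch t y (card T) * (\<Prod>i\<in>T. x i) * HL_cross x t T (S - T)) * (t ^ (min_stat T \<beta> div 2) * HL_R x t T \<beta>))"
    unfolding sum_comps_support[OF less.prems(1)]
  proof (intro sum.cong refl)
    fix T \<beta> assume "T \<in> {T. T \<subseteq> S \<and> card T \<le> n}"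
    then have T: "T \<subseteq> S" by auto
    have "{i\<in>S. raise T \<beta> i > 0} = T" using T by (auto simp: raise_def)
    \<comment> \<open>The product of \<open>card T\<close> and \<open>card T - 1\<close> is even, so
      halving distributes over the sum.\<close>
    moreover have "min_stat S (raise T \<beta>) div 2 = min_stat T \<beta> div 2 + card T * (card T - 1) div 2"
      unfolding min_stat_raise[OF less.prems(1) T]
      by (intro div_plus_div_distrib_dvd_right) (cases "card T"; simp)
    ultimately show "t ^ (min_stat S (raise T \<beta>) div 2) * rpoch t y (card {i\<in>S. raise T \<beta> i > 0}) * HL_R x t S (raise T \<beta>) =
      (qpoch t y (card T) * (\<Prod>i\<in>T. x i) * HL_cross x t T (S - T)) * (t ^ (min_stat T \<beta> div 2) * HL_R x t T \<beta>)"
      by (simp add: HL_R_raise[OF less.prems(1) T] qpoch_rpoch[OF t] power_add mult_ac)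
  qed
  also have "\<dots> = (\<Sum>T | T \<subseteq> S \<and> card T \<le> n. qpoch t y (card T) * (\<Prod>i\<in>T. x i) * HL_cross x t T (S - T) *
      hsum x 0 T (n - card T))"
    unfolding sum_distrib_left[symmetric] using IH by (intro sum.cong) auto
  also have "\<dots> = hsum x y S n" by (rule hsum_subset_identity[OF less.prems t])
  finally show ?case .
qed

section \<open>Hall-Littlewood polynomials\<close>

type_synonym mpol = "(nat \<Rightarrow>\<^sub>0 nat) \<Rightarrow>\<^sub>0 complex"

definition cst :: "complex \<Rightarrow> mpol" where "cst c = Poly_Mapping.single 0 c"
definition mvar :: "nat \<Rightarrow> mpol" where "mvar i = Poly_Mapping.single (Poly_Mapping.single i 1) 1"

lemma cst_simps [simp]: "cst 0 = 0" "cst 1 = 1"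
  and cst_add: "cst (a + b) = cst a + cst b"
  and cst_mult: "cst (a * b) = cst a * cst b"
  by (simp_all add: cst_def single_add mult_single)

lemma cst_uminus: "cst (- a) = - cst a"
  by (simp add: cst_def single_uminus)

section \<open>Substitution into polynomials\<close>

definition msubst :: "(nat \<Rightarrow> mpol) \<Rightarrow> (nat \<Rightarrow>\<^sub>0 nat) \<Rightarrow> mpol" where
  "msubst v m = (\<Prod>i\<in>Poly_Mapping.keys m. v i ^ Poly_Mapping.lookup m i)"

definition vsubst :: "(nat \<Rightarrow> mpol) \<Rightarrow> mpol \<Rightarrow> mpol" where
  "vsubst v p = (\<Sum>m\<in>Poly_Mapping.keys p. cst (Poly_Mapping.lookup p m) * msubst v m)"

lemma msubst_superset:
  "finite A \<Longrightarrow> Poly_Mapping.keys m \<subseteq> A \<Longrightarrow> msubst v m = (\<Prod>i\<in>A. v i ^ Poly_Mapping.lookup m i)"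
  unfolding msubst_def by (rule prod.mono_neutral_left) (auto simp: in_keys_iff)

lemma vsubst_superset:
  "finite A \<Longrightarrow> Poly_Mapping.keys p \<subseteq> A \<Longrightarrow> vsubst v p = (\<Sum>m\<in>A. cst (Poly_Mapping.lookup p m) * msubst v m)"
  unfolding vsubst_def by (rule sum.mono_neutral_left) (auto simp: in_keys_iff)

lemma msubst_0 [simp]: "msubst v 0 = 1"
  by (simp add: msubst_def)

lemma msubst_add: "msubst v (m + m') = msubst v m * msubst v m'"
proof -
  let ?A = "Poly_Mapping.keys m \<union> Poly_Mapping.keys m'"
  have "msubst v (m + m') = (\<Prod>i\<in>?A. v i ^ Poly_Mapping.lookup (m + m') i)"
    by (rule msubst_superset) (auto simp: Poly_Mapping.keys_add)
  also have "\<dots> = (\<Prod>i\<in>?A. v i ^ Poly_Mapping.lookup m i) * (\<Prod>i\<in>?A. v i ^ Poly_Mapping.lookup m' i)"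
    by (simp add: lookup_add power_add prod.distrib)
  also have "\<dots> = msubst v m * msubst v m'"
    by (subst (1 2) msubst_superset[of ?A]) auto
  finally show ?thesis .
qed

lemma vsubst_single [simp]: "vsubst v (Poly_Mapping.single m c) = cst c * msubst v m"
  by (subst vsubst_superset[of "{m}"]) auto

lemma vsubst_cst [simp]: "vsubst v (cst c) = cst c"
  using vsubst_single[of v 0 c] by (simp add: cst_def)

lemma vsubst_0 [simp]: "vsubst v 0 = 0"
  by (simp add: vsubst_def)

lemma vsubst_1 [simp]: "vsubst v 1 = 1"
  using vsubst_cst[of v 1] by simp

lemma vsubst_var [simp]: "vsubst v (mvar i) = v i"
  by (simp add: mvar_def msubst_def)

lemma vsubst_add [simp]: "vsubst v (p + q) = vsubst v p + vsubst v q"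
proof -
  let ?A = "Poly_Mapping.keys p \<union> Poly_Mapping.keys q"
  have "vsubst v (p + q) = (\<Sum>m\<in>?A. cst (Poly_Mapping.lookup (p + q) m) * msubst v m)"
    by (rule vsubst_superset) (auto simp: Poly_Mapping.keys_add)
  also have "\<dots> = (\<Sum>m\<in>?A. cst (Poly_Mapping.lookup p m) * msubst v m) + (\<Sum>m\<in>?A. cst (Poly_Mapping.lookup q m) * msubst v m)"
    by (simp add: lookup_add cst_add algebra_simps sum.distrib)
  also have "\<dots> = vsubst v p + vsubst v q"
    by (subst (1 2) vsubst_superset[of ?A]) auto
  finally show ?thesis .
qed

lemma vsubst_sum [simp]: "vsubst v (sum f A) = (\<Sum>a\<in>A. vsubst v (f a))"
  by (induction A rule: infinite_finite_induct) auto

lemma mpol_sum_single: "p = (\<Sum>m\<in>Poly_Mapping.keys p. Poly_Mapping.single m (Poly_Mapping.lookup p m))"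
proof (rule poly_mapping_eqI)
  fix k
  have "Poly_Mapping.lookup (\<Sum>m\<in>Poly_Mapping.keys p. Poly_Mapping.single m (Poly_Mapping.lookup p m)) k =
      (\<Sum>m\<in>Poly_Mapping.keys p. if m = k then Poly_Mapping.lookup p k else 0)"
    unfolding lookup_sum by (intro sum.cong) (auto simp: lookup_single when_def)
  also have "\<dots> = Poly_Mapping.lookup p k"
    by (simp add: sum.delta in_keys_iff)
  finally show "Poly_Mapping.lookup p k =
      Poly_Mapping.lookup (\<Sum>m\<in>Poly_Mapping.keys p. Poly_Mapping.single m (Poly_Mapping.lookup p m)) k" ..
qed

lemma vsubst_mult [simp]: "vsubst v (p * q) = vsubst v p * vsubst v q"
proof -
  have "p * q = (\<Sum>m\<in>Poly_Mapping.keys p. Poly_Mapping.single m (Poly_Mapping.lookup p m)) *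
      (\<Sum>m\<in>Poly_Mapping.keys q. Poly_Mapping.single m (Poly_Mapping.lookup q m))"
    by (simp flip: mpol_sum_single)
  also have "vsubst v \<dots> = (\<Sum>m\<in>Poly_Mapping.keys p. \<Sum>m'\<in>Poly_Mapping.keys q.
      cst (Poly_Mapping.lookup p m * Poly_Mapping.lookup q m') * msubst v (m + m'))"
    by (simp add: sum_product mult_single)
  also have "\<dots> = vsubst v p * vsubst v q"
    by (simp add: sum_product vsubst_def cst_mult msubst_add mult_ac)
  finally show ?thesis .
qed

lemma vsubst_power [simp]: "vsubst v (p ^ n) = vsubst v p ^ n"
  by (induction n) auto

lemma vsubst_prod [simp]: "vsubst v (prod f A) = (\<Prod>a\<in>A. vsubst v (f a))"
  by (induction A rule: infinite_finite_induct) auto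

lemma vsubst_uminus [simp]: "vsubst v (- p) = - vsubst v p"
  using vsubst_mult[of v "cst (- 1)" p] unfolding vsubst_cst by (simp add: cst_uminus)

lemma vsubst_diff [simp]: "vsubst v (p - q) = vsubst v p - vsubst v q"
  using vsubst_add[of v p "- q"] by simp

lemma single_var_power: "Poly_Mapping.single (Poly_Mapping.single i a) 1 = mvar i ^ a"
proof (induction a)
  case (Suc a)
  have "Poly_Mapping.single i (Suc a) = Poly_Mapping.single i 1 + Poly_Mapping.single i a"
    by (simp flip: single_add)
  then show ?case unfolding power_Suc Suc[symmetric] by (simp add: mvar_def mult_single)
qed simp

lemma msubst_var: "msubst mvar m = Poly_Mapping.single m 1"
proof -
  have "Poly_Mapping.single (\<Sum>i\<in>A. Poly_Mapping.single i (Poly_Mapping.lookup m i)) 1 =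
      (\<Prod>i\<in>A. mvar i ^ Poly_Mapping.lookup m i)" if "finite A" for A
    using that
  proof (induction A rule: finite_induct)
    case (insert i A)
    have "Poly_Mapping.single (\<Sum>i\<in>insert i A. Poly_Mapping.single i (Poly_Mapping.lookup m i)) 1 =
        Poly_Mapping.single (Poly_Mapping.single i (Poly_Mapping.lookup m i)) 1 *
        Poly_Mapping.single (\<Sum>i\<in>A. Poly_Mapping.single i (Poly_Mapping.lookup m i)) (1 :: complex)"
      using insert.hyps by (simp add: mult_single)
    then show ?case using insert by (simp add: single_var_power)
  qed simp
  moreover have "m = (\<Sum>i\<in>Poly_Mapping.keys m. Poly_Mapping.single i (Poly_Mapping.lookup m i))"
  proof (rule poly_mapping_eqI)
    fix k
    have "Poly_Mapping.lookup (\<Sum>i\<in>Poly_Mapping.keys m. Poly_Mapping.single i (Poly_Mapping.lookup m i)) k =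
        (\<Sum>i\<in>Poly_Mapping.keys m. if i = k then Poly_Mapping.lookup m k else 0)"
      unfolding lookup_sum by (intro sum.cong) (auto simp: lookup_single when_def)
    then show "Poly_Mapping.lookup m k =
        Poly_Mapping.lookup (\<Sum>i\<in>Poly_Mapping.keys m. Poly_Mapping.single i (Poly_Mapping.lookup m i)) k"
      by (simp add: sum.delta in_keys_iff)
  qed
  ultimately show ?thesis by (metis finite_keys msubst_def)
qed

text \<open>Constants and variables generate the polynomial ring. This rule serves to check
  identities and congruences between substitutions.\<close>

lemma mpol_induct [case_names cst var add mult]:
  assumes cst: "\<And>c. P (cst c)" and var: "\<And>i. P (mvar i)"
    and add: "\<And>p q. P p \<Longrightarrow> P q \<Longrightarrow> P (p + q)" and mult: "\<And>p q. P p \<Longrightarrow> P q \<Longrightarrow> P (p * q)"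
  shows "P p"
proof -
  have 1: "P 1" using cst[of 1] by simp
  have 0: "P 0" using cst[of 0] by simp
  have power: "P (p ^ n)" if "P p" for p n
    by (induction n) (use that 1 mult in auto)
  have prod: "P (\<Prod>i\<in>A. f i)" if "\<And>i. P (f i)" for A :: "nat set" and f
    by (induction A rule: infinite_finite_induct) (use that 1 mult in auto)
  have "P (msubst mvar m)" for m unfolding msubst_def by (intro prod power var)
  moreover have "Poly_Mapping.single m c = cst c * msubst mvar m" for m c
    by (simp add: msubst_var cst_def mult_single)
  ultimately have single: "P (Poly_Mapping.single m c)" for m c using mult cst by metis
  have "P (\<Sum>m\<in>A. Poly_Mapping.single m (f m))" for A f
    by (induction A rule: infinite_finite_induct) (use 0 add single in auto)
  then show ?thesis by (subst mpol_sum_single)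
qed

lemma vsubst_vsubst: "vsubst v (vsubst w p) = vsubst (\<lambda>i. vsubst v (w i)) p"
  by (induction p rule: mpol_induct) auto

text \<open>The factor theorem in several variables. For products it follows from pq - p'q' = (p -
  p')q + p'(q - q'), where the prime denotes the substitution x_l := x_k.\<close>

lemma dvd_diff_vsubst: "mvar k - mvar l dvd p - vsubst (mvar(l := mvar k)) p"
proof (induction p rule: mpol_induct)
  case (var i)
  have "mvar k - mvar l dvd mvar l - mvar k" by (metis dvd_minus_iff dvd_refl minus_diff_eq)
  then show ?case by (cases "i = l") auto
next
  case (add p q)
  then have "mvar k - mvar l dvd (p - vsubst (mvar(l := mvar k)) p) + (q - vsubst (mvar(l := mvar k)) q)" by (rule dvd_add)
  then show ?case by (simp add: algebra_simps del: fun_upd_apply)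
next
  case (mult p q)
  then have "mvar k - mvar l dvd (p - vsubst (mvar(l := mvar k)) p) * q + vsubst (mvar(l := mvar k)) p * (q - vsubst (mvar(l := mvar k)) q)"
    by (intro dvd_add[OF dvd_mult2[OF mult(1)] dvd_mult[OF mult(2)]])
  then show ?case by (simp add: algebra_simps del: fun_upd_apply)
qed simp

lemma mvar_inj [simp]: "mvar i = mvar j \<longleftrightarrow> i = j"
proof
  assume "mvar i = mvar j"
  then have "Poly_Mapping.lookup (mvar j) (Poly_Mapping.single i 1) = 1"
    by (metis lookup_single_eq mvar_def)
  then have "Poly_Mapping.single j (1 :: nat) = Poly_Mapping.single i 1"
    by (simp add: mvar_def lookup_single when_def split: if_splits)
  then have "Poly_Mapping.lookup (Poly_Mapping.single j (1 :: nat)) i = 1"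
    by (metis lookup_single_eq)
  then show "i = j" by (simp add: lookup_single when_def split: if_splits)
qed simp

lemma mvar_nonzero [simp]: "mvar i \<noteq> 0"
  by (metis lookup_single_eq lookup_zero mvar_def zero_neq_one)

text \<open>Setting x_N = 0 kills exactly the monomials that contain x_N and leaves the others
  alone; coefficients for N + 1 and N variables become comparable.\<close>

lemma lookup_vsubst_zero:
  assumes "Poly_Mapping.lookup m N = 0"
  shows "Poly_Mapping.lookup (vsubst (mvar(N := 0)) p) m = Poly_Mapping.lookup p m"
proof -
  have *: "msubst (mvar(N := 0)) m' = (if Poly_Mapping.lookup m' N = 0 then Poly_Mapping.single m' 1 else 0)" for m'
  proof (cases "Poly_Mapping.lookup m' N = 0")
    case True
    then have "N \<notin> Poly_Mapping.keys m'" by (simp add: in_keys_iff)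
    then have "msubst (mvar(N := 0)) m' = msubst mvar m'" unfolding msubst_def
      by (intro prod.cong) auto
    then show ?thesis using True by (simp add: msubst_var)
  next
    case False
    then show ?thesis unfolding msubst_def
      by (auto simp: in_keys_iff intro!: prod_zero bexI[of _ N])
  qed
  have "Poly_Mapping.lookup (vsubst (mvar(N := 0)) p) m =
      (\<Sum>m'\<in>Poly_Mapping.keys p. if m' = m then Poly_Mapping.lookup p m else 0)"
    unfolding vsubst_def lookup_sum
    using assms by (intro sum.cong) (auto simp: * cst_def mult_single lookup_single when_def)
  also have "\<dots> = Poly_Mapping.lookup p m"
    by (simp add: sum.delta in_keys_iff)
  finally show ?thesis .
qed

lemma fvar_to_fract: "fvar i = to_fract (mvar i)"
  by (simp add: fvar_def to_fract_def mvar_def)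

lemma fconst_to_fract: "fconst c = to_fract (cst c)"
  by (simp add: fconst_def to_fract_def cst_def)

lemma to_fract_power [simp]: "to_fract (p ^ n) = to_fract (p :: 'z::idom) ^ n"
  by (induction n) auto

lemma to_fract_prod: "to_fract (prod f A) = (\<Prod>a\<in>A. to_fract (f a :: 'z::idom))"
  by (induction A rule: infinite_finite_induct) auto

section \<open>Polynomiality of the Hall-Littlewood sum\<close>

definition offdiag :: "nat \<Rightarrow> (nat \<times> nat) set" where
  "offdiag N = {(i, j). i < N \<and> j < N \<and> i \<noteq> j}"

lemma finite_offdiag [simp]: "finite (offdiag N)"
  by (rule finite_subset[of _ "{..<N} \<times> {..<N}"]) (auto simp: offdiag_def)

text \<open>The numerator of a summand over the common denominator \<open>diffs Q\<close>: a pair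
  without a Hall-Littlewood factor repeats its own denominator.\<close>

definition HL_num :: "complex \<Rightarrow> (nat \<Rightarrow> nat) \<Rightarrow> (nat \<times> nat) set \<Rightarrow> mpol" where
  "HL_num t \<alpha> Q = (\<Prod>(i, j)\<in>Q. if \<alpha> i > \<alpha> j then mvar i - cst t * mvar j else mvar i - mvar j)"

text \<open>For Q = \<open>offdiag N\<close> both orders of each pair occur, and this is the square
  of the Vandermonde product up to sign.\<close>

definition diffs :: "(nat \<times> nat) set \<Rightarrow> mpol" where
  "diffs Q = (\<Prod>(i, j)\<in>Q. mvar i - mvar j)"

lemma diffs_nonzero: "Q \<subseteq> offdiag N \<Longrightarrow> diffs Q \<noteq> 0"
  using finite_subset[OF _ finite_offdiag, of Q N] by (auto simp: diffs_def offdiag_def)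

text \<open>A factor \<open>d = x\<^sub>k - x\<^sub>l\<close> of a denominator of \<open>S\<close> is superfluous if \<open>S\<close> also has a
  denominator on which the substitution \<open>x\<^sub>l := x\<^sub>k\<close> does not vanish.\<close>

lemma polynomial_if_denominators:
  fixes S :: mpoly_fract
  assumes "Q \<subseteq> offdiag N" "S * to_fract (diffs Q) = to_fract p"
    and den: "\<And>k l. (k, l) \<in> Q \<Longrightarrow> \<exists>d r. S * to_fract d = to_fract r \<and> vsubst (mvar(l := mvar k)) d \<noteq> 0"
  shows "\<exists>p. S = to_fract p"
proof -
  have "finite Q" using assms(1) finite_subset finite_offdiag by blast
  from this assms show ?thesis
  proof (induction Q arbitrary: p rule: finite_induct)
    case empty
    then show ?case by (auto simp: diffs_def)
  next
    case (insert x Q)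
    obtain k l where x: "x = (k, l)" by (cases x)
    have kl: "k \<noteq> l" using insert.prems x by (auto simp: offdiag_def)
    obtain d r where d: "S * to_fract d = to_fract r" "vsubst (mvar(l := mvar k)) d \<noteq> 0"
      using insert.prems(3)[of k l] unfolding x by blast
    have D: "diffs (insert x Q) = (mvar k - mvar l) * diffs Q"
      using insert.hyps x by (simp add: diffs_def)
    \<comment> \<open>Cross-multiplication of two representations of S. The right side is divisible
      by x_k - x_l, so p d vanishes under x_l := x_k; as d does not, p does.\<close>
    have "to_fract (p * d) = to_fract (r * diffs (insert x Q))"
      by (simp flip: insert.prems(2) d(1))
    then have "p * d = r * diffs (insert x Q)" by (simp only: to_fract_eq_iff)
    then have "vsubst (mvar(l := mvar k)) (p * d) = 0" unfolding D using kl by simp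
    then have "vsubst (mvar(l := mvar k)) p = 0" using d(2) by simp
    then obtain b where b: "p = (mvar k - mvar l) * b" using dvd_diff_vsubst[of k l p] by auto
    have "to_fract (mvar k - mvar l) * (S * to_fract (diffs Q)) = to_fract (mvar k - mvar l) * to_fract b"
      using insert.prems(2) unfolding D b by (simp add: mult_ac)
    then have "S * to_fract (diffs Q) = to_fract b"
      using kl by (subst (asm) mult_cancel_left) (simp flip: to_fract_diff)
    then show ?case using insert.IH[of b] insert.prems by blast
  qed
qed

lemma HL_R_times_diffs:
  fixes t :: complex
  assumes Q: "Q \<subseteq> offdiag N" "{(i, j). i < N \<and> j < N \<and> \<alpha> i > \<alpha> j} \<subseteq> Q"
  shows "HL_R fvar (fconst t) {..<N} \<alpha> * to_fract (diffs Q) =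
    to_fract ((\<Prod>i<N. mvar i ^ \<alpha> i) * HL_num t \<alpha> Q)"
proof -
  let ?P = "{(i, j). i < N \<and> j < N \<and> \<alpha> i > \<alpha> j}"
  have fin: "finite Q" using Q(1) finite_subset finite_offdiag by blast
  have "(\<Prod>(i, j)\<in>?P. (fvar i - fconst t * fvar j) / (fvar i - fvar j)) =
      (\<Prod>(i, j)\<in>Q. if \<alpha> i > \<alpha> j then (fvar i - fconst t * fvar j) / (fvar i - fvar j) else 1)"
    using fin Q by (intro prod.mono_neutral_cong_left) (auto simp: offdiag_def split: if_splits)
  also have "\<dots> * to_fract (diffs Q) = (\<Prod>(i, j)\<in>Q. to_fract (if \<alpha> i > \<alpha> j then mvar i - cst t * mvar j else mvar i - mvar j))"
    unfolding diffs_def to_fract_prod prod.distrib[symmetric]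
  proof (rule prod.cong[OF refl], clarify)
    fix i j assume "(i, j) \<in> Q"
    then have "to_fract (mvar i) - to_fract (mvar j) \<noteq> 0"
      using Q(1) by (auto simp: offdiag_def simp flip: to_fract_diff)
    then show "(if \<alpha> i > \<alpha> j then (fvar i - fconst t * fvar j) / (fvar i - fvar j) else 1) * to_fract (mvar i - mvar j) =
      to_fract (if \<alpha> i > \<alpha> j then mvar i - cst t * mvar j else mvar i - mvar j)"
      by (simp add: fvar_to_fract fconst_to_fract)
  qed
  also have "\<dots> = to_fract (HL_num t \<alpha> Q)"
    unfolding HL_num_def to_fract_prod by (simp add: case_prod_unfold)
  finally show ?thesis
    by (simp add: HL_R_def fvar_to_fract to_fract_prod mult.assoc lessThan_def)
qed

abbreviation pinv :: "('i \<Rightarrow> 'i) \<Rightarrow> 'i \<Rightarrow> 'i" where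
  "pinv \<equiv> inv_into UNIV"

definition rearr :: "nat \<Rightarrow> nat list \<Rightarrow> (nat \<Rightarrow> nat) set" where
  "rearr N \<nu> = {part_nth \<nu> \<circ> w | w. w permutes {..<N}}"

lemma finite_rearr [simp]: "finite (rearr N \<nu>)"
  unfolding rearr_def by (simp add: finite_permutations)

lemma rearr_comp: "\<alpha> \<in> rearr N \<nu> \<Longrightarrow> s permutes {..<N} \<Longrightarrow> \<alpha> \<circ> s \<in> rearr N \<nu>"
  unfolding rearr_def by (auto simp: comp_assoc intro: permutes_compose)

text \<open>The variable with index w i carries the exponent \<nu>_i, so the variable with index i
  carries the part of \<nu> at the preimage of i under w.\<close>

lemma HL_term_eq:
  assumes w: "w permutes {..<N}"
  shows "HL_term N \<nu> t w = HL_R fvar (fconst t) {..<N} (part_nth \<nu> \<circ> pinv w)"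
proof -
  have pinv_w: "pinv w (w i) = i" for i using permutes_inverses[OF w] by simp
  have "(\<Prod>i<N. fvar (w i) ^ part_nth \<nu> i) = (\<Prod>i<N. fvar i ^ part_nth \<nu> (pinv w i))"
    using prod.permute[OF w, of "\<lambda>i. fvar i ^ part_nth \<nu> (pinv w i)"] by (simp add: o_def pinv_w)
  moreover have "(\<Prod>(i, j)\<in>{(i, j). i < N \<and> j < N \<and> part_nth \<nu> i > part_nth \<nu> j}.
        (fvar (w i) - fconst t * fvar (w j)) / (fvar (w i) - fvar (w j))) =
      (\<Prod>(i, j)\<in>{(i, j). i \<in> {..<N} \<and> j \<in> {..<N} \<and> (part_nth \<nu> \<circ> pinv w) i > (part_nth \<nu> \<circ> pinv w) j}.
        (fvar i - fconst t * fvar j) / (fvar i - fvar j))"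
    by (rule prod.reindex_bij_witness[of _ "\<lambda>(i, j). (pinv w i, pinv w j)" "\<lambda>(i, j). (w i, w j)"])
      (use permutes_inverses[OF w] permutes_in_image[OF w] permutes_in_image[OF permutes_inv[OF w]] in \<open>auto simp: lessThan_iff\<close>)
  ultimately show ?thesis by (simp add: HL_term_def HL_R_def)
qed

text \<open>The stabilizer multiplies on the right, so a coset consists of all permutations that
  carry \<nu> to the same exponent vector. Cosets thus correspond to rearrangements of \<nu>, and
  every representative yields the same term.\<close>

lemma HL_coset_eq:
  assumes w: "w permutes {..<N}"
  shows "(\<lambda>s. w \<circ> s) ` HL_stabilizer N \<nu> =
    {v. v permutes {..<N} \<and> part_nth \<nu> \<circ> pinv v = part_nth \<nu> \<circ> pinv w}" (is "?L = ?R")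
proof (intro equalityI subsetI)
  fix v assume "v \<in> ?L"
  then obtain s where s: "v = w \<circ> s" "s permutes {..<N}" "\<forall>i<N. part_nth \<nu> (s i) = part_nth \<nu> i"
    by (auto simp: HL_stabilizer_def)
  have "part_nth \<nu> (pinv s i) = part_nth \<nu> i" for i
  proof (cases "i < N")
    case True
    then have "pinv s i < N" using permutes_in_image[OF permutes_inv[OF s(2)]] by auto
    then show ?thesis using s(3) permutes_inverses(1)[OF s(2)] by metis
  next
    case False
    then show ?thesis using permutes_not_in[OF permutes_inv[OF s(2)]] by simp
  qed
  moreover have "pinv v = pinv s \<circ> pinv w"
    unfolding s(1) by (intro o_inv_distrib permutes_bij[OF w] permutes_bij[OF s(2)])
  ultimately have "part_nth \<nu> \<circ> pinv v = part_nth \<nu> \<circ> pinv w" by (simp add: fun_eq_iff)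
  moreover have "v permutes {..<N}" unfolding s(1) by (intro permutes_compose s w)
  ultimately show "v \<in> ?R" by simp
next
  fix v assume v: "v \<in> ?R"
  then have "pinv w \<circ> v permutes {..<N}" by (auto intro: permutes_compose permutes_inv w)
  moreover have "part_nth \<nu> ((pinv w \<circ> v) i) = part_nth \<nu> i" for i
  proof -
    have vp: "v permutes {..<N}" using v by simp
    have "(part_nth \<nu> \<circ> pinv v) (v i) = (part_nth \<nu> \<circ> pinv w) (v i)" using v by simp
    then show ?thesis by (simp add: permutes_inverses(2)[OF vp])
  qed
  moreover have "v = w \<circ> (pinv w \<circ> v)"
    using permutes_inverses[OF w] by (auto simp: fun_eq_iff)
  ultimately show "v \<in> ?L" unfolding HL_stabilizer_def by (intro image_eqI[of _ _ "pinv w \<circ> v"]) auto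
qed

lemma HL_coset_sum:
  "(\<Sum>C\<in>HL_cosets N \<nu>. HL_term N \<nu> t (SOME w. w \<in> C)) = (\<Sum>\<alpha>\<in>rearr N \<nu>. HL_R fvar (fconst t) {..<N} \<alpha>)"
proof -
  let ?w = "\<lambda>C. SOME w. w \<in> C"
  let ?cl = "\<lambda>\<alpha>. {v. v permutes {..<N} \<and> part_nth \<nu> \<circ> pinv v = \<alpha>}"
  have w_class: "?w C permutes {..<N}" "?cl (part_nth \<nu> \<circ> pinv (?w C)) = C" if C_in: "C \<in> HL_cosets N \<nu>" for C
  proof -
    obtain w where w: "w permutes {..<N}" "C = (\<lambda>s. w \<circ> s) ` HL_stabilizer N \<nu>"
      using C_in unfolding HL_cosets_def by blast
    have C: "C = ?cl (part_nth \<nu> \<circ> pinv w)" unfolding w(2) by (rule HL_coset_eq[OF w(1)])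
    then have "w \<in> C" using w(1) by simp
    then have "?w C \<in> C" by (rule someI[of "\<lambda>w. w \<in> C"])
    then have *: "?w C permutes {..<N} \<and> part_nth \<nu> \<circ> pinv (?w C) = part_nth \<nu> \<circ> pinv w"
      by (subst (asm) (2) C) simp
    from * show "?w C permutes {..<N}" ..
    from * show "?cl (part_nth \<nu> \<circ> pinv (?w C)) = C" by (simp only: flip: C)
  qed
  have "(\<Sum>C\<in>HL_cosets N \<nu>. HL_term N \<nu> t (?w C)) =
      (\<Sum>C\<in>HL_cosets N \<nu>. HL_R fvar (fconst t) {..<N} (part_nth \<nu> \<circ> pinv (?w C)))"
    by (intro sum.cong refl HL_term_eq w_class(1))
  also have "\<dots> = (\<Sum>\<alpha>\<in>rearr N \<nu>. HL_R fvar (fconst t) {..<N} \<alpha>)"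
  proof (rule sum.reindex_bij_betw)
    show "bij_betw (\<lambda>C. part_nth \<nu> \<circ> pinv (?w C)) (HL_cosets N \<nu>) (rearr N \<nu>)"
    proof (rule bij_betw_imageI)
      show "inj_on (\<lambda>C. part_nth \<nu> \<circ> pinv (?w C)) (HL_cosets N \<nu>)"
      proof (rule inj_onI)
        fix C D assume "C \<in> HL_cosets N \<nu>" "D \<in> HL_cosets N \<nu>"
          and eq: "part_nth \<nu> \<circ> pinv (?w C) = part_nth \<nu> \<circ> pinv (?w D)"
        note w_class(2)[OF this(1), unfolded eq] w_class(2)[OF this(2)]
        then show "C = D" by simp
      qed
      show "(\<lambda>C. part_nth \<nu> \<circ> pinv (?w C)) ` HL_cosets N \<nu> = rearr N \<nu>"
      proof (intro equalityI subsetI)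
        fix \<alpha> assume "\<alpha> \<in> (\<lambda>C. part_nth \<nu> \<circ> pinv (?w C)) ` HL_cosets N \<nu>"
        then obtain C where "C \<in> HL_cosets N \<nu>" "\<alpha> = part_nth \<nu> \<circ> pinv (?w C)" by blast
        then show "\<alpha> \<in> rearr N \<nu>" unfolding rearr_def using permutes_inv[OF w_class(1)] by blast
      next
        fix \<alpha> assume "\<alpha> \<in> rearr N \<nu>"
        then obtain w where w: "w permutes {..<N}" "\<alpha> = part_nth \<nu> \<circ> w" by (auto simp: rearr_def)
        have w': "pinv w permutes {..<N}" "pinv (pinv w) = w"
          using permutes_inv[OF w(1)] permutes_inv_inv[OF w(1)] by auto
        let ?C = "(\<lambda>s. pinv w \<circ> s) ` HL_stabilizer N \<nu>"
        have in_cosets: "?C \<in> HL_cosets N \<nu>" unfolding HL_cosets_def using w'(1) by blast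
        have C: "?C = ?cl \<alpha>" using HL_coset_eq[OF w'(1), of \<nu>] unfolding w'(2) w(2) .
        have "pinv w \<in> ?cl \<alpha>" using w' w(2) by simp
        then have "?w ?C \<in> ?cl \<alpha>" unfolding C by (rule someI[of "\<lambda>w. w \<in> ?cl \<alpha>"])
        then have "\<alpha> = part_nth \<nu> \<circ> pinv (?w ?C)" by simp
        then show "\<alpha> \<in> (\<lambda>C. part_nth \<nu> \<circ> pinv (?w C)) ` HL_cosets N \<nu>"
          using in_cosets by (rule image_eqI)
      qed
    qed
  qed
  finally show ?thesis .
qed

text \<open>In each summand at most one of the pairs (k, l) and (l, k) gives a pole along x_k = x_l.
  Multiplied by x_k - x_l and by all other differences, the sum is a polynomial that changes sign
  when x_k and x_l are exchanged; hence it is divisible by x_k - x_l and the pole cancels.\<close>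

lemma HL_sum_polynomial:
  "\<exists>p. (\<Sum>\<alpha>\<in>rearr N \<nu>. HL_R fvar (fconst t) {..<N} \<alpha>) = to_fract p"
proof -
  let ?R = "HL_R fvar (fconst t) {..<N}" and ?A = "rearr N \<nu>"
  let ?S = "\<Sum>\<alpha>\<in>?A. ?R \<alpha>"
  let ?m = "\<lambda>\<alpha>. \<Prod>i<N. mvar i ^ \<alpha> i :: mpol"
  show ?thesis
  proof (rule polynomial_if_denominators)
    show "offdiag N \<subseteq> offdiag N" ..
    have "?R \<alpha> * to_fract (diffs (offdiag N)) = to_fract (?m \<alpha> * HL_num t \<alpha> (offdiag N))" for \<alpha>
      by (rule HL_R_times_diffs) (auto simp: offdiag_def)
    then show "?S * to_fract (diffs (offdiag N)) = to_fract (\<Sum>\<alpha>\<in>?A. ?m \<alpha> * HL_num t \<alpha> (offdiag N))"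
      by (simp add: sum_distrib_right)
  next
    fix k l assume kl: "(k, l) \<in> offdiag N"
    then have lt: "k < N" "l < N" "k \<noteq> l" by (auto simp: offdiag_def)
    let ?Q = "offdiag N - {(k, l), (l, k)}"
    let ?\<tau> = "transpose k l" and ?e = "mvar(l := mvar k)"
    have \<tau>: "?\<tau> permutes {..<N}" using lt by (simp add: permutes_swap_id)
    \<comment> \<open>Both orders of the pair are brought to the denominator x_k - x_l, which causes
      the sign in the second case. For equal exponents the summand has no pole there and the
      numerator repeats x_k - x_l.\<close>
    define F where "F \<alpha> = (if \<alpha> k > \<alpha> l then mvar k - cst t * mvar l else
        if \<alpha> l > \<alpha> k then - (mvar l - cst t * mvar k) else mvar k - mvar l)" for \<alpha> :: "nat \<Rightarrow> nat"
    define a where "a \<alpha> = ?m \<alpha> * HL_num t \<alpha> ?Q * F \<alpha>" for \<alpha>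
    have Ra: "?R \<alpha> * to_fract ((mvar k - mvar l) * diffs ?Q) = to_fract (a \<alpha>)" for \<alpha>
    proof -
      have ne: "to_fract (mvar l) - to_fract (mvar k) \<noteq> 0" "mvar k - mvar l \<noteq> 0" using lt by (auto simp flip: to_fract_diff)
      have sub: "{(i, j). i < N \<and> j < N \<and> \<alpha> j < \<alpha> i} \<subseteq> offdiag N" by (auto simp: offdiag_def)
      consider "\<alpha> k > \<alpha> l" | "\<alpha> l > \<alpha> k" | "\<alpha> k = \<alpha> l" by linarith
      then show ?thesis
      proof cases
        case 1
        have "?R \<alpha> * to_fract (diffs (insert (k, l) ?Q)) = to_fract (?m \<alpha> * HL_num t \<alpha> (insert (k, l) ?Q))"
          using kl sub 1 lt by (intro HL_R_times_diffs) auto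
        then show ?thesis using 1 by (simp add: diffs_def HL_num_def a_def F_def mult_ac)
      next
        case 2
        have "?R \<alpha> * to_fract (diffs (insert (l, k) ?Q)) = to_fract (?m \<alpha> * HL_num t \<alpha> (insert (l, k) ?Q))"
          using kl sub 2 lt by (intro HL_R_times_diffs) (auto simp: offdiag_def)
        then have "?R \<alpha> * to_fract ((mvar l - mvar k) * diffs ?Q) = to_fract (?m \<alpha> * ((mvar l - cst t * mvar k) * HL_num t \<alpha> ?Q))"
          using 2 lt by (simp add: diffs_def HL_num_def)
        then have "- (?R \<alpha> * to_fract ((mvar l - mvar k) * diffs ?Q)) = - to_fract (?m \<alpha> * ((mvar l - cst t * mvar k) * HL_num t \<alpha> ?Q))"
          by simp
        then show ?thesis using 2 by (simp add: a_def F_def algebra_simps)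
      next
        case 3
        have "?R \<alpha> * to_fract (diffs ?Q) = to_fract (?m \<alpha> * HL_num t \<alpha> ?Q)"
          using kl sub 3 lt by (intro HL_R_times_diffs) (auto simp: offdiag_def)
        then have "to_fract (mvar k - mvar l) * (?R \<alpha> * to_fract (diffs ?Q)) =
            to_fract (mvar k - mvar l) * to_fract (?m \<alpha> * HL_num t \<alpha> ?Q)" by simp
        then show ?thesis using 3 unfolding a_def F_def by (simp add: mult_ac del: to_fract_diff)
      qed
    qed
    \<comment> \<open>The exchange turns the summand of \<alpha> into that of \<alpha> \<circ>
      \<tau> and permutes the pairs in \<open>?Q\<close>; only the factor x_k - x_l changes
      sign.\<close>
    have anti: "vsubst (\<lambda>i. mvar (?\<tau> i)) (a \<alpha>) = - a (\<alpha> \<circ> ?\<tau>)" for \<alpha>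
    proof -
      have 1: "(\<Prod>i<N. mvar (?\<tau> i) ^ \<alpha> i) = ?m (\<alpha> \<circ> ?\<tau>)"
        using prod.permute[OF \<tau>, of "\<lambda>i. mvar i ^ \<alpha> (?\<tau> i)"] by (simp add: o_def)
      have 2: "vsubst (\<lambda>i. mvar (?\<tau> i)) (HL_num t \<alpha> ?Q) = HL_num t (\<alpha> \<circ> ?\<tau>) ?Q"
      proof -
        have "?\<tau> i < N \<longleftrightarrow> i < N" for i using permutes_in_image[OF \<tau>] by simp
        moreover have "?\<tau> i = ?\<tau> j \<longleftrightarrow> i = j" "?\<tau> i = k \<longleftrightarrow> i = l" "?\<tau> i = l \<longleftrightarrow> i = k" for i j
          by (auto simp: transpose_def)
        ultimately have "bij_betw (\<lambda>(i, j). (?\<tau> i, ?\<tau> j)) ?Q ?Q"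
          by (intro bij_betwI[of _ _ _ "\<lambda>(i, j). (?\<tau> i, ?\<tau> j)"]) (auto simp: offdiag_def)
        from prod.reindex_bij_betw[OF this, of "\<lambda>(i, j). if (\<alpha> \<circ> ?\<tau>) i > (\<alpha> \<circ> ?\<tau>) j then mvar i - cst t * mvar j else mvar i - mvar j"]
        show ?thesis unfolding HL_num_def vsubst_prod by (simp add: case_prod_unfold if_distrib[of "vsubst _"] cong: if_cong)
      qed
      have 3: "vsubst (\<lambda>i. mvar (?\<tau> i)) (F \<alpha>) = - F (\<alpha> \<circ> ?\<tau>)"
        by (simp add: F_def)
      show ?thesis unfolding a_def vsubst_mult 2 3 by (simp add: 1)
    qed
    let ?a = "\<Sum>\<alpha>\<in>?A. a \<alpha>"
    have "vsubst (\<lambda>i. mvar (?\<tau> i)) ?a = - (\<Sum>\<alpha>\<in>?A. a (\<alpha> \<circ> ?\<tau>))"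
      by (simp add: anti sum_negf)
    also have "(\<Sum>\<alpha>\<in>?A. a (\<alpha> \<circ> ?\<tau>)) = ?a"
      by (rule sum.reindex_bij_witness[of _ "\<lambda>\<alpha>. \<alpha> \<circ> ?\<tau>" "\<lambda>\<alpha>. \<alpha> \<circ> ?\<tau>"])
        (auto simp: comp_assoc intro: rearr_comp \<tau>)
    finally have "vsubst ?e (vsubst (\<lambda>i. mvar (?\<tau> i)) ?a) = - vsubst ?e ?a"
      by (simp only: vsubst_uminus)
    \<comment> \<open>Once x_l is set equal to x_k the exchange has no effect, so the value equals
      its own negative.\<close>
    moreover have "vsubst ?e (vsubst (\<lambda>i. mvar (?\<tau> i)) ?a) = vsubst ?e ?a"
    proof -
      have "vsubst ?e (mvar (?\<tau> i)) = ?e i" for i by (auto simp: transpose_def)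
      then show ?thesis unfolding vsubst_vsubst by presburger
    qed
    ultimately have "2 * vsubst ?e ?a = 0"
      by (metis add.right_inverse mult_2)
    then have "vsubst ?e ?a = 0" by simp
    then obtain b where b: "?a = (mvar k - mvar l) * b" using dvd_diff_vsubst[of k l ?a] by auto
    have "?S * to_fract ((mvar k - mvar l) * diffs ?Q) = to_fract ?a"
      unfolding sum_distrib_right Ra by simp
    then have "to_fract (mvar k - mvar l) * (?S * to_fract (diffs ?Q)) = to_fract (mvar k - mvar l) * to_fract b"
      unfolding b by (simp only: to_fract_mult mult_ac)
    then have "?S * to_fract (diffs ?Q) = to_fract b"
      using lt(3) by (subst (asm) mult_cancel_left) (simp flip: to_fract_diff)
    moreover have "vsubst ?e (diffs ?Q) \<noteq> 0"
      unfolding diffs_def vsubst_prod by (subst prod_zero_iff) (simp, auto simp: offdiag_def split: if_splits)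
    ultimately show "\<exists>d r. ?S * to_fract d = to_fract r \<and> vsubst ?e d \<noteq> 0" by blast
  qed
qed

lemma HL_poly_eq: "to_fract (HL_poly N \<nu> t) = (\<Sum>\<alpha>\<in>rearr N \<nu>. HL_R fvar (fconst t) {..<N} \<alpha>)"
proof -
  obtain p where p: "(\<Sum>\<alpha>\<in>rearr N \<nu>. HL_R fvar (fconst t) {..<N} \<alpha>) = to_fract p"
    using HL_sum_polynomial by blast
  have "HL_poly N \<nu> t = p"
    unfolding HL_poly_def HL_coset_sum p by (rule the_equality) (simp_all flip: to_fract_def)
  then show ?thesis by (simp add: p)
qed

section \<open>Stability in the number of variables\<close>

lemma rearr_Suc:
  assumes "length \<nu> \<le> N"
  shows "{\<alpha> \<in> rearr (Suc N) \<nu>. \<alpha> N = 0} = rearr N \<nu>"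
proof (intro equalityI subsetI)
  have N: "part_nth \<nu> N = 0" using assms by (simp add: part_nth_def)
  fix \<alpha> assume "\<alpha> \<in> {\<alpha> \<in> rearr (Suc N) \<nu>. \<alpha> N = 0}"
  then obtain w where w: "w permutes {..<Suc N}" "\<alpha> = part_nth \<nu> \<circ> w" "part_nth \<nu> (w N) = 0"
    by (auto simp: rearr_def)
  let ?w = "transpose (w N) N \<circ> w"
  have "w N < Suc N" using permutes_in_image[OF w(1), of N] by simp
  then have "?w permutes {..<Suc N}" using w(1) by (intro permutes_compose permutes_swap_id) auto
  then have "?w permutes {..<N}" by (rule permutes_superset) (auto simp: less_Suc_eq)
  moreover have "\<alpha> = part_nth \<nu> \<circ> ?w" using w N by (auto simp: fun_eq_iff transpose_def)
  ultimately show "\<alpha> \<in> rearr N \<nu>" by (auto simp: rearr_def)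
next
  fix \<alpha> assume "\<alpha> \<in> rearr N \<nu>"
  then obtain w where w: "w permutes {..<N}" "\<alpha> = part_nth \<nu> \<circ> w" by (auto simp: rearr_def)
  have "w permutes {..<Suc N}" by (rule permutes_subset[OF w(1)]) auto
  moreover have "w N = N" using permutes_not_in[OF w(1)] by simp
  ultimately show "\<alpha> \<in> {\<alpha> \<in> rearr (Suc N) \<nu>. \<alpha> N = 0}"
    using w assms by (auto simp: rearr_def part_nth_def)
qed

text \<open>At x_N = 0 the terms with \<alpha>_N > 0 vanish, and in the others each factor (x_k - t
  x_N)/(x_k - x_N) becomes 1. The comparison takes place after clearing denominators, because
  \<open>vsubst\<close> acts on polynomials and not on fractions.\<close>

lemma HL_poly_stable:
  assumes len: "length \<nu> \<le> N"
  shows "vsubst (mvar(N := 0)) (HL_poly (Suc N) \<nu> t) = HL_poly N \<nu> t"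
proof -
  let ?e = "mvar(N := 0)"
  let ?num = "\<lambda>N \<alpha>. (\<Prod>i<N. mvar i ^ \<alpha> i) * HL_num t \<alpha> (offdiag N)"
  have eq: "HL_poly N \<nu> t * diffs (offdiag N) = (\<Sum>\<alpha>\<in>rearr N \<nu>. ?num N \<alpha>)" for N
  proof -
    have "HL_R fvar (fconst t) {..<N} \<alpha> * to_fract (diffs (offdiag N)) = to_fract (?num N \<alpha>)" for \<alpha>
      by (rule HL_R_times_diffs) (auto simp: offdiag_def)
    then have "to_fract (HL_poly N \<nu> t * diffs (offdiag N)) = to_fract (\<Sum>\<alpha>\<in>rearr N \<nu>. ?num N \<alpha>)"
      by (simp add: HL_poly_eq sum_distrib_right del: to_fract_eq_iff)
    then show ?thesis by (simp only: to_fract_eq_iff)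
  qed
  \<comment> \<open>What the pairs (k, N) and (N, k) of the denominator become at x_N = 0.
    Numerators with \<alpha>_N = 0 acquire the same nonzero factor.\<close>
  let ?z = "(\<Prod>k<N. mvar k) * (\<Prod>k<N. - mvar k) :: mpol"
  have split: "(\<Prod>p\<in>offdiag (Suc N). f p) = (\<Prod>p\<in>offdiag N. f p) * ((\<Prod>k<N. f (k, N)) * (\<Prod>k<N. f (N, k)))"
    for f :: "nat \<times> nat \<Rightarrow> mpol"
  proof -
    have "offdiag (Suc N) = offdiag N \<union> ((\<lambda>k. (k, N)) ` {..<N} \<union> (\<lambda>k. (N, k)) ` {..<N})"
      by (auto simp: offdiag_def)
    moreover have "offdiag N \<inter> ((\<lambda>k. (k, N)) ` {..<N} \<union> (\<lambda>k. (N, k)) ` {..<N}) = {}"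
      "(\<lambda>k. (k, N)) ` {..<N} \<inter> (\<lambda>k. (N, k)) ` {..<N} = {}" by (auto simp: offdiag_def)
    ultimately show ?thesis
      by (simp add: prod.union_disjoint prod.reindex inj_on_def)
  qed
  have diffs: "vsubst ?e (diffs (offdiag (Suc N))) = diffs (offdiag N) * ?z"
  proof -
    have "(\<Prod>(i, j)\<in>offdiag N. ?e i - ?e j) = diffs (offdiag N)"
      unfolding diffs_def by (intro prod.cong) (auto simp: offdiag_def)
    then show ?thesis unfolding diffs_def split vsubst_mult vsubst_prod by (simp add: case_prod_unfold)
  qed
  have num: "vsubst ?e (?num (Suc N) \<alpha>) = (if \<alpha> N = 0 then ?num N \<alpha> * ?z else 0)" for \<alpha>
  proof (cases "\<alpha> N = 0")
    case True
    have "(\<Prod>i<N. ?e i ^ \<alpha> i) = (\<Prod>i<N. mvar i ^ \<alpha> i)"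
      by (intro prod.cong) auto
    moreover have "vsubst ?e (HL_num t \<alpha> (offdiag (Suc N))) = HL_num t \<alpha> (offdiag N) * ?z"
      unfolding HL_num_def split vsubst_mult vsubst_prod using True
      by (intro arg_cong2[where f = "(*)"] prod.cong refl) (auto simp: offdiag_def)
    ultimately show ?thesis using True by (simp add: mult_ac)
  next
    case False
    then show ?thesis by simp
  qed
  have "vsubst ?e (HL_poly (Suc N) \<nu> t) * (diffs (offdiag N) * ?z) =
      (\<Sum>\<alpha>\<in>rearr (Suc N) \<nu>. if \<alpha> N = 0 then ?num N \<alpha> * ?z else 0)"
    unfolding diffs[symmetric] vsubst_mult[symmetric] eq vsubst_sum num ..
  also have "\<dots> = (\<Sum>\<alpha>\<in>rearr N \<nu>. ?num N \<alpha> * ?z)"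
    unfolding rearr_Suc[OF len, symmetric] by (intro sum.mono_neutral_cong_right) auto
  also have "\<dots> = HL_poly N \<nu> t * (diffs (offdiag N) * ?z)"
    unfolding sum_distrib_right[symmetric] eq[symmetric] by (simp only: mult.assoc)
  finally show ?thesis
    using diffs_nonzero[of "offdiag N" N] by (subst (asm) mult_cancel_right) auto
qed

text \<open>By stability the coefficient is constant from this \<open>N\<close> on, so the limit
  defining \<open>HL_P\<close> is attained here.\<close>

lemma mcoeff_HL_P:
  assumes "length \<nu> \<le> N" "Poly_Mapping.keys m \<subseteq> {..<N}"
  shows "mcoeff (HL_P \<nu> t) m = Poly_Mapping.lookup (HL_poly N \<nu> t) m"
proof -
  have const: "Poly_Mapping.lookup (HL_poly M \<nu> t) m = Poly_Mapping.lookup (HL_poly N \<nu> t) m" if "M \<ge> N" for M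
    using that
  proof (induction M rule: dec_induct)
    case (step M)
    then have "Poly_Mapping.lookup m M = 0" using assms(2) by (auto simp: in_keys_iff)
    from lookup_vsubst_zero[OF this, of "HL_poly (Suc M) \<nu> t"]
    have "Poly_Mapping.lookup (HL_poly M \<nu> t) m = Poly_Mapping.lookup (HL_poly (Suc M) \<nu> t) m"
      using HL_poly_stable[of \<nu> M t] step(1) assms(1) by (metis le_trans)
    then show ?case using step(3) by simp
  qed simp
  have "(THE c. \<forall>\<^sub>F N in sequentially. Poly_Mapping.lookup (HL_poly N \<nu> t) m = c) =
      Poly_Mapping.lookup (HL_poly N \<nu> t) m"
  proof (rule the_equality)
    show *: "\<forall>\<^sub>F M in sequentially. Poly_Mapping.lookup (HL_poly M \<nu> t) m = Poly_Mapping.lookup (HL_poly N \<nu> t) m"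
      by (intro eventually_sequentiallyI[of N] const)
    fix c assume "\<forall>\<^sub>F M in sequentially. Poly_Mapping.lookup (HL_poly M \<nu> t) m = c"
    with * have "\<forall>\<^sub>F M in sequentially. c = Poly_Mapping.lookup (HL_poly N \<nu> t) m"
      by eventually_elim simp
    then show "c = Poly_Mapping.lookup (HL_poly N \<nu> t) m" by simp
  qed
  then show ?thesis by (simp add: HL_P_def)
qed

section \<open>Partitions and their rearrangements\<close>

definition parts_of :: "nat \<Rightarrow> nat list set" where
  "parts_of n = {\<nu> \<in> partitions. sum_list \<nu> = n}"

lemma length_le_sum_list: "0 \<notin> set \<nu> \<Longrightarrow> length \<nu> \<le> sum_list (\<nu> :: nat list)"
  by (induction \<nu>) auto

lemma parts_of_length: "\<nu> \<in> parts_of n \<Longrightarrow> length \<nu> \<le> n"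
  using length_le_sum_list by (auto simp: parts_of_def partitions_def)

lemma finite_parts_of [simp]: "finite (parts_of n)"
proof (rule finite_subset)
  show "parts_of n \<subseteq> {\<nu>. set \<nu> \<subseteq> {..n} \<and> length \<nu> \<le> n}"
    using parts_of_length member_le_sum_list by (fastforce simp: parts_of_def)
qed (simp add: finite_lists_length_le)

lemma map_part_nth: "length \<nu> \<le> N \<Longrightarrow> map (part_nth \<nu>) [0..<N] = \<nu> @ replicate (N - length \<nu>) 0"
  by (rule nth_equalityI) (auto simp: part_nth_def nth_append)

lemma mset_rearr:
  assumes "\<alpha> \<in> rearr N \<nu>" "length \<nu> \<le> N"
  shows "mset (map \<alpha> [0..<N]) = mset \<nu> + replicate_mset (N - length \<nu>) 0"
proof -
  obtain w where w: "w permutes {..<N}" "\<alpha> = part_nth \<nu> \<circ> w" using assms(1) by (auto simp: rearr_def)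
  have "mset (map w [0..<N]) = mset [0..<N]"
    using w(1) by (simp add: mset_upt permutes_image atLeast0LessThan image_mset_mset_set[OF permutes_inj_on])
  then have "mset (map \<alpha> [0..<N]) = mset (map (part_nth \<nu>) [0..<N])"
    unfolding w(2) by (metis map_map mset_map)
  then show ?thesis by (simp add: map_part_nth[OF assms(2)] del: mset_map)
qed

lemma sum_rearr:
  assumes "\<alpha> \<in> rearr N \<nu>" "length \<nu> \<le> N"
  shows "sum \<alpha> {..<N} = sum_list \<nu>"
proof -
  have "sum \<alpha> {..<N} = sum_list (map \<alpha> [0..<N])"
    by (simp add: interv_sum_list_conv_sum_set_nat atLeast0LessThan)
  also have "\<dots> = sum_mset (mset (map \<alpha> [0..<N]))" by (simp only: sum_mset_sum_list)
  finally show ?thesis unfolding mset_rearr[OF assms] by (simp add: sum_mset_sum_list)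
qed

lemma filter_mset_pos: "0 \<notin> set \<nu> \<Longrightarrow> filter_mset (\<lambda>a. a > 0) (mset \<nu>) = mset (\<nu> :: nat list)"
  by (subst mset_filter[symmetric], subst filter_True) (auto intro: gr0I)

lemma card_rearr:
  assumes "\<alpha> \<in> rearr N \<nu>" "length \<nu> \<le> N" "0 \<notin> set \<nu>"
  shows "card {i \<in> {..<N}. \<alpha> i > 0} = length \<nu>"
proof -
  have "{i \<in> {..<N}. \<alpha> i > 0} = set (filter (\<lambda>i. \<alpha> i > 0) [0..<N])" by auto
  then have "card {i \<in> {..<N}. \<alpha> i > 0} = length (filter (\<lambda>i. \<alpha> i > 0) [0..<N])"
    by (simp only: distinct_card[OF distinct_filter[OF distinct_upt]])
  also have "\<dots> = length (filter (\<lambda>a. a > 0) (map \<alpha> [0..<N]))"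
    by (simp add: filter_map o_def)
  also have "\<dots> = size (filter_mset (\<lambda>a. a > 0) (mset (map \<alpha> [0..<N])))"
    by (simp only: size_mset flip: mset_filter)
  also have "\<dots> = size (filter_mset (\<lambda>a. a > 0) (mset \<nu>))"
    unfolding mset_rearr[OF assms(1,2)] by simp
  also have "filter_mset (\<lambda>a. a > 0) (mset \<nu>) = mset \<nu>"
    by (rule filter_mset_pos) fact
  finally show ?thesis by simp
qed

text \<open>In a non-increasing sequence the minimum of a pair is its entry of larger index, so f i
  is counted for each of the i smaller indices, in both orders.\<close>

lemma min_stat_antimono:
  assumes "antimono f"
  shows "min_stat {..<N} f = 2 * (\<Sum>i<N. i * f i)"
proof (induction N)
  case (Suc N)
  have "min_stat {..<Suc N} f = (\<Sum>i<N. \<Sum>j\<in>{..<Suc N} - {i}. min (f i) (f j)) + (\<Sum>j\<in>{..<Suc N} - {N}. min (f N) (f j))"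
    by (simp add: min_stat_def)
  also have "(\<Sum>j\<in>{..<Suc N} - {N}. min (f N) (f j)) = (\<Sum>j<N. f N)"
    using assms by (intro sum.cong) (auto simp: antimono_def min_absorb1)
  also have "(\<Sum>i<N. \<Sum>j\<in>{..<Suc N} - {i}. min (f i) (f j)) = (\<Sum>i<N. f N + (\<Sum>j\<in>{..<N} - {i}. min (f i) (f j)))"
  proof (intro sum.cong refl)
    fix i assume "i \<in> {..<N}"
    then have "{..<Suc N} - {i} = insert N ({..<N} - {i})" by auto
    then show "(\<Sum>j\<in>{..<Suc N} - {i}. min (f i) (f j)) = f N + (\<Sum>j\<in>{..<N} - {i}. min (f i) (f j))"
      using \<open>i \<in> {..<N}\<close> antimonoD[OF assms, of i N] by (simp add: min_absorb2)
  qed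
  also have "\<dots> = N * f N + min_stat {..<N} f" by (simp add: sum.distrib min_stat_def)
  finally show ?case using Suc by simp
qed (simp add: min_stat_def)

lemma min_stat_rearr:
  assumes "\<alpha> \<in> rearr N \<nu>" "length \<nu> \<le> N" "\<nu> \<in> partitions"
  shows "min_stat {..<N} \<alpha> = 2 * n_part \<nu>"
proof -
  obtain w where w: "w permutes {..<N}" "\<alpha> = part_nth \<nu> \<circ> w" using assms(1) by (auto simp: rearr_def)
  let ?p = "part_nth \<nu>"
  have inner: "(\<Sum>j\<in>{..<N} - {i}. min (?p (w i)) (?p (w j))) = (\<Sum>j\<in>{..<N} - {w i}. min (?p (w i)) (?p j))"
    if "i < N" for i
  proof (rule sum.reindex_bij_betw[of w "{..<N} - {i}" "{..<N} - {w i}"])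
    show "bij_betw w ({..<N} - {i}) ({..<N} - {w i})"
      using permutes_imp_bij[OF w(1)] that by (intro bij_betw_DiffI) (auto simp: bij_betw_def)
  qed
  have "min_stat {..<N} \<alpha> = (\<Sum>i<N. \<Sum>j\<in>{..<N} - {w i}. min (?p (w i)) (?p j))"
    unfolding min_stat_def w(2) o_def by (rule sum.cong[OF refl]) (simp add: inner)
  also have "\<dots> = min_stat {..<N} ?p"
    unfolding min_stat_def
    using sum.permute[OF w(1), of "\<lambda>i. \<Sum>j\<in>{..<N} - {i}. min (?p i) (?p j)"] by (simp add: o_def)
  also have "\<dots> = 2 * (\<Sum>i<N. i * ?p i)"
    using assms(3) by (intro min_stat_antimono antimonoI)
      (auto simp: part_nth_def partitions_def sorted_wrt_iff_nth_less le_less)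
  also have "(\<Sum>i<N. i * ?p i) = n_part \<nu>"
    unfolding n_part_def using assms(2) by (intro sum.mono_neutral_cong_right) (auto simp: part_nth_def)
  finally show ?thesis .
qed

lemma partitions_mset_eqI:
  assumes "\<nu> \<in> partitions" "\<nu>' \<in> partitions" "mset \<nu> = mset \<nu>'"
  shows "\<nu> = \<nu>'"
proof -
  have "sorted (rev \<nu>)" "sorted (rev \<nu>')"
    using assms by (simp_all add: partitions_def sorted_wrt_rev)
  then have "rev \<nu> = rev \<nu>'" using assms(3) by (metis mset_rev properties_for_sort)
  then show ?thesis by simp
qed

text \<open>Sorting the nonzero entries of a composition produces its partition; n \<le> N leaves
  room for all parts of every partition of n.\<close>

lemma comps_eq_Union_rearr:
  assumes "n \<le> N"
  shows "comps {..<N} n = (\<Union>\<nu>\<in>parts_of n. rearr N \<nu>)"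
proof (intro equalityI subsetI)
  fix \<alpha> assume "\<alpha> \<in> (\<Union>\<nu>\<in>parts_of n. rearr N \<nu>)"
  then obtain \<nu> where \<nu>: "\<nu> \<in> parts_of n" "\<alpha> \<in> rearr N \<nu>" by auto
  have len: "length \<nu> \<le> N" using parts_of_length[OF \<nu>(1)] assms by simp
  have "\<alpha> i = 0" if "i \<ge> N" for i
    using \<nu>(2) len that by (auto simp: rearr_def part_nth_def permutes_not_in)
  then show "\<alpha> \<in> comps {..<N} n"
    using sum_rearr[OF \<nu>(2) len] \<nu>(1) by (auto simp: comps_def parts_of_def)
next
  fix \<alpha> assume "\<alpha> \<in> comps {..<N} n"
  then have \<alpha>: "\<And>i. i \<ge> N \<Longrightarrow> \<alpha> i = 0" "sum \<alpha> {..<N} = n" by (auto simp: comps_def)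
  let ?l = "map \<alpha> [0..<N]"
  define \<nu> where "\<nu> = rev (sort (filter (\<lambda>a. a \<noteq> 0) ?l))"
  have \<nu>: "\<nu> \<in> partitions" by (auto simp: partitions_def \<nu>_def sorted_wrt_rev)
  have len: "length \<nu> \<le> N"
    using length_filter_le[of "\<lambda>a. a \<noteq> 0" ?l] by (simp add: \<nu>_def)
  have "mset ?l = filter_mset (\<lambda>a. a \<noteq> 0) (mset ?l) + filter_mset (\<lambda>a. a = 0) (mset ?l)"
    using multiset_partition[of "mset ?l" "\<lambda>a. a \<noteq> 0"] by simp
  also have "filter_mset (\<lambda>a. a \<noteq> 0) (mset ?l) = mset \<nu>" by (simp add: \<nu>_def)
  also have "filter_mset (\<lambda>a. a = 0) (mset ?l) = replicate_mset (count (mset ?l) 0) 0"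
    by (metis filter_eq_replicate_mset)
  finally have ms: "mset ?l = mset \<nu> + replicate_mset (count (mset ?l) 0) 0" .
  have "count (mset ?l) 0 = N - length \<nu>" using arg_cong[OF ms, of size] by simp
  then have "mset ?l = mset (\<nu> @ replicate (N - length \<nu>) 0)" using ms by simp
  then obtain w where w: "w permutes {..<length (\<nu> @ replicate (N - length \<nu>) 0)}"
    "permute_list w (\<nu> @ replicate (N - length \<nu>) 0) = ?l" by (rule mset_eq_permutation)
  have w1: "w permutes {..<N}" using w(1) len by simp
  have "\<alpha> i = part_nth \<nu> (w i)" for i
  proof (cases "i < N")
    case True
    then have "\<alpha> i = ?l ! i" by simp
    also have "\<dots> = map (part_nth \<nu>) [0..<N] ! w i"
      unfolding w(2)[symmetric] map_part_nth[OF len] using True w(1) len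
      by (subst permute_list_nth) auto
    also have "\<dots> = part_nth \<nu> (w i)" using True permutes_in_image[OF w1] by simp
    finally show ?thesis .
  next
    case False
    then show ?thesis using \<alpha>(1) len permutes_not_in[OF w1] by (simp add: part_nth_def)
  qed
  then have "\<alpha> \<in> rearr N \<nu>" unfolding rearr_def using w1 by (auto simp: fun_eq_iff)
  moreover from sum_rearr[OF this len] have "\<nu> \<in> parts_of n" using \<nu> \<alpha>(2) by (simp add: parts_of_def)
  ultimately show "\<alpha> \<in> (\<Union>\<nu>\<in>parts_of n. rearr N \<nu>)" by blast
qed

lemma rearr_disjoint:
  assumes "\<nu> \<in> partitions" "\<nu>' \<in> partitions" "length \<nu> \<le> N" "length \<nu>' \<le> N" "\<nu> \<noteq> \<nu>'"
  shows "rearr N \<nu> \<inter> rearr N \<nu>' = {}"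
proof (rule ccontr)
  assume "rearr N \<nu> \<inter> rearr N \<nu>' \<noteq> {}"
  then obtain \<alpha> where \<alpha>: "\<alpha> \<in> rearr N \<nu>" "\<alpha> \<in> rearr N \<nu>'" by auto
  have pos: "filter_mset (\<lambda>a. a > 0) (mset \<mu>) = mset \<mu>" if "\<mu> \<in> partitions" for \<mu>
    using that by (intro filter_mset_pos) (simp add: partitions_def)
  have "filter_mset (\<lambda>a. a > 0) (mset (map \<alpha> [0..<N])) = mset \<nu>"
    unfolding mset_rearr[OF \<alpha>(1) assms(3)] using pos[OF assms(1)] by simp
  moreover have "filter_mset (\<lambda>a. a > 0) (mset (map \<alpha> [0..<N])) = mset \<nu>'"
    unfolding mset_rearr[OF \<alpha>(2) assms(4)] using pos[OF assms(2)] by simp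
  ultimately have "mset \<nu> = mset \<nu>'" by simp
  then show False using partitions_mset_eqI[OF assms(1,2)] assms(5) by simp
qed

section \<open>Expansion in Hall-Littlewood functions\<close>

lemma fconst_mult: "fconst (a * b) = fconst a * fconst b"
  and fconst_diff: "fconst (a - b) = fconst a - fconst b"
  and fconst_1 [simp]: "fconst 1 = 1"
  and fconst_eq_0 [simp]: "fconst a = 0 \<longleftrightarrow> a = 0"
proof -
  show "fconst (a - b) = fconst a - fconst b"
    using cst_add[of a "- b"] by (simp add: fconst_to_fract cst_uminus)
  have "cst a \<noteq> 0" if "a \<noteq> 0"
    using that by (metis cst_def lookup_single_eq lookup_zero)
  then show "fconst a = 0 \<longleftrightarrow> a = 0" by (auto simp: fconst_to_fract)
qed (simp_all add: fconst_to_fract cst_mult)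

lemma fconst_power: "fconst (a ^ n) = fconst a ^ n"
  by (induction n) (auto simp: fconst_mult)

lemma fconst_rpoch: "t \<noteq> 0 \<Longrightarrow> rpoch (fconst t) (fconst y) r = fconst (rpoch t y r)"
proof -
  assume t: "t \<noteq> 0"
  have "fconst (1 - y / t ^ j) = 1 - fconst y / fconst t ^ j" for j
  proof -
    have "fconst (y / t ^ j) * fconst t ^ j = fconst y"
      using t by (simp flip: fconst_power fconst_mult)
    then have "fconst (y / t ^ j) = fconst y / fconst t ^ j" using t by (simp add: field_simps)
    then show ?thesis by (simp add: fconst_diff)
  qed
  then show ?thesis unfolding rpoch_def by (induction r) (auto simp: fconst_mult)
qed

text \<open>The function Q_n(y) by its coefficients: in the generating product a variable that
  occurs contributes 1 - y whatever its exponent, so only the number of variables of the monomial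
  counts.\<close>

definition Qs :: "nat \<Rightarrow> complex \<Rightarrow> nat mseries" where
  "Qs n y = Mseries (\<lambda>m. if mdegree m = n then (1 - y) ^ card (Poly_Mapping.keys m) else 0)"

definition Qs_poly :: "nat \<Rightarrow> nat \<Rightarrow> complex \<Rightarrow> mpol" where
  "Qs_poly N n y = (\<Sum>\<alpha>\<in>comps {..<N} n. \<Prod>i<N. if \<alpha> i = 0 then 1 else cst (1 - y) * mvar i ^ \<alpha> i)"

lemma hsum_to_fract: "hsum fvar (fconst y) {..<N} n = to_fract (Qs_poly N n y)"
proof -
  have "1 - fconst y = to_fract (cst (1 - y))" by (simp flip: fconst_to_fract add: fconst_diff)
  then show ?thesis
    by (simp add: hsum_def Qs_poly_def to_fract_prod fvar_to_fract if_distrib[of to_fract] cong: if_cong prod.cong)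
qed

lemma lookup_Qs_poly:
  assumes m: "Poly_Mapping.keys m \<subseteq> {..<N}"
  shows "Poly_Mapping.lookup (Qs_poly N n y) m = mcoeff (Qs n y) m"
proof -
  let ?s = "\<lambda>\<alpha>. \<Sum>i<N. Poly_Mapping.single i (\<alpha> i)"
  have single: "(\<Prod>i\<in>A. if \<alpha> i = 0 then 1 else cst (1 - y) * mvar i ^ \<alpha> i) =
      Poly_Mapping.single (\<Sum>i\<in>A. Poly_Mapping.single i (\<alpha> i)) ((1 - y) ^ card {i\<in>A. \<alpha> i > 0})"
    if "finite A" for A and \<alpha> :: "nat \<Rightarrow> nat"
    using that
  proof (induction A rule: finite_induct)
    case (insert i A)
    have "{j \<in> insert i A. \<alpha> j > 0} = (if \<alpha> i = 0 then {j\<in>A. \<alpha> j > 0} else insert i {j\<in>A. \<alpha> j > 0})"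
      by auto
    then show ?case using insert
      by (auto simp: single_var_power[symmetric] cst_def mult_single)
  qed simp
  have lookup_s: "Poly_Mapping.lookup (?s \<alpha>) k = (if k < N then \<alpha> k else 0)" for \<alpha> k
    unfolding lookup_sum by (simp add: lookup_single when_def sum.delta)
  have s_eq: "?s \<alpha> = m \<longleftrightarrow> \<alpha> = Poly_Mapping.lookup m" if "\<alpha> \<in> comps {..<N} n" for \<alpha>
  proof
    assume "?s \<alpha> = m"
    then show "\<alpha> = Poly_Mapping.lookup m" using that lookup_s[of \<alpha>] by (auto simp: comps_def fun_eq_iff)
  next
    assume "\<alpha> = Poly_Mapping.lookup m"
    then show "?s \<alpha> = m" using m by (intro poly_mapping_eqI) (auto simp: lookup_s in_keys_iff)
  qed
  have "Poly_Mapping.lookup (Qs_poly N n y) m = (\<Sum>\<alpha>\<in>comps {..<N} n. if \<alpha> = Poly_Mapping.lookup m then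
      (1 - y) ^ card {i\<in>{..<N}. Poly_Mapping.lookup m i > 0} else 0)"
    unfolding Qs_poly_def lookup_sum
    by (intro sum.cong refl) (auto simp: single lookup_single when_def s_eq)
  also have "\<dots> = (if Poly_Mapping.lookup m \<in> comps {..<N} n then
      (1 - y) ^ card {i\<in>{..<N}. Poly_Mapping.lookup m i > 0} else 0)"
    by (simp add: sum.delta finite_comps)
  also have "{i\<in>{..<N}. Poly_Mapping.lookup m i > 0} = Poly_Mapping.keys m"
    using m by (auto simp: in_keys_iff)
  also have "Poly_Mapping.lookup m \<in> comps {..<N} n \<longleftrightarrow> mdegree m = n"
    using m mdegree_superset[of "{..<N}" m] by (auto simp: comps_def in_keys_iff)
  finally show ?thesis by (simp add: Qs_def)
qed

lemma mcoeff_sum: "mcoeff (sum f A) m = (\<Sum>a\<in>A. mcoeff (f a) m)"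
  by (induction A rule: infinite_finite_induct) (auto simp: zero_mseries.rep_eq plus_mseries.rep_eq)

text \<open>The numbers attached to \<nu> can be read off from any rearrangement: n(\<nu>) as half
  of \<open>min_stat\<close>, the length as the size of the support. The double sum over partitions
  and rearrangements thereby merges into the sum over all compositions in
  \<open>HL_R_sum\<close>.\<close>

theorem HL_P_expansion:
  assumes t: "t \<noteq> 0"
  shows "(\<Sum>\<nu>\<in>parts_of n. mconst (t ^ n_part \<nu> * rpoch t y (length \<nu>)) * HL_P \<nu> t) = Qs n y"
proof (rule mseries_eqI)
  fix m :: "nat \<Rightarrow>\<^sub>0 nat"
  \<comment> \<open>Large enough for all partitions of n and for all variables of m, so that N
    variables decide this coefficient.\<close>
  define N where "N = max n (Suc (Max (insert 0 (Poly_Mapping.keys m))))"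
  have N: "n \<le> N" "Poly_Mapping.keys m \<subseteq> {..<N}"
    using Max_ge[of "insert 0 (Poly_Mapping.keys m)"] by (auto simp: N_def less_max_iff_disj less_Suc_eq_le)
  have len: "length \<nu> \<le> N" if "\<nu> \<in> parts_of n" for \<nu> using parts_of_length[OF that] N by simp
  have part: "\<nu> \<in> partitions" if "\<nu> \<in> parts_of n" for \<nu> using that by (simp add: parts_of_def)
  let ?c = "\<lambda>\<nu>. t ^ n_part \<nu> * rpoch t y (length \<nu>)"
  let ?p = "\<Sum>\<nu>\<in>parts_of n. cst (?c \<nu>) * HL_poly N \<nu> t"
  have "to_fract ?p = (\<Sum>\<nu>\<in>parts_of n. \<Sum>\<alpha>\<in>rearr N \<nu>. fconst (?c \<nu>) * HL_R fvar (fconst t) {..<N} \<alpha>)"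
    by (simp add: HL_poly_eq sum_distrib_left fconst_to_fract)
  also have "\<dots> = (\<Sum>\<nu>\<in>parts_of n. \<Sum>\<alpha>\<in>rearr N \<nu>. fconst t ^ (min_stat {..<N} \<alpha> div 2) *
      rpoch (fconst t) (fconst y) (card {i \<in> {..<N}. \<alpha> i > 0}) * HL_R fvar (fconst t) {..<N} \<alpha>)"
  proof (intro sum.cong refl)
    fix \<nu> \<alpha> assume *: "\<nu> \<in> parts_of n" "\<alpha> \<in> rearr N \<nu>"
    have "min_stat {..<N} \<alpha> = 2 * n_part \<nu>" by (rule min_stat_rearr[OF *(2) len part]) (fact *)+
    moreover have "card {i \<in> {..<N}. \<alpha> i > 0} = length \<nu>"
      by (rule card_rearr[OF *(2) len]) (use part[OF *(1)] * in \<open>auto simp: partitions_def\<close>)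
    ultimately show "fconst (?c \<nu>) * HL_R fvar (fconst t) {..<N} \<alpha> = fconst t ^ (min_stat {..<N} \<alpha> div 2) *
      rpoch (fconst t) (fconst y) (card {i \<in> {..<N}. \<alpha> i > 0}) * HL_R fvar (fconst t) {..<N} \<alpha>"
      by (simp add: fconst_rpoch[OF t] fconst_mult fconst_power)
  qed
  also have "\<dots> = (\<Sum>\<alpha>\<in>comps {..<N} n. fconst t ^ (min_stat {..<N} \<alpha> div 2) *
      rpoch (fconst t) (fconst y) (card {i \<in> {..<N}. \<alpha> i > 0}) * HL_R fvar (fconst t) {..<N} \<alpha>)"
    unfolding comps_eq_Union_rearr[OF N(1)]
    using rearr_disjoint len part by (intro sum.UNION_disjoint[symmetric]) auto
  also have "\<dots> = hsum fvar (fconst y) {..<N} n"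
    using t by (intro HL_R_sum) (auto simp: inj_on_def fvar_to_fract)
  finally have "?p = Qs_poly N n y"
    unfolding hsum_to_fract by (simp only: to_fract_eq_iff)
  then have "Poly_Mapping.lookup ?p m = mcoeff (Qs n y) m"
    using lookup_Qs_poly[OF N(2)] by simp
  moreover have "Poly_Mapping.lookup (cst c * p) m = c * Poly_Mapping.lookup p m" for c and p :: mpol
    unfolding cst_def mult_map_scale_conv_mult[symmetric] by (simp add: Poly_Mapping.map.rep_eq when_def)
  ultimately have "(\<Sum>\<nu>\<in>parts_of n. ?c \<nu> * Poly_Mapping.lookup (HL_poly N \<nu> t) m) = mcoeff (Qs n y) m"
    by (simp add: lookup_sum)
  then show "mcoeff (\<Sum>\<nu>\<in>parts_of n. mconst (?c \<nu>) * HL_P \<nu> t) m = mcoeff (Qs n y) m"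
    by (simp add: mcoeff_sum mcoeff_HL_P[OF len N(2)])
qed

section \<open>Power sums and complete functions\<close>

lemma mconst_add: "mconst (a + b) = mconst a + mconst b"
  by (rule mseries_eqI) (simp add: mconst_def plus_mseries.rep_eq)

lemma mconst_mult: "mconst (a * b) = mconst a * mconst b"
  by (rule mseries_eqI) (simp, simp add: mconst_def)

lemma mconst_0 [simp]: "mconst 0 = 0"
  by (rule mseries_eqI) (simp add: mconst_def zero_mseries.rep_eq)

lemma mconst_1 [simp]: "mconst 1 = 1"
  by (rule mseries_eqI) (simp add: mconst_def one_mseries.rep_eq)

text \<open>\<open>complete_of\<close> is built by constants, sums and products, hence commutes with
  algebra homomorphisms. The set \<open>A\<close> is there for \<rho>, which is a homomorphism on
  \<open>Lambda\<close> only.\<close>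

lemma complete_of_hom_on:
  assumes p: "\<And>k. k \<ge> 1 \<Longrightarrow> p k \<in> A"
    and closed: "\<And>c. mconst c \<in> A" "\<And>F G. F \<in> A \<Longrightarrow> G \<in> A \<Longrightarrow> F + G \<in> A" "\<And>F G. F \<in> A \<Longrightarrow> G \<in> A \<Longrightarrow> F * G \<in> A"
    and hom: "\<And>c. h (mconst c) = mconst c" "\<And>F G. F \<in> A \<Longrightarrow> G \<in> A \<Longrightarrow> h (F + G) = h F + h G"
      "\<And>F G. F \<in> A \<Longrightarrow> G \<in> A \<Longrightarrow> h (F * G) = h F * h G"
  shows "complete_of p a \<in> A \<and> h (complete_of p a) = complete_of (\<lambda>k. h (p k)) a"
proof (induction a rule: less_induct)
  case (less a)
  show ?case
  proof (cases "a = 0")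
    case True
    then show ?thesis using closed(1)[of 1] hom(1)[of 1] by (simp add: complete_of.simps)
  next
    case False
    have sum: "(\<Sum>k\<in>S. p k * complete_of p (a - k)) \<in> A \<and>
        h (\<Sum>k\<in>S. p k * complete_of p (a - k)) = (\<Sum>k\<in>S. h (p k) * complete_of (\<lambda>k. h (p k)) (a - k))"
      if "finite S" "S \<subseteq> {1..a}" for S
      using that
    proof (induction S rule: finite_induct)
      case empty
      then show ?case using closed(1)[of 0] hom(1)[of 0] by simp
    next
      case (insert k S)
      have "p k \<in> A" "complete_of p (a - k) \<in> A" "h (complete_of p (a - k)) = complete_of (\<lambda>k. h (p k)) (a - k)"
        using p less[of "a - k"] insert.prems by auto
      then show ?case using insert closed hom by simp
    qed
    have eq: "complete_of p a = mconst (1 / of_nat a) * (\<Sum>k=1..a. p k * complete_of p (a - k))" for p :: "nat \<Rightarrow> 'z mseries"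
      using False by (simp add: complete_of.simps[of p a])
    show ?thesis unfolding eq using sum[of "{1..a}"] closed hom by simp
  qed
qed

lemma complete_of_newton:
  assumes "a \<ge> 1"
  shows "mconst (of_nat a) * complete_of p a = (\<Sum>k=1..a. p k * complete_of p (a - k))"
proof -
  have "complete_of p a = mconst (1 / of_nat a) * (\<Sum>k=1..a. p k * complete_of p (a - k))"
    using assms by (simp add: complete_of.simps[of p a])
  then show ?thesis using assms by (simp add: mult.assoc[symmetric] mconst_mult[symmetric])
qed

text \<open>Newton's identity is triangular: with h_0 = 1, its instance for k isolates p_k once the
  earlier power sums agree. It transfers the prescription of \<rho> from complete functions to power
  sums.\<close>

lemma complete_of_inj:
  assumes "\<And>a. complete_of p a = complete_of p' a" "k \<ge> 1"
  shows "p k = p' k"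
  using assms(2)
proof (induction k rule: less_induct)
  case (less k)
  have split: "(\<Sum>j=1..k. f j) = f k + (\<Sum>j\<in>{1..<k}. f j)" for f :: "nat \<Rightarrow> 'a mseries"
    using less.prems by (metis atLeastLessThanSuc_atLeastAtMost sum.atLeastLessThan_Suc add.commute)
  have "p k + (\<Sum>j\<in>{1..<k}. p j * complete_of p (k - j)) = p' k + (\<Sum>j\<in>{1..<k}. p' j * complete_of p' (k - j))"
    using complete_of_newton[OF less.prems, of p] complete_of_newton[OF less.prems, of p'] assms(1)
    unfolding split by (simp add: complete_of.simps[of _ 0])
  moreover have "(\<Sum>j\<in>{1..<k}. p j * complete_of p (k - j)) = (\<Sum>j\<in>{1..<k}. p' j * complete_of p' (k - j))"
    using less.IH assms(1) by (intro sum.cong) auto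
  ultimately show ?case by simp
qed

lemma complete_of_cong:
  assumes "\<And>k. k \<ge> 1 \<Longrightarrow> p k = p' k"
  shows "complete_of p a = complete_of p' a"
proof (induction a rule: less_induct)
  case (less a)
  then have "(\<Sum>k=1..a. p k * complete_of p (a - k)) = (\<Sum>k=1..a. p' k * complete_of p' (a - k))"
    using assms by (intro sum.cong) auto
  then show ?case by (simp add: complete_of.simps[of _ a])
qed

text \<open>With c = -1 this moves the sign of the characteristic into the power sums; with c = q it
  extracts the factor q^n of the result.\<close>

lemma complete_of_scale: "complete_of (\<lambda>k. mconst (c ^ k) * p k) a = mconst (c ^ a) * complete_of p a"
proof (induction a rule: less_induct)
  case (less a)
  have "(\<Sum>k=1..a. mconst (c ^ k) * p k * complete_of (\<lambda>k. mconst (c ^ k) * p k) (a - k)) =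
      mconst (c ^ a) * (\<Sum>k=1..a. p k * complete_of p (a - k))"
    unfolding sum_distrib_left
  proof (intro sum.cong refl)
    fix k assume k: "k \<in> {1..a}"
    then have eq: "mconst (c ^ a) = mconst (c ^ k) * mconst (c ^ (a - k))"
      by (simp flip: mconst_mult power_add)
    have IH: "complete_of (\<lambda>k. mconst (c ^ k) * p k) (a - k) = mconst (c ^ (a - k)) * complete_of p (a - k)"
      using k by (intro less) auto
    show "mconst (c ^ k) * p k * complete_of (\<lambda>k. mconst (c ^ k) * p k) (a - k) =
      mconst (c ^ a) * (p k * complete_of p (a - k))"
      unfolding IH eq by (simp add: mult_ac)
  qed
  then show ?case by (simp add: complete_of.simps[of _ a] mult_ac)
qed

lemma mdegree_eq_0 [simp]: "mdegree m = 0 \<longleftrightarrow> m = 0"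
  by (auto simp: mdegree_def in_keys_iff poly_mapping_eq_iff fun_eq_iff)

lemma lookup_le_mdegree: "Poly_Mapping.lookup m i \<le> mdegree m"
  by (cases "i \<in> Poly_Mapping.keys m") (auto simp: mdegree_def in_keys_iff intro: member_le_sum)

text \<open>Newton's identity, checked on a monomial with s variables. A variable of exponent a + 1
  contributes (1 - y^k)(1 - y)^s for 1 \<le> k \<le> a. For k = a + 1 it disappears from the
  monomial, and 1 - y^(a+1) = (1 - y)(1 + ... + y^a) restores the lost factor. The total is (a +
  1)(1 - y)^s, and the exponents add up to n.\<close>

lemma Qs_complete_of: "Qs n y = complete_of (\<lambda>k. mconst (1 - y ^ k) * power_sum k) n"
proof (induction n rule: less_induct)
  case (less n)
  show ?case
  proof (cases "n = 0")
    case True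
    then show ?thesis
      by (intro mseries_eqI) (simp add: Qs_def complete_of.simps one_mseries.rep_eq)
  next
    case False
    show ?thesis
    proof (rule mseries_eqI)
      fix m :: "nat \<Rightarrow>\<^sub>0 nat"
      let ?K = "Poly_Mapping.keys m" and ?l = "Poly_Mapping.lookup m"
      let ?s = "card ?K"
      let ?d = "if mdegree m = n then 1 else 0 :: complex"
      have "mcoeff (\<Sum>k=1..n. mconst (1 - y ^ k) * power_sum k * complete_of (\<lambda>k. mconst (1 - y ^ k) * power_sum k) (n - k)) m =
          (\<Sum>k=1..n. (1 - y ^ k) * mcoeff (power_sum k * Qs (n - k) y) m)"
        using less False by (simp add: mcoeff_sum mult.assoc)
      also have "\<dots> = (\<Sum>k=1..n. \<Sum>i | k \<le> ?l i. ?d * ((1 - y ^ k) * (1 - y) ^ (if k = ?l i then ?s - 1 else ?s)))"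
      proof (intro sum.cong refl)
        fix k assume k: "k \<in> {1..n}"
        have "mcoeff (Qs (n - k) y) (m - Poly_Mapping.single i k) = ?d * (1 - y) ^ (if k = ?l i then ?s - 1 else ?s)"
          if i: "k \<le> ?l i" for i
        proof -
          have "Poly_Mapping.keys (m - Poly_Mapping.single i k) = (if k = ?l i then ?K - {i} else ?K)"
            using k i by (auto simp: in_keys_iff lookup_minus lookup_single when_def split: if_splits)
          moreover have "i \<in> ?K" using k i by (auto simp: in_keys_iff)
          moreover have "mdegree m - k = n - k \<longleftrightarrow> mdegree m = n"
            using k i lookup_le_mdegree[of m i] by auto
          ultimately show ?thesis using k i by (simp add: Qs_def mdegree_minus_single)
        qed
        with k show "(1 - y ^ k) * mcoeff (power_sum k * Qs (n - k) y) m =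
            (\<Sum>i | k \<le> ?l i. ?d * ((1 - y ^ k) * (1 - y) ^ (if k = ?l i then ?s - 1 else ?s)))"
          by (simp add: mcoeff_power_sum_mult sum_distrib_left mult_ac)
      qed
      also have "\<dots> = ?d * (\<Sum>k=1..n. \<Sum>i | k \<le> ?l i. (1 - y ^ k) * (1 - y) ^ (if k = ?l i then ?s - 1 else ?s))"
        by (simp only: sum_distrib_left)
      also have "\<dots> = ?d * (of_nat n * (1 - y) ^ ?s)"
      proof (cases "mdegree m = n")
        case True
        let ?f = "\<lambda>i k. (1 - y ^ k) * (1 - y) ^ (if k = ?l i then ?s - 1 else ?s)"
        have "(\<Sum>k=1..n. \<Sum>i | k \<le> ?l i. ?f i k) = (\<Sum>k=1..n. \<Sum>i\<in>{i\<in>?K. k \<le> ?l i}. ?f i k)"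
          by (intro sum.cong refl) (auto simp: in_keys_iff)
        also have "\<dots> = (\<Sum>i\<in>?K. \<Sum>k\<in>{k\<in>{1..n}. k \<le> ?l i}. ?f i k)"
          by (rule sum.swap_restrict) auto
        also have "\<dots> = (\<Sum>i\<in>?K. of_nat (?l i) * (1 - y) ^ ?s)"
        proof (intro sum.cong refl)
          fix i assume i: "i \<in> ?K"
          define a where "a = ?l i - 1"
          have a: "?l i = Suc a" using i by (simp add: a_def in_keys_iff)
          have s: "(1 - y) ^ ?s = (1 - y) * (1 - y) ^ (?s - 1)"
            using i by (cases ?s) (auto simp: card_eq_0_iff)
          have "{k\<in>{1..n}. k \<le> ?l i} = insert (Suc a) {1..a}"
            using lookup_le_mdegree[of m i] True a by auto
          then have "(\<Sum>k\<in>{k\<in>{1..n}. k \<le> ?l i}. ?f i k) = ?f i (Suc a) + (\<Sum>k=1..a. ?f i k)" by simp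
          also have "(\<Sum>k=1..a. ?f i k) = (\<Sum>k=1..a. 1 - y ^ k) * (1 - y) ^ ?s"
            unfolding sum_distrib_right using a by (intro sum.cong) auto
          also have "?f i (Suc a) = (\<Sum>k\<le>a. y ^ k) * (1 - y) ^ ?s"
            using one_diff_power_eq[of y "Suc a"] a by (simp add: s lessThan_Suc_atMost mult_ac)
          also have "(\<Sum>k\<le>a. y ^ k) * (1 - y) ^ ?s + (\<Sum>k=1..a. 1 - y ^ k) * (1 - y) ^ ?s =
              ((\<Sum>k\<le>a. y ^ k) + (\<Sum>k=1..a. 1 - y ^ k)) * (1 - y) ^ ?s" by (simp only: distrib_right)
          also have "(\<Sum>k\<le>a. y ^ k) + (\<Sum>k=1..a. 1 - y ^ k) = of_nat (Suc a)"
            by (induction a) auto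
          finally show "(\<Sum>k\<in>{k\<in>{1..n}. k \<le> ?l i}. ?f i k) = of_nat (?l i) * (1 - y) ^ ?s" unfolding a .
        qed
        also have "\<dots> = of_nat n * (1 - y) ^ ?s"
          using True by (simp add: mdegree_def flip: of_nat_sum sum_distrib_right)
        finally show ?thesis by simp
      qed simp
      finally show "mcoeff (Qs n y) m = mcoeff (complete_of (\<lambda>k. mconst (1 - y ^ k) * power_sum k) n) m"
        using False by (simp add: complete_of.simps[of _ n] Qs_def)
    qed
  qed
qed

text \<open>Both \<^const>\<open>plethysm_power\<close> and \<^const>\<open>in_alphabet\<close> pull series back along an isomorphism \<open>q\<close>
  from a submonoid \<open>D\<close> of the monomials.\<close>

lemma pullback_mult:
  fixes T :: "'u mseries \<Rightarrow> 'v mseries"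
  assumes T: "\<And>F m. mcoeff (T F) m = (if m \<in> D then mcoeff F (q m) else 0)"
    and D_add: "\<And>x y. x \<in> D \<Longrightarrow> y \<in> D \<Longrightarrow> x + y \<in> D"
    and q_add: "\<And>x y. x \<in> D \<Longrightarrow> y \<in> D \<Longrightarrow> q (x + y) = q x + q y"
    and inv: "\<And>u. t u \<in> D" "\<And>u. q (t u) = u" "\<And>x. x \<in> D \<Longrightarrow> t (q x) = x"
  shows "T (F * G) = T F * T G"
proof (rule mseries_eqI)
  fix m
  show "mcoeff (T (F * G)) m = mcoeff (T F * T G) m"
  proof (cases "m \<in> D")
    case True
    have "mcoeff (T F * T G) m = (\<Sum>(x, y)\<in>{(x, y)\<in>mono_splits m. x \<in> D \<and> y \<in> D}. mcoeff F (q x) * mcoeff G (q y))"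
      unfolding mcoeff_mult by (rule sum.mono_neutral_cong_right) (auto simp: T split: if_splits)
    also have "\<dots> = (\<Sum>(x, y)\<in>mono_splits (q m). mcoeff F x * mcoeff G y)"
    proof (rule sum.reindex_bij_witness[of _ "\<lambda>(x, y). (t x, t y)" "\<lambda>(x, y). (q x, q y)"], goal_cases)
      case (4 p)
      then have "q (t (fst p) + t (snd p)) = q m" by (auto simp: q_add inv mono_splits_def)
      then have "t (fst p) + t (snd p) = m" using inv True D_add by metis
      then show ?case using 4 inv by (auto simp: mono_splits_def)
    qed (auto simp: inv q_add mono_splits_def)
    finally show ?thesis using True by (simp add: T mcoeff_mult[of F G])
  next
    case False
    then have "mcoeff (T F) x * mcoeff (T G) y = 0" if "x + y = m" for x y
      using that D_add by (auto simp: T)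
    then have "mcoeff (T F * T G) m = 0"
      unfolding mcoeff_mult by (intro sum.neutral) (auto simp: mono_splits_def)
    then show ?thesis using False by (simp add: T)
  qed
qed

section \<open>Plethysm and alphabets as algebra homomorphisms\<close>

lemma plethysm_power_mult:
  assumes b: "b \<ge> 1"
  shows "plethysm_power b (F * G) = plethysm_power b F * plethysm_power b G"
proof -
  let ?q = "Poly_Mapping.map (\<lambda>e. e div b) :: (nat \<Rightarrow>\<^sub>0 nat) \<Rightarrow> _"
  let ?t = "Poly_Mapping.map (\<lambda>e. e * b) :: (nat \<Rightarrow>\<^sub>0 nat) \<Rightarrow> _"
  have q: "Poly_Mapping.lookup (?q m) i = Poly_Mapping.lookup m i div b" for m i
    by (simp add: Poly_Mapping.map.rep_eq when_def)
  have t: "Poly_Mapping.lookup (?t m) i = Poly_Mapping.lookup m i * b" for m i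
    by (simp add: Poly_Mapping.map.rep_eq when_def)
  show ?thesis
  proof (rule pullback_mult[where D = "{m. \<forall>i. b dvd Poly_Mapping.lookup m i}" and q = ?q and t = ?t])
    show "?q (?t u) = u" for u using b by (intro poly_mapping_eqI) (simp add: q t)
  qed (auto simp: plethysm_power_def q t lookup_add div_add intro!: poly_mapping_eqI)
qed

lemma plethysm_power_add: "plethysm_power b (F + G) = plethysm_power b F + plethysm_power b G"
  by (rule mseries_eqI) (simp add: plethysm_power_def plus_mseries.rep_eq)

lemma plethysm_power_mconst:
  assumes "b \<ge> 1"
  shows "plethysm_power b (mconst c) = mconst c"
proof (rule mseries_eqI)
  fix m :: "nat \<Rightarrow>\<^sub>0 nat"
  have "Poly_Mapping.map (\<lambda>e. e div b) m = 0 \<longleftrightarrow> m = 0" if "\<forall>i. b dvd Poly_Mapping.lookup m i"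
    using that assms by (auto simp: poly_mapping_eq_iff fun_eq_iff Poly_Mapping.map.rep_eq when_def dvd_div_eq_0_iff)
  then show "mcoeff (plethysm_power b (mconst c)) m = mcoeff (mconst c) m"
    by (auto simp: plethysm_power_def mconst_def)
qed

lemma plethysm_power_power_sum:
  assumes b: "b \<ge> 1"
  shows "plethysm_power b (power_sum k) = power_sum (k * b)"
proof (rule mseries_eqI)
  fix m :: "nat \<Rightarrow>\<^sub>0 nat"
  have q: "Poly_Mapping.lookup (Poly_Mapping.map (\<lambda>e. e div b) m) i = Poly_Mapping.lookup m i div b" for i
    by (simp add: Poly_Mapping.map.rep_eq when_def)
  have "(\<forall>i. b dvd Poly_Mapping.lookup m i) \<and> (\<exists>i. Poly_Mapping.map (\<lambda>e. e div b) m = Poly_Mapping.single i k) \<longleftrightarrow>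
      (\<exists>i. m = Poly_Mapping.single i (k * b))"
  proof (intro iffI conjI)
    assume *: "(\<forall>i. b dvd Poly_Mapping.lookup m i) \<and> (\<exists>i. Poly_Mapping.map (\<lambda>e. e div b) m = Poly_Mapping.single i k)"
    then obtain i where i: "Poly_Mapping.map (\<lambda>e. e div b) m = Poly_Mapping.single i k" by blast
    have "m = Poly_Mapping.single i (k * b)"
    proof (rule poly_mapping_eqI)
      fix j
      have "Poly_Mapping.lookup m j = Poly_Mapping.lookup m j div b * b" using * by simp
      also have "\<dots> = Poly_Mapping.lookup (Poly_Mapping.single i k) j * b" unfolding i[symmetric] q ..
      finally show "Poly_Mapping.lookup m j = Poly_Mapping.lookup (Poly_Mapping.single i (k * b)) j"
        by (simp add: lookup_single when_def)
    qed
    then show "\<exists>i. m = Poly_Mapping.single i (k * b)" ..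
  next
    assume "\<exists>i. m = Poly_Mapping.single i (k * b)"
    then obtain i where i: "m = Poly_Mapping.single i (k * b)" by blast
    then show "\<forall>i. b dvd Poly_Mapping.lookup m i" by (simp add: lookup_single when_def)
    have "Poly_Mapping.map (\<lambda>e. e div b) m = Poly_Mapping.single i k"
      using b by (intro poly_mapping_eqI) (simp add: q, simp add: i lookup_single when_def)
    then show "\<exists>i. Poly_Mapping.map (\<lambda>e. e div b) m = Poly_Mapping.single i k" ..
  qed
  then show "mcoeff (plethysm_power b (power_sum k)) m = mcoeff (power_sum (k * b)) m"
    by (auto simp: plethysm_power_def power_sum_def)
qed

lemma plethysm_power_complete_sym:
  assumes "b \<ge> 1"
  shows "plethysm_power b (complete_sym a) = complete_of (\<lambda>k. power_sum (k * b)) a"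
  using complete_of_hom_on[of power_sum UNIV "plethysm_power b" a] assms
  by (simp add: complete_of_power_sum plethysm_power_mult plethysm_power_add plethysm_power_mconst plethysm_power_power_sum)

lemma in_alphabet_add: "in_alphabet f (F + G) = in_alphabet f F + in_alphabet f G"
  by (rule mseries_eqI) (simp add: in_alphabet_def plus_mseries.rep_eq)

lemma lookup_map_key_Pair: "Poly_Mapping.lookup (Poly_Mapping.map_key (Pair f) m) i = Poly_Mapping.lookup m (f, i)"
  by (simp add: map_key.rep_eq inj_on_def)

lemma in_alphabet_mconst: "in_alphabet f (mconst c) = mconst c"
proof (rule mseries_eqI)
  fix m :: "('a \<times> nat) \<Rightarrow>\<^sub>0 nat"
  have "Poly_Mapping.map_key (Pair f) m = 0 \<longleftrightarrow> m = 0" if "Poly_Mapping.keys m \<subseteq> {f} \<times> UNIV"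
  proof
    assume *: "Poly_Mapping.map_key (Pair f) m = 0"
    show "m = 0"
    proof (rule poly_mapping_eqI)
      fix p
      show "Poly_Mapping.lookup m p = Poly_Mapping.lookup 0 p"
        using lookup_map_key_Pair[of f m "snd p"] subsetD[OF that, of p] * by (cases p) (auto simp: in_keys_iff)
    qed
  qed (auto intro!: poly_mapping_eqI simp: lookup_map_key_Pair)
  then show "mcoeff (in_alphabet f (mconst c)) m = mcoeff (mconst c) m"
    by (auto simp: in_alphabet_def mconst_def)
qed

lemma in_alphabet_mult: "in_alphabet f (F * G) = in_alphabet f F * in_alphabet f G"
proof -
  let ?D = "{m. Poly_Mapping.keys m \<subseteq> {f} \<times> (UNIV :: nat set)}"
  let ?q = "Poly_Mapping.map_key (Pair f) :: _ \<Rightarrow> nat \<Rightarrow>\<^sub>0 nat"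
  define t where "t u = (\<Sum>i\<in>Poly_Mapping.keys u. Poly_Mapping.single (f, i) (Poly_Mapping.lookup u i))"
    for u :: "nat \<Rightarrow>\<^sub>0 nat"
  have lt: "Poly_Mapping.lookup (t u) (g, i) = (if g = f then Poly_Mapping.lookup u i else 0)" for u g i
  proof -
    have "Poly_Mapping.lookup (t u) (g, i) =
        (\<Sum>j\<in>Poly_Mapping.keys u. if j = i then (if g = f then Poly_Mapping.lookup u i else 0) else 0)"
      unfolding t_def lookup_sum by (intro sum.cong) (auto simp: lookup_single when_def)
    then show ?thesis by (simp add: sum.delta in_keys_iff)
  qed
  show ?thesis
  proof (rule pullback_mult[where D = ?D and q = ?q and t = t])
    show "mcoeff (in_alphabet f F) m = (if m \<in> ?D then mcoeff F (?q m) else 0)" for F m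
      by (simp add: in_alphabet_def)
    show "x + y \<in> ?D" if "x \<in> ?D" "y \<in> ?D" for x y
      using that Poly_Mapping.keys_add[of x y] by blast
    show "?q (x + y) = ?q x + ?q y" for x y
      by (intro poly_mapping_eqI) (simp add: lookup_map_key_Pair lookup_add)
    show "t u \<in> ?D" for u by (auto simp: in_keys_iff lt split: if_splits)
    show "?q (t u) = u" for u by (intro poly_mapping_eqI) (simp add: lookup_map_key_Pair lt)
    show "t (?q x) = x" if "x \<in> ?D" for x
    proof (rule poly_mapping_eqI)
      fix p
      show "Poly_Mapping.lookup (t (?q x)) p = Poly_Mapping.lookup x p"
        using subsetD[of "Poly_Mapping.keys x" "{f} \<times> UNIV" p] that
        by (cases p) (auto simp: lt lookup_map_key_Pair in_keys_iff)
    qed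
  qed
qed

lemma power_sum_sym: "power_sum k \<in> sym_funs"
proof -
  have "mdegree m \<le> k" if "mcoeff (power_sum k) m \<noteq> 0" for m
    using that by (auto simp: power_sum_def mdegree_def split: if_splits)
  moreover have "mcoeff (power_sum k) (Poly_Mapping.map_key \<pi> m) = mcoeff (power_sum k) m" if \<pi>: "bij \<pi>" for \<pi> m
  proof -
    have l: "Poly_Mapping.lookup (Poly_Mapping.map_key \<pi> m) i = Poly_Mapping.lookup m (\<pi> i)" for i
      using \<pi> by (simp add: map_key.rep_eq bij_is_inj)
    have "(\<exists>i. Poly_Mapping.map_key \<pi> m = Poly_Mapping.single i k) \<longleftrightarrow> (\<exists>i. m = Poly_Mapping.single i k)"
    proof
      assume "\<exists>i. Poly_Mapping.map_key \<pi> m = Poly_Mapping.single i k"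
      then obtain i where i: "Poly_Mapping.map_key \<pi> m = Poly_Mapping.single i k" ..
      have "m = Poly_Mapping.single (\<pi> i) k"
      proof (rule poly_mapping_eqI)
        fix j
        obtain j' where j': "j = \<pi> j'" using bij_is_surj[OF \<pi>] by (metis surjD)
        show "Poly_Mapping.lookup m j = Poly_Mapping.lookup (Poly_Mapping.single (\<pi> i) k) j"
          using l[of j'] bij_is_inj[OF \<pi>] unfolding i j' by (auto simp: lookup_single when_def inj_eq)
      qed
      then show "\<exists>i. m = Poly_Mapping.single i k" ..
    next
      assume "\<exists>i. m = Poly_Mapping.single i k"
      then obtain i where i: "m = Poly_Mapping.single i k" ..
      obtain i' where i': "i = \<pi> i'" using bij_is_surj[OF \<pi>] by (metis surjD)
      have "Poly_Mapping.map_key \<pi> m = Poly_Mapping.single i' k"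
        using bij_is_inj[OF \<pi>] by (intro poly_mapping_eqI) (auto simp: l i i' lookup_single when_def inj_eq)
      then show "\<exists>i. Poly_Mapping.map_key \<pi> m = Poly_Mapping.single i k" ..
    qed
    then show ?thesis by (simp add: power_sum_def)
  qed
  ultimately show ?thesis by (auto simp: sym_funs_def)
qed

section \<open>Finite fields and their orbits\<close>

text \<open>Multiplication by a nonzero a permutes the nonzero elements, so their product is
  unchanged although it is multiplied by a^(q-1).\<close>

lemma finite_field_power_card: "(a :: 'a::{finite,field}) ^ CARD('a) = a"
proof (cases "a = 0")
  case True
  then show ?thesis by (simp add: card_gt_0_iff)
next
  case False
  let ?U = "UNIV - {0 :: 'a}" and ?P = "prod (\<lambda>x :: 'a. x) (UNIV - {0})"
  have "?P = prod (\<lambda>x. a * x) ?U"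
    by (rule prod.reindex_bij_witness[of _ "\<lambda>x. a * x" "\<lambda>x. x / a"]) (use False in auto)
  also have "\<dots> = a ^ card ?U * ?P" unfolding prod.distrib prod_constant ..
  finally have "1 * ?P = a ^ card ?U * ?P" by (simp only: mult_1_left)
  moreover have "?P \<noteq> 0" by (simp add: prod_zero_iff)
  ultimately have "1 = a ^ card ?U" using mult_right_cancel by blast
  moreover have "CARD('a) = Suc (card ?U)"
    by (rule card_Suc_Diff1[symmetric]) auto
  ultimately show ?thesis by (metis mult.right_neutral power_Suc)
qed

lemma card_field_ge_2: "CARD('a::{finite,field}) \<ge> 2"
proof -
  have "card {0, 1 :: 'a} \<le> CARD('a)" by (rule card_mono) auto
  then show ?thesis by simp
qed

text \<open>The polynomial (a + 1)^q - a^q - 1 has degree below q but vanishes at all q elements,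
  since each is its own q-th power. Its coefficients are these binomials. Additivity of Frobenius
  follows without first writing q as a prime power.\<close>

lemma finite_field_binomial_eq_0:
  assumes "0 < i" "i < CARD('a)"
  shows "(of_nat (CARD('a) choose i) :: 'a::{finite,field}) = 0"
proof -
  let ?q = "CARD('a)"
  define P where "P = (\<Sum>i\<in>{0<..<?q}. monom (of_nat (?q choose i)) i :: 'a poly)"
  have "poly P a = 0" for a
  proof -
    have q: "{..?q} = insert 0 (insert ?q {0<..<?q})" using card_field_ge_2[where 'a = 'a] by auto
    have "a + 1 = (a + 1) ^ ?q" by (simp only: finite_field_power_card)
    also have "\<dots> = (\<Sum>k\<le>?q. of_nat (?q choose k) * a ^ k)" by (simp add: binomial_ring)
    also have "\<dots> = 1 + a + poly P a"
      unfolding q P_def using card_field_ge_2[where 'a = 'a]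
      by (simp add: finite_field_power_card poly_sum poly_monom)
    finally show ?thesis by (simp add: algebra_simps)
  qed
  moreover have "degree P < CARD('a)"
  proof -
    have "degree P \<le> ?q - 1" unfolding P_def
      by (rule degree_sum_le) (auto intro: order.trans[OF degree_monom_le])
    then show ?thesis using card_field_ge_2[where 'a = 'a] by linarith
  qed
  ultimately have "P = 0"
    by (intro poly_eqI_degree[of UNIV]) (auto simp: card_gt_0_iff)
  then have "coeff P i = 0" by simp
  also have "coeff P i = (\<Sum>j\<in>{0<..<?q}. if j = i then of_nat (?q choose i) else 0)"
    unfolding P_def coeff_sum by (intro sum.cong) auto
  finally show ?thesis using assms by (simp add: sum.delta)
qed

lemma frob_add: "(x + y) ^ CARD('a) = x ^ CARD('a) + (y :: 'a::{finite,field} alg_closure) ^ CARD('a)"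
proof -
  let ?q = "CARD('a)"
  have "(of_nat (?q choose k) :: 'a alg_closure) = 0" if "0 < k" "k < ?q" for k
    using finite_field_binomial_eq_0[OF that] by (metis to_ac_0 to_ac_of_nat)
  moreover have q: "{..?q} = insert 0 (insert ?q {0<..<?q})" using card_field_ge_2[where 'a = 'a] by auto
  ultimately show ?thesis
    using card_field_ge_2[where 'a = 'a] unfolding binomial_ring q by simp
qed

lemma frob_iter_add: "(x + y) ^ (CARD('a) ^ k) = x ^ (CARD('a) ^ k) + (y :: 'a::{finite,field} alg_closure) ^ (CARD('a) ^ k)"
  by (induction k arbitrary: x y) (simp_all add: power_mult frob_add)

lemma card_pow_gt_1: "n \<ge> 1 \<Longrightarrow> CARD('a::{finite,field}) ^ n > 1"
  using card_field_ge_2[where 'a = 'a] by (intro one_less_power) auto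

lemma finite_power_fixed: "N > 1 \<Longrightarrow> finite {z :: 'b::field. z ^ N = z}"
proof -
  assume N: "N > 1"
  have "coeff (monom 1 N - monom 1 1 :: 'b poly) N = 1" using N by simp
  then have "monom 1 N - monom 1 1 \<noteq> (0 :: 'b poly)" by (metis coeff_0 zero_neq_one)
  then have "finite {z. poly (monom 1 N - monom 1 1) z = (0 :: 'b)}" by (rule poly_roots_finite)
  then show ?thesis by (simp add: poly_monom)
qed

lemma finite_ext_units: "n \<ge> 1 \<Longrightarrow> finite (ext_units n :: 'a::{finite,field} alg_closure set)"
  by (rule finite_subset[OF _ finite_power_fixed[OF card_pow_gt_1[where 'a = 'a], of n]])
    (auto simp: ext_units_def)

lemma ext_units_1 [simp]: "1 \<in> ext_units n"
  by (simp add: ext_units_def)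

lemma ext_units_mult: "z \<in> ext_units n \<Longrightarrow> w \<in> ext_units n \<Longrightarrow> z * w \<in> ext_units n"
  by (simp add: ext_units_def power_mult_distrib)

lemma ext_units_power: "z \<in> ext_units n \<Longrightarrow> z ^ k \<in> ext_units n"
  by (induction k) (simp_all add: ext_units_mult)

text \<open>The embedded field provides q roots of z^q - z, which has at most q of them.\<close>

lemma range_to_ac: "range to_ac = {z :: 'a::{finite,field} alg_closure. z ^ CARD('a) = z}"
proof (rule card_subset_eq)
  have q: "CARD('a) > 1" using card_field_ge_2[where 'a = 'a] by simp
  show fin: "finite {z :: 'a alg_closure. z ^ CARD('a) = z}" by (rule finite_power_fixed[OF q])
  show sub: "range to_ac \<subseteq> {z :: 'a alg_closure. z ^ CARD('a) = z}"
    using finite_field_power_card by (auto simp flip: to_ac_power)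
  let ?P = "monom 1 CARD('a) - monom 1 1 :: 'a alg_closure poly"
  have "coeff ?P CARD('a) = 1" using q by simp
  then have "?P \<noteq> 0" by (metis coeff_0 zero_neq_one)
  then have "card {z. poly ?P z = 0} \<le> degree ?P" by (rule card_poly_roots_bound)
  also have "degree ?P \<le> CARD('a)"
    using q by (intro degree_diff_le order.trans[OF degree_monom_le]) auto
  finally have "card {z :: 'a alg_closure. z ^ CARD('a) = z} \<le> CARD('a)" by (simp add: poly_monom)
  moreover have "card (range (to_ac :: 'a \<Rightarrow> _)) = CARD('a)" by (rule card_image) (rule inj_to_ac)
  ultimately show "card (range (to_ac :: 'a \<Rightarrow> _)) = card {z :: 'a alg_closure. z ^ CARD('a) = z}"
    using card_mono[OF fin sub] by linarith
qed

lemma map_poly_mult_hom: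
  fixes h :: "'b::comm_ring_1 \<Rightarrow> 'c::comm_ring_1"
  assumes [simp]: "h 0 = 0" and add: "\<And>x y. h (x + y) = h x + h y" and mult: "\<And>x y. h (x * y) = h x * h y"
  shows "map_poly h (p * r) = map_poly h p * map_poly h r"
proof -
  have "h (sum f A) = (\<Sum>a\<in>A. h (f a))" for f and A :: "nat set"
    by (induction A rule: infinite_finite_induct) (auto simp: add)
  then show ?thesis by (intro poly_eqI) (simp add: coeff_map_poly coeff_mult mult)
qed

lemma map_poly_prod_hom:
  fixes h :: "'b::comm_ring_1 \<Rightarrow> 'c::comm_ring_1"
  assumes "h 0 = 0" "h 1 = 1" "\<And>x y. h (x + y) = h x + h y" "\<And>x y. h (x * y) = h x * h y"
  shows "map_poly h (prod f A) = (\<Prod>a\<in>A. map_poly h (f a))"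
  by (induction A rule: infinite_finite_induct) (use assms in \<open>auto simp: map_poly_mult_hom map_poly_1'\<close>)

section \<open>Frobenius orbits and monic irreducible polynomials\<close>

abbreviation ac_eval :: "'a::{finite,field} poly \<Rightarrow> 'a alg_closure \<Rightarrow> 'a alg_closure" where
  "ac_eval f z \<equiv> poly (map_poly to_ac f) z"

lemma ac_eval_mult: "ac_eval (f * g) z = ac_eval f z * ac_eval g z"
  by (simp add: map_poly_mult_hom)

lemma ac_eval_add: "ac_eval (f + g) z = ac_eval f z + ac_eval g z"
proof -
  have "map_poly to_ac (f + g) = map_poly to_ac f + map_poly to_ac g"
    by (intro poly_eqI) (simp add: coeff_map_poly)
  then show ?thesis by simp
qed

lemma ac_eval_1 [simp]: "ac_eval 1 z = 1"
  by (simp add: map_poly_1')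

lemma ac_eval_frob: "ac_eval f (z ^ CARD('a)) = ac_eval (f :: 'a::{finite,field} poly) z ^ CARD('a)"
proof (induction f)
  case (pCons a f)
  have "to_ac a ^ CARD('a) = to_ac a" by (metis finite_field_power_card to_ac_power)
  then show ?case using pCons by (simp add: map_poly_pCons frob_add power_mult_distrib)
qed (simp add: card_gt_0_iff)

lemma finite_frob_orbit:
  fixes z :: "'a::{finite,field} alg_closure"
  assumes "n \<ge> 1" "z \<in> ext_units n"
  shows "frob_orbit z \<subseteq> ext_units n" "finite (frob_orbit z)"
    "bij_betw (\<lambda>w. w ^ CARD('a)) (frob_orbit z) (frob_orbit z)"
proof -
  show sub: "frob_orbit z \<subseteq> ext_units n"
    unfolding frob_orbit_def using ext_units_power[OF assms(2)] by auto
  then show fin: "finite (frob_orbit z)" using finite_ext_units[OF assms(1)] finite_subset by blast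
  have "inj_on (\<lambda>w. w ^ CARD('a)) (frob_orbit z)"
  proof (rule inj_onI)
    fix v w assume vw: "v \<in> frob_orbit z" "w \<in> frob_orbit z" "v ^ CARD('a) = w ^ CARD('a)"
    have *: "u ^ CARD('a) ^ n = u" if "u \<in> frob_orbit z" for u using sub that by (auto simp: ext_units_def)
    have "CARD('a) ^ n = CARD('a) * CARD('a) ^ (n - 1)" using assms(1) by (simp flip: power_Suc)
    then show "v = w" using *[OF vw(1)] *[OF vw(2)] vw(3) by (metis power_mult)
  qed
  moreover have "(\<lambda>w. w ^ CARD('a)) ` frob_orbit z \<subseteq> frob_orbit z"
  proof clarify
    fix w assume "w \<in> frob_orbit z"
    then obtain k where "w = z ^ (CARD('a) ^ k)" by (auto simp: frob_orbit_def)
    then have "w ^ CARD('a) = z ^ (CARD('a) ^ Suc k)" by (simp add: mult.commute flip: power_mult)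
    then show "w ^ CARD('a) \<in> frob_orbit z" unfolding frob_orbit_def by blast
  qed
  ultimately show "bij_betw (\<lambda>w. w ^ CARD('a)) (frob_orbit z) (frob_orbit z)"
    using endo_inj_surj[OF fin] by (simp add: bij_betw_def)
qed

lemma frob_orbit_self: "z \<in> frob_orbit z"
  unfolding frob_orbit_def by (auto intro: exI[of _ 0])

text \<open>Frobenius permutes the roots and therefore fixes the coefficients of the product, which
  puts them into the base field.\<close>

lemma frob_orbit_poly:
  fixes z :: "'a::{finite,field} alg_closure"
  assumes "n \<ge> 1" "z \<in> ext_units n"
  shows "\<exists>f::'a poly. map_poly to_ac f = (\<Prod>w\<in>frob_orbit z. [:- w, 1:])"
proof -
  let ?G = "\<Prod>w\<in>frob_orbit z. [:- w, 1:]"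
  let ?h = "\<lambda>w :: 'a alg_closure. w ^ CARD('a)"
  have q0: "CARD('a) > 0" by (simp add: card_gt_0_iff)
  have minus: "?h (- w) = - ?h w" for w
  proof -
    have "?h (- w) + ?h w = ?h (- w + w)" by (rule frob_add[symmetric])
    then show ?thesis using q0 by (simp add: eq_neg_iff_add_eq_0)
  qed
  have "map_poly ?h ?G = (\<Prod>w\<in>frob_orbit z. map_poly ?h [:- w, 1:])"
    using q0 by (intro map_poly_prod_hom) (auto simp: frob_add power_mult_distrib)
  also have "\<dots> = (\<Prod>w\<in>frob_orbit z. [:- ?h w, 1:])"
    using q0 by (intro prod.cong refl) (simp add: map_poly_pCons minus)
  also have "\<dots> = ?G"
    using prod.reindex_bij_betw[OF finite_frob_orbit(3)[OF assms], of "\<lambda>w. [:- w, 1:]"] by simp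
  finally have fixed: "map_poly ?h ?G = ?G" .
  have "?h (coeff ?G i) = coeff ?G i" for i
    using coeff_map_poly[of ?h ?G i] q0 unfolding fixed by simp
  then have "coeff ?G i \<in> range to_ac" for i unfolding range_to_ac by simp
  then have "map_poly to_ac (map_poly of_ac ?G) = ?G"
    by (intro poly_eqI) (simp add: coeff_map_poly to_ac_of_ac)
  then show ?thesis by blast
qed

lemma poly_prod_roots: "finite S \<Longrightarrow> poly (\<Prod>w\<in>S. [:- w, 1:]) x = 0 \<longleftrightarrow> x \<in> (S :: 'b::idom set)"
  by (auto simp: poly_prod prod_zero_iff)

lemma degree_map_to_ac [simp]: "degree (map_poly to_ac (f :: 'a::{finite,field} poly)) = degree f"
  by (rule degree_map_poly) simp

text \<open>A divisor over the base field that vanishes at z vanishes on the whole orbit and so has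
  full degree; this is why the product is irreducible.\<close>

lemma Phi_orbit_exists:
  fixes z :: "'a::{finite,field} alg_closure"
  assumes "n \<ge> 1" "z \<in> ext_units n"
  shows "\<exists>f \<in> Phi. {w. ac_eval f w = 0} = frob_orbit z"
proof -
  obtain f :: "'a poly" where f: "map_poly to_ac f = (\<Prod>w\<in>frob_orbit z. [:- w, 1:])"
    using frob_orbit_poly[OF assms] by blast
  note fin = finite_frob_orbit(2)[OF assms]
  have roots: "{w. ac_eval f w = 0} = frob_orbit z"
    unfolding f using poly_prod_roots[OF fin] by auto
  have deg: "degree f = card (frob_orbit z)"
    using arg_cong[OF f, of degree] fin by (simp add: degree_prod_eq_sum_degree)
  have "lead_coeff (map_poly to_ac f) = 1" unfolding f by (simp add: lead_coeff_prod)
  then have monic: "lead_coeff f = 1" by (simp add: coeff_map_poly)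
  have z: "z \<in> frob_orbit z" by (rule frob_orbit_self)
  have "card (frob_orbit z) > 0" using fin z by (auto simp: card_gt_0_iff)
  have full: "degree g \<ge> degree f" if g: "g dvd f" "ac_eval g z = 0" for g
  proof -
    have orbit: "ac_eval g w = 0" if "w \<in> frob_orbit z" for w
    proof -
      obtain k where k: "w = z ^ (CARD('a) ^ k)" using \<open>w \<in> frob_orbit z\<close> by (auto simp: frob_orbit_def)
      have "ac_eval g (z ^ (CARD('a) ^ k)) = 0"
      proof (induction k)
        case (Suc k)
        have "ac_eval g (z ^ (CARD('a) ^ Suc k)) = ac_eval g ((z ^ (CARD('a) ^ k)) ^ CARD('a))"
          by (simp add: mult.commute flip: power_mult)
        then show ?case unfolding ac_eval_frob using Suc by (simp add: card_gt_0_iff)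
      qed (use g in simp)
      then show ?thesis by (simp add: k)
    qed
    have "g \<noteq> 0" using g(1) monic by auto
    then have "map_poly to_ac g \<noteq> 0" by (metis map_poly_eq_0_iff to_ac_0 to_ac_eq_0_iff)
    then have "card {w. ac_eval g w = 0} \<le> degree (map_poly to_ac g)" by (rule card_poly_roots_bound)
    moreover have "card (frob_orbit z) \<le> card {w. ac_eval g w = 0}"
      using orbit poly_roots_finite[OF \<open>map_poly to_ac g \<noteq> 0\<close>] by (intro card_mono) auto
    ultimately show ?thesis using deg by simp
  qed
  have "irreducible f"
  proof (rule irreducibleI)
    show "f \<noteq> 0" using monic by auto
    show "\<not> is_unit f" using deg \<open>card (frob_orbit z) > 0\<close> by (auto simp: is_unit_iff_degree[OF \<open>f \<noteq> 0\<close>])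
    fix a b assume ab: "f = a * b"
    have ne: "a \<noteq> 0" "b \<noteq> 0" using ab \<open>f \<noteq> 0\<close> by auto
    have "ac_eval a z * ac_eval b z = 0" using roots z unfolding ab ac_eval_mult by blast
    then have "degree a \<ge> degree f \<or> degree b \<ge> degree f" using full[of a] full[of b] ab by auto
    moreover have "degree f = degree a + degree b" unfolding ab using ne by (rule degree_mult_eq)
    ultimately have "degree a = 0 \<or> degree b = 0" by linarith
    then show "is_unit a \<or> is_unit b" using ne by (simp add: is_unit_iff_degree)
  qed
  moreover have "f \<noteq> [:0, 1:]"
  proof
    assume "f = [:0, 1:]"
    then have "0 \<in> frob_orbit z" unfolding roots[symmetric] by (simp add: map_poly_pCons)
    then show False using finite_frob_orbit(1)[OF assms] by (auto simp: ext_units_def)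
  qed
  ultimately show ?thesis using monic roots by (auto simp: Phi_def)
qed

text \<open>A nonzero polynomial h of least degree with root z divides every polynomial with root z.
  A monic irreducible multiple of h is h divided by its leading coefficient.\<close>

lemma Phi_unique:
  fixes f g :: "'a::{finite,field} poly"
  assumes "f \<in> Phi" "g \<in> Phi" "ac_eval f z = 0" "ac_eval g z = 0"
  shows "f = g"
proof -
  obtain h where h: "h \<noteq> 0" "ac_eval h z = 0" and least: "\<And>p. p \<noteq> 0 \<Longrightarrow> ac_eval p z = 0 \<Longrightarrow> degree h \<le> degree p"
  proof -
    have "f \<noteq> 0" using assms(1) by (auto simp: Phi_def)
    then show ?thesis
      using ex_has_least_nat[of "\<lambda>p. p \<noteq> 0 \<and> ac_eval p z = 0" f degree] assms(3) that by blast
  qed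
  have div: "h dvd p" if "ac_eval p z = 0" for p
  proof (rule ccontr)
    assume "\<not> h dvd p"
    then have "p mod h \<noteq> 0" by (simp add: mod_eq_0_iff_dvd)
    moreover have "ac_eval (p mod h) z = 0"
      using that h(2) ac_eval_add[of "p div h * h" "p mod h" z] ac_eval_mult[of "p div h" h z] by simp
    ultimately show False using least[of "p mod h"] degree_mod_less[OF h(1), of p] by auto
  qed
  have "\<not> is_unit h"
  proof
    assume "is_unit h"
    then obtain c where "h = [:c:]" using h(1) by (auto simp: is_unit_iff_degree elim: degree_eq_zeroE)
    then show False using h by (simp add: map_poly_pCons)
  qed
  have *: "p = smult (inverse (lead_coeff h)) h" if p: "p \<in> Phi" "ac_eval p z = 0" for p
  proof -
    obtain c where c: "p = h * c" using div[OF p(2)] by auto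
    have "is_unit c" using p(1) irreducibleD[OF _ c] \<open>\<not> is_unit h\<close> by (auto simp: Phi_def)
    then obtain d where d: "c = [:d:]" by (metis is_unit_polyE)
    have "lead_coeff p = lead_coeff h * lead_coeff c" unfolding c by (rule lead_coeff_mult)
    then have "lead_coeff h * d = 1" using p(1) d by (simp add: Phi_def)
    then have "d = inverse (lead_coeff h)" by (metis inverse_unique)
    then show ?thesis using c d by simp
  qed
  show ?thesis using *[OF assms(1,3)] *[OF assms(2,4)] by simp
qed

lemma Phi_of_eqI:
  assumes "f \<in> Phi" "{w. ac_eval f w = 0} = frob_orbit z"
  shows "Phi_of z = f"
  unfolding Phi_of_def
proof (rule the_equality)
  show "f \<in> Phi \<and> {w. ac_eval f w = 0} = frob_orbit z" using assms by simp
  fix g assume g: "g \<in> Phi \<and> {w. ac_eval g w = 0} = frob_orbit z"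
  then have "ac_eval g z = 0" "ac_eval f z = 0" using assms frob_orbit_self[of z] by blast+
  then show "g = f" using g assms Phi_unique by blast
qed

lemma Phi_of_in_Phi: "n \<ge> 1 \<Longrightarrow> z \<in> ext_units n \<Longrightarrow> Phi_of z \<in> Phi"
  using Phi_orbit_exists[of n z] Phi_of_eqI by blast

text \<open>As z returns to itself after n Frobenius steps, j steps are undone by n j - j further
  ones, a natural number because n \<ge> 1.\<close>

lemma frob_orbit_power:
  fixes z :: "'a::{finite,field} alg_closure"
  assumes "n \<ge> 1" "z \<in> ext_units n"
  shows "frob_orbit (z ^ (CARD('a) ^ j)) = frob_orbit z"
proof -
  let ?q = "CARD('a)"
  have period: "z ^ (?q ^ (n * k)) = z" for k
  proof (induction k)
    case (Suc k)
    have "z ^ (?q ^ (n * Suc k)) = (z ^ (?q ^ n)) ^ (?q ^ (n * k))"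
      by (simp add: power_add flip: power_mult)
    then show ?case using assms(2) Suc by (simp add: ext_units_def)
  qed simp
  have 1: "(z ^ (?q ^ j)) ^ (?q ^ k) = z ^ (?q ^ (j + k))" for k
    by (simp add: power_add flip: power_mult)
  have "z ^ (?q ^ k) = (z ^ (?q ^ j)) ^ (?q ^ (n * j - j + k))" for k
  proof -
    have "j \<le> n * j" using assms(1) by simp
    then have "j + (n * j - j + k) = n * j + k" by linarith
    then have "(z ^ (?q ^ j)) ^ (?q ^ (n * j - j + k)) = z ^ (?q ^ (n * j + k))" unfolding 1 by (simp only:)
    also have "\<dots> = (z ^ (?q ^ (n * j))) ^ (?q ^ k)" by (simp add: power_add flip: power_mult)
    finally show ?thesis by (simp add: period)
  qed
  then show ?thesis unfolding frob_orbit_def using 1 by (auto; metis)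
qed

lemma Phi_of_frob: "n \<ge> 1 \<Longrightarrow> z \<in> ext_units n \<Longrightarrow> Phi_of (z ^ (CARD('a) ^ j)) = Phi_of (z :: 'a::{finite,field} alg_closure)"
  unfolding Phi_of_def by (simp only: frob_orbit_power)

lemma linear_in_Phi: "[:- 1, 1:] \<in> (Phi :: 'a::{finite,field} poly set)"
  unfolding Phi_def
proof (intro CollectI conjI)
  show "irreducible ([:- 1, 1:] :: 'a poly)"
  proof (rule irreducibleI)
    fix a b :: "'a poly" assume ab: "[:- 1, 1:] = a * b"
    then have "a \<noteq> 0" "b \<noteq> 0" by auto
    moreover from this have "degree a + degree b = 1"
      using arg_cong[OF ab, of degree] by (simp add: degree_mult_eq)
    ultimately show "is_unit a \<or> is_unit b" by (auto simp: is_unit_iff_degree)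
  qed (auto simp: is_unit_iff_degree)
qed auto

lemma Phi_of_1: "Phi_of (1 :: 'a::{finite,field} alg_closure) = [:- 1, 1:]"
  by (rule Phi_of_eqI) (auto simp: linear_in_Phi frob_orbit_def map_poly_pCons)

section \<open>Characters of the groups of units\<close>

text \<open>The fixed points of z \<mapsto> z^(q^n) are made into an explicit finite field
  \<open>R\<close>, to which the cyclicity of multiplicative groups of finite fields
  applies.\<close>

lemma ext_units_cyclic:
  assumes n: "n \<ge> 1"
  shows "\<exists>g \<in> ext_units n. ext_units n = {g ^ i | i::nat. True} \<and> (g :: 'a::{finite,field} alg_closure) \<noteq> 0"
proof -
  let ?Q = "CARD('a) ^ n"
  define R :: "'a alg_closure ring" where
    "R = \<lparr>carrier = {z. z ^ ?Q = z}, monoid.mult = (*), one = 1, ring.zero = 0, add = (+)\<rparr>"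
  have simps: "carrier R = {z. z ^ ?Q = z}" "monoid.mult R = (*)" "one R = 1" "ring.zero R = 0" "add R = (+)"
    by (simp_all add: R_def)
  have q0: "?Q > 0" by (simp add: card_gt_0_iff)
  have neg: "(- z) ^ ?Q = - z" if "z ^ ?Q = z" for z :: "'a alg_closure"
  proof -
    have "(- z) ^ ?Q + z ^ ?Q = (- z + z) ^ ?Q" by (rule frob_iter_add[symmetric])
    then show ?thesis using that q0 by (simp add: eq_neg_iff_add_eq_0)
  qed
  have ab: "abelian_group R"
  proof (rule abelian_groupI)
    fix x assume "x \<in> carrier R"
    then show "\<exists>y\<in>carrier R. y \<oplus>\<^bsub>R\<^esub> x = \<zero>\<^bsub>R\<^esub>" using neg by (intro bexI[of _ "- x"]) (auto simp: simps)
  qed (auto simp: simps frob_iter_add q0 algebra_simps)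
  have "comm_monoid R"
    by (rule comm_monoidI) (auto simp: simps power_mult_distrib)
  with ab have cring: "cring R" by (rule cringI) (auto simp: simps algebra_simps)
  have "Units R = carrier R - {\<zero>\<^bsub>R\<^esub>}"
  proof (intro equalityI subsetI)
    fix x assume "x \<in> carrier R - {\<zero>\<^bsub>R\<^esub>}"
    then show "x \<in> Units R"
      unfolding Units_def by (auto simp: simps power_inverse intro!: exI[of _ "inverse x"])
  qed (auto simp: Units_def simps)
  then have "Ring.field R" using cring by (intro cring.cring_fieldI)
  moreover have "finite (carrier R)"
    unfolding simps by (rule finite_power_fixed[OF card_pow_gt_1[OF n]])
  ultimately obtain g where g: "g \<in> carrier (mult_of R)"
    "carrier (mult_of R) = {g [^]\<^bsub>R\<^esub> i | i::nat. i \<in> UNIV}"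
    using field.finite_field_mult_group_has_gen[of R] by auto
  have "g [^]\<^bsub>R\<^esub> i = g ^ i" for i :: nat
    by (induction i) (simp_all add: simps mult.commute nat_pow_def)
  moreover have "carrier (mult_of R) = ext_units n" by (auto simp: carrier_mult_of simps ext_units_def)
  ultimately have "g \<in> ext_units n" "ext_units n = {g ^ i | i::nat. True}" using g by simp_all
  moreover from this(1) have "g \<noteq> 0" by (simp add: ext_units_def)
  ultimately show ?thesis by blast
qed

lemma M_hatD:
  assumes "\<xi> \<in> M_hat n"
  shows "z \<in> ext_units n \<Longrightarrow> \<xi> z \<noteq> 0" "z \<in> ext_units n \<Longrightarrow> w \<in> ext_units n \<Longrightarrow> \<xi> (z * w) = \<xi> z * \<xi> w"
    "z \<notin> ext_units n \<Longrightarrow> \<xi> z = 0" "\<xi> 1 = 1"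
proof -
  show *: "\<xi> z \<noteq> 0" if "z \<in> ext_units n" for z using assms that by (auto simp: M_hat_def)
  show mult: "\<xi> (z * w) = \<xi> z * \<xi> w" if "z \<in> ext_units n" "w \<in> ext_units n" for z w
    using assms that by (auto simp: M_hat_def)
  show "z \<notin> ext_units n \<Longrightarrow> \<xi> z = 0" using assms by (auto simp: M_hat_def)
  show "\<xi> 1 = 1" using mult[of 1 1] *[of 1] by simp
qed

lemma M_hat_power: "\<xi> \<in> M_hat n \<Longrightarrow> z \<in> ext_units n \<Longrightarrow> \<xi> (z ^ k) = \<xi> z ^ k"
  by (induction k) (simp_all add: M_hatD ext_units_power)

lemma finite_M_hat:
  assumes n: "n \<ge> 1"
  shows "finite (M_hat n :: ('a::{finite,field} alg_closure \<Rightarrow> complex) set)"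
proof -
  let ?Q = "CARD('a) ^ n"
  have Q: "?Q > 1" by (rule card_pow_gt_1[OF n])
  have "\<xi> z ^ ?Q = \<xi> z" if "\<xi> \<in> M_hat n" "z \<in> ext_units n" for \<xi> :: "'a alg_closure \<Rightarrow> complex" and z
    using M_hat_power[OF that, of ?Q] that(2) by (simp add: ext_units_def)
  then have "M_hat n \<subseteq> {\<xi>. \<forall>z. (z \<in> (ext_units n :: 'a alg_closure set) \<longrightarrow> \<xi> z \<in> {w. w ^ ?Q = w}) \<and>
      (z \<notin> ext_units n \<longrightarrow> \<xi> z = 0)}" using M_hatD(3) by blast
  then show ?thesis
    by (rule finite_subset) (intro finite_set_of_finite_funs finite_ext_units n finite_power_fixed Q)
qed

lemma M_hat_mult:
  assumes "\<xi> \<in> M_hat n" "\<eta> \<in> M_hat n"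
  shows "(\<lambda>z. \<xi> z * \<eta> z) \<in> M_hat n"
  unfolding M_hat_def using M_hatD[OF assms(1)] M_hatD[OF assms(2)] by auto

lemma M_hat_divide:
  assumes "\<xi> \<in> M_hat n" "\<eta> \<in> M_hat n"
  shows "(\<lambda>z. \<xi> z / \<eta> z) \<in> M_hat n"
  unfolding M_hat_def using M_hatD[OF assms(1)] M_hatD[OF assms(2)] by auto

text \<open>For a generator g of order d, the map sending g^k to \<open>cis (2 * pi * k / d)\<close>
  is an injective character, so its value is 1 at the identity only.\<close>

lemma M_hat_separates:
  fixes z :: "'a::{finite,field} alg_closure"
  assumes n: "n \<ge> 1" and z: "z \<in> ext_units n" "z \<noteq> 1"
  shows "\<exists>\<xi>\<in>M_hat n. \<xi> z \<noteq> 1"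
proof -
  obtain g :: "'a alg_closure" where g: "g \<in> ext_units n" "ext_units n = {g ^ i | i::nat. True}" "g \<noteq> 0"
    using ext_units_cyclic[OF n] by blast
  have "g ^ (CARD('a) ^ n) = g" using g(1) by (simp add: ext_units_def)
  then have "g ^ (CARD('a) ^ n - 1) * g = 1 * g"
    using card_pow_gt_1[OF n, where 'a = 'a] by (simp flip: power_Suc2)
  then have "g ^ (CARD('a) ^ n - 1) = 1" using g(3) by simp
  then have ex: "\<exists>k>0. g ^ k = 1" using card_pow_gt_1[OF n, where 'a = 'a] by (intro exI[of _ "CARD('a) ^ n - 1"]) auto
  define d where "d = (LEAST k. k > 0 \<and> g ^ k = 1)"
  have d: "d > 0" "g ^ d = 1" using LeastI_ex[OF ex] by (auto simp: d_def)
  have least: "g ^ k \<noteq> 1" if "0 < k" "k < d" for k using not_less_Least[of k] that by (auto simp: d_def)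
  have gmod: "g ^ (i mod d) = g ^ i" for i
  proof -
    have "g ^ i = g ^ (d * (i div d) + i mod d)" by simp
    also have "\<dots> = g ^ (i mod d)" unfolding power_add power_mult d by simp
    finally show ?thesis ..
  qed
  have inj: "i = j" if "i < d" "j < d" "g ^ i = g ^ j" for i j
    using that
  proof (induction i j rule: linorder_wlog)
    case (le i j)
    have "g ^ (i + (j - i)) = g ^ i" using le by simp
    then have "g ^ i * g ^ (j - i) = g ^ i * 1" unfolding power_add by simp
    then have "g ^ (j - i) = 1" using g(3) by simp
    then show ?case using least[of "j - i"] le by (cases "i = j") auto
  qed metis
  \<comment> \<open>The discrete logarithm to base g, normalised to lie below d.\<close>
  define ind where "ind w = (THE i. i < d \<and> w = g ^ i)" for w
  have ind: "ind (g ^ i) = i mod d" for i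
    unfolding ind_def
  proof (rule the_equality)
    show "i mod d < d \<and> g ^ i = g ^ (i mod d)" using d gmod by simp
    fix j assume "j < d \<and> g ^ i = g ^ j"
    then show "j = i mod d" using inj[of j "i mod d"] gmod[of i] d by simp
  qed
  define c where "c k = cis (2 * pi * real k / real d)" for k
  have c_add: "c (i + j) = c i * c j" for i j by (simp add: c_def cis_mult add_divide_distrib distrib_left)
  have c_d: "c d = 1" using d by (simp add: c_def)
  have c_mult: "c (d * k) = 1" for k
    by (induction k) (simp_all add: c_add c_d, simp add: c_def)
  have c_mod: "c (i mod d) = c i" for i
    using c_add[of "d * (i div d)" "i mod d"] c_mult by simp
  define \<xi> where "\<xi> w = (if w \<in> ext_units n then c (ind w) else 0)" for w
  have \<xi>_pow: "\<xi> (g ^ i) = c i" for i using g(2) by (auto simp: \<xi>_def ind c_mod)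
  have "\<xi> \<in> M_hat n"
  proof -
    have "\<xi> w \<noteq> 0" if "w \<in> ext_units n" for w using that by (simp add: \<xi>_def c_def)
    moreover have "\<xi> (v * w) = \<xi> v * \<xi> w" if vw: "v \<in> ext_units n" "w \<in> ext_units n" for v w
    proof -
      obtain i j where "v = g ^ i" "w = g ^ j" using vw unfolding g(2) by auto
      then show ?thesis by (simp add: \<xi>_pow c_add flip: power_add)
    qed
    ultimately show ?thesis by (simp add: M_hat_def \<xi>_def)
  qed
  moreover have "\<xi> z \<noteq> 1"
  proof
    obtain i where i: "z = g ^ i" using z g(2) by auto
    assume "\<xi> z = 1"
    then have "c (i mod d) = c 0" unfolding i \<xi>_pow c_mod by (simp add: c_def)
    moreover have "inj_on c {..<d}"
      using bij_betw_roots_unity[OF d(1)] by (simp add: bij_betw_def c_def[abs_def])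
    ultimately have "i mod d = 0" using d by (auto dest: inj_onD)
    then have "z = 1" using gmod[of i] i by simp
    then show False using z(2) by simp
  qed
  ultimately show ?thesis by blast
qed

text \<open>Multiplication by a character \<eta> with \<eta> z \<noteq> 1 permutes the character
  group and multiplies the sum by \<eta> z.\<close>

lemma M_hat_orthogonality:
  fixes z :: "'a::{finite,field} alg_closure"
  assumes n: "n \<ge> 1" and z: "z \<in> ext_units n"
  shows "(\<Sum>\<xi>\<in>M_hat n. \<xi> z) = (if z = 1 then of_nat (card (M_hat n :: ('a alg_closure \<Rightarrow> complex) set)) else 0)"
proof (cases "z = 1")
  case True
  then show ?thesis by (simp add: M_hatD(4))
next
  case False
  obtain \<eta> where \<eta>: "\<eta> \<in> M_hat n" "\<eta> z \<noteq> 1" using M_hat_separates[OF n z False] by blast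
  have ne: "\<eta> w \<noteq> 0 \<or> \<xi> w = 0" if "\<xi> \<in> M_hat n" for \<xi> w
    using M_hatD(1)[OF \<eta>(1), of w] M_hatD(3)[OF that, of w] by blast
  have "(\<Sum>\<xi>\<in>M_hat n. \<xi> z) = (\<Sum>\<xi>\<in>M_hat n. \<eta> z * \<xi> z)"
    by (rule sum.reindex_bij_witness[of _ "\<lambda>\<xi> w. \<eta> w * \<xi> w" "\<lambda>\<xi> w. \<xi> w / \<eta> w"])
      (use ne M_hat_mult[OF \<eta>(1)] M_hat_divide[OF _ \<eta>(1)] M_hatD(1)[OF \<eta>(1) z] in \<open>auto simp: fun_eq_iff\<close>)
  also have "\<dots> = \<eta> z * (\<Sum>\<xi>\<in>M_hat n. \<xi> z)" by (simp add: sum_distrib_left)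
  finally show ?thesis using \<eta>(2) False by (auto simp: mult_cancel_right1)
qed

lemma card_M_hat:
  assumes n: "n \<ge> 1"
  shows "card (M_hat n :: ('a::{finite,field} alg_closure \<Rightarrow> complex) set) > 0"
proof -
  have "(\<lambda>z. if z \<in> ext_units n then 1 else 0) \<in> (M_hat n :: ('a alg_closure \<Rightarrow> complex) set)"
    by (auto simp: M_hat_def ext_units_mult)
  then show ?thesis using finite_M_hat[OF n] by (auto simp: card_gt_0_iff)
qed

section \<open>Norm maps and the direct limit of the character groups\<close>

lemma norm_map_power:
  fixes z :: "'a::{finite,field} alg_closure"
  shows "norm_map N m z = z ^ (\<Sum>i<N div m. CARD('a) ^ (m * i))"
  by (simp add: norm_map_def power_sum)

text \<open>The norm is the power map with exponent e = (q^N - 1)/(q^n - 1). An e-th root z of y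
  exists in the algebraic closure, and y^(q^n - 1) = 1 gives z^(q^N) = z.\<close>

lemma norm_map_surj:
  fixes y :: "'a::{finite,field} alg_closure"
  assumes "N \<ge> 1" "n dvd N" and y: "y \<in> ext_units n"
  shows "\<exists>z\<in>ext_units N. norm_map N n z = y"
proof -
  let ?q = "CARD('a)"
  let ?e = "\<Sum>i<N div n. ?q ^ (n * i)"
  have n: "n \<ge> 1" and k: "N div n \<ge> 1" and N: "n * (N div n) = N"
    using assms(1,2) dvd_imp_le[of n N] by (auto simp: Suc_le_eq div_greater_zero_iff intro: Nat.gr0I)
  have "?e > 0" using k by (intro sum_pos) (auto simp: card_gt_0_iff lessThan_empty_iff)
  then obtain z where z: "z ^ ?e = y" using nth_root_exists[of ?e y] by auto
  have "(?q ^ n - 1) * (\<Sum>i<m. ?q ^ (n * i)) + 1 = ?q ^ (n * m)" for m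
  proof (induction m)
    case (Suc m)
    have "(?q ^ n - 1) * ?q ^ (n * m) + ?q ^ (n * m) = ?q ^ (n * Suc m)"
      using card_pow_gt_1[OF n, where 'a = 'a] by (simp add: power_add diff_mult_distrib)
    then show ?case using Suc by (simp add: distrib_left)
  qed simp
  from this[of "N div n"] have e: "?q ^ N = ?e * (?q ^ n - 1) + 1" unfolding N by (simp only: mult.commute)
  have "y ^ (?q ^ n - 1) * y = 1 * y"
    using y card_pow_gt_1[OF n, where 'a = 'a] by (simp add: ext_units_def flip: power_Suc2)
  then have "y ^ (?q ^ n - 1) = 1" using y by (simp add: ext_units_def)
  then have "z ^ (?q ^ N) = z"
    unfolding e by (simp only: power_add[of z] power_mult[of z] z power_one_right mult_1_left)
  moreover have "z \<noteq> 0" using z \<open>?e > 0\<close> y by (auto simp: ext_units_def)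
  ultimately show ?thesis using z by (intro bexI[of _ z]) (auto simp: ext_units_def norm_map_power)
qed

definition char_class :: "nat \<Rightarrow> ('a::{finite,field} alg_closure \<Rightarrow> complex) \<Rightarrow> 'a lim_char" where
  "char_class n \<xi> = M_hat_rel `` {(n, \<xi>)}"

text \<open>Characters of M_n that agree after composition with a norm agree, by surjectivity of the
  norm. This stands behind the unique choice in \<open>lim_char_value\<close>.\<close>

lemma char_class_unique:
  assumes "(n, \<eta>) \<in> char_class n \<xi>"
  shows "\<eta> = \<xi>"
proof
  fix y :: "'a alg_closure"
  have mem: "\<xi> \<in> M_hat n" "\<eta> \<in> M_hat n" and "\<exists>N\<ge>1. n dvd N \<and> (\<forall>z\<in>ext_units N. \<xi> (norm_map N n z) = \<eta> (norm_map N n z))"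
    using assms by (auto simp: char_class_def M_hat_rel_def M_hat_pairs_def)
  then obtain N where N: "N \<ge> 1" "n dvd N" "\<And>z. z \<in> ext_units N \<Longrightarrow> \<xi> (norm_map N n z) = \<eta> (norm_map N n z)" by auto
  show "\<eta> y = \<xi> y"
  proof (cases "y \<in> ext_units n")
    case True
    then show ?thesis using norm_map_surj[OF N(1,2)] N(3) by metis
  next
    case False
    then show ?thesis using mem M_hatD(3) by metis
  qed
qed

lemma char_class_self: "n \<ge> 1 \<Longrightarrow> \<xi> \<in> M_hat n \<Longrightarrow> (n, \<xi>) \<in> char_class n \<xi>"
  by (auto simp: char_class_def M_hat_rel_def M_hat_pairs_def intro!: exI[of _ n])

lemma lim_char_frob_iter:
  "(lim_char_frob ^^ k) (C :: 'a::{finite,field} lim_char) = (\<lambda>(n, \<xi>). (n, \<lambda>z. \<xi> z ^ (CARD('a) ^ k))) ` C"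
proof (induction k)
  case (Suc k)
  show ?case unfolding funpow.simps o_apply Suc
    unfolding lim_char_frob_def image_image
    by (intro image_cong) (auto simp: mult.commute simp flip: power_mult)
qed auto

lemma M_hat_frob:
  assumes "\<xi> \<in> M_hat n"
  shows "(\<lambda>z. \<xi> z ^ (CARD('a) ^ k)) \<in> (M_hat n :: ('a::{finite,field} alg_closure \<Rightarrow> complex) set)"
  unfolding M_hat_def using M_hatD[OF assms] by (auto simp: power_mult_distrib card_gt_0_iff zero_power)

lemma M_hat_frob_period:
  assumes "\<xi> \<in> M_hat n"
  shows "(\<lambda>z. \<xi> z ^ (CARD('a) ^ (n * k))) = (\<xi> :: 'a::{finite,field} alg_closure \<Rightarrow> complex)"
proof
  fix z
  show "\<xi> z ^ (CARD('a) ^ (n * k)) = \<xi> z"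
  proof (cases "z \<in> ext_units n")
    case True
    have "\<xi> z ^ (CARD('a) ^ n) = \<xi> z"
      using M_hat_power[OF assms True, of "CARD('a) ^ n"] True by (simp add: ext_units_def)
    then show ?thesis
      by (induction k) (simp_all add: power_add power_mult)
  next
    case False
    then show ?thesis using M_hatD(3)[OF assms] by (simp add: zero_power card_gt_0_iff)
  qed
qed

text \<open>On M_n one has \<xi>^(q^n) = \<xi>, and compatibility with the norms carries this to the
  representatives at all other levels. Consequently the orbit of a character of M_n has a size
  dividing n.\<close>

lemma char_class_frob_period:
  assumes n: "n \<ge> 1" and \<xi>: "\<xi> \<in> M_hat n"
  shows "(lim_char_frob ^^ n) (char_class n \<xi>) = (char_class n \<xi> :: 'a::{finite,field} lim_char)"
proof -
  let ?q = "CARD('a)" and ?C = "char_class n \<xi>"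
  have C: "(m, \<eta>) \<in> ?C \<longleftrightarrow> m \<ge> 1 \<and> \<eta> \<in> M_hat m \<and> (\<exists>N\<ge>1. n dvd N \<and> m dvd N \<and>
      (\<forall>z\<in>ext_units N. \<xi> (norm_map N n z) = \<eta> (norm_map N m z)))" for m \<eta>
    using n \<xi> by (auto simp: char_class_def M_hat_rel_def M_hat_pairs_def)
  have step: "(m, \<lambda>z. \<eta> z ^ (?q ^ (n * k))) \<in> ?C" if \<eta>: "(m, \<eta>) \<in> ?C" for m \<eta> k
  proof -
    have "m \<ge> 1" "\<eta> \<in> M_hat m" using \<eta> C by auto
    obtain N where N: "N \<ge> 1" "n dvd N" "m dvd N" "\<And>z. z \<in> ext_units N \<Longrightarrow> \<xi> (norm_map N n z) = \<eta> (norm_map N m z)"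
      using \<eta> C by auto
    have "\<xi> (norm_map N n z) = \<eta> (norm_map N m z) ^ (?q ^ (n * k))" if "z \<in> ext_units N" for z
      using fun_cong[OF M_hat_frob_period[OF \<xi>, of k], of "norm_map N n z"] N(4)[OF that] by simp
    then show ?thesis unfolding C using N \<open>m \<ge> 1\<close> M_hat_frob[OF \<open>\<eta> \<in> M_hat m\<close>] by auto
  qed
  show ?thesis unfolding lim_char_frob_iter
  proof (intro equalityI subsetI)
    fix p assume "p \<in> (\<lambda>(m, \<eta>). (m, \<lambda>z. \<eta> z ^ (?q ^ n))) ` ?C"
    then show "p \<in> ?C" using step[where k = 1] by auto
  next
    fix p assume p: "p \<in> ?C"
    obtain m \<eta> where m: "p = (m, \<eta>)" by (cases p)
    then have me: "m \<ge> 1" "\<eta> \<in> M_hat m" using p C by auto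
    \<comment> \<open>The preimage of \<eta>: a further power q^n gives \<eta>^(q^(m n)), which is
      \<eta> since \<eta> is a character of M_m.\<close>
    let ?\<eta> = "\<lambda>z. \<eta> z ^ (?q ^ (n * (m - 1)))"
    have "(m, ?\<eta>) \<in> ?C" using step p m by blast
    moreover have "(\<lambda>z. ?\<eta> z ^ (?q ^ n)) = \<eta>"
    proof -
      have "n * (m - 1) + n = m * n" using me(1) by (cases m) auto
      then have "(\<lambda>z. ?\<eta> z ^ (?q ^ n)) = (\<lambda>z. \<eta> z ^ (?q ^ (m * n)))" by (simp flip: power_mult power_add)
      then show ?thesis using M_hat_frob_period[OF me(2)] by simp
    qed
    ultimately show "p \<in> (\<lambda>(m, \<eta>). (m, \<lambda>z. \<eta> z ^ (?q ^ n))) ` ?C"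
      unfolding m by (intro image_eqI[of _ _ "(m, ?\<eta>)"]) auto
  qed
qed

text \<open>The size is the least period d, and reducing n modulo d would otherwise give a smaller
  period.\<close>

lemma card_funpow_orbit:
  assumes n: "(f ^^ n) x = x" "n \<ge> 1"
  shows "card {(f ^^ k) x | k. True} dvd n \<and> card {(f ^^ k) x | k. True} \<ge> 1"
proof -
  define P where "P k \<longleftrightarrow> k > 0 \<and> (f ^^ k) x = x" for k
  have ex: "P n" using n by (simp add: P_def)
  define d where "d = (LEAST k. P k)"
  have "P d" unfolding d_def using ex by (rule LeastI)
  then have d: "d > 0" "(f ^^ d) x = x" by (simp_all add: P_def)
  have least: "\<not> P k" if "k < d" for k using not_less_Least[of k P] that by (simp add: d_def)
  have red: "(f ^^ k) x = (f ^^ (k mod d)) x" for k by (rule funpow_mod_eq[OF d(2), symmetric])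
  have "inj_on (\<lambda>k. (f ^^ k) x) {..<d}"
  proof (rule linorder_inj_onI)
    fix i j assume ij: "i < j" "i \<in> {..<d}" "j \<in> {..<d}"
    show "(f ^^ i) x \<noteq> (f ^^ j) x"
    proof
      assume eq: "(f ^^ i) x = (f ^^ j) x"
      have "(f ^^ (d - j + i)) x = (f ^^ (d - j + j)) x" unfolding funpow_add o_apply eq ..
      moreover have "d - j + j = d" using ij by simp
      ultimately have "(f ^^ (d - j + i)) x = x" using d(2) by (simp only:)
      moreover have "0 < d - j + i" "d - j + i < d" using ij by auto
      ultimately show False using least[of "d - j + i"] by (simp add: P_def)
    qed
  qed (rule linear)
  moreover have "{(f ^^ k) x | k. True} = (\<lambda>k. (f ^^ k) x) ` {..<d}"
  proof (intro equalityI subsetI)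
    fix y assume "y \<in> {(f ^^ k) x | k. True}"
    then obtain k where "y = (f ^^ k) x" by blast
    then have "y = (f ^^ (k mod d)) x" using red[of k] by (rule trans)
    moreover have "k mod d \<in> {..<d}" using d(1) by simp
    ultimately show "y \<in> (\<lambda>k. (f ^^ k) x) ` {..<d}" by (rule image_eqI)
  qed blast
  ultimately have card: "card {(f ^^ k) x | k. True} = d" by (simp add: card_image)
  have "(f ^^ (n mod d)) x = x" using red[of n] n(1) by (rule subst)
  moreover have "n mod d < d" using d(1) by simp
  ultimately have "n mod d = 0" using least[of "n mod d"] by (auto simp: P_def)
  then have "d dvd n" by (rule mod_0_imp_dvd)
  then show ?thesis unfolding card using d(1) by (simp add: Suc_le_eq)
qed

definition char_orbit :: "nat \<Rightarrow> ('a::{finite,field} alg_closure \<Rightarrow> complex) \<Rightarrow> 'a lim_char set" where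
  "char_orbit n \<xi> = {(lim_char_frob ^^ k) (char_class n \<xi>) | k. True}"

lemma char_orbit_Theta: "n \<ge> 1 \<Longrightarrow> \<xi> \<in> M_hat n \<Longrightarrow> char_orbit n \<xi> \<in> Theta"
  unfolding char_orbit_def Theta_def lim_chars_def char_class_def M_hat_pairs_def
  by (auto intro!: exI[of _ "M_hat_rel `` {(n, \<xi>)}"] quotientI)

text \<open>The representative chosen in \<open>power_sum_Y\<close> is some Frobenius power
  \<xi>^(q^j). The substitution of z^(q^j) for z is a bijection of M_n that preserves the polynomial
  of z, and it absorbs this power.\<close>

lemma power_sum_Y_char_orbit:
  fixes \<xi> :: "'a::{finite,field} alg_closure \<Rightarrow> complex"
  assumes n: "n \<ge> 1" and \<xi>: "\<xi> \<in> M_hat n"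
  shows "power_sum_Y (char_orbit n \<xi>) (n div card (char_orbit n \<xi>)) =
    mconst ((-1) ^ (n - 1)) * (\<Sum>z\<in>ext_units n. mconst (\<xi> z) * in_alphabet (Phi_of z) (power_sum (n div degree (Phi_of z))))"
proof -
  let ?o = "char_orbit n \<xi>" and ?A = "\<lambda>z :: 'a alg_closure. in_alphabet (Phi_of z) (power_sum (n div degree (Phi_of z)))"
  have card: "n div card ?o * card ?o = n"
    using card_funpow_orbit[OF char_class_frob_period[OF n \<xi>] n] by (simp add: char_orbit_def)
  define \<zeta> where "\<zeta> = (SOME \<zeta>. \<zeta> \<in> ?o)"
  have "\<exists>\<zeta>. \<zeta> \<in> ?o" by (auto simp: char_orbit_def)
  then have "\<zeta> \<in> ?o" unfolding \<zeta>_def by (rule someI_ex)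
  then obtain j where j: "\<zeta> = (lim_char_frob ^^ j) (char_class n \<xi>)" by (auto simp: char_orbit_def)
  have "(THE \<eta>. (n, \<eta>) \<in> \<zeta>) = (\<lambda>z. \<xi> z ^ (CARD('a) ^ j))"
    unfolding j lim_char_frob_iter
    using char_class_self[OF n \<xi>] char_class_unique by (intro the_equality) fastforce+
  then have val: "lim_char_value \<zeta> n z = \<xi> z ^ (CARD('a) ^ j)" for z by (simp add: lim_char_value_def)
  have bij: "bij_betw (\<lambda>z. z ^ (CARD('a) ^ j)) (ext_units n) (ext_units n :: 'a alg_closure set)"
  proof (rule bij_betwI[of _ _ _ "\<lambda>z. z ^ (CARD('a) ^ (n * j - j))"])
    have "j + (n * j - j) = n * j" using n by simp
    moreover have "z ^ (CARD('a) ^ (n * j)) = z" if "z \<in> ext_units n" for z :: "'a alg_closure"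
      using that by (induction j) (auto simp: power_add power_mult ext_units_def)
    ultimately show "(z ^ (CARD('a) ^ j)) ^ (CARD('a) ^ (n * j - j)) = z" "(z ^ (CARD('a) ^ (n * j - j))) ^ (CARD('a) ^ j) = z"
      if "z \<in> ext_units n" for z :: "'a alg_closure"
      using that by (simp_all add: add.commute flip: power_mult power_add)
  qed (auto intro: ext_units_power)
  have "(\<Sum>z\<in>ext_units n. mconst (lim_char_value \<zeta> n z) * ?A z) =
      (\<Sum>z\<in>ext_units n. mconst (\<xi> (z ^ (CARD('a) ^ j))) * ?A (z ^ (CARD('a) ^ j)))"
    using M_hat_power[OF \<xi>] Phi_of_frob[OF n, where 'a = 'a] by (intro sum.cong refl) (simp add: val)
  also have "\<dots> = (\<Sum>z\<in>ext_units n. mconst (\<xi> z) * ?A z)"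
    by (rule sum.reindex_bij_betw[OF bij])
  finally show ?thesis unfolding power_sum_Y_def Let_def card \<zeta>_def[symmetric] by simp
qed

section \<open>The plethysm map on power sums\<close>

lemma Lambda_sum: "(\<And>a. a \<in> A \<Longrightarrow> f a \<in> Lambda) \<Longrightarrow> sum f A \<in> Lambda"
  using Lambda.const[of 0] by (induction A rule: infinite_finite_induct) (auto intro: Lambda.add)

lemma power_sum_Y_Lambda: "k * card \<phi> \<ge> 1 \<Longrightarrow> power_sum_Y \<phi> k \<in> Lambda"
  unfolding power_sum_Y_def Let_def
  by (intro Lambda.mult Lambda.const Lambda_sum Lambda.alphabet power_sum_sym Phi_of_in_Phi)

lemma
  assumes \<rho>: "plethysm_map \<rho>"
  shows rho_const: "\<rho> (mconst c) = mconst c"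
  and rho_add: "F \<in> Lambda \<Longrightarrow> G \<in> Lambda \<Longrightarrow> \<rho> (F + G) = \<rho> F + \<rho> G"
  and rho_mult: "F \<in> Lambda \<Longrightarrow> G \<in> Lambda \<Longrightarrow> \<rho> (F * G) = \<rho> F * \<rho> G"
  using \<rho> by (auto simp: plethysm_map_def)

lemma rho_sum: "plethysm_map \<rho> \<Longrightarrow> (\<And>a. a \<in> A \<Longrightarrow> f a \<in> Lambda) \<Longrightarrow> \<rho> (sum f A) = (\<Sum>a\<in>A. \<rho> (f a))"
  using rho_const[of \<rho> 0] by (induction A rule: infinite_finite_induct) (auto simp: rho_add Lambda_sum)

lemma rho_complete_of:
  assumes \<rho>: "plethysm_map \<rho>" and p: "\<And>k. k \<ge> 1 \<Longrightarrow> p k \<in> Lambda"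
  shows "\<rho> (complete_of p a) = complete_of (\<lambda>k. \<rho> (p k)) a"
  using complete_of_hom_on[of p Lambda \<rho> a] p Lambda.intros rho_const[OF \<rho>] rho_add[OF \<rho>] rho_mult[OF \<rho>] by blast

text \<open>\<rho> is prescribed on complete functions. Both sequences of power sums have h_a[p_b],
  b = d(\<phi>), as their complete functions, and these determine the power sums.\<close>

lemma rho_power_sum_Y:
  assumes \<rho>: "plethysm_map \<rho>" and \<phi>: "\<phi> \<in> Theta" "card \<phi> \<ge> 1" "k \<ge> 1"
  shows "\<rho> (power_sum_Y \<phi> k) = power_sum (k * card \<phi>)"
proof (rule complete_of_inj[where p = "\<lambda>k. \<rho> (power_sum_Y \<phi> k)" and p' = "\<lambda>k. power_sum (k * card \<phi>)"])
  fix a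
  have "complete_of (\<lambda>k. \<rho> (power_sum_Y \<phi> k)) a = \<rho> (complete_Y \<phi> a)"
    unfolding complete_Y_def using assms(3) by (intro rho_complete_of[symmetric] power_sum_Y_Lambda \<rho>) simp
  also have "\<dots> = plethysm_power (card \<phi>) (complete_sym a)"
    using \<rho> \<phi> by (simp add: plethysm_map_def)
  also have "\<dots> = complete_of (\<lambda>k. power_sum (k * card \<phi>)) a"
    by (rule plethysm_power_complete_sym[OF assms(3)])
  finally show "complete_of (\<lambda>k. \<rho> (power_sum_Y \<phi> k)) a = complete_of (\<lambda>k. power_sum (k * card \<phi>)) a" .
qed fact

lemma mconst_of_nat: "mconst (of_nat k) = of_nat k"
  by (induction k) (simp_all add: mconst_add)

text \<open>Summing \<open>p\<^sub>k(Y\<^sup>\<phi>)\<close> over all characters of \<open>M\<^sub>n\<close> isolates the unipotent alphabet, on which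
  \<open>\<rho>\<close> thus acts as the involution \<open>\<omega>\<close>.\<close>

lemma rho_unipotent_power_sum:
  fixes \<rho> :: "('a::{finite,field} poly \<times> nat) mseries \<Rightarrow> nat mseries"
  assumes \<rho>: "plethysm_map \<rho>" and n: "n \<ge> 1"
  shows "\<rho> (in_alphabet [:- 1, 1:] (power_sum n)) = mconst ((-1) ^ (n - 1)) * power_sum n"
proof -
  let ?M = "M_hat n :: ('a alg_closure \<Rightarrow> complex) set"
  define A :: "'a alg_closure \<Rightarrow> ('a poly \<times> nat) mseries"
    where "A z = in_alphabet (Phi_of z) (power_sum (n div degree (Phi_of z)))" for z
  let ?s = "(-1) ^ (n - 1) :: complex"
  let ?p = "\<lambda>\<xi>. power_sum_Y (char_orbit n \<xi>) (n div card (char_orbit n \<xi>))"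
  have mconst_sum: "(mconst (sum f B) :: ('a poly \<times> nat) mseries) = (\<Sum>\<xi>\<in>B. mconst (f \<xi>))"
    for f :: "('a alg_closure \<Rightarrow> complex) \<Rightarrow> complex" and B
    by (induction B rule: infinite_finite_induct) (auto simp: mconst_add)
  have "(\<Sum>\<xi>\<in>?M. ?p \<xi>) = (\<Sum>\<xi>\<in>?M. mconst ?s * (\<Sum>z\<in>ext_units n. mconst (\<xi> z) * A z))"
    unfolding A_def by (intro sum.cong refl power_sum_Y_char_orbit n)
  also have "\<dots> = mconst ?s * (\<Sum>\<xi>\<in>?M. \<Sum>z\<in>ext_units n. mconst (\<xi> z) * A z)"
    by (rule sum_distrib_left[symmetric])
  also have "(\<Sum>\<xi>\<in>?M. \<Sum>z\<in>ext_units n. mconst (\<xi> z) * A z) =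
      (\<Sum>z\<in>ext_units n. \<Sum>\<xi>\<in>?M. mconst (\<xi> z) * A z)" by (rule sum.swap)
  also have "\<dots> = (\<Sum>z\<in>ext_units n. mconst (\<Sum>\<xi>\<in>?M. \<xi> z) * A z)"
    unfolding mconst_sum sum_distrib_right ..
  also have "\<dots> = (\<Sum>z\<in>(ext_units n :: 'a alg_closure set). if z = 1 then mconst (of_nat (card ?M)) * A 1 else 0)"
    by (rule sum.cong[OF refl]) (auto simp: M_hat_orthogonality[OF n])
  also have "\<dots> = mconst (of_nat (card ?M)) * A 1"
    using finite_ext_units[OF n, where 'a = 'a] by (simp add: sum.delta')
  finally have sum: "(\<Sum>\<xi>\<in>?M. ?p \<xi>) = mconst ?s * (mconst (of_nat (card ?M)) * in_alphabet [:- 1, 1:] (power_sum n))"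
    by (simp add: A_def Phi_of_1)
  have orbit: "card (char_orbit n \<xi>) dvd n" "card (char_orbit n \<xi>) \<ge> 1" "n div card (char_orbit n \<xi>) \<ge> 1"
    if "\<xi> \<in> ?M" for \<xi>
  proof -
    show 1: "card (char_orbit n \<xi>) dvd n" "card (char_orbit n \<xi>) \<ge> 1"
      using card_funpow_orbit[OF char_class_frob_period[OF n that] n] by (simp_all add: char_orbit_def)
    then show "n div card (char_orbit n \<xi>) \<ge> 1" using n dvd_imp_le[of "card (char_orbit n \<xi>)" n] by (simp add: Suc_le_eq div_greater_zero_iff)
  qed
  \<comment> \<open>For an orbit of size d the image is p_(n/d)[p_d] = p_n, the same for every
    character; so the sum may run over characters, meeting an orbit repeatedly.\<close>
  have "\<rho> (\<Sum>\<xi>\<in>?M. ?p \<xi>) = (\<Sum>\<xi>\<in>?M. power_sum n)"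
  proof -
    have "?p \<xi> \<in> Lambda" if "\<xi> \<in> ?M" for \<xi> using orbit[OF that] n by (intro power_sum_Y_Lambda) simp
    moreover have "\<rho> (?p \<xi>) = power_sum n" if "\<xi> \<in> ?M" for \<xi>
      using rho_power_sum_Y[OF \<rho> char_orbit_Theta[OF n that]] orbit[OF that] by simp
    ultimately show ?thesis by (simp add: rho_sum[OF \<rho>])
  qed
  moreover have "in_alphabet [:- 1, 1:] (power_sum n) \<in> (Lambda :: ('a poly \<times> nat) mseries set)"
    by (intro Lambda.alphabet linear_in_Phi power_sum_sym)
  then have "\<rho> (mconst ?s * (mconst (of_nat (card ?M)) * in_alphabet [:- 1, 1:] (power_sum n))) =
      mconst ?s * (mconst (of_nat (card ?M)) * \<rho> (in_alphabet [:- 1, 1:] (power_sum n)))"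
    by (simp only: rho_mult[OF \<rho>] rho_const[OF \<rho>] Lambda.const Lambda.mult)
  ultimately have eq: "mconst (?s * of_nat (card ?M)) * \<rho> (in_alphabet [:- 1, 1:] (power_sum n)) =
      mconst (of_nat (card ?M)) * power_sum n"
    unfolding sum by (simp add: mconst_mult mult.assoc mconst_of_nat)
  have "of_nat (card ?M) \<noteq> (0 :: complex)" using card_M_hat[OF n, where 'a = 'a] by simp
  \<comment> \<open>The sign \<open>?s\<close> squares to 1 and so reappears on the other
    side.\<close>
  then have "\<rho> (in_alphabet [:- 1, 1:] (power_sum n)) =
      mconst (?s / of_nat (card ?M)) * (mconst (?s * of_nat (card ?M)) * \<rho> (in_alphabet [:- 1, 1:] (power_sum n)))"
    unfolding mult.assoc[symmetric] mconst_mult[symmetric] by (simp flip: power_add mult_2)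
  also have "\<dots> = mconst ?s * power_sum n"
    unfolding eq using \<open>of_nat (card ?M) \<noteq> 0\<close>
    unfolding mult.assoc[symmetric] mconst_mult[symmetric] by simp
  finally show ?thesis .
qed

section \<open>Block matrices\<close>

text \<open>Keeps the shape \<open>carrier_mat 1 n\<close> of row vectors stable under simplification.\<close>

declare One_nat_def [simp del]

lemma finite_carrier_mat: "finite (carrier_mat n m :: 'a::finite mat set)"
proof -
  let ?F = "{f. \<forall>p. (p \<in> {..<n} \<times> {..<m} \<longrightarrow> f p \<in> (UNIV :: 'a set)) \<and> (p \<notin> {..<n} \<times> {..<m} \<longrightarrow> f p = undefined)}"
  have "finite ?F" by (rule finite_set_of_finite_funs) auto
  moreover have "carrier_mat n m \<subseteq> mat n m ` ?F"
  proof
    fix A :: "'a mat" assume A: "A \<in> carrier_mat n m"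
    let ?f = "\<lambda>p. if p \<in> {..<n} \<times> {..<m} then A $$ p else undefined"
    have "A = mat n m ?f" using A by (intro eq_matI) auto
    moreover have "?f \<in> ?F" by auto
    ultimately show "A \<in> mat n m ` ?F" by (rule image_eqI)
  qed
  ultimately show ?thesis using finite_surj by blast
qed

lemma card_carrier_col: "card (carrier_mat n 1 :: 'a::finite mat set) = CARD('a) ^ n"
proof -
  have "bij_betw (\<lambda>f. mat n 1 (\<lambda>(i, j). f i)) (PiE {..<n} (\<lambda>_. UNIV)) (carrier_mat n 1 :: 'a mat set)"
  proof (rule bij_betwI[of _ _ _ "\<lambda>A i. if i < n then A $$ (i, 0) else undefined"])
    fix f :: "nat \<Rightarrow> 'a" assume f: "f \<in> PiE {..<n} (\<lambda>_. UNIV)"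
    show "(\<lambda>i. if i < n then mat n 1 (\<lambda>(i, j). f i) $$ (i, 0) else undefined) = f"
    proof
      fix i show "(if i < n then mat n 1 (\<lambda>(i, j). f i) $$ (i, 0) else undefined) = f i"
        using f by (auto simp: PiE_def extensional_def)
    qed
  next
    fix A :: "'a mat" assume "A \<in> carrier_mat n 1"
    then show "mat n 1 (\<lambda>(i, j). if i < n then A $$ (i, 0) else undefined) = A"
      by (intro eq_matI) auto
  qed (auto simp: PiE_def extensional_def)
  then have "card (carrier_mat n 1 :: 'a mat set) = card (PiE {..<n} (\<lambda>_. UNIV :: 'a set))"
    by (rule bij_betw_same_card[symmetric])
  then show ?thesis by (simp add: card_PiE)
qed

text \<open>Invertible matrices travel together with their inverses, so that both sides of a
  conjugation are explicit in sums over the group.\<close>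

definition GL_pairs :: "nat \<Rightarrow> ('a::field mat \<times> 'a mat) set" where
  "GL_pairs n = {(x, y). x \<in> carrier_mat n n \<and> y \<in> carrier_mat n n \<and> x * y = 1\<^sub>m n \<and> y * x = 1\<^sub>m n}"

lemma GL_pairsI: "x \<in> carrier_mat n n \<Longrightarrow> y \<in> carrier_mat n n \<Longrightarrow> y * x = 1\<^sub>m n \<Longrightarrow> (x, y) \<in> GL_pairs n"
  by (auto simp: GL_pairs_def intro: mat_mult_left_right_inverse)

lemma finite_GL_pairs: "finite (GL_pairs n :: ('a::{finite,field} mat \<times> 'a mat) set)"
  by (rule finite_subset[of _ "carrier_mat n n \<times> carrier_mat n n"]) (auto simp: GL_pairs_def finite_carrier_mat)

text \<open>Used with s = 1 for invertible matrices with last row (0, ..., 0, 1) or for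
  unitriangular ones, and with s = 0 for matrices with last row zero.\<close>

definition blk :: "nat \<Rightarrow> 'a::field mat \<Rightarrow> 'a mat \<Rightarrow> 'a \<Rightarrow> 'a mat" where
  "blk n A b s = four_block_mat A b (0\<^sub>m 1 n) (mat 1 1 (\<lambda>_. s))"

lemma blk_carrier [simp]: "A \<in> carrier_mat n n \<Longrightarrow> b \<in> carrier_mat n 1 \<Longrightarrow> blk n A b s \<in> carrier_mat (Suc n) (Suc n)"
  unfolding blk_def by (metis Suc_eq_plus1 four_block_carrier_mat mat_carrier)

lemma blk_index:
  assumes "A \<in> carrier_mat n n" "b \<in> carrier_mat n 1" "i < Suc n" "j < Suc n"
  shows "blk n A b s $$ (i, j) = (if i < n then if j < n then A $$ (i, j) else b $$ (i, 0) else if j < n then 0 else s)"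
proof -
  have "j < n \<or> j = n" using assms by auto
  then show ?thesis using assms unfolding blk_def by (subst index_mat_four_block) auto
qed

lemma blk_eqI:
  assumes M: "M \<in> carrier_mat (Suc n) (Suc n)" and "\<And>j. j < n \<Longrightarrow> M $$ (n, j) = 0" "M $$ (n, n) = s"
  shows "M = blk n (mat n n (\<lambda>p. M $$ p)) (mat n 1 (\<lambda>(i, j). M $$ (i, n))) s"
proof (rule eq_matI)
  fix i j
  let ?B = "blk n (mat n n (\<lambda>p. M $$ p)) (mat n 1 (\<lambda>(i, j). M $$ (i, n))) s"
  have B: "dim_row ?B = Suc n" "dim_col ?B = Suc n" by (rule carrier_matD[OF blk_carrier]; simp)+
  assume "i < dim_row ?B" "j < dim_col ?B"
  then have ij: "i < Suc n" "j < Suc n" by (simp_all only: B)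
  then consider "i < n" | "i = n" "j < n" | "i = n" "j = n" by linarith
  then show "M $$ (i, j) = ?B $$ (i, j)"
    using assms ij by cases (auto simp: blk_index less_Suc_eq)
qed (use M in \<open>auto simp: blk_def\<close>)

lemma blk_inject:
  assumes "A \<in> carrier_mat n n" "b \<in> carrier_mat n 1" "A' \<in> carrier_mat n n" "b' \<in> carrier_mat n 1"
    and eq: "blk n A b s = blk n A' b' s'"
  shows "A = A' \<and> b = b' \<and> s = s'"
proof -
  have idx: "blk n A b s $$ (i, j) = blk n A' b' s' $$ (i, j)" for i j using eq by simp
  have "A = A'"
  proof (rule eq_matI)
    fix i j assume "i < dim_row A'" "j < dim_col A'"
    then show "A $$ (i, j) = A' $$ (i, j)" using idx[of i j] assms(1-4) by (simp add: blk_index)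
  qed (use assms in auto)
  moreover have "b = b'"
  proof (rule eq_matI)
    fix i j assume "i < dim_row b'" "j < dim_col b'"
    then show "b $$ (i, j) = b' $$ (i, j)" using idx[of i n] assms(1-4) by (simp add: blk_index)
  qed (use assms in auto)
  moreover have "s = s'" using idx[of n n] assms(1-4) by (simp add: blk_index)
  ultimately show ?thesis by simp
qed

lemma blk_mult:
  assumes c: "A \<in> carrier_mat n n" "b \<in> carrier_mat n 1" "A' \<in> carrier_mat n n" "b' \<in> carrier_mat n 1"
  shows "blk n A b s * blk n A' b' s' = blk n (A * A') (A * b' + s' \<cdot>\<^sub>m b) (s * s')"
proof -
  have "blk n A b s * blk n A' b' s' = four_block_mat (A * A' + b * 0\<^sub>m 1 n) (A * b' + b * mat 1 1 (\<lambda>_. s'))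
      (0\<^sub>m 1 n * A' + mat 1 1 (\<lambda>_. s) * 0\<^sub>m 1 n) (0\<^sub>m 1 n * b' + mat 1 1 (\<lambda>_. s) * mat 1 1 (\<lambda>_. s'))"
    unfolding blk_def by (rule mult_four_block_mat) (use c in auto)
  also have "A * A' + b * 0\<^sub>m 1 n = A * A'" using c by simp
  also have "0\<^sub>m 1 n * A' + mat 1 1 (\<lambda>_. s) * 0\<^sub>m 1 n = 0\<^sub>m 1 n" using c by simp
  also have "0\<^sub>m 1 n * b' + mat 1 1 (\<lambda>_. s) * mat 1 1 (\<lambda>_. s') = mat 1 1 (\<lambda>_. s * s')"
    using c by (intro eq_matI) (auto simp: scalar_prod_def)
  also have "b * mat 1 1 (\<lambda>_. s') = s' \<cdot>\<^sub>m b"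
    using c by (intro eq_matI) (auto simp: scalar_prod_def mult.commute One_nat_def)
  finally show ?thesis by (simp add: blk_def)
qed

lemma blk_one: "1\<^sub>m (Suc n) = blk n (1\<^sub>m n) (0\<^sub>m n 1) (1 :: 'a::field)"
  by (rule eq_matI) (auto simp: blk_index less_Suc_eq, auto simp: blk_def)

definition lrow :: "nat \<Rightarrow> 'a mat \<Rightarrow> 'a mat" where
  "lrow n M = mat 1 (dim_col M) (\<lambda>(i, j). M $$ (n, j))"

lemma lrow_carrier [simp]: "M \<in> carrier_mat (Suc n) m \<Longrightarrow> lrow n M \<in> carrier_mat 1 m"
  by (simp add: lrow_def)

lemma lrow_mult:
  assumes "A \<in> carrier_mat (Suc n) m" "B \<in> carrier_mat m k"
  shows "lrow n (A * B) = lrow n A * B"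
  using assms by (intro eq_matI) (auto simp: lrow_def scalar_prod_def)

definition unit_row :: "nat \<Rightarrow> 'a::field mat" where
  "unit_row n = mat 1 (Suc n) (\<lambda>(i, j). if j = n then 1 else 0)"

lemma lrow_blk [simp]:
  "A \<in> carrier_mat n n \<Longrightarrow> b \<in> carrier_mat n 1 \<Longrightarrow> lrow n (blk n A b 1) = unit_row n"
  by (rule eq_matI) (auto simp: lrow_def unit_row_def blk_index, auto simp: blk_def)

lemma lrow_unit_blk:
  assumes "M \<in> carrier_mat (Suc n) (Suc n)" "lrow n M = unit_row n"
  shows "\<exists>A b. A \<in> carrier_mat n n \<and> b \<in> carrier_mat n 1 \<and> M = blk n A b 1"
proof -
  have "M $$ (n, j) = (if j = n then 1 else 0)" if "j < Suc n" for j
    using arg_cong[OF assms(2), of "\<lambda>A. A $$ (0, j)"] that assms(1) by (simp add: lrow_def unit_row_def)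
  then show ?thesis using blk_eqI[of M n 1] assms(1) by (metis lessI less_SucI less_irrefl mat_carrier)
qed

lemma unit_row_mult:
  assumes "M \<in> carrier_mat (Suc n) k"
  shows "unit_row n * M = lrow n M"
proof (rule eq_matI)
  fix i j assume "i < dim_row (lrow n M)" "j < dim_col (lrow n M)"
  then have ij: "i = 0" "j < k" using assms by (auto simp: lrow_def)
  have "(unit_row n * M) $$ (i, j) = (\<Sum>l<Suc n. (if l = n then 1 else 0) * M $$ (l, j))"
    using ij assms by (auto simp: unit_row_def scalar_prod_def atLeast0LessThan intro!: sum.cong)
  then show "(unit_row n * M) $$ (i, j) = lrow n M $$ (i, j)" using ij assms by (simp add: lrow_def)
qed (use assms in \<open>auto simp: unit_row_def lrow_def\<close>)

text \<open>Take k with l_k \<noteq> 0. The matrix y is the permutation matrix exchanging k and n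
  with its last row replaced by l, and x is its inverse written out.\<close>

lemma exists_lrow:
  fixes l :: "'a::field mat"
  assumes l: "l \<in> carrier_mat 1 (Suc n)" "l \<noteq> 0\<^sub>m 1 (Suc n)"
  shows "\<exists>P Q. (P, Q) \<in> GL_pairs (Suc n) \<and> lrow n Q = l"
proof -
  have "\<exists>k<Suc n. l $$ (0, k) \<noteq> 0"
  proof (rule ccontr)
    assume "\<not> ?thesis"
    then have "l = 0\<^sub>m 1 (Suc n)" using l(1) by (intro eq_matI) auto
    then show False using l(2) by simp
  qed
  then obtain k where k: "k < Suc n" "l $$ (0, k) \<noteq> 0" by blast
  let ?s = "transpose k n"
  have s: "?s i < Suc n" if "i < Suc n" for i using that k by (auto simp: transpose_def)
  have s_inj: "?s i = ?s j \<longleftrightarrow> i = j" for i j by (auto simp: transpose_def)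
  have s_k: "?s i = k \<longleftrightarrow> i = n" for i by (auto simp: transpose_def)
  define y where "y = mat (Suc n) (Suc n) (\<lambda>(i, j). if i = n then l $$ (0, j) else if j = ?s i then 1 else 0)"
  define x where "x = mat (Suc n) (Suc n) (\<lambda>(m, j). if m = k then (if j = n then 1 else - l $$ (0, ?s j)) / l $$ (0, k)
      else if m = ?s j then 1 else 0)"
  have c: "x \<in> carrier_mat (Suc n) (Suc n)" "y \<in> carrier_mat (Suc n) (Suc n)" by (simp_all add: x_def y_def)
  have "y * x = 1\<^sub>m (Suc n)"
  proof (rule eq_matI)
    fix i j assume "i < dim_row (1\<^sub>m (Suc n) :: 'a mat)" "j < dim_col (1\<^sub>m (Suc n) :: 'a mat)"
    then have ij: "i < Suc n" "j < Suc n" by auto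
    have yx: "(y * x) $$ (i, j) = (\<Sum>m<Suc n. y $$ (i, m) * x $$ (m, j))"
      using ij c by (auto simp: scalar_prod_def atLeast0LessThan intro!: sum.cong)
    show "(y * x) $$ (i, j) = 1\<^sub>m (Suc n) $$ (i, j)"
    proof (cases "i = n")
      case False
      have "(\<Sum>m<Suc n. y $$ (i, m) * x $$ (m, j)) = (\<Sum>m<Suc n. if m = ?s i then x $$ (m, j) else 0)"
        using ij False by (intro sum.cong) (auto simp: y_def)
      also have "\<dots> = x $$ (?s i, j)" using s[OF ij(1)] by (simp add: sum.delta)
      also have "\<dots> = (if i = j then 1 else 0)"
        using ij s[OF ij(1)] False s_k[of i] by (simp add: x_def s_inj)
      finally show ?thesis unfolding yx using ij by simp
    next
      case True
      have fin: "finite {..<Suc n}" "k \<in> {..<Suc n}" using k by auto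
      have "(\<Sum>m<Suc n. y $$ (i, m) * x $$ (m, j)) = (\<Sum>m<Suc n. l $$ (0, m) * x $$ (m, j))"
        using True by (intro sum.cong) (auto simp: y_def)
      also have "\<dots> = l $$ (0, k) * x $$ (k, j) + (\<Sum>m\<in>{..<Suc n} - {k}. l $$ (0, m) * x $$ (m, j))"
        by (rule sum.remove[OF fin])
      also have "l $$ (0, k) * x $$ (k, j) = (if j = n then 1 else - l $$ (0, ?s j))"
        using k ij by (simp add: x_def)
      also have "(\<Sum>m\<in>{..<Suc n} - {k}. l $$ (0, m) * x $$ (m, j)) =
          (\<Sum>m\<in>{..<Suc n} - {k}. if m = ?s j then l $$ (0, m) else 0)"
        using ij by (intro sum.cong) (auto simp: x_def)
      also have "\<dots> = (if j = n then 0 else l $$ (0, ?s j))"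
        using s[OF ij(2)] s_k[of j] by (auto simp: sum.delta)
      finally show ?thesis unfolding yx using ij True by auto
    qed
  qed (use c in auto)
  then have "(x, y) \<in> GL_pairs (Suc n)" by (rule GL_pairsI[OF c])
  moreover have "lrow n y = l" using l(1) by (intro eq_matI) (auto simp: lrow_def y_def)
  ultimately show ?thesis by blast
qed

section \<open>Left null spaces and nilpotency\<close>

definition strictly_upper :: "nat \<Rightarrow> 'a::zero mat \<Rightarrow> bool" where
  "strictly_upper n S \<longleftrightarrow> (\<forall>i<n. \<forall>j\<le>i. S $$ (i, j) = 0)"

definition left_null :: "nat \<Rightarrow> 'a::field mat \<Rightarrow> 'a mat set" where
  "left_null n N = {l \<in> carrier_mat 1 n. l * N = 0\<^sub>m 1 n}"

text \<open>The left null space of the matrix N bordered by the column w.\<close>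

definition left_null2 :: "nat \<Rightarrow> 'a::field mat \<Rightarrow> 'a mat \<Rightarrow> 'a mat set" where
  "left_null2 n N w = {l \<in> left_null n N. l * w = 0\<^sub>m 1 1}"

text \<open>Stated through the action on rows, because multiplying \<open>row_app n l s\<close> by
  \<open>blk n A b 0\<close> acts on l as A does; nilpotency is thereby handed down to the block
  A.\<close>

definition row_nilpotent :: "nat \<Rightarrow> 'a::field mat \<Rightarrow> bool" where
  "row_nilpotent n N \<longleftrightarrow> (\<exists>m. \<forall>l\<in>carrier_mat 1 n. ((\<lambda>r. r * N) ^^ m) l = 0\<^sub>m 1 n)"

lemma strictly_upper_blk:
  assumes "A \<in> carrier_mat n n" "b \<in> carrier_mat n 1"
  shows "strictly_upper (Suc n) (blk n A b 0) \<longleftrightarrow> strictly_upper n A"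
proof -
  have "blk n A b 0 $$ (i, j) = (if i < n then A $$ (i, j) else 0)" if "i < Suc n" "j \<le> i" for i j
    using that assms by (auto simp: blk_index)
  then show ?thesis unfolding strictly_upper_def by (auto simp: less_Suc_eq)
qed

lemma left_null_conj:
  assumes P: "(P, Q) \<in> GL_pairs n" and N: "N \<in> carrier_mat n n"
  shows "bij_betw (\<lambda>l. l * P) (left_null n N) (left_null n (Q * N * P))"
proof -
  have c: "P \<in> carrier_mat n n" "Q \<in> carrier_mat n n" "P * Q = 1\<^sub>m n" "Q * P = 1\<^sub>m n"
    using P by (auto simp: GL_pairs_def)
  show ?thesis
  proof (rule bij_betwI[of _ _ _ "\<lambda>l. l * Q"])
    show "(\<lambda>l. l * P) \<in> left_null n N \<rightarrow> left_null n (Q * N * P)"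
    proof
      fix l assume "l \<in> left_null n N"
      then have l: "l \<in> carrier_mat 1 n" "l * N = 0\<^sub>m 1 n" by (auto simp: left_null_def)
      have "l * P * (Q * N * P) = l * ((P * Q) * N * P)"
        using l(1) c(1,2) N by (simp add: assoc_mult_mat[of _ 1 n _ n _ n] assoc_mult_mat[of _ n n _ n _ n])
      also have "\<dots> = l * N * P" unfolding c(3) using l(1) c(1,2) N by (simp add: assoc_mult_mat[of _ 1 n _ n _ n])
      finally show "l * P \<in> left_null n (Q * N * P)" using l c by (simp add: left_null_def)
    qed
    show "(\<lambda>l. l * Q) \<in> left_null n (Q * N * P) \<rightarrow> left_null n N"
    proof
      fix l assume "l \<in> left_null n (Q * N * P)"
      then have l: "l \<in> carrier_mat 1 n" "l * (Q * N * P) = 0\<^sub>m 1 n" by (auto simp: left_null_def)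
      have "l * Q * N = l * Q * N * (P * Q)" using l c(1,2) N unfolding c(3) by simp
      also have "\<dots> = l * (Q * N * P) * Q"
        using l(1) c(1,2) N by (simp add: assoc_mult_mat[of _ 1 n _ n _ n] assoc_mult_mat[of _ n n _ n _ n])
      finally show "l * Q \<in> left_null n N" using l c by (simp add: left_null_def)
    qed
  qed (use c in \<open>auto simp: left_null_def\<close>)
qed

lemma mat_1_1_eq_0_iff: "A \<in> carrier_mat 1 1 \<Longrightarrow> A = 0\<^sub>m 1 1 \<longleftrightarrow> A $$ (0, 0) = 0"
  by (auto intro!: eq_matI)

lemma mat_mult_index:
  assumes "A \<in> carrier_mat a k" "B \<in> carrier_mat k b" "i < a" "j < b"
  shows "(A * B) $$ (i, j) = (\<Sum>l<k. A $$ (i, l) * B $$ (l, j))"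
  using assms by (auto simp: scalar_prod_def atLeast0LessThan intro!: sum.cong)

definition row_app :: "nat \<Rightarrow> 'a mat \<Rightarrow> 'a \<Rightarrow> 'a mat" where
  "row_app n l s = mat 1 (Suc n) (\<lambda>(i, j). if j < n then l $$ (0, j) else s)"

lemma row_app_carrier [simp]: "row_app n l s \<in> carrier_mat 1 (Suc n)"
  by (simp add: row_app_def)

lemma row_app_blk:
  assumes "A \<in> carrier_mat n n" "b \<in> carrier_mat n 1" "l \<in> carrier_mat 1 n"
  shows "row_app n l s * blk n A b 0 = row_app n (l * A) ((l * b) $$ (0, 0))"
proof (rule eq_matI)
  fix i j assume "i < dim_row (row_app n (l * A) ((l * b) $$ (0, 0)))" "j < dim_col (row_app n (l * A) ((l * b) $$ (0, 0)))"
  then have ij: "i = 0" "j < Suc n" by (auto simp: row_app_def)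
  have "(row_app n l s * blk n A b 0) $$ (i, j) = (\<Sum>k<Suc n. row_app n l s $$ (0, k) * blk n A b 0 $$ (k, j))"
    using ij mat_mult_index[OF row_app_carrier blk_carrier[OF assms(1,2)]] by simp
  also have "\<dots> = (\<Sum>k<n. l $$ (0, k) * (if j < n then A $$ (k, j) else b $$ (k, 0)))"
    using assms ij by (simp add: blk_index row_app_def)
  also have "\<dots> = row_app n (l * A) ((l * b) $$ (0, 0)) $$ (i, j)"
    using assms ij by (auto simp: row_app_def scalar_prod_def atLeast0LessThan)
  finally show "(row_app n l s * blk n A b 0) $$ (i, j) = row_app n (l * A) ((l * b) $$ (0, 0)) $$ (i, j)" .
qed (use blk_carrier[OF assms(1,2), of 0] in \<open>auto simp: row_app_def\<close>)

lemma row_app_surj: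
  assumes "r \<in> carrier_mat 1 (Suc n)"
  shows "r = row_app n (mat 1 n (\<lambda>p. r $$ p)) (r $$ (0, n))"
  using assms by (intro eq_matI) (auto simp: row_app_def less_Suc_eq)

lemma row_app_inject:
  assumes "l \<in> carrier_mat 1 n" "l' \<in> carrier_mat 1 n" "row_app n l s = row_app n l' s'"
  shows "l = l' \<and> s = s'"
proof -
  have *: "row_app n l s $$ (0, j) = row_app n l' s' $$ (0, j)" for j using assms(3) by simp
  have "l = l'"
  proof (rule eq_matI)
    fix i j assume "i < dim_row l'" "j < dim_col l'"
    then show "l $$ (i, j) = l' $$ (i, j)" using *[of j] assms(1,2) by (auto simp: row_app_def)
  qed (use assms in auto)
  then show ?thesis using *[of n] by (simp add: row_app_def)
qed

lemma row_app_zero: "l \<in> carrier_mat 1 n \<Longrightarrow> row_app n l s = 0\<^sub>m 1 (Suc n) \<longleftrightarrow> l = 0\<^sub>m 1 n \<and> s = 0"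
proof -
  assume l: "l \<in> carrier_mat 1 n"
  have "0\<^sub>m 1 (Suc n) = row_app n (0\<^sub>m 1 n) 0" by (rule eq_matI) (auto simp: row_app_def)
  then show ?thesis using row_app_inject[OF l zero_carrier_mat] by metis
qed

text \<open>The last row of the block matrix is zero, so the last entry of an annihilating row is
  free, while the rest must annihilate both A and b.\<close>

lemma left_null_blk:
  fixes A :: "'a::{finite,field} mat"
  assumes "A \<in> carrier_mat n n" "b \<in> carrier_mat n 1"
  shows "card (left_null (Suc n) (blk n A b 0)) = CARD('a) * card (left_null2 n A b)"
proof -
  have "bij_betw (\<lambda>(s, l). row_app n l s) ((UNIV :: 'a set) \<times> left_null2 n A b) (left_null (Suc n) (blk n A b 0))"
  proof (rule bij_betw_imageI)
    show "inj_on (\<lambda>(s, l). row_app n l s) ((UNIV :: 'a set) \<times> left_null2 n A b)"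
    proof (rule inj_onI, clarify)
      fix s l s' l' assume "l \<in> left_null2 n A b" "l' \<in> left_null2 n A b" "row_app n l s = row_app n l' s'"
      then show "s = s' \<and> l = l'" using row_app_inject[of l n l' s s'] by (simp add: left_null2_def left_null_def)
    qed
    have iff: "row_app n l s \<in> left_null (Suc n) (blk n A b 0) \<longleftrightarrow> l \<in> left_null2 n A b" if "l \<in> carrier_mat 1 n" for l s
    proof -
      have "l * A \<in> carrier_mat 1 n" "l * b \<in> carrier_mat 1 1" using that assms by auto
      then show ?thesis using that unfolding left_null_def left_null2_def
        by (simp add: row_app_blk[OF assms that] row_app_zero[OF \<open>l * A \<in> carrier_mat 1 n\<close>]
          mat_1_1_eq_0_iff[OF \<open>l * b \<in> carrier_mat 1 1\<close>] del: index_mult_mat)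
    qed
    show "(\<lambda>(s, l). row_app n l s) ` ((UNIV :: 'a set) \<times> left_null2 n A b) = left_null (Suc n) (blk n A b 0)"
    proof (intro equalityI subsetI)
      fix r assume "r \<in> (\<lambda>(s, l). row_app n l s) ` ((UNIV :: 'a set) \<times> left_null2 n A b)"
      then show "r \<in> left_null (Suc n) (blk n A b 0)" using iff by (auto simp: left_null2_def left_null_def)
    next
      fix r assume r: "r \<in> left_null (Suc n) (blk n A b 0)"
      then have "r \<in> carrier_mat 1 (Suc n)" by (simp add: left_null_def)
      from row_app_surj[OF this] r iff[of "mat 1 n (\<lambda>p. r $$ p)" "r $$ (0, n)"]
      show "r \<in> (\<lambda>(s, l). row_app n l s) ` ((UNIV :: 'a set) \<times> left_null2 n A b)"
        by (intro image_eqI[of _ _ "(r $$ (0, n), mat 1 n (\<lambda>p. r $$ p))"]) auto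
    qed
  qed
  then show ?thesis by (metis bij_betw_same_card card_cartesian_product)
qed

text \<open>l N = 0 removes the summand N b. Hence every b in the fibre sum leads to the same
  value.\<close>

lemma left_null2_shift:
  assumes "N \<in> carrier_mat n n" "b \<in> carrier_mat n 1" "v \<in> carrier_mat n 1"
  shows "left_null2 n N (N * b + v) = left_null2 n N v"
proof -
  have "l * (N * b + v) = l * v" if "l \<in> left_null n N" for l
  proof -
    have l: "l \<in> carrier_mat 1 n" "l * N = 0\<^sub>m 1 n" using that by (auto simp: left_null_def)
    have "l * (N * b + v) = l * N * b + l * v"
      using l(1) assms by (simp add: mult_add_distrib_mat[of _ 1 n _ 1] assoc_mult_mat[of _ 1 n _ n _ 1])
    then show ?thesis using l assms by simp
  qed
  then show ?thesis unfolding left_null2_def by auto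
qed

lemma row_nilpotent_conj:
  assumes P: "(P, Q) \<in> GL_pairs n" and N: "N \<in> carrier_mat n n" and nil: "row_nilpotent n N"
  shows "row_nilpotent n (Q * N * P)"
proof -
  have c: "P \<in> carrier_mat n n" "Q \<in> carrier_mat n n" "P * Q = 1\<^sub>m n" "Q * P = 1\<^sub>m n"
    using P by (auto simp: GL_pairs_def)
  obtain m where m: "\<And>l. l \<in> carrier_mat 1 n \<Longrightarrow> ((\<lambda>r. r * N) ^^ m) l = 0\<^sub>m 1 n" using nil by (auto simp: row_nilpotent_def)
  have iter: "((\<lambda>r. r * (Q * N * P)) ^^ k) l = ((\<lambda>r. r * N) ^^ k) (l * Q) * P \<and> ((\<lambda>r. r * N) ^^ k) (l * Q) \<in> carrier_mat 1 n"
    if l: "l \<in> carrier_mat 1 n" for l k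
  proof (induction k)
    case 0
    have "l * Q * P = l * (Q * P)" using l c(1,2) by (simp add: assoc_mult_mat[of _ 1 n _ n _ n])
    then show ?case using l c by simp
  next
    case (Suc k)
    let ?r = "((\<lambda>r. r * N) ^^ k) (l * Q)"
    have r: "?r \<in> carrier_mat 1 n" using Suc by simp
    have "((\<lambda>r. r * (Q * N * P)) ^^ Suc k) l = ?r * P * (Q * N * P)" using Suc by simp
    also have "\<dots> = ?r * ((P * Q) * N * P)"
      using r c(1,2) N by (simp add: assoc_mult_mat[of _ 1 n _ n _ n] assoc_mult_mat[of _ n n _ n _ n])
    also have "\<dots> = ?r * N * P" unfolding c(3) using r c(1,2) N by (simp add: assoc_mult_mat[of _ 1 n _ n _ n])
    finally show ?case using r N by simp
  qed
  have "((\<lambda>r. r * (Q * N * P)) ^^ m) l = 0\<^sub>m 1 n" if "l \<in> carrier_mat 1 n" for l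
    using iter[OF that, of m] m[of "l * Q"] that c by simp
  then show ?thesis unfolding row_nilpotent_def by blast
qed

lemma row_nilpotent_blk:
  assumes "A \<in> carrier_mat n n" "b \<in> carrier_mat n 1" "row_nilpotent (Suc n) (blk n A b 0)"
  shows "row_nilpotent n A"
proof -
  obtain m where m: "\<And>l. l \<in> carrier_mat 1 (Suc n) \<Longrightarrow> ((\<lambda>r. r * blk n A b 0) ^^ m) l = 0\<^sub>m 1 (Suc n)"
    using assms(3) by (auto simp: row_nilpotent_def)
  have iter: "((\<lambda>r. r * A) ^^ k) l \<in> carrier_mat 1 n \<and> (\<exists>s. ((\<lambda>r. r * blk n A b 0) ^^ k) (row_app n l 0) = row_app n (((\<lambda>r. r * A) ^^ k) l) s)"
    if "l \<in> carrier_mat 1 n" for l k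
    using that by (induction k) (auto simp: row_app_blk[OF assms(1,2)] assms(1))
  have "((\<lambda>r. r * A) ^^ m) l = 0\<^sub>m 1 n" if l: "l \<in> carrier_mat 1 n" for l
  proof -
    obtain s where "((\<lambda>r. r * blk n A b 0) ^^ m) (row_app n l 0) = row_app n (((\<lambda>r. r * A) ^^ m) l) s"
      and c: "((\<lambda>r. r * A) ^^ m) l \<in> carrier_mat 1 n"
      using iter[OF l, of m] by blast
    then have "row_app n (((\<lambda>r. r * A) ^^ m) l) s = 0\<^sub>m 1 (Suc n)" using m[OF row_app_carrier, of l 0] by simp
    then show ?thesis using row_app_zero[OF c] by blast
  qed
  then show ?thesis unfolding row_nilpotent_def by blast
qed

text \<open>Otherwise multiplication by N would keep nonzero rows nonzero forever.\<close>

lemma left_null_nontrivial: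
  assumes N: "N \<in> carrier_mat (Suc n) (Suc n)" and nil: "row_nilpotent (Suc n) N"
  shows "\<exists>l\<in>left_null (Suc n) N. l \<noteq> 0\<^sub>m 1 (Suc n)"
proof (rule ccontr)
  assume *: "\<not> ?thesis"
  define C where "C = carrier_mat 1 (Suc n) - {0\<^sub>m 1 (Suc n) :: 'a mat}"
  have step: "r * N \<in> C" if "r \<in> C" for r
  proof -
    have "r * N \<in> carrier_mat 1 (Suc n)" using that N unfolding C_def by auto
    then show ?thesis using * that unfolding C_def left_null_def by blast
  qed
  obtain m where m: "\<And>l. l \<in> carrier_mat 1 (Suc n) \<Longrightarrow> ((\<lambda>r. r * N) ^^ m) l = 0\<^sub>m 1 (Suc n)"
    using nil unfolding row_nilpotent_def by blast
  have "unit_row n $$ (0, n) \<noteq> (0\<^sub>m 1 (Suc n) :: 'a mat) $$ (0, n)" by (simp add: unit_row_def)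
  then have "unit_row n \<noteq> (0\<^sub>m 1 (Suc n) :: 'a mat)" by metis
  then have unit: "unit_row n \<in> C" unfolding C_def by (simp add: unit_row_def)
  have "((\<lambda>r. r * N) ^^ k) (unit_row n) \<in> C" for k
  proof (induction k)
    case 0
    show ?case using unit by simp
  next
    case (Suc k)
    show ?case using step[OF Suc] by simp
  qed
  from this[of m] m[of "unit_row n"] unit show False unfolding C_def by blast
qed

section \<open>Values of the induced character\<close>

definition gg_weight :: "('a::field \<Rightarrow> complex) \<Rightarrow> (nat \<Rightarrow> 'a) \<Rightarrow> nat \<Rightarrow> 'a mat \<Rightarrow> complex" where
  "gg_weight \<psi> c n S = (\<Prod>i\<in>{1..<n}. \<psi> (c i * S $$ (i - 1, i)))"

text \<open>The value of \<psi> at the superdiagonal entry that u contributes when it is appended as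
  column n to an n by n matrix; for n = 0 there is no such entry.\<close>

definition gg_last :: "('a::field \<Rightarrow> complex) \<Rightarrow> (nat \<Rightarrow> 'a) \<Rightarrow> nat \<Rightarrow> 'a mat \<Rightarrow> complex" where
  "gg_last \<psi> c n u = (if n = 0 then 1 else \<psi> (c n * u $$ (n - 1, 0)))"

definition gg_term :: "('a::field \<Rightarrow> complex) \<Rightarrow> (nat \<Rightarrow> 'a) \<Rightarrow> nat \<Rightarrow> 'a mat \<Rightarrow> complex" where
  "gg_term \<psi> c n S = (if strictly_upper n S then gg_weight \<psi> c n S else 0)"

text \<open>The additional column \<open>w\<close> plays the role of \<open>N b\<close> for a next basis vector \<open>b\<close>; it makes the
  induction on the dimension go through.\<close>

definition gg_sum :: "('a::field \<Rightarrow> complex) \<Rightarrow> (nat \<Rightarrow> 'a) \<Rightarrow> nat \<Rightarrow> 'a mat \<Rightarrow> 'a mat \<Rightarrow> complex" where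
  "gg_sum \<psi> c n N w = (\<Sum>(x, y)\<in>GL_pairs n. gg_term \<psi> c n (y * N * x) * gg_last \<psi> c n (y * w))"

lemma gg_term_blk:
  assumes "A \<in> carrier_mat n n" "b \<in> carrier_mat n 1"
  shows "gg_term \<psi> c (Suc n) (blk n A b 0) = gg_term \<psi> c n A * gg_last \<psi> c n b"
proof -
  have "gg_weight \<psi> c (Suc n) (blk n A b 0) = gg_weight \<psi> c n A * gg_last \<psi> c n b"
  proof (cases "n = 0")
    case True
    then show ?thesis by (simp add: gg_weight_def gg_last_def)
  next
    case False
    then have "{1..<Suc n} = insert n {1..<n}" by auto
    moreover have "(\<Prod>i\<in>{1..<n}. \<psi> (c i * blk n A b 0 $$ (i - 1, i))) = gg_weight \<psi> c n A"
      unfolding gg_weight_def using assms by (intro prod.cong) (auto simp: blk_index)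
    moreover have "blk n A b 0 $$ (n - 1, n) = b $$ (n - 1, 0)"
      using False assms by (simp add: blk_index)
    ultimately show ?thesis using False by (simp add: gg_weight_def gg_last_def mult.commute)
  qed
  then show ?thesis using strictly_upper_blk[OF assms] by (simp add: gg_term_def)
qed

lemma one_smult_mat: "(1 :: 'a::field) \<cdot>\<^sub>m A = A"
  by (rule eq_matI) auto

text \<open>The y with the same last row as Q form one coset of the stabilizer of the row (0, ...,
  0, 1), which consists of the block matrices with s = 1. The column -(y b) is the one occurring in
  the inverse of \<open>blk n x b 1\<close>.\<close>

lemma GL_pairs_blk_bij:
  assumes PQ: "(P, Q) \<in> GL_pairs (Suc n)"
  shows "bij_betw (\<lambda>((x, y), b). (P * blk n x b 1, blk n y (- (y * b)) 1 * Q))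
    (GL_pairs n \<times> carrier_mat n 1) {(x, y) \<in> GL_pairs (Suc n). lrow n y = lrow n Q}"
proof (rule bij_betw_imageI)
  let ?m = "Suc n"
  have PQc: "P \<in> carrier_mat ?m ?m" "Q \<in> carrier_mat ?m ?m" "P * Q = 1\<^sub>m ?m" "Q * P = 1\<^sub>m ?m"
    using PQ by (auto simp: GL_pairs_def)
  have cancelP: "Q * (P * M) = M" if "M \<in> carrier_mat ?m ?m" for M
    using PQc that by (simp flip: assoc_mult_mat[of _ ?m ?m _ ?m _ ?m])
  show "inj_on (\<lambda>((x, y), b). (P * blk n x b 1, blk n y (- (y * b)) 1 * Q)) (GL_pairs n \<times> carrier_mat n 1)"
  proof (rule inj_onI)
    fix p p' assume p: "p \<in> GL_pairs n \<times> carrier_mat n 1" and p': "p' \<in> GL_pairs n \<times> carrier_mat n 1"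
      and eq': "(\<lambda>((x, y), b). (P * blk n x b 1, blk n y (- (y * b)) 1 * Q)) p =
        (\<lambda>((x, y), b). (P * blk n x b 1, blk n y (- (y * b)) 1 * Q)) p'"
    obtain x y b where pe: "p = ((x, y), b)" by (metis prod.exhaust)
    obtain x' y' b' where pe': "p' = ((x', y'), b')" by (metis prod.exhaust)
    have xy: "(x, y) \<in> GL_pairs n" "b \<in> carrier_mat n 1" "(x', y') \<in> GL_pairs n" "b' \<in> carrier_mat n 1"
      and eq: "P * blk n x b 1 = P * blk n x' b' 1" using p p' eq' by (auto simp: pe pe')
    have c: "x \<in> carrier_mat n n" "y \<in> carrier_mat n n" "x' \<in> carrier_mat n n" "y' \<in> carrier_mat n n"
      "y * x = 1\<^sub>m n" "x' * y' = 1\<^sub>m n" using xy by (auto simp: GL_pairs_def)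
    have "blk n x b 1 = blk n x' b' 1"
      using arg_cong[OF eq, of "\<lambda>M. Q * M"] cancelP blk_carrier[OF c(1) xy(2)] blk_carrier[OF c(3) xy(4)] by metis
    then have *: "x = x'" "b = b'" using blk_inject[OF c(1) xy(2) c(3) xy(4)] by auto
    have "y = y * (x * y')" using * c by simp
    also have "\<dots> = y * x * y'" by (rule assoc_mult_mat[OF c(2,1,4), symmetric])
    also have "\<dots> = y'" unfolding c(5) using c by simp
    finally show "p = p'" using * by (simp add: pe pe')
  qed
  show "(\<lambda>((x, y), b). (P * blk n x b 1, blk n y (- (y * b)) 1 * Q)) ` (GL_pairs n \<times> carrier_mat n 1) =
      {(x, y) \<in> GL_pairs ?m. lrow n y = lrow n Q}"
  proof (intro equalityI subsetI)
    fix p assume "p \<in> (\<lambda>((x, y), b). (P * blk n x b 1, blk n y (- (y * b)) 1 * Q)) ` (GL_pairs n \<times> carrier_mat n 1)"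
    then obtain x y b where p: "p = (P * blk n x b 1, blk n y (- (y * b)) 1 * Q)" and xy: "(x, y) \<in> GL_pairs n" "b \<in> carrier_mat n 1"
      by auto
    have c: "x \<in> carrier_mat n n" "y \<in> carrier_mat n n" "y * x = 1\<^sub>m n" using xy by (auto simp: GL_pairs_def)
    have yb: "- (y * b) \<in> carrier_mat n 1" using c xy by auto
    note X = blk_carrier[OF c(1) xy(2), of 1] and Y = blk_carrier[OF c(2) yb, of 1]
    have "y * b + - (y * b) = 0\<^sub>m n 1" using c xy(2) by (intro eq_matI) auto
    then have YX: "blk n y (- (y * b)) 1 * blk n x b 1 = 1\<^sub>m ?m"
      using blk_mult[OF c(2) yb c(1) xy(2), of 1 1] c(3) yb by (simp add: blk_one one_smult_mat)
    have "(blk n y (- (y * b)) 1 * Q) * (P * blk n x b 1) = blk n y (- (y * b)) 1 * (Q * (P * blk n x b 1))"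
      using X Y PQc by (simp add: assoc_mult_mat[of _ ?m ?m _ ?m _ ?m])
    then have "(blk n y (- (y * b)) 1 * Q) * (P * blk n x b 1) = 1\<^sub>m ?m" using cancelP[OF X] YX by simp
    moreover have "lrow n (blk n y (- (y * b)) 1 * Q) = lrow n Q"
      unfolding lrow_mult[OF Y PQc(2)] lrow_blk[OF c(2) yb] using unit_row_mult[OF PQc(2)] .
    ultimately show "p \<in> {(x, y) \<in> GL_pairs ?m. lrow n y = lrow n Q}"
      unfolding p using GL_pairsI[of "P * blk n x b 1" ?m "blk n y (- (y * b)) 1 * Q"] X Y PQc by auto
  next
    fix p assume "p \<in> {(x, y) \<in> GL_pairs ?m. lrow n y = lrow n Q}"
    then obtain g h where p: "p = (g, h)" and XY: "(g, h) \<in> GL_pairs ?m" "lrow n h = lrow n Q" by auto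
    have C: "g \<in> carrier_mat ?m ?m" "h \<in> carrier_mat ?m ?m" "h * g = 1\<^sub>m ?m" using XY by (auto simp: GL_pairs_def)
    have "lrow n (h * P) = lrow n (Q * P)" unfolding lrow_mult[OF C(2) PQc(1)] lrow_mult[OF PQc(2,1)] XY(2) ..
    also have "\<dots> = unit_row n" unfolding PQc(4) blk_one by simp
    finally obtain y b' where y: "y \<in> carrier_mat n n" "b' \<in> carrier_mat n 1" "h * P = blk n y b' 1"
      using lrow_unit_blk[of "h * P" n] C PQc by auto
    have YX: "(h * P) * (Q * g) = 1\<^sub>m ?m"
    proof -
      have "(h * P) * (Q * g) = h * ((P * Q) * g)"
        using C(1,2) PQc(1,2) by (simp add: assoc_mult_mat[of _ ?m ?m _ ?m _ ?m])
      then show ?thesis using C PQc by simp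
    qed
    have QX: "Q * g \<in> carrier_mat ?m ?m" using C PQc by auto
    have "lrow n (Q * g) = unit_row n * (Q * g)" using unit_row_mult[OF QX] ..
    also have "unit_row n = lrow n (h * P)" unfolding y(3) using y by simp
    also have "lrow n (h * P) * (Q * g) = lrow n ((h * P) * (Q * g))" using C PQc QX by (intro lrow_mult[symmetric]) auto
    also have "\<dots> = unit_row n" unfolding YX blk_one by simp
    finally obtain x b where x: "x \<in> carrier_mat n n" "b \<in> carrier_mat n 1" "Q * g = blk n x b 1"
      using lrow_unit_blk[OF QX] by auto
    have xb: "y * b + 1 \<cdot>\<^sub>m b' \<in> carrier_mat n 1" "y * x \<in> carrier_mat n n" using x y by auto
    have "blk n (y * x) (y * b + 1 \<cdot>\<^sub>m b') (1 * 1) = blk n (1\<^sub>m n) (0\<^sub>m n 1) 1"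
      using YX unfolding x(3) y(3) blk_mult[OF y(1,2) x(1,2)] blk_one .
    then have yx: "y * x = 1\<^sub>m n" "y * b + 1 \<cdot>\<^sub>m b' = 0\<^sub>m n 1"
      using blk_inject[OF xb(2,1) one_carrier_mat zero_carrier_mat] by auto
    have "b' = - (y * b)"
    proof (rule eq_matI)
      fix i j assume "i < dim_row (- (y * b))" "j < dim_col (- (y * b))"
      then have ij: "i < n" "j < 1" using x y by auto
      then have "(y * b + 1 \<cdot>\<^sub>m b') $$ (i, j) = 0" unfolding yx by simp
      then show "b' $$ (i, j) = (- (y * b)) $$ (i, j)" using ij x y by (simp add: eq_neg_iff_add_eq_0 add.commute del: index_mult_mat(1))
    qed (use x y in auto)
    then have "h = blk n y (- (y * b)) 1 * Q"
    proof -
      have "h = h * (P * Q)" using C PQc by simp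
      also have "\<dots> = h * P * Q" using C(1,2) PQc(1,2) by (simp add: assoc_mult_mat[of _ ?m ?m _ ?m _ ?m])
      finally show ?thesis unfolding y(3) \<open>b' = - (y * b)\<close> .
    qed
    moreover have "g = P * blk n x b 1"
    proof -
      have "g = (P * Q) * g" using C PQc by simp
      also have "\<dots> = P * (Q * g)" using C(1,2) PQc(1,2) by (simp add: assoc_mult_mat[of _ ?m ?m _ ?m _ ?m])
      finally show ?thesis unfolding x(3) .
    qed
    moreover have "(x, y) \<in> GL_pairs n" using GL_pairsI[OF x(1) y(1) yx(1)] .
    ultimately show "p \<in> (\<lambda>((x, y), b). (P * blk n x b 1, blk n y (- (y * b)) 1 * Q)) ` (GL_pairs n \<times> carrier_mat n 1)"
      unfolding p using x(2) by (intro image_eqI[of _ _ "((x, y), b)"]) auto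
  qed
qed

text \<open>Conjugation by a block matrix turns \<open>blk n A v 0\<close> into the one with blocks
  y A x and y (A b + v), so the fibre sum becomes a sum over b of sums of size n with bordering
  column A b + v. The factor for w depends only on the fixed last row and comes out.\<close>

lemma gg_sum_fiber:
  fixes N :: "'a::{finite,field} mat"
  assumes N: "N \<in> carrier_mat (Suc n) (Suc n)" and w: "w \<in> carrier_mat (Suc n) 1"
    and PQ: "(P, Q) \<in> GL_pairs (Suc n)" and A: "A \<in> carrier_mat n n" and v: "v \<in> carrier_mat n 1"
    and N': "Q * N * P = blk n A v 0"
  shows "(\<Sum>(x, y)\<in>{(x, y) \<in> GL_pairs (Suc n). lrow n y = lrow n Q}.
      gg_term \<psi> c (Suc n) (y * N * x) * gg_last \<psi> c (Suc n) (y * w)) =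
    \<psi> (c (Suc n) * (lrow n Q * w) $$ (0, 0)) * (\<Sum>b\<in>carrier_mat n 1. gg_sum \<psi> c n A (A * b + v))"
proof -
  let ?m = "Suc n"
  let ?e = "\<psi> (c (Suc n) * (lrow n Q * w) $$ (0, 0))"
  let ?S = "{(x, y) \<in> GL_pairs ?m. lrow n y = lrow n Q}"
  have PQc: "P \<in> carrier_mat ?m ?m" "Q \<in> carrier_mat ?m ?m" using PQ by (auto simp: GL_pairs_def)
  have last: "gg_last \<psi> c ?m (y * w) = ?e" if "(x, y) \<in> ?S" for x y
  proof -
    have y: "y \<in> carrier_mat ?m ?m" "lrow n y = lrow n Q" using that by (auto simp: GL_pairs_def)
    have "(y * w) $$ (n, 0) = lrow n (y * w) $$ (0, 0)" using y w by (simp add: lrow_def)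
    then show ?thesis unfolding lrow_mult[OF y(1) w] y(2) by (simp add: gg_last_def)
  qed
  let ?F = "\<lambda>((x, y), b). (P * blk n x b 1, blk n y (- (y * b)) 1 * Q)"
  let ?g = "\<lambda>(x, y). gg_term \<psi> c ?m (y * N * x) * ?e"
  let ?h = "\<lambda>(x, y) b. ?e * (gg_term \<psi> c n (y * A * x) * gg_last \<psi> c n (y * (A * b + v)))"
  have "(\<Sum>(x, y)\<in>?S. gg_term \<psi> c ?m (y * N * x) * gg_last \<psi> c ?m (y * w)) = (\<Sum>p\<in>?S. ?g p)"
    using last by (intro sum.cong) auto
  also have "\<dots> = (\<Sum>p\<in>GL_pairs n \<times> carrier_mat n 1. ?g (?F p))"
    by (rule sum.reindex_bij_betw[OF GL_pairs_blk_bij[OF PQ], symmetric])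
  also have "\<dots> = (\<Sum>p\<in>GL_pairs n \<times> carrier_mat n 1. case p of (p, b) \<Rightarrow> ?h p b)"
  proof (rule sum.cong[OF refl])
    fix p assume p: "p \<in> (GL_pairs n :: ('a mat \<times> 'a mat) set) \<times> (carrier_mat n 1 :: 'a mat set)"
    obtain x y b where p_eq: "p = ((x, y), b)" by (metis prod.exhaust)
    have xy: "(x, y) \<in> GL_pairs n" and b: "b \<in> carrier_mat n 1" using p by (auto simp: p_eq)
    have c: "x \<in> carrier_mat n n" "y \<in> carrier_mat n n" using xy by (auto simp: GL_pairs_def)
    have yb: "- (y * b) \<in> carrier_mat n 1" using c b by auto
    note X = blk_carrier[OF c(1) b, of 1] and Y = blk_carrier[OF c(2) yb, of 1]
    have "(blk n y (- (y * b)) 1 * Q) * N * (P * blk n x b 1) = blk n y (- (y * b)) 1 * ((Q * N * P) * blk n x b 1)"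
      using X Y PQc N by (simp add: assoc_mult_mat[of _ ?m ?m _ ?m _ ?m])
    also have "(Q * N * P) * blk n x b 1 = blk n (A * x) (A * b + 1 \<cdot>\<^sub>m v) (0 * 1)"
      unfolding N' by (rule blk_mult[OF A v c(1) b])
    also have "blk n y (- (y * b)) 1 * \<dots> = blk n (y * (A * x)) (y * (A * b + 1 \<cdot>\<^sub>m v) + (0 * 1) \<cdot>\<^sub>m (- (y * b))) (1 * (0 * 1))"
      using A v c b by (intro blk_mult yb) auto
    also have "y * (A * b + 1 \<cdot>\<^sub>m v) + (0 * 1) \<cdot>\<^sub>m (- (y * b)) = y * (A * b + v)"
      using A v c b by (intro eq_matI) (auto simp: one_smult_mat)
    also have "y * (A * x) = y * A * x" using c A by (simp add: assoc_mult_mat[of _ n n _ n _ n])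
    finally have eq: "(blk n y (- (y * b)) 1 * Q) * N * (P * blk n x b 1) = blk n (y * A * x) (y * (A * b + v)) 0" by simp
    have "gg_term \<psi> c ?m ((blk n y (- (y * b)) 1 * Q) * N * (P * blk n x b 1)) =
        gg_term \<psi> c n (y * A * x) * gg_last \<psi> c n (y * (A * b + v))"
      unfolding eq using c A v b by (intro gg_term_blk) auto
    then show "?g (?F p) = (case p of (p, b) \<Rightarrow> ?h p b)" by (simp add: p_eq)
  qed
  also have "\<dots> = (\<Sum>p\<in>GL_pairs n. \<Sum>b\<in>carrier_mat n 1. ?h p b)"
    by (rule sum.cartesian_product[symmetric])
  also have "\<dots> = (\<Sum>b\<in>carrier_mat n 1. \<Sum>p\<in>GL_pairs n. ?h p b)"
    by (rule sum.swap)
  also have "\<dots> = ?e * (\<Sum>b\<in>carrier_mat n 1. gg_sum \<psi> c n A (A * b + v))"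
    by (simp add: gg_sum_def sum_distrib_left case_prod_unfold)
  finally show ?thesis .
qed

lemma strictly_upper_lrow:
  assumes "S \<in> carrier_mat (Suc n) (Suc n)" "strictly_upper (Suc n) S"
  shows "lrow n S = 0\<^sub>m 1 (Suc n)"
  using assms by (intro eq_matI) (auto simp: lrow_def strictly_upper_def)

text \<open>A strictly upper triangular matrix has last row zero. A nonzero term therefore forces l
  N = 0 for the last row l of y, and l \<noteq> 0 because y is invertible.\<close>

lemma gg_sum_split:
  fixes N :: "'a::{finite,field} mat"
  assumes N: "N \<in> carrier_mat (Suc n) (Suc n)"
  shows "gg_sum \<psi> c (Suc n) N w = (\<Sum>l\<in>left_null (Suc n) N - {0\<^sub>m 1 (Suc n)}.
    \<Sum>(x, y)\<in>{(x, y) \<in> GL_pairs (Suc n). lrow n y = l}. gg_term \<psi> c (Suc n) (y * N * x) * gg_last \<psi> c (Suc n) (y * w))"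
proof -
  let ?m = "Suc n" and ?R = "carrier_mat 1 (Suc n) - {0\<^sub>m 1 (Suc n)} :: 'a mat set"
  let ?f = "\<lambda>(x, y). gg_term \<psi> c ?m (y * N * x) * gg_last \<psi> c ?m (y * w)"
  have "lrow n y \<in> ?R" if "(x, y) \<in> GL_pairs ?m" for x y
  proof -
    have xy: "x \<in> carrier_mat ?m ?m" "y \<in> carrier_mat ?m ?m" "y * x = 1\<^sub>m ?m" using that by (auto simp: GL_pairs_def)
    have "lrow n y * x = unit_row n" unfolding lrow_mult[OF xy(2,1), symmetric] xy(3) blk_one by simp
    moreover have "unit_row n $$ (0, n) \<noteq> (0\<^sub>m 1 ?m :: 'a mat) $$ (0, n)" by (simp add: unit_row_def)
    moreover have "0\<^sub>m 1 ?m * x = 0\<^sub>m 1 ?m" using xy by simp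
    ultimately have "lrow n y \<noteq> 0\<^sub>m 1 ?m" by metis
    then show ?thesis using xy by auto
  qed
  then have "gg_sum \<psi> c ?m N w = (\<Sum>l\<in>?R. \<Sum>p\<in>{p \<in> GL_pairs ?m. (case p of (x, y) \<Rightarrow> lrow n y) = l}. ?f p)"
    unfolding gg_sum_def
    by (intro sum.group[symmetric]) (auto simp: finite_GL_pairs finite_carrier_mat)
  also have "\<dots> = (\<Sum>l\<in>left_null ?m N - {0\<^sub>m 1 ?m}. \<Sum>p\<in>{p \<in> GL_pairs ?m. (case p of (x, y) \<Rightarrow> lrow n y) = l}. ?f p)"
  proof (rule sum.mono_neutral_right)
    show "\<forall>l\<in>?R - (left_null ?m N - {0\<^sub>m 1 ?m}). (\<Sum>p\<in>{p \<in> GL_pairs ?m. (case p of (x, y) \<Rightarrow> lrow n y) = l}. ?f p) = 0"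
    proof (intro ballI sum.neutral)
      fix l p assume lR: "l \<in> ?R - (left_null ?m N - {0\<^sub>m 1 ?m})" and p: "p \<in> {p \<in> GL_pairs ?m. (case p of (x, y) \<Rightarrow> lrow n y) = l}"
      obtain x y where p_eq: "p = (x, y)" by (cases p)
      have l: "lrow n y \<in> carrier_mat 1 ?m" "lrow n y \<notin> left_null ?m N" and xy': "(x, y) \<in> GL_pairs ?m"
        using lR p p_eq by auto
      have xy: "x \<in> carrier_mat ?m ?m" "y \<in> carrier_mat ?m ?m" "x * y = 1\<^sub>m ?m" using xy' by (auto simp: GL_pairs_def)
      have "\<not> strictly_upper ?m (y * N * x)"
      proof
        assume "strictly_upper ?m (y * N * x)"
        then have "lrow n (y * N * x) = 0\<^sub>m 1 ?m" using xy N by (intro strictly_upper_lrow) auto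
        moreover have "lrow n (y * N * x) = lrow n y * N * x"
          using xy N lrow_mult[of "y * N" n ?m x ?m] lrow_mult[of y n ?m N ?m] by auto
        ultimately have "lrow n y * N * x * y = 0\<^sub>m 1 ?m" using xy by simp
        then have "lrow n y * N * (x * y) = 0\<^sub>m 1 ?m"
          using xy(1,2) N l(1) by (simp add: assoc_mult_mat[of _ 1 ?m _ ?m _ ?m])
        then show False using l xy N by (auto simp: left_null_def)
      qed
      then show "?f p = 0" by (simp add: gg_term_def p_eq)
    qed
  qed (auto simp: finite_carrier_mat left_null_def)
  also have "\<dots> = (\<Sum>l\<in>left_null ?m N - {0\<^sub>m 1 ?m}.
    \<Sum>(x, y)\<in>{(x, y) \<in> GL_pairs ?m. lrow n y = l}. gg_term \<psi> c ?m (y * N * x) * gg_last \<psi> c ?m (y * w))"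
    by (intro sum.cong) auto
  finally show ?thesis .
qed

lemma additive_char_0: "additive_char \<psi> \<Longrightarrow> \<psi> 0 = 1"
  unfolding additive_char_def by (metis add.right_neutral mult_cancel_left1)

lemma left_null_add: "N \<in> carrier_mat n n \<Longrightarrow> l \<in> left_null n N \<Longrightarrow> l' \<in> left_null n N \<Longrightarrow> l + l' \<in> left_null n N"
  by (auto simp: left_null_def add_mult_distrib_mat[of _ 1 n _ _ n])

lemma left_null_smult: "N \<in> carrier_mat n n \<Longrightarrow> l \<in> left_null n N \<Longrightarrow> s \<cdot>\<^sub>m l \<in> left_null n N"
  by (auto simp: left_null_def mult_smult_assoc_mat[of _ 1 n _ n])

lemma finite_left_null: "finite (left_null n (N :: 'a::{finite,field} mat))"
  by (rule finite_subset[OF _ finite_carrier_mat[of 1 n]]) (auto simp: left_null_def)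

lemma row_times_col_add:
  "l \<in> carrier_mat 1 n \<Longrightarrow> l' \<in> carrier_mat 1 n \<Longrightarrow> w \<in> carrier_mat n 1 \<Longrightarrow>
   ((l + l') * w) $$ (0, 0) = (l * w) $$ (0, 0) + (l' * w :: 'a::field mat) $$ (0, 0)"
  by (simp add: add_mult_distrib_mat[of _ 1 n _ _ 1] del: index_mult_mat(1))

lemma row_times_col_smult:
  "l \<in> carrier_mat 1 n \<Longrightarrow> w \<in> carrier_mat n 1 \<Longrightarrow> (s \<cdot>\<^sub>m l * w) $$ (0, 0) = s * (l * w :: 'a::field mat) $$ (0, 0)"
  by (simp add: mult_smult_assoc_mat[of _ 1 n _ 1] del: index_mult_mat(1))

text \<open>The map l \<mapsto> \<psi>(d l w) is a character of the left null space, trivial exactly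
  if the functional l w vanishes there; a nonzero functional has a kernel of index q.\<close>

lemma left_null_character_sum:
  fixes N :: "'a::{finite,field} mat"
  assumes \<psi>: "additive_char \<psi>" "\<exists>x. \<psi> x \<noteq> 1" and d: "d \<noteq> 0"
    and N: "N \<in> carrier_mat n n" and w: "w \<in> carrier_mat n 1"
  shows "(\<Sum>l\<in>left_null n N. \<psi> (d * (l * w) $$ (0, 0))) =
    (if left_null2 n N w = left_null n N then of_nat (card (left_null n N)) else 0)"
    and "left_null2 n N w \<noteq> left_null n N \<Longrightarrow> card (left_null n N) = CARD('a) * card (left_null2 n N w)"
proof -
  define L where "L = left_null n N"
  define v where "v l = (l * w) $$ (0, 0)" for l
  have c: "l \<in> carrier_mat 1 n" if "l \<in> L" for l using that by (auto simp: left_null_def L_def)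
  have L2: "left_null2 n N w = {l \<in> L. v l = 0}"
  proof -
    have "l * w = 0\<^sub>m 1 1 \<longleftrightarrow> v l = 0" if "l \<in> L" for l
      unfolding v_def by (rule mat_1_1_eq_0_iff[OF mult_carrier_mat[OF c[OF that] w]])
    then show ?thesis unfolding left_null2_def L_def by blast
  qed
  have v_add: "v (l + l') = v l + v l'" if "l \<in> L" "l' \<in> L" for l l'
    unfolding v_def by (rule row_times_col_add[OF c[OF that(1)] c[OF that(2)] w])
  have v_smult: "v (s \<cdot>\<^sub>m l) = s * v l" if "l \<in> L" for s l
    unfolding v_def by (rule row_times_col_smult[OF c[OF that] w])
  have smult: "s \<cdot>\<^sub>m l \<in> L" if "l \<in> L" for s l using left_null_smult[OF N] that by (simp add: L_def)
  have add: "l + l' \<in> L" if "l \<in> L" "l' \<in> L" for l l' using left_null_add[OF N] that by (simp add: L_def)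
  have cancel: "(- s) \<cdot>\<^sub>m k + (s \<cdot>\<^sub>m k + l) = l" "s \<cdot>\<^sub>m k + ((- s) \<cdot>\<^sub>m k + l) = l" if "l \<in> L" "k \<in> L" for s l k
    using c[OF that(1)] c[OF that(2)] by (auto intro!: eq_matI)
  have unit: "\<exists>l0\<in>L. v l0 = 1" if ne: "left_null2 n N w \<noteq> L"
  proof -
    obtain l where l: "l \<in> L" "v l \<noteq> 0" using ne L2 by blast
    have "v (inverse (v l) \<cdot>\<^sub>m l) = 1" unfolding v_smult[OF l(1)] using l(2) by simp
    then show ?thesis using smult[OF l(1)] by blast
  qed
  have "(\<Sum>l\<in>L. \<psi> (d * v l)) = (if left_null2 n N w = L then of_nat (card L) else 0)"
  proof (cases "left_null2 n N w = L")
    case True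
    then have "v l = 0" if "l \<in> L" for l using that L2 by blast
    then show ?thesis using True additive_char_0[OF \<psi>(1)] by simp
  next
    case False
    obtain l0 where l0: "l0 \<in> L" "v l0 = 1" using unit[OF False] by blast
    obtain t where t: "\<psi> t \<noteq> 1" using \<psi>(2) by blast
    \<comment> \<open>The multiple t/d of l0 is chosen so that translation by it multiplies every
      summand by \<psi> t \<noteq> 1.\<close>
    have shift: "\<psi> (d * v ((t / d) \<cdot>\<^sub>m l0 + l)) = \<psi> t * \<psi> (d * v l)" if l: "l \<in> L" for l
    proof -
      have "d * v ((t / d) \<cdot>\<^sub>m l0 + l) = t + d * v l"
        unfolding v_add[OF smult[OF l0(1)] l] v_smult[OF l0(1)] l0(2) using d by (simp add: distrib_left)
      then show ?thesis using \<psi>(1) by (simp add: additive_char_def)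
    qed
    have "(\<Sum>l\<in>L. \<psi> (d * v l)) = (\<Sum>l\<in>L. \<psi> (d * v ((t / d) \<cdot>\<^sub>m l0 + l)))"
    proof (rule sum.reindex_bij_betw[symmetric])
      show "bij_betw (\<lambda>l. (t / d) \<cdot>\<^sub>m l0 + l) L L"
      proof (rule bij_betwI[of _ _ _ "\<lambda>l. (- (t / d)) \<cdot>\<^sub>m l0 + l"])
        show "(- (t / d)) \<cdot>\<^sub>m l0 + ((t / d) \<cdot>\<^sub>m l0 + l) = l" "(t / d) \<cdot>\<^sub>m l0 + ((- (t / d)) \<cdot>\<^sub>m l0 + l) = l"
          if "l \<in> L" for l
          by (rule cancel[OF that l0(1)])+
      qed (use add[OF smult[OF l0(1)]] in auto)
    qed
    also have "\<dots> = (\<Sum>l\<in>L. \<psi> t * \<psi> (d * v l))" by (intro sum.cong refl shift)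
    also have "\<dots> = \<psi> t * (\<Sum>l\<in>L. \<psi> (d * v l))" by (rule sum_distrib_left[symmetric])
    finally have "(1 - \<psi> t) * (\<Sum>l\<in>L. \<psi> (d * v l)) = 0" unfolding left_diff_distrib by simp
    then have "(\<Sum>l\<in>L. \<psi> (d * v l)) = 0" using t unfolding mult_eq_0_iff by simp
    then show ?thesis using False by (simp only: if_False)
  qed
  then show "(\<Sum>l\<in>left_null n N. \<psi> (d * (l * w) $$ (0, 0))) =
    (if left_null2 n N w = left_null n N then of_nat (card (left_null n N)) else 0)" unfolding v_def L_def .
  assume "left_null2 n N w \<noteq> left_null n N"
  then have ne: "left_null2 n N w \<noteq> L" by (simp add: L_def)
  obtain l0 where l0: "l0 \<in> L" "v l0 = 1" using unit[OF ne] by blast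
  have v: "v (s \<cdot>\<^sub>m l0 + l) = s + v l" if "l \<in> L" for s l
    unfolding v_add[OF smult[OF l0(1)] that] v_smult[OF l0(1)] l0(2) by simp
  have "bij_betw (\<lambda>(s, l). s \<cdot>\<^sub>m l0 + l) ((UNIV :: 'a set) \<times> {l \<in> L. v l = 0}) L"
  proof (rule bij_betw_byWitness[of _ "\<lambda>l. (v l, (- v l) \<cdot>\<^sub>m l0 + l)"])
    show "\<forall>p\<in>(UNIV :: 'a set) \<times> {l \<in> L. v l = 0}.
        (\<lambda>l. (v l, (- v l) \<cdot>\<^sub>m l0 + l)) (case p of (s, l) \<Rightarrow> s \<cdot>\<^sub>m l0 + l) = p"
      using v cancel(1)[OF _ l0(1)] by auto
    show "\<forall>l\<in>L. (case (v l, (- v l) \<cdot>\<^sub>m l0 + l) of (s, l) \<Rightarrow> s \<cdot>\<^sub>m l0 + l) = l"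
      using cancel(2)[OF _ l0(1)] by auto
    show "(\<lambda>(s, l). s \<cdot>\<^sub>m l0 + l) ` ((UNIV :: 'a set) \<times> {l \<in> L. v l = 0}) \<subseteq> L"
      using add smult[OF l0(1)] by auto
    show "(\<lambda>l. (v l, (- v l) \<cdot>\<^sub>m l0 + l)) ` L \<subseteq> (UNIV :: 'a set) \<times> {l \<in> L. v l = 0}"
      using add smult[OF l0(1)] v by auto
  qed
  from bij_betw_same_card[OF this] show "card (left_null n N) = CARD('a) * card (left_null2 n N w)"
    unfolding L2 L_def[symmetric] card_cartesian_product by (rule sym)
qed

text \<open>The sign is (-1)^(n-k), written with n + k to avoid truncated subtraction.\<close>

definition gg_val :: "complex \<Rightarrow> nat \<Rightarrow> nat \<Rightarrow> complex" where
  "gg_val q n k = (-1) ^ (n + k) * (\<Prod>i<k. q ^ Suc i - 1)"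

text \<open>Induction over the last row l of the inverse. With q^(r+1) elements in the left null
  space of N, all fibres over l \<noteq> 0 give the same value for n and r, up to the factor
  \<psi>(c l w). Summed over l \<noteq> 0 this factor yields q^(r+1) - 1 if w imposes no condition
  on the null space, and -1 if it does; these are the steps of \<open>gg_val\<close> to k = r + 1
  and to k = r. The sum over b adds the factor q^n.\<close>

theorem gg_sum_value:
  fixes N :: "'a::{finite,field} mat"
  assumes \<psi>: "additive_char \<psi>" "\<exists>x. \<psi> x \<noteq> 1"
    and c: "\<And>i. i \<in> {1..n} \<Longrightarrow> c i \<noteq> 0"
    and N: "N \<in> carrier_mat n n" and w: "w \<in> carrier_mat n 1" and nil: "row_nilpotent n N"
    and k: "card (left_null2 n N w) = CARD('a) ^ k"
  shows "gg_sum \<psi> c n N w = (\<Prod>i<n. of_nat CARD('a) ^ i) * gg_val (of_nat CARD('a)) n k"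
  using c N w nil k
proof (induction n arbitrary: N w k)
  case 0
  have one: "M = 1\<^sub>m 0" if "M \<in> carrier_mat 0 0" for M :: "'a mat" using that by (intro eq_matI) auto
  have "GL_pairs 0 = {(1\<^sub>m 0, 1\<^sub>m 0 :: 'a mat)}"
    using one by (auto simp: GL_pairs_def)
  moreover have "left_null2 0 N w = {0\<^sub>m 1 0}"
  proof -
    have "l = 0\<^sub>m 1 0" if "l \<in> carrier_mat 1 0" for l :: "'a mat" using that by (intro eq_matI) auto
    moreover have "0\<^sub>m 1 0 \<in> left_null2 0 N w" using 0 by (simp add: left_null2_def left_null_def)
    ultimately show ?thesis by (auto simp: left_null2_def left_null_def)
  qed
  then have "k = 0" using 0(5) card_field_ge_2[where 'a = 'a] by (cases k) auto
  ultimately show ?case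
    by (simp add: gg_sum_def gg_term_def gg_last_def gg_weight_def strictly_upper_def gg_val_def)
next
  case (Suc n)
  let ?m = "Suc n" and ?q = "of_nat CARD('a) :: complex"
  note N = Suc.prems(2) and w = Suc.prems(3)
  let ?L = "left_null ?m N" and ?z = "0\<^sub>m 1 ?m :: 'a mat"
  have z: "?z \<in> ?L" using N by (simp add: left_null_def)
  have q2: "CARD('a) \<ge> 2" by (rule card_field_ge_2)
  obtain l where "l \<in> ?L" "l \<noteq> ?z" using left_null_nontrivial[OF N Suc.prems(4)] by blast
  have "card ?L > 1"
  proof -
    have "card {?z, l} \<le> card ?L" using z \<open>l \<in> ?L\<close> by (intro card_mono finite_left_null) auto
    then show ?thesis using \<open>l \<noteq> ?z\<close> by simp
  qed
  \<comment> \<open>If w imposes no condition then k > 0, as nilpotency makes the null space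
    nonzero; otherwise the condition costs one factor q.\<close>
  have "\<exists>r. card ?L = CARD('a) ^ Suc r \<and> k = (if left_null2 ?m N w = ?L then Suc r else r)"
  proof (cases "left_null2 ?m N w = ?L")
    case True
    then show ?thesis using \<open>card ?L > 1\<close> Suc.prems(5) by (cases k) auto
  next
    case False
    then show ?thesis using left_null_character_sum(2)[OF \<psi> _ N w False, of 1] Suc.prems(5) by auto
  qed
  then obtain r where r: "card ?L = CARD('a) ^ Suc r" "k = (if left_null2 ?m N w = ?L then Suc r else r)" by blast
  have fiber: "(\<Sum>(x, y)\<in>{(x, y) \<in> GL_pairs ?m. lrow n y = l}. gg_term \<psi> c ?m (y * N * x) * gg_last \<psi> c ?m (y * w)) =
      \<psi> (c ?m * (l * w) $$ (0, 0)) * (?q ^ n * ((\<Prod>i<n. ?q ^ i) * gg_val ?q n r))"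
    if l: "l \<in> ?L - {?z}" for l
  proof -
    have lc: "l \<in> carrier_mat 1 ?m" "l * N = ?z" using l by (auto simp: left_null_def)
    obtain P Q where PQ: "(P, Q) \<in> GL_pairs ?m" "lrow n Q = l" using exists_lrow[OF lc(1)] l by auto
    have PQc: "P \<in> carrier_mat ?m ?m" "Q \<in> carrier_mat ?m ?m" using PQ by (auto simp: GL_pairs_def)
    have N'c: "Q * N * P \<in> carrier_mat ?m ?m" using PQc N by auto
    have "lrow n (Q * N * P) = l * N * P"
      using PQc N lrow_mult[of "Q * N" n ?m P ?m] lrow_mult[of Q n ?m N ?m] PQ(2) by auto
    then have "lrow n (Q * N * P) = ?z" unfolding lc(2) using PQc by simp
    then have zero: "(Q * N * P) $$ (n, j) = 0" if "j < ?m" for j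
    proof -
      have "(Q * N * P) $$ (n, j) = lrow n (Q * N * P) $$ (0, j)"
        using that carrier_matD(2)[OF N'c] by (simp add: lrow_def del: index_mult_mat)
      then show ?thesis using \<open>lrow n (Q * N * P) = ?z\<close> that by simp
    qed
    define A where "A = mat n n (\<lambda>p. (Q * N * P) $$ p)"
    define v where "v = mat n 1 (\<lambda>(i, j). (Q * N * P) $$ (i, n))"
    have A: "A \<in> carrier_mat n n" and v: "v \<in> carrier_mat n 1" by (simp_all add: A_def v_def)
    have N': "Q * N * P = blk n A v 0" unfolding A_def v_def by (rule blk_eqI[OF N'c]) (auto intro: zero simp del: index_mult_mat(1))
    have nilA: "row_nilpotent n A"
      by (rule row_nilpotent_blk[OF A v]) (use row_nilpotent_conj[OF PQ(1) N Suc.prems(4)] N' in simp)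
    have "CARD('a) * card (left_null2 n A v) = card (left_null ?m (Q * N * P))"
      unfolding N' by (rule left_null_blk[OF A v, symmetric])
    also have "\<dots> = card ?L" using bij_betw_same_card[OF left_null_conj[OF PQ(1) N]] ..
    finally have "card (left_null2 n A v) = CARD('a) ^ r" using r(1) q2 by simp
    then have "gg_sum \<psi> c n A (A * b + v) = (\<Prod>i<n. ?q ^ i) * gg_val ?q n r" if "b \<in> carrier_mat n 1" for b
      using that A v Suc.prems(1) by (intro Suc.IH nilA) (auto simp: left_null2_shift)
    then show ?thesis
      using gg_sum_fiber[OF N w PQ(1) A v N', of \<psi> c] unfolding PQ(2)
      by (simp add: card_carrier_col del: index_mult_mat(1))
  qed
  \<comment> \<open>The omitted zero row accounts for the -1.\<close>
  have ch: "(\<Sum>l\<in>?L - {?z}. \<psi> (c ?m * (l * w) $$ (0, 0))) = (if left_null2 ?m N w = ?L then ?q ^ Suc r else 0) - 1"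
  proof -
    have "(\<Sum>l\<in>?L - {?z}. \<psi> (c ?m * (l * w) $$ (0, 0))) =
        (\<Sum>l\<in>?L. \<psi> (c ?m * (l * w) $$ (0, 0))) - \<psi> (c ?m * (?z * w) $$ (0, 0))"
      by (rule sum_diff1[OF finite_left_null, THEN trans]) (simp add: z del: index_mult_mat(1))
    also have "\<psi> (c ?m * (?z * w) $$ (0, 0)) = 1" using w additive_char_0[OF \<psi>(1)] by simp
    also have "(\<Sum>l\<in>?L. \<psi> (c ?m * (l * w) $$ (0, 0))) = (if left_null2 ?m N w = ?L then ?q ^ Suc r else 0)"
      using left_null_character_sum(1)[OF \<psi> _ N w, of "c ?m"] Suc.prems(1)[of ?m] r(1) by (simp del: index_mult_mat(1))
    finally show ?thesis .
  qed
  have "gg_sum \<psi> c ?m N w = (\<Sum>l\<in>?L - {?z}. \<psi> (c ?m * (l * w) $$ (0, 0)) * (?q ^ n * ((\<Prod>i<n. ?q ^ i) * gg_val ?q n r)))"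
    unfolding gg_sum_split[OF N] by (intro sum.cong refl fiber)
  also have "\<dots> = ((if left_null2 ?m N w = ?L then ?q ^ Suc r else 0) - 1) * (?q ^ n * ((\<Prod>i<n. ?q ^ i) * gg_val ?q n r))"
    unfolding sum_distrib_right[symmetric] ch ..
  also have "\<dots> = (\<Prod>i<?m. ?q ^ i) * gg_val ?q ?m k"
    using r(2) by (auto simp: gg_val_def mult_ac)
  finally show ?case .
qed

section \<open>From the group \<open>GL n\<close> to sums over inverse pairs\<close>

lemma GL_carrier: "x \<in> carrier (GL n) \<longleftrightarrow> (\<exists>y. (x, y) \<in> GL_pairs n)"
  by (auto simp: GL_def units_of_def Units_def ring_mat_def GL_pairs_def)

lemma GL_mult [simp]: "x \<otimes>\<^bsub>GL n\<^esub> y = x * y"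
  by (simp add: GL_def units_of_def ring_mat_def)

lemma GL_one [simp]: "\<one>\<^bsub>GL n\<^esub> = 1\<^sub>m n"
  by (simp add: GL_def units_of_def ring_mat_def)

lemma GL_pairs_unique:
  assumes "(x, y) \<in> GL_pairs n" "(x, y') \<in> GL_pairs n"
  shows "y = y'"
proof -
  have c: "x \<in> carrier_mat n n" "y \<in> carrier_mat n n" "y' \<in> carrier_mat n n" "y * x = 1\<^sub>m n" "x * y' = 1\<^sub>m n"
    using assms by (auto simp: GL_pairs_def)
  have "y = y * (x * y')" using c by simp
  also have "\<dots> = y * x * y'" by (rule assoc_mult_mat[OF c(2,1,3), symmetric])
  also have "\<dots> = y'" unfolding c(4) using c by simp
  finally show ?thesis .
qed

lemma GL_inv: "(x, y) \<in> GL_pairs n \<Longrightarrow> inv\<^bsub>GL n\<^esub> x = y"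
  unfolding m_inv_def
proof (rule the_equality)
  assume xy: "(x, y) \<in> GL_pairs n"
  then have "(y, x) \<in> GL_pairs n" by (auto simp: GL_pairs_def)
  then show "y \<in> carrier (GL n) \<and> x \<otimes>\<^bsub>GL n\<^esub> y = \<one>\<^bsub>GL n\<^esub> \<and> y \<otimes>\<^bsub>GL n\<^esub> x = \<one>\<^bsub>GL n\<^esub>"
    using xy by (auto simp: GL_carrier GL_pairs_def)
  fix y' assume "y' \<in> carrier (GL n) \<and> x \<otimes>\<^bsub>GL n\<^esub> y' = \<one>\<^bsub>GL n\<^esub> \<and> y' \<otimes>\<^bsub>GL n\<^esub> x = \<one>\<^bsub>GL n\<^esub>"
  then have "(x, y') \<in> GL_pairs n" using xy by (auto simp: GL_carrier GL_pairs_def)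
  then show "y' = y" using GL_pairs_unique xy by blast
qed

lemma unitriangular_iff:
  assumes S: "S \<in> carrier_mat n n"
  shows "1\<^sub>m n + S \<in> unitriangular n \<longleftrightarrow> strictly_upper n S"
proof
  assume U: "1\<^sub>m n + S \<in> unitriangular n"
  show "strictly_upper n S" unfolding strictly_upper_def
  proof (intro allI impI)
    fix i j assume ij: "i < n" "j \<le> i"
    have "(1\<^sub>m n + S) $$ (i, j) = (if i = j then 1 else 0)"
      using U ij S by (cases "i = j") (auto simp: unitriangular_def upper_triangular_def)
    then show "S $$ (i, j) = 0" using ij S by (auto split: if_splits)
  qed
next
  assume "strictly_upper n S"
  then show "1\<^sub>m n + S \<in> unitriangular n"
    using S by (auto simp: unitriangular_def upper_triangular_def strictly_upper_def)
qed

lemma linear_char_one_plus: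
  assumes "S \<in> carrier_mat n n"
  shows "linear_char \<psi> n c (1\<^sub>m n + S) = gg_weight \<psi> c n S"
  unfolding linear_char_def gg_weight_def using assms by (intro prod.cong) auto

lemma unitriangular_blk:
  assumes "A \<in> carrier_mat n n" "b \<in> carrier_mat n 1"
  shows "blk n A b s \<in> unitriangular (Suc n) \<longleftrightarrow> A \<in> unitriangular n \<and> s = 1"
proof -
  have c: "blk n A b s \<in> carrier_mat (Suc n) (Suc n)" using assms by simp
  have "blk n A b s $$ (i, j) = (if i < n then A $$ (i, j) else 0)" if "i < Suc n" "j < i" for i j
    using that assms by (simp add: blk_index)
  moreover have "blk n A b s $$ (i, i) = (if i < n then A $$ (i, i) else s)" if "i < Suc n" for i
    using that assms by (simp add: blk_index)
  ultimately show ?thesis using c carrier_matD[OF c] carrier_matD[OF assms(1)] assms(1)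
    unfolding unitriangular_def upper_triangular_def by (auto simp: less_Suc_eq)
qed

lemma card_unitriangular: "card (unitriangular n :: 'a::{finite,field} mat set) = (\<Prod>i<n. CARD('a) ^ i)"
proof (induction n)
  case 0
  have "(unitriangular 0 :: 'a mat set) = {1\<^sub>m 0}"
    by (auto simp: unitriangular_def upper_triangular_def)
  then show ?case by simp
next
  case (Suc n)
  have "bij_betw (\<lambda>(A, b). blk n A b 1) (unitriangular n \<times> carrier_mat n 1) (unitriangular (Suc n) :: 'a mat set)"
  proof (rule bij_betw_imageI)
    show "inj_on (\<lambda>(A, b). blk n A b 1) (unitriangular n \<times> (carrier_mat n 1 :: 'a mat set))"
    proof (rule inj_onI)
      fix p p' :: "'a mat \<times> 'a mat"
      assume p: "p \<in> unitriangular n \<times> carrier_mat n 1" "p' \<in> unitriangular n \<times> carrier_mat n 1"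
        and eq: "(\<lambda>(A, b). blk n A b 1) p = (\<lambda>(A, b). blk n A b 1) p'"
      then show "p = p'"
        using blk_inject[of "fst p" n "snd p" "fst p'" "snd p'" 1 1]
        by (auto simp: unitriangular_def case_prod_unfold prod_eq_iff)
    qed
    show "(\<lambda>(A, b). blk n A b 1) ` (unitriangular n \<times> carrier_mat n 1) = (unitriangular (Suc n) :: 'a mat set)"
    proof (intro equalityI subsetI)
      fix M :: "'a mat" assume "M \<in> (\<lambda>(A, b). blk n A b 1) ` (unitriangular n \<times> carrier_mat n 1)"
      then obtain A b where "M = blk n A b 1" "A \<in> unitriangular n" "b \<in> carrier_mat n 1" by auto
      then show "M \<in> unitriangular (Suc n)" using unitriangular_blk[of A n b 1] by (simp add: unitriangular_def)
    next
      fix M :: "'a mat" assume M: "M \<in> unitriangular (Suc n)"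
      then have c: "M \<in> carrier_mat (Suc n) (Suc n)" by (simp add: unitriangular_def)
      define A b where "A = mat n n (\<lambda>p. M $$ p)" and "b = mat n 1 (\<lambda>(i, j). M $$ (i, n))"
      have "M = blk n A b 1" unfolding A_def b_def
        by (rule blk_eqI[OF c]) (use M c in \<open>auto simp: unitriangular_def upper_triangular_def\<close>)
      moreover from this have "A \<in> unitriangular n" using M unitriangular_blk[of A n b 1] by (simp add: A_def b_def)
      moreover have "b \<in> carrier_mat n 1" by (simp add: b_def)
      ultimately show "M \<in> (\<lambda>(A, b). blk n A b 1) ` (unitriangular n \<times> carrier_mat n 1)" by force
    qed
  qed
  from bij_betw_same_card[OF this] show ?case
    by (simp add: card_cartesian_product card_carrier_col Suc)
qed

lemma conj_one_plus:
  fixes g :: "'a::field mat"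
  assumes xy: "(x, y) \<in> GL_pairs n" and g: "g \<in> carrier_mat n n"
  shows "y * g * x = 1\<^sub>m n + y * (g - 1\<^sub>m n) * x"
proof -
  have c: "x \<in> carrier_mat n n" "y \<in> carrier_mat n n" "y * x = 1\<^sub>m n" using xy by (auto simp: GL_pairs_def)
  have N: "g - 1\<^sub>m n \<in> carrier_mat n n" by (rule minus_carrier_mat) simp
  have "g = 1\<^sub>m n + (g - 1\<^sub>m n)" using g by (intro eq_matI) auto
  then have "y * g * x = y * (1\<^sub>m n + (g - 1\<^sub>m n)) * x" by simp
  also have "y * (1\<^sub>m n + (g - 1\<^sub>m n)) = y + y * (g - 1\<^sub>m n)"
    using mult_add_distrib_mat[OF c(2) one_carrier_mat N] c(2) by simp
  also have "(y + y * (g - 1\<^sub>m n)) * x = y * x + y * (g - 1\<^sub>m n) * x"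
    by (rule add_mult_distrib_mat[OF c(2) mult_carrier_mat[OF c(2) N] c(1)])
  finally show ?thesis unfolding c(3) .
qed

text \<open>A conjugate of g is unitriangular exactly if the corresponding conjugate of g - 1 is
  strictly upper triangular, and both have the same superdiagonal. The bordering column is 0; the
  update \<open>c(n := 1)\<close> supplies the nonzero coefficient at n that
  \<open>gg_sum_value\<close> asks for.\<close>

lemma induced_fun_gg_sum:
  fixes g :: "'a::{finite,field} mat"
  assumes g: "g \<in> carrier_mat n n" and \<psi>: "additive_char \<psi>"
  shows "induced_fun (GL n) (unitriangular n) (linear_char \<psi> n c) g =
    gg_sum \<psi> (c(n := 1)) n (g - 1\<^sub>m n) (0\<^sub>m n 1) / (\<Prod>i<n. of_nat CARD('a) ^ i)"
proof -
  let ?\<chi> = "linear_char \<psi> n c" and ?G = "GL n :: 'a mat monoid" and ?N = "g - 1\<^sub>m n"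
  have pairs: "inv\<^bsub>?G\<^esub> x \<otimes>\<^bsub>?G\<^esub> g \<otimes>\<^bsub>?G\<^esub> x = 1\<^sub>m n + y * ?N * x" if "(x, y) \<in> GL_pairs n" for x y
    using conj_one_plus[OF that g] by (simp add: GL_inv[OF that])
  have S: "y * ?N * x \<in> carrier_mat n n" if "(x, y) \<in> GL_pairs n" for x y
    using that by (auto simp: GL_pairs_def intro!: mult_carrier_mat[of _ n n] minus_carrier_mat)
  have "(\<Sum>x\<in>{x \<in> carrier ?G. inv\<^bsub>?G\<^esub> x \<otimes>\<^bsub>?G\<^esub> g \<otimes>\<^bsub>?G\<^esub> x \<in> unitriangular n}.
      ?\<chi> (inv\<^bsub>?G\<^esub> x \<otimes>\<^bsub>?G\<^esub> g \<otimes>\<^bsub>?G\<^esub> x)) =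
    (\<Sum>p\<in>{p \<in> GL_pairs n. strictly_upper n (snd p * ?N * fst p)}. gg_weight \<psi> c n (snd p * ?N * fst p))"
  proof (rule sum.reindex_bij_witness[of _ fst "\<lambda>x. (x, inv\<^bsub>?G\<^esub> x)"], goal_cases)
    case (2 x)
    then obtain y where xy: "(x, y) \<in> GL_pairs n" by (auto simp: GL_carrier)
    show ?case using 2 pairs[OF xy] S[OF xy] GL_inv[OF xy] xy unitriangular_iff[OF S[OF xy]] by simp
  next
    case (3 p)
    then show ?case using GL_inv[of "fst p" "snd p" n] by (simp add: prod_eq_iff)
  next
    case (4 p)
    then have xy: "(fst p, snd p) \<in> GL_pairs n" by simp
    have "fst p \<in> carrier ?G" unfolding GL_carrier using xy by blast
    then show ?case using 4 pairs[OF xy] unitriangular_iff[OF S[OF xy]] by auto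
  next
    case (5 x)
    then obtain y where xy: "(x, y) \<in> GL_pairs n" by (auto simp: GL_carrier)
    show ?case unfolding pairs[OF xy] using linear_char_one_plus[OF S[OF xy], of \<psi> c] GL_inv[OF xy] by simp
  qed simp
  also have "\<dots> = gg_sum \<psi> (c(n := 1)) n ?N (0\<^sub>m n 1)"
  proof -
    have last: "gg_last \<psi> (c(n := 1)) n (y * 0\<^sub>m n 1) = 1" if "(x, y) \<in> GL_pairs n" for x y
    proof (cases "n = 0")
      case False
      have "y * 0\<^sub>m n 1 = 0\<^sub>m n 1" using that by (auto simp: GL_pairs_def)
      then show ?thesis using False additive_char_0[OF \<psi>] by (simp add: gg_last_def del: index_mult_mat(1))
    qed (simp add: gg_last_def)
    have weight: "gg_weight \<psi> (c(n := 1)) n M = gg_weight \<psi> c n M" for M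
      unfolding gg_weight_def by (intro prod.cong) auto
    have "gg_sum \<psi> (c(n := 1)) n ?N (0\<^sub>m n 1) = (\<Sum>p\<in>GL_pairs n. gg_term \<psi> (c(n := 1)) n (snd p * ?N * fst p))"
      unfolding gg_sum_def
    proof (rule sum.cong[OF refl])
      fix p :: "'a mat \<times> 'a mat" assume "p \<in> GL_pairs n"
      then have "(fst p, snd p) \<in> GL_pairs n" by simp
      then show "(case p of (x, y) \<Rightarrow> gg_term \<psi> (c(n := 1)) n (y * ?N * x) * gg_last \<psi> (c(n := 1)) n (y * 0\<^sub>m n 1)) =
          gg_term \<psi> (c(n := 1)) n (snd p * ?N * fst p)"
        using last[of "fst p" "snd p"] by (simp add: case_prod_unfold)
    qed
    also have "\<dots> = (\<Sum>p\<in>{p \<in> GL_pairs n. strictly_upper n (snd p * ?N * fst p)}. gg_weight \<psi> c n (snd p * ?N * fst p))"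
      by (rule sum.mono_neutral_cong_right) (auto simp: finite_GL_pairs gg_term_def weight)
    finally show ?thesis by simp
  qed
  finally show ?thesis unfolding induced_fun_def by (simp add: card_unitriangular)
qed

lemma row_nilpotent_iff_pow:
  assumes N: "N \<in> carrier_mat n n"
  shows "row_nilpotent n N \<longleftrightarrow> (\<exists>m. N ^\<^sub>m m = 0\<^sub>m n n)"
proof -
  have pc: "N ^\<^sub>m k \<in> carrier_mat n n" for k by (rule pow_carrier_mat[OF N])
  have iter: "((\<lambda>r. r * N) ^^ k) l = l * N ^\<^sub>m k" if "l \<in> carrier_mat 1 n" for l k
  proof (induction k)
    case 0
    show ?case using that N by simp
  next
    case (Suc k)
    then show ?case using assoc_mult_mat[OF that pc[of k] N] by simp
  qed
  have "(\<forall>l\<in>carrier_mat 1 n. l * M = 0\<^sub>m 1 n) \<longleftrightarrow> M = 0\<^sub>m n n" if M: "M \<in> carrier_mat n n" for M :: "'a mat"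
  proof
    assume *: "\<forall>l\<in>carrier_mat 1 n. l * M = 0\<^sub>m 1 n"
    show "M = 0\<^sub>m n n"
    proof (rule eq_matI)
      fix i j assume "i < dim_row (0\<^sub>m n n :: 'a mat)" "j < dim_col (0\<^sub>m n n :: 'a mat)"
      then have ij: "i < n" "j < n" by auto
      let ?l = "mat 1 n (\<lambda>(a, k). if k = i then 1 else 0 :: 'a)"
      have "(?l * M) $$ (0, j) = (\<Sum>k<n. ?l $$ (0, k) * M $$ (k, j))"
        by (rule mat_mult_index[OF _ M]) (use ij in auto)
      also have "\<dots> = (\<Sum>k<n. if k = i then M $$ (k, j) else 0)"
        by (intro sum.cong) auto
      also have "\<dots> = M $$ (i, j)" using ij by (simp add: sum.delta)
      finally show "M $$ (i, j) = 0\<^sub>m n n $$ (i, j)" using * ij by simp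
    qed (use M in auto)
  next
    assume "M = 0\<^sub>m n n"
    then show "\<forall>l\<in>carrier_mat 1 n. l * M = 0\<^sub>m 1 n" by simp
  qed
  then show ?thesis unfolding row_nilpotent_def using iter pc by simp
qed

text \<open>After k multiplications the first k entries of a row are zero.\<close>

lemma strictly_upper_nilpotent:
  assumes S: "S \<in> carrier_mat n n" "strictly_upper n S"
  shows "row_nilpotent n S"
proof -
  have iter: "((\<lambda>r. r * S) ^^ k) l \<in> carrier_mat 1 n \<and> (\<forall>j<n. j < k \<longrightarrow> ((\<lambda>r. r * S) ^^ k) l $$ (0, j) = 0)"
    if "l \<in> carrier_mat 1 n" for l k
  proof (induction k)
    case (Suc k)
    let ?r = "((\<lambda>r. r * S) ^^ k) l"
    have r: "?r \<in> carrier_mat 1 n" "\<And>j. j < n \<Longrightarrow> j < k \<Longrightarrow> ?r $$ (0, j) = 0" using Suc by auto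
    have "(?r * S) $$ (0, j) = 0" if j: "j < n" "j < Suc k" for j
    proof -
      have "(?r * S) $$ (0, j) = (\<Sum>i<n. ?r $$ (0, i) * S $$ (i, j))"
        by (rule mat_mult_index[OF r(1) S(1)]) (use j in auto)
      also have "\<dots> = 0"
      proof (rule sum.neutral, intro ballI)
        fix i assume "i \<in> {..<n}"
        then show "?r $$ (0, i) * S $$ (i, j) = 0"
          using r(2)[of i] S(2) j by (cases "i < k") (auto simp: strictly_upper_def)
      qed
      finally show ?thesis .
    qed
    then show ?case using mult_carrier_mat[OF r(1) S(1)] by simp
  qed (use that in auto)
  have "((\<lambda>r. r * S) ^^ n) l = 0\<^sub>m 1 n" if "l \<in> carrier_mat 1 n" for l
    using iter[OF that, of n] by (intro eq_matI) auto
  then show ?thesis unfolding row_nilpotent_def by blast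
qed

text \<open>A unitriangular conjugate would make g - 1 conjugate to a nilpotent matrix, so the sum
  in \<open>induced_fun\<close> is empty.\<close>

lemma induced_fun_not_unipotent:
  fixes g :: "'a::{finite,field} mat"
  assumes g: "g \<in> carrier_mat n n" and nil: "\<not> row_nilpotent n (g - 1\<^sub>m n)"
  shows "induced_fun (GL n) (unitriangular n) \<chi> g = 0"
proof -
  let ?G = "GL n :: 'a mat monoid" and ?N = "g - 1\<^sub>m n"
  have N: "?N \<in> carrier_mat n n" by (rule minus_carrier_mat) simp
  have "inv\<^bsub>?G\<^esub> x \<otimes>\<^bsub>?G\<^esub> g \<otimes>\<^bsub>?G\<^esub> x \<notin> unitriangular n" if x: "x \<in> carrier ?G" for x
  proof
    assume U: "inv\<^bsub>?G\<^esub> x \<otimes>\<^bsub>?G\<^esub> g \<otimes>\<^bsub>?G\<^esub> x \<in> unitriangular n"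
    obtain y where xy: "(x, y) \<in> GL_pairs n" using x by (auto simp: GL_carrier)
    then have yx: "(y, x) \<in> GL_pairs n" by (auto simp: GL_pairs_def)
    have c: "x \<in> carrier_mat n n" "y \<in> carrier_mat n n" "x * y = 1\<^sub>m n" using xy by (auto simp: GL_pairs_def)
    have S: "y * ?N * x \<in> carrier_mat n n" using c N by auto
    have "strictly_upper n (y * ?N * x)"
      using U conj_one_plus[OF xy g] GL_inv[OF xy] unitriangular_iff[OF S] by simp
    then have "row_nilpotent n (y * ?N * x)" using strictly_upper_nilpotent[OF S] by simp
    then have "row_nilpotent n (x * (y * ?N * x) * y)" by (rule row_nilpotent_conj[OF yx S])
    also have "x * (y * ?N * x) * y = (x * y) * ?N * (x * y)"
      using c(1,2) N by (simp add: assoc_mult_mat[of _ n n _ n _ n])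
    also have "\<dots> = ?N" unfolding c(3) using N by simp
    finally show False using nil by simp
  qed
  then have "{x \<in> carrier ?G. inv\<^bsub>?G\<^esub> x \<otimes>\<^bsub>?G\<^esub> g \<otimes>\<^bsub>?G\<^esub> x \<in> unitriangular n} = {}" by blast
  then show ?thesis unfolding induced_fun_def by (simp only: sum.empty mult_zero_right)
qed

theorem induced_fun_unipotent:
  fixes g :: "'a::{finite,field} mat"
  assumes \<psi>: "additive_char \<psi>" "\<exists>x. \<psi> x \<noteq> 1" and c: "\<forall>i\<in>{1..<n}. c i \<noteq> 0"
    and g: "g \<in> carrier_mat n n" and nil: "row_nilpotent n (g - 1\<^sub>m n)"
    and k: "card (left_null n (g - 1\<^sub>m n)) = CARD('a) ^ k"
  shows "induced_fun (GL n) (unitriangular n) (linear_char \<psi> n c) g = gg_val (of_nat CARD('a)) n k"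
proof -
  have N: "g - 1\<^sub>m n \<in> carrier_mat n n" by (rule minus_carrier_mat) simp
  have "left_null2 n (g - 1\<^sub>m n) (0\<^sub>m n 1) = left_null n (g - 1\<^sub>m n)"
    by (auto simp: left_null2_def left_null_def)
  then have "gg_sum \<psi> (c(n := 1)) n (g - 1\<^sub>m n) (0\<^sub>m n 1) = (\<Prod>i<n. of_nat CARD('a) ^ i) * gg_val (of_nat CARD('a)) n k"
    using k c by (intro gg_sum_value[OF \<psi> _ N zero_carrier_mat nil]) auto
  then show ?thesis unfolding induced_fun_gg_sum[OF g \<psi>(1)]
    by (simp add: card_gt_0_iff)
qed

section \<open>Row rank and column rank\<close>

definition right_null :: "nat \<Rightarrow> 'a::field mat \<Rightarrow> 'a mat set" where
  "right_null n N = {v \<in> carrier_mat n 1. N * v = 0\<^sub>m n 1}"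

text \<open>The case N = 0 of \<open>left_null_character_sum\<close>, in which all rows belong to
  the null space.\<close>

lemma all_rows_character_sum:
  fixes w :: "'a::{finite,field} mat"
  assumes \<psi>: "additive_char \<psi>" "\<exists>x. \<psi> x \<noteq> 1" and w: "w \<in> carrier_mat n 1"
  shows "(\<Sum>l\<in>carrier_mat 1 n. \<psi> ((l * w) $$ (0, 0))) =
    (if w = 0\<^sub>m n 1 then of_nat (card (carrier_mat 1 n :: 'a mat set)) else 0)"
proof -
  have all: "left_null n (0\<^sub>m n n) = carrier_mat 1 n" by (auto simp: left_null_def)
  have "left_null2 n (0\<^sub>m n n) w = left_null n (0\<^sub>m n n) \<longleftrightarrow> w = 0\<^sub>m n 1"
  proof
    assume "left_null2 n (0\<^sub>m n n) w = left_null n (0\<^sub>m n n)"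
    then have *: "l * w = 0\<^sub>m 1 1" if "l \<in> carrier_mat 1 n" for l using that by (auto simp: left_null2_def all)
    show "w = 0\<^sub>m n 1"
    proof (rule eq_matI)
      fix i j assume "i < dim_row (0\<^sub>m n 1 :: 'a mat)" "j < dim_col (0\<^sub>m n 1 :: 'a mat)"
      then have ij: "i < n" "j = 0" by auto
      let ?l = "mat 1 n (\<lambda>(a, k). if k = i then 1 else 0 :: 'a)"
      have "(?l * w) $$ (0, 0) = (\<Sum>k<n. ?l $$ (0, k) * w $$ (k, 0))"
        by (rule mat_mult_index[OF _ w]) auto
      also have "\<dots> = (\<Sum>k<n. if k = i then w $$ (k, 0) else 0)"
        by (intro sum.cong) auto
      also have "\<dots> = w $$ (i, 0)" using ij by (simp add: sum.delta)
      finally show "w $$ (i, j) = 0\<^sub>m n 1 $$ (i, j)" using *[of ?l] ij by simp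
    qed (use w in auto)
  next
    assume "w = 0\<^sub>m n 1"
    then show "left_null2 n (0\<^sub>m n n) w = left_null n (0\<^sub>m n n)" by (auto simp: left_null2_def left_null_def)
  qed
  then show ?thesis
    using left_null_character_sum(1)[OF \<psi>, of 1 "0\<^sub>m n n" n w] w unfolding all by (simp del: index_mult_mat(1))
qed

text \<open>Row rank equals column rank: evaluate the sum of \<open>\<psi>(l N v)\<close> over all rows \<open>l\<close> and columns
  \<open>v\<close> in both orders.\<close>

lemma card_left_null_eq_right_null:
  fixes N :: "'a::{finite,field} mat" and \<psi> :: "'a \<Rightarrow> complex"
  assumes \<psi>: "additive_char \<psi>" "\<exists>x. \<psi> x \<noteq> 1" and N: "N \<in> carrier_mat n n"
  shows "card (left_null n N) = card (right_null n N)"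
proof -
  let ?R = "carrier_mat 1 n :: 'a mat set" and ?C = "carrier_mat n 1 :: 'a mat set"
  let ?f = "\<lambda>l v. \<psi> ((l * (N * v)) $$ (0, 0))"
  have card0: "card ?R > 0" using zero_carrier_mat[of 1 n] finite_carrier_mat[of 1 n, where 'a = 'a]
    by (auto simp: card_gt_0_iff)
  have "(\<Sum>v\<in>?C. \<Sum>l\<in>?R. ?f l v) = (\<Sum>v\<in>?C. if N * v = 0\<^sub>m n 1 then of_nat (card ?R) else 0)"
    by (rule sum.cong[OF refl], rule all_rows_character_sum[OF \<psi>]) (use N in auto)
  also have "\<dots> = of_nat (card (right_null n N)) * of_nat (card ?R)"
    unfolding right_null_def by (subst sum.inter_filter[symmetric]) (auto simp: finite_carrier_mat)
  finally have 1: "(\<Sum>v\<in>?C. \<Sum>l\<in>?R. ?f l v) = of_nat (card (right_null n N)) * of_nat (card ?R)" .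
  have inner: "(\<Sum>v\<in>?C. ?f l v) = (if l * N = 0\<^sub>m 1 n then of_nat (card ?R) else 0)" if l: "l \<in> ?R" for l
  proof -
    have lN: "l * N \<in> carrier_mat 1 n" using l N by auto
    have tr: "transpose_mat (l * N) = 0\<^sub>m n 1 \<longleftrightarrow> l * N = 0\<^sub>m 1 n"
    proof -
      have "transpose_mat (0\<^sub>m a b :: 'a mat) = 0\<^sub>m b a" for a b by (rule eq_matI) auto
      then show ?thesis by (metis transpose_transpose)
    qed
    have "(\<Sum>v\<in>?C. ?f l v) = (\<Sum>r\<in>?R. \<psi> ((r * transpose_mat (l * N)) $$ (0, 0)))"
    proof (rule sum.reindex_bij_witness[of _ transpose_mat transpose_mat])
      fix v assume v: "v \<in> ?C"
      have "l * (N * v) = l * N * v" by (rule assoc_mult_mat[OF l N v, symmetric])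
      moreover have "transpose_mat v * transpose_mat (l * N) = transpose_mat (l * N * v)"
        by (rule transpose_mult[OF lN v, symmetric])
      moreover have "transpose_mat (l * N * v) $$ (0, 0) = (l * N * v) $$ (0, 0)"
        using lN v by (intro index_transpose_mat(1)) auto
      ultimately show "\<psi> ((transpose_mat v * transpose_mat (l * N)) $$ (0, 0)) = ?f l v" by simp
    qed auto
    also have "\<dots> = (if transpose_mat (l * N) = 0\<^sub>m n 1 then of_nat (card ?R) else 0)"
      by (rule all_rows_character_sum[OF \<psi>]) (use lN in auto)
    finally show ?thesis unfolding tr .
  qed
  have "(\<Sum>v\<in>?C. \<Sum>l\<in>?R. ?f l v) = (\<Sum>l\<in>?R. \<Sum>v\<in>?C. ?f l v)" by (rule sum.swap)
  also have "\<dots> = (\<Sum>l\<in>?R. if l * N = 0\<^sub>m 1 n then of_nat (card ?R) else 0)"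
    by (rule sum.cong[OF refl inner])
  also have "\<dots> = of_nat (card (left_null n N)) * of_nat (card ?R)"
    unfolding left_null_def by (subst sum.inter_filter[symmetric]) (auto simp: finite_carrier_mat)
  finally have "of_nat (card (left_null n N)) * of_nat (card ?R) = (of_nat (card (right_null n N)) * of_nat (card ?R) :: complex)"
    using 1 by simp
  then show ?thesis using card0 by (simp flip: of_nat_mult)
qed

section \<open>Conjugacy classes\<close>

lemma Phi_degree: "f \<in> Phi \<Longrightarrow> degree f \<ge> 1"
proof -
  assume f: "f \<in> Phi"
  then have "f \<noteq> 0" "\<not> is_unit f" by (auto simp: Phi_def irreducible_def)
  then show ?thesis using is_unit_iff_degree[of f] by simp
qed

lemma Phi_power_monic:
  assumes "f \<in> Phi"
  shows "lead_coeff (f ^ a) = 1" "degree (f ^ a) = degree f * a" "f ^ a \<noteq> 0"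
proof -
  have f: "f \<noteq> 0" "lead_coeff f = 1" using assms by (auto simp: Phi_def)
  then show "lead_coeff (f ^ a) = 1" by (simp add: lead_coeff_power)
  show "degree (f ^ a) = degree f * a" using f by (simp add: degree_power_eq mult.commute)
  show "f ^ a \<noteq> 0" using f by simp
qed

text \<open>A zero constant term would make x a factor of the irreducible f, but x is excluded from
  \<open>Phi\<close>. This is what makes multiplication by x invertible on the modules.\<close>

lemma Phi_poly_0:
  assumes f: "f \<in> Phi"
  shows "poly f 0 \<noteq> 0"
proof
  assume "poly f 0 = 0"
  then obtain h where h: "f = [:0, 1:] * h" using poly_eq_0_iff_dvd[of f 0] by auto
  have irr: "irreducible f" and lc: "lead_coeff f = 1" and ne: "f \<noteq> [:0, 1:]" using f by (auto simp: Phi_def)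
  have "\<not> is_unit ([:0, 1:] :: 'a poly)" by (simp add: is_unit_iff_degree)
  then have "is_unit h" using irreducibleD[OF irr h] by blast
  then obtain d where d: "h = [:d:]" by (metis is_unit_polyE)
  then show False using h lc ne by (cases "d = 0") (auto simp: One_nat_def)
qed

lemma dvd_x_mult_cancel:
  fixes F :: "'a::field poly"
  assumes "poly F 0 \<noteq> 0" "F dvd [:0, 1:] * w"
  shows "F dvd w"
proof -
  obtain r where r: "[:0, 1:] * w = F * r" using assms(2) by auto
  have "poly F 0 * poly r 0 = poly ([:0, 1:] * w) 0" unfolding r by simp
  then have "poly r 0 = 0" using assms(1) by simp
  then obtain r' where r': "r = [:0, 1:] * r'" using poly_eq_0_iff_dvd[of r 0] by auto
  have "[:0, 1:] * w = [:0, 1:] * (F * r')" using r unfolding r' by (simp add: mult_ac)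
  then have "w = F * r'" by (simp del: mult_pCons_left)
  then show ?thesis by simp
qed

lemma mod_eq_self_iff:
  fixes F u :: "'a::field poly"
  assumes "F \<noteq> 0"
  shows "u mod F = u \<longleftrightarrow> (\<forall>k\<ge>degree F. coeff u k = 0)"
proof
  assume *: "u mod F = u"
  show "\<forall>k\<ge>degree F. coeff u k = 0"
  proof (intro allI impI)
    fix k assume "k \<ge> degree F"
    then show "coeff u k = 0" using degree_mod_less[OF assms, of u] * by (auto intro: coeff_eq_0)
  qed
next
  assume *: "\<forall>k\<ge>degree F. coeff u k = 0"
  show "u mod F = u"
  proof (cases "u = 0")
    case False
    then have "degree u < degree F" using * by (metis leading_coeff_neq_0 not_le)
    then show ?thesis by (rule mod_poly_less)
  qed simp
qed

lemma part_funs_PhiD: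
  assumes "\<mu> \<in> part_funs_Phi n"
  shows "finite {f. \<mu> f \<noteq> []}" "\<mu> f \<noteq> [] \<Longrightarrow> f \<in> Phi" "\<mu> f \<in> partitions"
    "(\<Sum>f | \<mu> f \<noteq> []. degree f * sum_list (\<mu> f)) = n"
  using assms by (auto simp: part_funs_Phi_def)

lemma finite_polys_degree_le: "finite {p :: 'a::{finite,field} poly. degree p \<le> n}"
proof (rule finite_subset)
  show "{p :: 'a poly. degree p \<le> n} \<subseteq> Poly ` {xs. set xs \<subseteq> UNIV \<and> length xs \<le> Suc n}"
  proof
    fix p :: "'a poly" assume "p \<in> {p. degree p \<le> n}"
    then have "length (coeffs p) \<le> Suc n" by (cases "p = 0") (auto simp: length_coeffs_degree)
    then show "p \<in> Poly ` {xs. set xs \<subseteq> UNIV \<and> length xs \<le> Suc n}"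
      by (intro image_eqI[of _ _ "coeffs p"]) auto
  qed
  show "finite (Poly ` {xs :: 'a list. set xs \<subseteq> UNIV \<and> length xs \<le> Suc n})"
    by (intro finite_imageI finite_lists_length_le) simp
qed

lemma finite_part_funs_Phi: "finite (part_funs_Phi n :: ('a::{finite,field} poly \<Rightarrow> nat list) set)"
proof (rule finite_subset)
  let ?A = "{p :: 'a poly. degree p \<le> n}" and ?B = "\<Union>m\<le>n. parts_of m"
  show "part_funs_Phi n \<subseteq> {\<mu>. \<forall>f. (f \<in> ?A \<longrightarrow> \<mu> f \<in> ?B) \<and> (f \<notin> ?A \<longrightarrow> \<mu> f = [])}"
  proof (intro subsetI CollectI allI)
    fix \<mu> :: "'a poly \<Rightarrow> nat list" and f assume \<mu>: "\<mu> \<in> part_funs_Phi n"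
    note D = part_funs_PhiD[OF \<mu>]
    show "(f \<in> ?A \<longrightarrow> \<mu> f \<in> ?B) \<and> (f \<notin> ?A \<longrightarrow> \<mu> f = [])"
    proof (cases "\<mu> f = []")
      case True
      then show ?thesis by (auto simp: parts_of_def partitions_def)
    next
      case False
      have "degree f * sum_list (\<mu> f) \<le> n"
        unfolding D(4)[symmetric] using D(1) False by (intro member_le_sum) auto
      moreover have "sum_list (\<mu> f) \<ge> 1"
        using False length_le_sum_list[of "\<mu> f"] D(3)[of f] by (cases "\<mu> f") (auto simp: partitions_def)
      moreover have "degree f \<ge> 1" by (rule Phi_degree[OF D(2)[OF False]])
      ultimately have "degree f \<le> n" "sum_list (\<mu> f) \<le> n"
        using mult_le_mono1[of 1 "degree f" "sum_list (\<mu> f)"]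
          mult_le_mono2[of 1 "sum_list (\<mu> f)" "degree f"] by linarith+
      then show ?thesis using D(3)[of f] by (auto simp: parts_of_def)
    qed
  qed
  show "finite {\<mu>. \<forall>f. (f \<in> ?A \<longrightarrow> \<mu> f \<in> ?B) \<and> (f \<notin> ?A \<longrightarrow> \<mu> f = [])}"
    by (intro finite_set_of_finite_funs finite_polys_degree_le) auto
qed

lemma card_right_null_vec:
  fixes N :: "'a::field mat"
  assumes N: "N \<in> carrier_mat n n"
  shows "card (right_null n N) = card {v \<in> carrier_vec n. N *\<^sub>v v = 0\<^sub>v n}"
proof -
  let ?V = "{v \<in> carrier_vec n. N *\<^sub>v v = 0\<^sub>v n}"
  have "bij_betw (\<lambda>M. col M 0) (right_null n N) ?V"
  proof (rule bij_betwI[of _ _ _ "\<lambda>v :: 'a vec. mat n 1 (\<lambda>(i, j). v $ i)"])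
    have iff: "N * M = 0\<^sub>m n 1 \<longleftrightarrow> N *\<^sub>v col M 0 = 0\<^sub>v n" if M: "M \<in> carrier_mat n 1" for M
    proof -
      have c: "col (N * M) 0 = N *\<^sub>v col M 0" using col_mult2[OF N M, of 0] by simp
      have "N * M = 0\<^sub>m n 1 \<longleftrightarrow> col (N * M) 0 = 0\<^sub>v n"
      proof
        assume *: "col (N * M) 0 = 0\<^sub>v n"
        show "N * M = 0\<^sub>m n 1"
        proof (rule eq_matI)
          fix i j assume "i < dim_row (0\<^sub>m n 1 :: 'a mat)" "j < dim_col (0\<^sub>m n 1 :: 'a mat)"
          then have ij: "i < n" "j = 0" by auto
          have "(N * M) $$ (i, 0) = col (N * M) 0 $ i" using ij M N by (intro index_col[symmetric]) auto
          then show "(N * M) $$ (i, j) = 0\<^sub>m n 1 $$ (i, j)" unfolding * using ij by simp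
        qed (use M N in auto)
      next
        assume *: "N * M = 0\<^sub>m n 1"
        show "col (N * M) 0 = 0\<^sub>v n" unfolding * by (intro eq_vecI) auto
      qed
      then show ?thesis unfolding c .
    qed
    show "(\<lambda>M. col M 0) \<in> right_null n N \<rightarrow> ?V" using iff by (auto simp: right_null_def)
    have colv: "col (mat n 1 (\<lambda>(i, j). v $ i)) 0 = v" if "v \<in> carrier_vec n" for v :: "'a vec"
      using that by (intro eq_vecI) auto
    show "(\<lambda>v :: 'a vec. mat n 1 (\<lambda>(i, j). v $ i)) \<in> ?V \<rightarrow> right_null n N"
      using iff colv by (auto simp: right_null_def)
    show "mat n 1 (\<lambda>(i, j). col M 0 $ i) = M" if "M \<in> right_null n N" for M :: "'a mat"
      using that by (intro eq_matI) (auto simp: right_null_def)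
    show "col (mat n 1 (\<lambda>(i, j). v $ i)) 0 = v" if "v \<in> ?V" for v :: "'a vec" using colv that by simp
  qed
  then show ?thesis by (rule bij_betw_same_card)
qed

text \<open>On F_q[x]/((x - 1)^a) the kernel of multiplication by x - 1 is the line spanned by (x -
  1)^(a-1), so each part of \<nu> contributes one dimension.\<close>

lemma card_unipotent_kernel:
  fixes \<mu> :: "'a::{finite,field} poly \<Rightarrow> nat list"
  assumes single: "\<And>f. \<mu> f = (if f = [:- 1, 1:] then \<nu> else [])" and \<nu>: "\<nu> \<in> partitions"
  shows "card {u \<in> elem_module \<mu>. \<forall>i<length \<nu>. ([:- 1, 1:] * u ([:- 1, 1:], i)) mod [:- 1, 1:] ^ (\<nu> ! i) = 0} =
    CARD('a) ^ length \<nu>"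
proof -
  let ?f = "[:- 1, 1:] :: 'a poly"
  let ?U = "{u \<in> elem_module \<mu>. \<forall>i<length \<nu>. (?f * u (?f, i)) mod ?f ^ (\<nu> ! i) = 0}"
  have pos: "\<nu> ! i \<ge> 1" if "i < length \<nu>" for i
  proof -
    have "\<nu> ! i \<noteq> 0" using \<nu> nth_mem[OF that] unfolding partitions_def by (metis (mono_tags, lifting) mem_Collect_eq)
    then show ?thesis by linarith
  qed
  have "card ?U = card (PiE {..<length \<nu>} (\<lambda>_. UNIV :: 'a set))"
  proof (rule bij_betw_same_card)
    let ?c = "\<lambda>u. \<lambda>i\<in>{..<length \<nu>}. coeff (u (?f, i)) (\<nu> ! i - 1)"
    let ?b = "\<lambda>c (f, i). if f = ?f \<and> i < length \<nu> then smult (c i) (?f ^ (\<nu> ! i - 1)) else 0"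
    note monic = Phi_power_monic[OF linear_in_Phi, where 'a = 'a]
    have lc: "coeff (?f ^ a) a = 1" for a using monic(1)[of a] monic(2)[of a] by simp
    have power: "?f ^ (\<nu> ! i) = ?f * ?f ^ (\<nu> ! i - 1)" if "i < length \<nu>" for i
    proof -
      have "\<nu> ! i = Suc (\<nu> ! i - 1)" using pos[OF that] by simp
      then show ?thesis by (metis power_Suc)
    qed
    have form: "u (?f, i) = smult (coeff (u (?f, i)) (\<nu> ! i - 1)) (?f ^ (\<nu> ! i - 1))"
      if u: "u \<in> ?U" and i: "i < length \<nu>" for u i
    proof -
      let ?w = "u (?f, i)"
      have "?w mod ?f ^ (\<nu> ! i) = ?w" using u i single[of ?f] by (auto simp: elem_module_def split: if_splits)
      then have deg: "\<forall>k\<ge>\<nu> ! i. coeff ?w k = 0" using mod_eq_self_iff[OF monic(3)] monic(2)[of "\<nu> ! i"] by simp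
      have "?f ^ (\<nu> ! i) dvd ?f * ?w" using u i by (simp add: mod_eq_0_iff_dvd del: mult_pCons_left)
      then have "?f * ?f ^ (\<nu> ! i - 1) dvd ?f * ?w" unfolding power[OF i] .
      then obtain r where "?f * ?w = ?f * ?f ^ (\<nu> ! i - 1) * r" by (rule dvdE)
      then have "?f * ?w = ?f * (?f ^ (\<nu> ! i - 1) * r)" by (simp only: mult.assoc)
      then have r: "?w = ?f ^ (\<nu> ! i - 1) * r" by (rule mult_left_cancel[THEN iffD1, rotated]) simp
      have "degree r = 0"
      proof (rule ccontr)
        assume "degree r \<noteq> 0"
        then have "r \<noteq> 0" by auto
        then have "degree ?w = \<nu> ! i - 1 + degree r" unfolding r using monic(2)[of "\<nu> ! i - 1"] by (subst degree_mult_eq) auto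
        then have "degree ?w \<ge> \<nu> ! i" using pos[OF i] \<open>degree r \<noteq> 0\<close> by linarith
        moreover have "?w \<noteq> 0" unfolding r using \<open>r \<noteq> 0\<close> by simp
        ultimately show False using deg leading_coeff_neq_0[of ?w] by auto
      qed
      then obtain d where d: "r = [:d:]" by (rule degree_eq_zeroE)
      have w: "?w = smult d (?f ^ (\<nu> ! i - 1))" unfolding r d by simp
      then have "coeff ?w (\<nu> ! i - 1) = d * coeff (?f ^ (\<nu> ! i - 1)) (\<nu> ! i - 1)" by simp
      also have "\<dots> = d" unfolding lc by simp
      finally have "coeff ?w (\<nu> ! i - 1) = d" .
      then show ?thesis using w by (simp only:)
    qed
    have out: "u (f, i) = 0" if "u \<in> ?U" "\<not> (f = ?f \<and> i < length \<nu>)" for u f i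
      using that single[of f] by (auto simp: elem_module_def split: if_splits)
    have b_mem: "?b c \<in> ?U" for c
    proof -
      have "smult (c i) (?f ^ (\<nu> ! i - 1)) mod ?f ^ (\<nu> ! i) = smult (c i) (?f ^ (\<nu> ! i - 1))" if "i < length \<nu>" for i
      proof (subst mod_eq_self_iff[OF monic(3)], intro allI impI)
        fix k assume "k \<ge> degree (?f ^ (\<nu> ! i))"
        then have "k > degree (?f ^ (\<nu> ! i - 1))" using monic(2)[of "\<nu> ! i"] monic(2)[of "\<nu> ! i - 1"] pos[OF that] by simp
        then show "coeff (smult (c i) (?f ^ (\<nu> ! i - 1))) k = 0" by (simp add: coeff_eq_0)
      qed
      then have "?b c \<in> elem_module \<mu>" unfolding elem_module_def single by auto
      moreover have "(?f * smult (c i) (?f ^ (\<nu> ! i - 1))) mod ?f ^ (\<nu> ! i) = 0" if "i < length \<nu>" for i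
        using power[OF that] by (simp add: mod_eq_0_iff_dvd dvd_smult del: mult_pCons_left)
      ultimately show ?thesis by (simp del: mult_pCons_left)
    qed
    show "bij_betw ?c ?U (PiE {..<length \<nu>} (\<lambda>_. UNIV :: 'a set))"
    proof (rule bij_betwI[of _ _ _ ?b])
      show "?c \<in> ?U \<rightarrow> (PiE {..<length \<nu>} (\<lambda>_. UNIV :: 'a set))" by auto
      show "?b \<in> (PiE {..<length \<nu>} (\<lambda>_. UNIV :: 'a set)) \<rightarrow> ?U" using b_mem by blast
      show "?b (?c u) = u" if u: "u \<in> ?U" for u
      proof
        fix p :: "'a poly \<times> nat"
        obtain f i where p: "p = (f, i)" by (cases p)
        show "?b (?c u) p = u p"
        proof (cases "f = ?f \<and> i < length \<nu>")
          case True
          then show ?thesis using form[OF u, of i] by (simp add: p)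
        next
          case False
          then show ?thesis using out[OF u False] by (auto simp: p)
        qed
      qed
      show "?c (?b c) = c" if "c \<in> PiE {..<length \<nu>} (\<lambda>_. UNIV)" for c
        using that lc by (auto simp: PiE_def extensional_def fun_eq_iff restrict_def)
    qed
  qed
  then show ?thesis by (simp only: card_PiE finite_lessThan prod_constant card_lessThan)
qed

text \<open>A matrix together with a module isomorphism \<open>T\<close> onto the standard module of
  type \<mu>, as extracted from membership in \<open>K_class\<close>.\<close>

locale class_rep =
  fixes \<mu> :: "'a::{finite,field} poly \<Rightarrow> nat list" and n :: nat and g :: "'a mat"
    and T :: "'a vec \<Rightarrow> 'a poly \<times> nat \<Rightarrow> 'a poly"
  assumes \<mu>: "\<mu> \<in> part_funs_Phi n" and g: "g \<in> carrier_mat n n"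
    and bij: "bij_betw T (carrier_vec n) (elem_module \<mu>)"
    and add: "\<And>v w. v \<in> carrier_vec n \<Longrightarrow> w \<in> carrier_vec n \<Longrightarrow> T (v + w) = (\<lambda>k. T v k + T w k)"
    and smult: "\<And>c v. v \<in> carrier_vec n \<Longrightarrow> T (c \<cdot>\<^sub>v v) = (\<lambda>k. smult c (T v k))"
    and equiv: "\<And>v. v \<in> carrier_vec n \<Longrightarrow> T (g *\<^sub>v v) = elem_module_x \<mu> (T v)"
begin

abbreviation "N \<equiv> g - 1\<^sub>m n"

lemma N: "N \<in> carrier_mat n n"
  by (rule minus_carrier_mat) simp

lemma T_mem: "v \<in> carrier_vec n \<Longrightarrow> T v \<in> elem_module \<mu>"
  using bij by (auto simp: bij_betw_def)

lemma T_inj: "v \<in> carrier_vec n \<Longrightarrow> w \<in> carrier_vec n \<Longrightarrow> T v = T w \<Longrightarrow> v = w"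
  using bij by (auto simp: bij_betw_def inj_on_def)

lemma T_zero: "T (0\<^sub>v n) = (\<lambda>_. 0)"
proof -
  have "(0 :: 'a) \<cdot>\<^sub>v 0\<^sub>v n = 0\<^sub>v n" by (rule eq_vecI) auto
  then show ?thesis using smult[of "0\<^sub>v n" 0] by simp
qed

lemma T_red: "v \<in> carrier_vec n \<Longrightarrow> i < length (\<mu> f) \<Longrightarrow> T v (f, i) mod f ^ (\<mu> f ! i) = T v (f, i)"
  using T_mem[of v] by (auto simp: elem_module_def split: if_splits)

lemma T_out: "v \<in> carrier_vec n \<Longrightarrow> \<not> i < length (\<mu> f) \<Longrightarrow> T v (f, i) = 0"
  using T_mem[of v] by (auto simp: elem_module_def split: if_splits)

lemma T_N:
  assumes v: "v \<in> carrier_vec n" and i: "i < length (\<mu> f)"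
  shows "T (N *\<^sub>v v) (f, i) = ([:- 1, 1:] * T v (f, i)) mod f ^ (\<mu> f ! i)"
proof -
  let ?F = "f ^ (\<mu> f ! i)" and ?u = "T v (f, i)"
  have gv: "g *\<^sub>v v \<in> carrier_vec n" using g v by auto
  have "N *\<^sub>v v = g *\<^sub>v v + (- 1) \<cdot>\<^sub>v v"
    using g v by (intro eq_vecI) (auto simp: minus_mult_distrib_mat_vec[of _ n n])
  then have "T (N *\<^sub>v v) (f, i) = T (g *\<^sub>v v) (f, i) + smult (- 1) ?u"
    using add[OF gv, of "(- 1) \<cdot>\<^sub>v v"] smult[OF v] v by simp
  also have "\<dots> = ([:0, 1:] * ?u) mod ?F - ?u"
    using i by (simp add: equiv[OF v] elem_module_x_def)
  also have "\<dots> = ([:0, 1:] * ?u) mod ?F - ?u mod ?F" using T_red[OF v i] by simp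
  also have "\<dots> = ([:0, 1:] * ?u - ?u) mod ?F" by (rule poly_mod_diff_left[symmetric])
  also have "[:0, 1:] * ?u - ?u = [:- 1, 1:] * ?u" by simp
  finally show ?thesis .
qed

lemma T_N_power:
  assumes "v \<in> carrier_vec n" "i < length (\<mu> f)"
  shows "T ((N ^\<^sub>m k) *\<^sub>v v) (f, i) = ([:- 1, 1:] ^ k * T v (f, i)) mod f ^ (\<mu> f ! i)"
  using assms
proof (induction k arbitrary: v)
  case 0
  then show ?case using T_red[of v i f] N by simp
next
  case (Suc k)
  have Nv: "N *\<^sub>v v \<in> carrier_vec n" using N Suc.prems by auto
  have "(N ^\<^sub>m Suc k) *\<^sub>v v = (N ^\<^sub>m k) *\<^sub>v (N *\<^sub>v v)"
    using assoc_mult_mat_vec[OF pow_carrier_mat[OF N] N Suc.prems(1)] by simp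
  then have "T ((N ^\<^sub>m Suc k) *\<^sub>v v) (f, i) = ([:- 1, 1:] ^ k * (([:- 1, 1:] * T v (f, i)) mod f ^ (\<mu> f ! i))) mod f ^ (\<mu> f ! i)"
    using Suc.IH[OF Nv Suc.prems(2)] T_N[OF Suc.prems] by simp
  then show ?case by (simp only: mod_mult_right_eq power_Suc2 mult.assoc)
qed

text \<open>Applied to the generator 1 of a summand F_q[x]/(f^a), nilpotency of N shows that f
  divides a power of x - 1. A root of f in the closure is then a root of x - 1, and
  \<open>Phi_unique\<close> identifies the two polynomials.\<close>

lemma nilpotent_imp_unipotent_type:
  assumes nil: "row_nilpotent n N" and f: "\<mu> f \<noteq> []"
  shows "f = [:- 1, 1:]"
proof -
  note D = part_funs_PhiD[OF \<mu>]
  have fP: "f \<in> Phi" by (rule D(2)[OF f])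
  obtain m where m: "N ^\<^sub>m m = 0\<^sub>m n n" using nil row_nilpotent_iff_pow[OF N] by blast
  let ?F = "f ^ (\<mu> f ! 0)"
  have a: "\<mu> f ! 0 \<noteq> 0" using D(3)[of f] f by (cases "\<mu> f") (auto simp: partitions_def)
  define u where "u p = (if p = (f, 0) then 1 else 0 :: 'a poly)" for p :: "'a poly \<times> nat"
  have "degree ?F > 0" using a Phi_power_monic(2)[OF fP] Phi_degree[OF fP] by simp
  then have one: "1 mod ?F = 1" by (intro mod_poly_less) simp
  have "u \<in> elem_module \<mu>" using f one by (auto simp: elem_module_def u_def)
  then have "u \<in> T ` carrier_vec n" using bij by (simp add: bij_betw_def)
  then obtain v where v: "v \<in> carrier_vec n" "T v = u" by blast
  have "([:- 1, 1:] ^ m * T v (f, 0)) mod ?F = T ((N ^\<^sub>m m) *\<^sub>v v) (f, 0)"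
    using T_N_power[OF v(1), of 0 f m] f by simp
  also have "(N ^\<^sub>m m) *\<^sub>v v = 0\<^sub>v n" unfolding m using v(1) by (intro eq_vecI) auto
  finally have "([:- 1, 1:] ^ m) mod ?F = 0" by (simp add: v u_def T_zero)
  then have "?F dvd [:- 1, 1:] ^ m" by (simp add: mod_eq_0_iff_dvd)
  moreover have "f dvd ?F" using a by (simp add: dvd_power)
  ultimately obtain h where h: "[:- 1, 1:] ^ m = f * h" by (meson dvd_trans dvdE)
  have "degree (map_poly to_ac f) > 0" using Phi_degree[OF fP] by simp
  then obtain z where z: "ac_eval f z = 0" using alg_closed_imp_poly_has_root by blast
  have pow: "ac_eval (p ^ k) z = ac_eval p z ^ k" for p :: "'a poly" and k
    by (induction k) (simp_all only: power_0 power_Suc ac_eval_1 ac_eval_mult)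
  have "ac_eval [:- 1, 1:] z ^ m = 0" unfolding pow[symmetric] h ac_eval_mult z by simp
  then have "ac_eval [:- 1, 1:] z = 0" by simp
  then show ?thesis using Phi_unique[OF fP linear_in_Phi z] by blast
qed

lemma unipotent_type_imp_nilpotent:
  assumes single: "\<And>f. \<mu> f = (if f = [:- 1, 1:] then \<nu> else [])"
  shows "row_nilpotent n N"
proof -
  define m where "m = sum_list \<nu>"
  have zero: "(N ^\<^sub>m m) *\<^sub>v v = 0\<^sub>v n" if v: "v \<in> carrier_vec n" for v
  proof -
    have Nmv: "(N ^\<^sub>m m) *\<^sub>v v \<in> carrier_vec n" by (rule mult_mat_vec_carrier[OF pow_carrier_mat[OF N] v])
    have "T ((N ^\<^sub>m m) *\<^sub>v v) (f, i) = 0" for f i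
    proof (cases "i < length (\<mu> f)")
      case True
      then have f: "f = [:- 1, 1:]" and i: "i < length \<nu>" using single[of f] by (auto split: if_splits)
      have "\<nu> ! i \<le> m" unfolding m_def using i by (intro member_le_sum_list) auto
      then have "f ^ (\<mu> f ! i) dvd [:- 1, 1:] ^ m * T v (f, i)"
        using single[of f] f by (intro dvd_mult2) (simp add: le_imp_power_dvd)
      then show ?thesis using T_N_power[OF v True, of m] by (simp add: mod_eq_0_iff_dvd)
    next
      case False
      then show ?thesis by (rule T_out[OF Nmv])
    qed
    then have "T ((N ^\<^sub>m m) *\<^sub>v v) = T (0\<^sub>v n)" unfolding T_zero by auto
    then show ?thesis using T_inj Nmv by simp
  qed
  have pc: "N ^\<^sub>m m \<in> carrier_mat n n" by (rule pow_carrier_mat[OF N])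
  have "N ^\<^sub>m m = 0\<^sub>m n n"
  proof (rule eq_matI)
    fix i j assume "i < dim_row (0\<^sub>m n n :: 'a mat)" "j < dim_col (0\<^sub>m n n :: 'a mat)"
    then have ij: "i < n" "j < n" by auto
    then have "(N ^\<^sub>m m) $$ (i, j) = ((N ^\<^sub>m m) *\<^sub>v unit_vec n j) $ i" using carrier_matD[OF pc] by simp
    then show "(N ^\<^sub>m m) $$ (i, j) = 0\<^sub>m n n $$ (i, j)" using zero[of "unit_vec n j"] ij by simp
  qed (use carrier_matD[OF pc] in auto)
  then show ?thesis using row_nilpotent_iff_pow[OF N] by blast
qed

lemma card_right_null:
  assumes single: "\<And>f. \<mu> f = (if f = [:- 1, 1:] then \<nu> else [])"
  shows "card (right_null n N) = CARD('a) ^ length \<nu>"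
proof -
  let ?f = "[:- 1, 1:] :: 'a poly"
  let ?V = "{v \<in> carrier_vec n. N *\<^sub>v v = 0\<^sub>v n}"
  have \<nu>: "\<nu> \<in> partitions" using part_funs_PhiD(3)[OF \<mu>, of ?f] single[of ?f] by simp
  have "card (right_null n N) = card ?V" by (rule card_right_null_vec[OF N])
  also have "\<dots> = card (T ` ?V)"
    using bij by (intro card_image[symmetric]) (auto simp: bij_betw_def inj_on_def)
  also have "T ` ?V = {u \<in> elem_module \<mu>. \<forall>i<length \<nu>. (?f * u (?f, i)) mod ?f ^ (\<nu> ! i) = 0}"
  proof -
    have "N *\<^sub>v v = 0\<^sub>v n \<longleftrightarrow> (\<forall>i<length \<nu>. (?f * T v (?f, i)) mod ?f ^ (\<nu> ! i) = 0)" if v: "v \<in> carrier_vec n" for v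
    proof -
      have Nv: "N *\<^sub>v v \<in> carrier_vec n" using N v by auto
      have "N *\<^sub>v v = 0\<^sub>v n \<longleftrightarrow> T (N *\<^sub>v v) = (\<lambda>_. 0)"
      proof
        assume "T (N *\<^sub>v v) = (\<lambda>_. 0)"
        then have "T (N *\<^sub>v v) = T (0\<^sub>v n)" by (simp only: T_zero)
        then show "N *\<^sub>v v = 0\<^sub>v n" by (rule T_inj[OF Nv zero_carrier_vec])
      qed (simp only: T_zero)
      also have "\<dots> \<longleftrightarrow> (\<forall>f i. i < length (\<mu> f) \<longrightarrow> T (N *\<^sub>v v) (f, i) = 0)"
        using T_out[OF Nv] by (auto simp: fun_eq_iff)
      also have "\<dots> \<longleftrightarrow> (\<forall>i<length \<nu>. T (N *\<^sub>v v) (?f, i) = 0)"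
        unfolding single by auto
      also have "\<dots> \<longleftrightarrow> (\<forall>i<length \<nu>. (?f * T v (?f, i)) mod ?f ^ (\<nu> ! i) = 0)"
        using T_N[OF v, of _ ?f] single[of ?f] by (simp del: mult_pCons_left)
      finally show ?thesis .
    qed
    then have iff: "N *\<^sub>v v = 0\<^sub>v n \<longleftrightarrow> T v \<in> {u. \<forall>i<length \<nu>. (?f * u (?f, i)) mod ?f ^ (\<nu> ! i) = 0}"
      if "v \<in> carrier_vec n" for v using that by (simp only: mem_Collect_eq)
    have em: "elem_module \<mu> = T ` carrier_vec n" using bij by (simp add: bij_betw_def)
    show ?thesis
    proof (intro equalityI subsetI)
      fix u assume "u \<in> T ` ?V"
      then obtain v where v: "v \<in> carrier_vec n" "N *\<^sub>v v = 0\<^sub>v n" "u = T v" by blast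
      then show "u \<in> {u \<in> elem_module \<mu>. \<forall>i<length \<nu>. (?f * u (?f, i)) mod ?f ^ (\<nu> ! i) = 0}"
        using iff[OF v(1)] T_mem[OF v(1)] by (simp only: mem_Collect_eq)
    next
      fix u assume u: "u \<in> {u \<in> elem_module \<mu>. \<forall>i<length \<nu>. (?f * u (?f, i)) mod ?f ^ (\<nu> ! i) = 0}"
      then obtain v where v: "v \<in> carrier_vec n" "u = T v" unfolding em by blast
      then show "u \<in> T ` ?V" using u iff[OF v(1)] by (simp only: mem_Collect_eq image_iff) blast
    qed
  qed
  also have "card \<dots> = CARD('a) ^ length \<nu>" by (rule card_unipotent_kernel[OF single \<nu>])
  finally show ?thesis .
qed

end

lemma linear_as_matrix:
  fixes L :: "'a::field vec \<Rightarrow> 'a vec"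
  assumes carrier: "\<And>v. v \<in> carrier_vec n \<Longrightarrow> L v \<in> carrier_vec n"
    and add: "\<And>v w. v \<in> carrier_vec n \<Longrightarrow> w \<in> carrier_vec n \<Longrightarrow> L (v + w) = L v + L w"
    and smult: "\<And>a v. v \<in> carrier_vec n \<Longrightarrow> L (a \<cdot>\<^sub>v v) = a \<cdot>\<^sub>v L v"
    and v: "v \<in> carrier_vec n"
  shows "mat n n (\<lambda>(i, j). L (unit_vec n j) $ i) *\<^sub>v v = L v"
proof -
  \<comment> \<open>Truncations of v, which build it up one coordinate at a time.\<close>
  define p where "p k = vec n (\<lambda>i. if i < k then v $ i else 0)" for k
  have p: "p k \<in> carrier_vec n" for k by (simp add: p_def)
  have "L (p k) $ i = (\<Sum>j<k. v $ j * L (unit_vec n j) $ i)" if "k \<le> n" "i < n" for k i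
    using that(1)
  proof (induction k)
    case 0
    have "p 0 = 0 \<cdot>\<^sub>v p 0" by (rule eq_vecI) (auto simp: p_def)
    then have "L (p 0) = 0 \<cdot>\<^sub>v L (p 0)" using smult[OF p, of 0 0] by simp
    then have "L (p 0) $ i = 0 * L (p 0) $ i" using carrier[OF p, of 0] that(2) by (metis carrier_vecD index_smult_vec(1))
    then show ?case by simp
  next
    case (Suc k)
    have "p (Suc k) = p k + v $ k \<cdot>\<^sub>v unit_vec n k"
      using Suc.prems by (intro eq_vecI) (auto simp: p_def unit_vec_def less_Suc_eq)
    then have "L (p (Suc k)) = L (p k) + v $ k \<cdot>\<^sub>v L (unit_vec n k)"
      using add[OF p, of "v $ k \<cdot>\<^sub>v unit_vec n k" k] smult[of "unit_vec n k" "v $ k"] by simp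
    then show ?case
      using Suc that(2) carrier[OF p, of k] carrier[of "unit_vec n k"] by simp
  qed
  moreover have "p n = v" using v by (intro eq_vecI) (auto simp: p_def)
  ultimately have *: "L v $ i = (\<Sum>j<n. v $ j * L (unit_vec n j) $ i)" if "i < n" for i
    using that by fastforce
  show ?thesis
  proof (rule eq_vecI)
    fix i assume "i < dim_vec (L v)"
    then have i: "i < n" using carrier[OF v] by auto
    show "(mat n n (\<lambda>(i, j). L (unit_vec n j) $ i) *\<^sub>v v) $ i = L v $ i"
      using i v by (simp add: * scalar_prod_def atLeast0LessThan mult.commute)
  qed (use carrier[OF v] in auto)
qed

text \<open>The coordinates are the coefficients of the reduced polynomials. Their index set
  \<open>J\<close> of triples (f, i, k) has n elements by the norm condition on \<mu>, so any
  enumeration of it gives a linear isomorphism.\<close>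

lemma elem_module_coords:
  fixes \<mu> :: "'a::{finite,field} poly \<Rightarrow> nat list"
  assumes \<mu>: "\<mu> \<in> part_funs_Phi n"
  obtains T where "bij_betw T (carrier_vec n) (elem_module \<mu>)"
    "\<And>v w. v \<in> carrier_vec n \<Longrightarrow> w \<in> carrier_vec n \<Longrightarrow> T (v + w) = (\<lambda>k. T v k + T w k)"
    "\<And>c v. v \<in> carrier_vec n \<Longrightarrow> T (c \<cdot>\<^sub>v v) = (\<lambda>k. smult c (T v k))"
proof -
  note D = part_funs_PhiD[OF \<mu>]
  define d where "d f i = degree f * \<mu> f ! i" for f i
  define J where "J = (SIGMA f:{f. \<mu> f \<noteq> []}. SIGMA i:{..<length (\<mu> f)}. {..<d f i})"
  have "card J = (\<Sum>f | \<mu> f \<noteq> []. \<Sum>i<length (\<mu> f). d f i)"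
    unfolding J_def using D(1) by (simp add: card_SigmaI)
  also have "\<dots> = (\<Sum>f | \<mu> f \<noteq> []. degree f * sum_list (\<mu> f))"
    by (simp add: d_def sum_list_sum_nth sum_distrib_left atLeast0LessThan)
  finally have cJ: "card J = n" using D(4) by simp
  have fJ: "finite J" unfolding J_def using D(1) by (intro finite_SigmaI) auto
  obtain e where e: "bij_betw e {0..<n} J" using ex_bij_betw_nat_finite[OF fJ] cJ by auto
  define e' where "e' = inv_into {0..<n} e"
  have e'e: "e' (e j) = j" if "j < n" for j
    unfolding e'_def using e that by (auto simp: bij_betw_def)
  have ee': "e (e' x) = x" and e'n: "e' x < n" if "x \<in> J" for x
  proof -
    show "e (e' x) = x" unfolding e'_def using bij_betw_inv_into_right[OF e that] .
    have "e' x \<in> {0..<n}" unfolding e'_def using that e by (intro inv_into_into) (auto simp: bij_betw_def)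
    then show "e' x < n" by simp
  qed
  have J: "(f, i, k) \<in> J \<longleftrightarrow> i < length (\<mu> f) \<and> k < d f i" for f i k by (auto simp: J_def)
  define T where "T v = (\<lambda>(f, i). if i < length (\<mu> f) then \<Sum>k<d f i. monom (v $ e' (f, i, k)) k else 0)"
    for v :: "'a vec"
  define S where "S u = vec n (\<lambda>j. case e j of (f, i, k) \<Rightarrow> coeff (u (f, i)) k)"
    for u :: "'a poly \<times> nat \<Rightarrow> 'a poly"
  have coeff_T: "coeff (T v (f, i)) k = (if (f, i, k) \<in> J then v $ e' (f, i, k) else 0)" for v f i k
    by (simp add: T_def coeff_sum J sum.delta)
  have mem: "u \<in> elem_module \<mu> \<longleftrightarrow> (\<forall>f i k. (f, i, k) \<notin> J \<longrightarrow> coeff (u (f, i)) k = 0)"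
    for u :: "'a poly \<times> nat \<Rightarrow> 'a poly"
  proof -
    have "(if i < length (\<mu> f) then u (f, i) mod f ^ (\<mu> f ! i) = u (f, i) else u (f, i) = 0) \<longleftrightarrow>
      (\<forall>k. (f, i, k) \<notin> J \<longrightarrow> coeff (u (f, i)) k = 0)" for f i
    proof (cases "i < length (\<mu> f)")
      case True
      then have fP: "f \<in> Phi" by (intro D(2)) auto
      show ?thesis
        using True by (simp add: mod_eq_self_iff[OF Phi_power_monic(3)[OF fP]] Phi_power_monic(2)[OF fP] J d_def not_less)
    qed (auto simp: J poly_eq_iff)
    then show ?thesis unfolding elem_module_def by simp
  qed
  show ?thesis
  proof (rule that[of T])
    show "bij_betw T (carrier_vec n) (elem_module \<mu>)"
    proof (rule bij_betwI[of _ _ _ S])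
      show "T \<in> carrier_vec n \<rightarrow> elem_module \<mu>" by (simp add: mem coeff_T)
      show "S \<in> elem_module \<mu> \<rightarrow> carrier_vec n" by (simp add: S_def)
      show "S (T v) = v" if v: "v \<in> carrier_vec n" for v
      proof (rule eq_vecI)
        fix j assume "j < dim_vec v"
        then have j: "j < n" using v by simp
        obtain f i k where ej: "e j = (f, i, k)" by (cases "e j")
        have "(f, i, k) \<in> J" unfolding ej[symmetric] using e j by (auto simp: bij_betw_def)
        then show "S (T v) $ j = v $ j" using j e'e[OF j] by (simp add: S_def ej coeff_T)
      qed (use v in \<open>simp add: S_def\<close>)
      show "T (S u) = u" if u: "u \<in> elem_module \<mu>" for u
      proof
        fix x :: "'a poly \<times> nat"
        obtain f i where x: "x = (f, i)" by (cases x)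
        show "T (S u) x = u x" unfolding x
        proof (rule poly_eqI)
          fix k
          show "coeff (T (S u) (f, i)) k = coeff (u (f, i)) k"
          proof (cases "(f, i, k) \<in> J")
            case True
            then show ?thesis using ee'[OF True] e'n[OF True] by (simp add: coeff_T S_def)
          next
            case False
            then show ?thesis using u by (simp add: coeff_T mem)
          qed
        qed
      qed
    qed
    show "T (v + w) = (\<lambda>k. T v k + T w k)" if "v \<in> carrier_vec n" "w \<in> carrier_vec n" for v w
    proof
      fix x :: "'a poly \<times> nat"
      obtain f i where x: "x = (f, i)" by (cases x)
      show "T (v + w) x = T v x + T w x" unfolding x
        using that e'n by (intro poly_eqI) (simp add: coeff_T)
    qed
    show "T (c \<cdot>\<^sub>v v) = (\<lambda>k. smult c (T v k))" if "v \<in> carrier_vec n" for c v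
    proof
      fix x :: "'a poly \<times> nat"
      obtain f i where x: "x = (f, i)" by (cases x)
      show "T (c \<cdot>\<^sub>v v) x = smult c (T v x)" unfolding x
        using that e'n by (intro poly_eqI) (simp add: coeff_T)
    qed
  qed
qed

text \<open>Multiplication by x, transported to coordinates, is a matrix; it is injective since f(0)
  \<noteq> 0 for all f in \<open>Phi\<close>, hence invertible. Nonemptiness gives meaning to the
  \<open>SOME\<close> in \<open>char_map\<close>.\<close>

lemma K_class_nonempty:
  fixes \<mu> :: "'a::{finite,field} poly \<Rightarrow> nat list"
  assumes \<mu>: "\<mu> \<in> part_funs_Phi n"
  shows "K_class n \<mu> \<noteq> {}"
proof -
  note D = part_funs_PhiD[OF \<mu>]
  obtain T where T: "bij_betw T (carrier_vec n) (elem_module \<mu>)"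
    and add: "\<And>v w. v \<in> carrier_vec n \<Longrightarrow> w \<in> carrier_vec n \<Longrightarrow> T (v + w) = (\<lambda>k. T v k + T w k)"
    and smult: "\<And>c v. v \<in> carrier_vec n \<Longrightarrow> T (c \<cdot>\<^sub>v v) = (\<lambda>k. smult c (T v k))"
    using elem_module_coords[OF \<mu>] by blast
  have T_mem: "T v \<in> elem_module \<mu>" if "v \<in> carrier_vec n" for v
    using T that by (auto simp: bij_betw_def)
  have T_inj: "v = w" if "v \<in> carrier_vec n" "w \<in> carrier_vec n" "T v = T w" for v w
    using T that by (auto simp: bij_betw_def inj_on_def)
  have x_mem: "elem_module_x \<mu> u \<in> elem_module \<mu>" for u
    by (auto simp: elem_module_def elem_module_x_def)
  define L where "L v = inv_into (carrier_vec n) T (elem_module_x \<mu> (T v))" for v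
  have L: "L v \<in> carrier_vec n" for v
    unfolding L_def using x_mem T by (intro inv_into_into) (auto simp: bij_betw_def)
  have TL: "T (L v) = elem_module_x \<mu> (T v)" for v
    unfolding L_def using bij_betw_inv_into_right[OF T x_mem] .
  have x_add: "elem_module_x \<mu> (\<lambda>k. u k + w k) = (\<lambda>k. elem_module_x \<mu> u k + elem_module_x \<mu> w k)" for u w
    by (auto simp: elem_module_x_def fun_eq_iff distrib_left poly_mod_add_left simp del: mult_pCons_left)
  have x_smult: "elem_module_x \<mu> (\<lambda>k. smult c (u k)) = (\<lambda>k. smult c (elem_module_x \<mu> u k))" for c u
    by (auto simp: elem_module_x_def fun_eq_iff mod_smult_left simp del: mult_pCons_left)
  define g where "g = mat n n (\<lambda>(i, j). L (unit_vec n j) $ i)"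
  have g: "g \<in> carrier_mat n n" by (simp add: g_def)
  have gL: "g *\<^sub>v v = L v" if "v \<in> carrier_vec n" for v
    unfolding g_def
  proof (rule linear_as_matrix[OF _ _ _ that])
    show "L (v + w) = L v + L w" if "v \<in> carrier_vec n" "w \<in> carrier_vec n" for v w
      using that L by (intro T_inj) (simp_all add: TL add x_add)
    show "L (c \<cdot>\<^sub>v v) = c \<cdot>\<^sub>v L v" if "v \<in> carrier_vec n" for c v
      using that L by (intro T_inj) (simp_all add: TL smult x_smult)
  qed (rule L)
  have zero: "T (0\<^sub>v n) = (\<lambda>_. 0)"
  proof -
    have "(0 :: 'a) \<cdot>\<^sub>v 0\<^sub>v n = 0\<^sub>v n" by (rule eq_vecI) auto
    then show ?thesis using smult[of "0\<^sub>v n" 0] by simp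
  qed
  have "v = 0\<^sub>v n" if v: "v \<in> carrier_vec n" and "g *\<^sub>v v = 0\<^sub>v n" for v
  proof (rule T_inj[OF v])
    have "elem_module_x \<mu> (T v) = T (g *\<^sub>v v)" unfolding gL[OF v] by (rule TL[symmetric])
    then have x0: "elem_module_x \<mu> (T v) = (\<lambda>_. 0)" unfolding that(2) zero .
    have "T v (f, i) = 0" for f i
    proof (cases "i < length (\<mu> f)")
      case True
      then have fP: "f \<in> Phi" by (intro D(2)) auto
      have "elem_module_x \<mu> (T v) (f, i) = ([:0, 1:] * T v (f, i)) mod f ^ (\<mu> f ! i)"
        unfolding elem_module_x_def using True by (simp only: prod.case if_True)
      then have dvd: "f ^ (\<mu> f ! i) dvd [:0, 1:] * T v (f, i)"
        unfolding x0 by (intro mod_0_imp_dvd) (rule sym)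
      have "f ^ (\<mu> f ! i) dvd T v (f, i)"
        by (rule dvd_x_mult_cancel[OF _ dvd]) (simp add: poly_power Phi_poly_0[OF fP])
      then have "T v (f, i) mod f ^ (\<mu> f ! i) = 0" by (rule dvd_imp_mod_0)
      moreover have "T v (f, i) mod f ^ (\<mu> f ! i) = T v (f, i)"
        using T_mem[OF v] True unfolding elem_module_def by (auto split: if_splits)
      ultimately show ?thesis by (simp only:)
    next
      case False
      then show ?thesis using T_mem[OF v] unfolding elem_module_def by (auto split: if_splits)
    qed
    then show "T v = T (0\<^sub>v n)" unfolding zero by auto
  qed simp
  then have "det g \<noteq> 0" using det_0_iff_vec_prod_zero_field[OF g] by blast
  then have "g \<in> carrier (GL n)"
    using det_non_zero_imp_unit[OF g] by (simp add: GL_def units_of_def)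
  then have "g \<in> K_class n \<mu>"
    unfolding K_class_def using T add smult by (auto simp: gL TL intro!: exI[of _ T])
  then show ?thesis by blast
qed

section \<open>The characteristic of the induced character\<close>

lemma in_alphabet_sum: "in_alphabet f (sum h A) = (\<Sum>a\<in>A. in_alphabet f (h a))"
  using in_alphabet_mconst[of f 0]
  by (induction A rule: infinite_finite_induct) (simp_all add: in_alphabet_add)

lemma K_class_rep:
  assumes "\<mu> \<in> part_funs_Phi n" "g \<in> K_class n \<mu>"
  obtains T where "class_rep \<mu> n g T"
proof -
  have "g \<in> carrier (GL n)" using assms(2) by (simp add: K_class_def)
  then have "g \<in> carrier_mat n n" by (auto simp: GL_carrier GL_pairs_def)
  moreover obtain T where "bij_betw T (carrier_vec n) (elem_module \<mu>)"
    "\<forall>v\<in>carrier_vec n. \<forall>w\<in>carrier_vec n. T (v + w) = (\<lambda>k. T v k + T w k)"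
    "\<forall>c. \<forall>v\<in>carrier_vec n. T (c \<cdot>\<^sub>v v) = (\<lambda>k. smult c (T v k))"
    "\<forall>v\<in>carrier_vec n. T (g *\<^sub>v v) = elem_module_x \<mu> (T v)"
    using assms(2) unfolding K_class_def by blast
  ultimately have "class_rep \<mu> n g T" using assms(1) by unfold_locales blast+
  then show ?thesis by (rule that)
qed

lemma induced_fun_K_class:
  fixes g :: "'a::{finite,field} mat" and \<psi> :: "'a \<Rightarrow> complex"
  assumes \<psi>: "additive_char \<psi>" "\<exists>x. \<psi> x \<noteq> 1" and c: "\<forall>i\<in>{1..<n}. c i \<noteq> 0"
    and \<mu>: "\<mu> \<in> part_funs_Phi n" and g: "g \<in> K_class n \<mu>"
  shows "(\<And>f. \<mu> f = (if f = [:- 1, 1:] then \<nu> else [])) \<Longrightarrow>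
      induced_fun (GL n) (unitriangular n) (linear_char \<psi> n c) g = gg_val (of_nat CARD('a)) n (length \<nu>)"
    and "\<mu> f \<noteq> [] \<Longrightarrow> f \<noteq> [:- 1, 1:] \<Longrightarrow>
      induced_fun (GL n) (unitriangular n) (linear_char \<psi> n c) g = 0"
proof -
  obtain T where "class_rep \<mu> n g T" using K_class_rep[OF \<mu> g] .
  then interpret class_rep \<mu> n g T .
  note g' = class_rep.g[OF \<open>class_rep \<mu> n g T\<close>]
  show "induced_fun (GL n) (unitriangular n) (linear_char \<psi> n c) g = gg_val (of_nat CARD('a)) n (length \<nu>)"
    if "\<And>f. \<mu> f = (if f = [:- 1, 1:] then \<nu> else [])"
    using unipotent_type_imp_nilpotent[OF that] card_right_null[OF that]
      card_left_null_eq_right_null[OF \<psi> N] induced_fun_unipotent[OF \<psi> c g'] by simp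
  show "induced_fun (GL n) (unitriangular n) (linear_char \<psi> n c) g = 0" if "\<mu> f \<noteq> []" "f \<noteq> [:- 1, 1:]"
    using nilpotent_imp_unipotent_type[OF _ that(1)] that(2) induced_fun_not_unipotent[OF g'] by blast
qed

definition unipotent_type :: "nat list \<Rightarrow> 'a::{finite,field} poly \<Rightarrow> nat list" where
  "unipotent_type \<nu> = (\<lambda>f. if f = [:- 1, 1:] then \<nu> else [])"

lemma unipotent_type_support: "\<nu> \<noteq> [] \<Longrightarrow> {f. unipotent_type \<nu> f \<noteq> []} = {[:- 1, 1:]}"
  by (auto simp: unipotent_type_def)

lemma parts_of_ne_Nil: "n \<ge> 1 \<Longrightarrow> \<nu> \<in> parts_of n \<Longrightarrow> \<nu> \<noteq> []"
  by (auto simp: parts_of_def)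

lemma unipotent_type_in_part_funs:
  assumes "n \<ge> 1"
  shows "unipotent_type ` parts_of n \<subseteq> (part_funs_Phi n :: ('a::{finite,field} poly \<Rightarrow> nat list) set)"
proof
  fix \<mu> :: "'a poly \<Rightarrow> nat list" assume "\<mu> \<in> unipotent_type ` parts_of n"
  then obtain \<nu> where \<nu>: "\<nu> \<in> parts_of n" and \<mu>: "\<mu> = unipotent_type \<nu>" by blast
  have "\<mu> f \<in> partitions" for f
    using \<nu> by (simp add: \<mu> unipotent_type_def parts_of_def) (simp add: partitions_def)
  moreover have "{f. \<mu> f \<noteq> []} = {[:- 1, 1:]}"
    unfolding \<mu> by (rule unipotent_type_support[OF parts_of_ne_Nil[OF assms \<nu>]])
  moreover have "\<mu> [:- 1, 1:] = \<nu>" by (simp add: \<mu> unipotent_type_def)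
  ultimately show "\<mu> \<in> part_funs_Phi n"
    using \<nu> linear_in_Phi by (simp add: part_funs_Phi_def parts_of_def)
qed

text \<open>Only types concentrated at x - 1 survive. There the character value is (-1)^n times the
  product of 1 - q q^j over j < l, which is \<open>rpoch\<close> at t = 1/q and y = q, while the
  twist of \<open>HL_P_twisted\<close> supplies t^(n(\<nu>)). The sum is thus an instance of
  \<open>HL_P_expansion\<close>.\<close>

lemma char_map_gelfand_graev:
  fixes \<psi> :: "'a::{finite,field} \<Rightarrow> complex"
  assumes \<psi>: "additive_char \<psi>" "\<exists>x. \<psi> x \<noteq> 1" and c: "\<forall>i\<in>{1..<n}. c i \<noteq> 0" and n: "n \<ge> 1"
    and q: "q = of_nat CARD('a)"
  shows "char_map n (induced_fun (GL n) (unitriangular n) (linear_char \<psi> n c)) =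
    in_alphabet [:- 1, 1:] (mconst ((-1) ^ n) * Qs n q)"
proof -
  let ?\<gamma> = "induced_fun (GL n) (unitriangular n) (linear_char \<psi> n c)"
  let ?f = "[:- 1, 1:] :: 'a poly"
  have q0: "q \<noteq> 0" by (simp add: q)
  have some: "(SOME g. g \<in> K_class n \<mu>) \<in> K_class n \<mu>" if "\<mu> \<in> part_funs_Phi n" for \<mu> :: "'a poly \<Rightarrow> nat list"
    using K_class_nonempty[OF that] by (simp add: some_in_eq)
  have "char_map n ?\<gamma> = (\<Sum>\<mu>\<in>unipotent_type ` parts_of n. mconst (?\<gamma> (SOME g. g \<in> K_class n \<mu>)) * P_tilde \<mu>)"
    unfolding char_map_def
  proof (rule sum.mono_neutral_right[OF finite_part_funs_Phi unipotent_type_in_part_funs[OF n]], rule ballI)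
    fix \<mu> :: "'a poly \<Rightarrow> nat list" assume "\<mu> \<in> part_funs_Phi n - unipotent_type ` parts_of n"
    then have \<mu>: "\<mu> \<in> part_funs_Phi n" "\<mu> \<notin> unipotent_type ` parts_of n" by auto
    have "\<exists>f. \<mu> f \<noteq> [] \<and> f \<noteq> ?f"
    proof (rule ccontr)
      assume "\<not> (\<exists>f. \<mu> f \<noteq> [] \<and> f \<noteq> ?f)"
      then have supp: "{f. \<mu> f \<noteq> []} \<subseteq> {?f}" by blast
      then have "\<mu> = unipotent_type (\<mu> ?f)" by (auto simp: unipotent_type_def fun_eq_iff)
      moreover have "(\<Sum>f | \<mu> f \<noteq> []. degree f * sum_list (\<mu> f)) = (\<Sum>f\<in>{?f}. degree f * sum_list (\<mu> f))"
        using supp by (intro sum.mono_neutral_left) auto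
      then have "\<mu> ?f \<in> parts_of n"
        using part_funs_PhiD(3,4)[OF \<mu>(1)] by (simp add: parts_of_def)
      ultimately show False using \<mu>(2) by blast
    qed
    then show "mconst (?\<gamma> (SOME g. g \<in> K_class n \<mu>)) * P_tilde \<mu> = 0"
      using induced_fun_K_class(2)[OF \<psi> c \<mu>(1) some[OF \<mu>(1)]] by auto
  qed
  also have "\<dots> = (\<Sum>\<nu>\<in>parts_of n. mconst (?\<gamma> (SOME g. g \<in> K_class n (unipotent_type \<nu>))) * P_tilde (unipotent_type \<nu>))"
    by (rule sum.reindex_cong[OF _ refl refl]) (auto simp: inj_on_def unipotent_type_def fun_eq_iff)
  also have "\<dots> = (\<Sum>\<nu>\<in>parts_of n. in_alphabet ?f (mconst ((-1) ^ n) *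
      (mconst (inverse q ^ n_part \<nu> * rpoch (inverse q) q (length \<nu>)) * HL_P \<nu> (inverse q))))"
  proof (rule sum.cong[OF refl])
    fix \<nu> assume \<nu>: "\<nu> \<in> parts_of n"
    define u where "u = (unipotent_type \<nu> :: 'a poly \<Rightarrow> nat list)"
    have u: "u \<in> part_funs_Phi n" using unipotent_type_in_part_funs[OF n] \<nu> by (auto simp: u_def)
    have 1: "?\<gamma> (SOME g. g \<in> K_class n u) = gg_val q n (length \<nu>)"
      unfolding q by (rule induced_fun_K_class(1)[OF \<psi> c u some[OF u]]) (simp add: u_def unipotent_type_def)
    have 2: "P_tilde u = in_alphabet ?f (HL_P_twisted \<nu> q)"
      unfolding P_tilde_def u_def unipotent_type_support[OF parts_of_ne_Nil[OF n \<nu>]]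
      by (simp add: unipotent_type_def q)
    have "rpoch (inverse q) q l = (-1) ^ l * (\<Prod>i<l. q ^ Suc i - 1)" for l
      by (induction l) (simp_all add: rpoch_def power_inverse divide_inverse algebra_simps)
    then have "gg_val q n l = (-1) ^ n * rpoch (inverse q) q l" for l
      by (simp add: gg_val_def power_add)
    then show "mconst (?\<gamma> (SOME g. g \<in> K_class n u)) * P_tilde u =
        in_alphabet ?f (mconst ((-1) ^ n) * (mconst (inverse q ^ n_part \<nu> * rpoch (inverse q) q (length \<nu>)) * HL_P \<nu> (inverse q)))"
      unfolding 1 2 HL_P_twisted_def
      by (simp add: in_alphabet_mult in_alphabet_mconst mconst_mult power_inverse mult_ac)
  qed
  also have "\<dots> = in_alphabet ?f (\<Sum>\<nu>\<in>parts_of n. mconst ((-1) ^ n) *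
      (mconst (inverse q ^ n_part \<nu> * rpoch (inverse q) q (length \<nu>)) * HL_P \<nu> (inverse q)))"
    by (rule in_alphabet_sum[symmetric])
  also have "\<dots> = in_alphabet ?f (mconst ((-1) ^ n) * Qs n q)"
    using q0 by (simp add: HL_P_expansion flip: sum_distrib_left)
  finally show ?thesis .
qed

text \<open>At y = t the factor j = 1 of \<open>rpoch\<close> is 1 - t/t = 0, so only the partition
  with a single part remains, with coefficient 1 - t.\<close>

lemma Qs_inverse:
  assumes n: "n \<ge> 1" and t: "t \<noteq> 0"
  shows "HL_q n t = Qs n t"
proof -
  have one: "[n] \<in> parts_of n" using n by (simp add: parts_of_def partitions_def)
  have "Qs n t = (\<Sum>\<nu>\<in>parts_of n. mconst (t ^ n_part \<nu> * rpoch t t (length \<nu>)) * HL_P \<nu> t)"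
    by (rule HL_P_expansion[OF t, symmetric])
  also have "\<dots> = (\<Sum>\<nu>\<in>{[n]}. mconst (t ^ n_part \<nu> * rpoch t t (length \<nu>)) * HL_P \<nu> t)"
  proof (rule sum.mono_neutral_right)
    show "\<forall>\<nu>\<in>parts_of n - {[n]}. mconst (t ^ n_part \<nu> * rpoch t t (length \<nu>)) * HL_P \<nu> t = 0"
    proof
      fix \<nu> assume \<nu>: "\<nu> \<in> parts_of n - {[n]}"
      then have "\<nu> \<noteq> []" "length \<nu> \<noteq> 1" using parts_of_ne_Nil[OF n] by (auto simp: parts_of_def length_Suc_conv One_nat_def)
      then have "1 < length \<nu>" by (cases \<nu>) auto
      then have "rpoch t t (length \<nu>) = 0" unfolding rpoch_def using t by (intro prod_zero bexI[of _ 1]) auto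
      then show "mconst (t ^ n_part \<nu> * rpoch t t (length \<nu>)) * HL_P \<nu> t = 0" by simp
    qed
  qed (use one in auto)
  finally show ?thesis using n by (simp add: HL_q_def rpoch_def n_part_def)
qed

theorem corollary3p11:
  fixes \<psi> :: "'a::{finite,field} \<Rightarrow> complex"
    and \<rho> :: "('a poly \<times> nat) mseries \<Rightarrow> nat mseries"
    and c :: "nat \<Rightarrow> 'a"
    and n :: nat and q :: complex and \<rho>\<^sub>n :: "nat mseries"
  assumes q: "q = of_nat CARD('a)"
    and \<psi>: "additive_char \<psi>" "\<exists>x. \<psi> x \<noteq> 1"
    and \<rho>: "plethysm_map \<rho>"
    and n: "n \<ge> 1"
    and c: "\<forall>i\<in>{1..<n}. c i \<noteq> 0"
    and \<rho>\<^sub>n: "\<rho>\<^sub>n = \<rho> (char_map n (induced_fun (GL n) (unitriangular n) (linear_char \<psi> n c)))"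
  shows "\<rho>\<^sub>n = mconst (q ^ n) * HL_q n (inverse q) \<and>
         mconst (q ^ n) * HL_q n (inverse q) =
         mconst ((1 - inverse q) * q ^ n) * HL_P [n] (inverse q) \<and>
         mconst ((1 - inverse q) * q ^ n) * HL_P [n] (inverse q) =
         mconst (q ^ (n - 1) * (q - 1)) * HL_P [n] (inverse q) \<and>
         mconst (q ^ (n - 1) * (q - 1)) * HL_P [n] (inverse q) =
         mconst (q ^ (n - 1) * (q - 1)) * HL_P_twisted [n] q"
proof (intro conjI)
  let ?f = "[:- 1, 1:] :: 'a poly"
  have q0: "q \<noteq> 0" by (simp add: q)
  define p where "p k = in_alphabet ?f (mconst ((-1) ^ k * (1 - q ^ k)) * power_sum k)" for k
  have p: "p k \<in> Lambda" for k
    unfolding p_def in_alphabet_mult in_alphabet_mconst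
    by (intro Lambda.mult Lambda.const Lambda.alphabet linear_in_Phi power_sum_sym)
  have "mconst ((-1) ^ n) * Qs n q = complete_of (\<lambda>k. mconst ((-1) ^ k * (1 - q ^ k)) * power_sum k) n"
    by (simp add: Qs_complete_of mconst_mult mult.assoc flip: complete_of_scale)
  then have "in_alphabet ?f (mconst ((-1) ^ n) * Qs n q) = complete_of p n"
    using complete_of_hom_on[of "\<lambda>k. mconst ((-1) ^ k * (1 - q ^ k)) * power_sum k" UNIV "in_alphabet ?f" n]
    by (simp add: in_alphabet_mconst in_alphabet_add in_alphabet_mult p_def[abs_def])
  then have "\<rho>\<^sub>n = complete_of (\<lambda>k. \<rho> (p k)) n"
    unfolding \<rho>\<^sub>n char_map_gelfand_graev[OF \<psi> c n q] using rho_complete_of[OF \<rho> p] by simp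
  also have "\<dots> = complete_of (\<lambda>k. mconst (q ^ k) * (mconst (1 - inverse q ^ k) * power_sum k)) n"
  proof (rule complete_of_cong)
    fix k :: nat assume k: "k \<ge> 1"
    have "\<rho> (p k) = mconst ((-1) ^ k * (1 - q ^ k)) * \<rho> (in_alphabet ?f (power_sum k))"
      unfolding p_def in_alphabet_mult in_alphabet_mconst
      by (subst rho_mult[OF \<rho>]) (simp_all add: Lambda.const Lambda.alphabet linear_in_Phi power_sum_sym rho_const[OF \<rho>])
    also have "\<dots> = mconst ((-1) ^ k * (1 - q ^ k) * (-1) ^ (k - 1)) * power_sum k"
      by (simp add: rho_unipotent_power_sum[OF \<rho> k] mconst_mult mult.assoc)
    \<comment> \<open>The sign (-1)^k from the characteristic and (-1)^(k-1) from \<rho> combine to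
      -1, turning 1 - q^k into q^k - 1.\<close>
    also have "(-1) ^ k * (1 - q ^ k) * (-1) ^ (k - 1) = q ^ k * (1 - inverse q ^ k)"
      using k q0 by (cases k) (simp_all add: field_simps flip: power_add)
    finally show "\<rho> (p k) = mconst (q ^ k) * (mconst (1 - inverse q ^ k) * power_sum k)"
      by (simp add: mconst_mult mult.assoc)
  qed
  also have "\<dots> = mconst (q ^ n) * Qs n (inverse q)"
    by (simp add: complete_of_scale Qs_complete_of)
  finally show "\<rho>\<^sub>n = mconst (q ^ n) * HL_q n (inverse q)"
    using q0 n by (simp add: Qs_inverse)
  show "mconst (q ^ n) * HL_q n (inverse q) = mconst ((1 - inverse q) * q ^ n) * HL_P [n] (inverse q)"
    using n by (simp add: HL_q_def mconst_mult mult_ac)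
  have "(1 - inverse q) * q ^ n = q ^ (n - 1) * (q - 1)"
    using n q0 by (cases n) (simp_all add: field_simps)
  then show "mconst ((1 - inverse q) * q ^ n) * HL_P [n] (inverse q) =
    mconst (q ^ (n - 1) * (q - 1)) * HL_P [n] (inverse q)" by simp
  \<comment> \<open>A single part has n(\<nu>) = 0, so the twist factor is 1.\<close>
  show "mconst (q ^ (n - 1) * (q - 1)) * HL_P [n] (inverse q) =
    mconst (q ^ (n - 1) * (q - 1)) * HL_P_twisted [n] q"
    by (simp add: HL_P_twisted_def n_part_def)
qed

end
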